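(* Let $d\ge3$ and $2\sqrt{d-1}<\mu<d$ be fixed, and let $\mathcal G$ be the random infinite $d$-regular graph described in the context. For any constant $\mathfrak q\ge0$, with probability $1-O(N^{-\mathfrak q})$ conditioned on the event $\overline\Omega$, we have $\lambda_2(\mathcal G)\le 2\sqrt{d-1}+O((\log\log N)^{-1})$.
   Context: Construction of $\mathcal G$. Let $\theta$ be the unique solution of $\theta^2-\mu\theta+d-1=0$ with $\theta\in(\sqrt{d-1},d-1)$ and put $p=\theta/(d-1)$. Let $V_0$ be a set of $N$ vertices, and let $\mathcal H$ be the random $d$-regular graph on $V_0$ given by the configuration model: choose a uniformly random perfect matching of the set of half-edges $V_0\times[d]$ and add an edge $i_1i_2$ for every matched pair $(i_1,j_1),(i_2,j_2)$ (loops and multiedges allowed). Let $\mathcal G_0$ be the random subgraph of $\mathcal H$ on $V_0$ obtained by including every edge independently with probability $p$. Let $\mathcal G=T^\infty\mathcal G_0$ be the infinite $d$-regular graph obtained by attaching to each $v\in V_0$ exactly $d-\deg_{\mathcal G_0}(v)$ disjoint infinite rooted $(d-1)$-ary trees, each root being joined to $v$ by an edge. Event $\overline\Omega$. Let $\vec E_0$ be the set of directed edges $(u,v)$ of $\mathcal G$ with $u,v\in V_0$ (each undirected edge gives two directed edges). A graph is $s$-tangle-free if every neighborhood of radius $s$ contains at most one cycle (loops and multiple edges count as cycles). $\overline\Omega$ is the event that $\mathcal G$ is $\frac16\log_{d-1}N$-tangle-free and $|\vec E_0|\ge\frac12pdN$. Asymptotics are as $N\to\infty$ with $d,\mu,\mathfrak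 q$ fixed. For a possibly infinite graph with vertex set $V$ and adjacency operator $A$ on $\ell^2(V)$, $\lambda_i(\mathcal G)=\sup_{S}\inf_{v\in S,\|v\|=1}\langle v,Av\rangle$, the supremum being over $i$-dimensional subspaces $S$ of $\ell^2(V)$. *)

theory Defs
  imports
    "HOL-Probability.Probability"
    "HOL-Library.Function_Algebras"
    "HOL-Library.Disjoint_Sets"
    "HOL-Library.Multiset"
begin

section \<open>Multigraphs\<close>

text \<open>Undirected multigraphs, possibly infinite. Every edge carries the two-element multiset
  of its end points, so a loop at \<open>v\<close> has end points \<open>{#v, v#}\<close> and contributes 2 to the
  degree of \<open>v\<close> and to the diagonal entry of the adjacency matrix.\<close>

record ('v, 'e) multigraph =
  verts :: "'v set"
  edges :: "'e set"
  ends :: "'e \<Rightarrow> 'v multiset"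

definition degree :: "('v, 'e) multigraph \<Rightarrow> 'v \<Rightarrow> nat" where
  "degree G v = (\<Sum>e\<in>edges G. count (ends G e) v)"

definition adj :: "('v, 'e) multigraph \<Rightarrow> 'v \<Rightarrow> 'v \<Rightarrow> real" where
  "adj G u v = (if u = v then 2 else 1) * real (card {e \<in> edges G. ends G e = {#u, v#}})"

definition adj_rel :: "('v, 'e) multigraph \<Rightarrow> ('v \<times> 'v) set" where
  "adj_rel G = {(u, v). \<exists>e\<in>edges G. ends G e = {#u, v#}}"

definition graph_ball :: "('v, 'e) multigraph \<Rightarrow> 'v \<Rightarrow> real \<Rightarrow> 'v set" where
  "graph_ball G v s = {w \<in> verts G. \<exists>k. real k \<le> s \<and> (v, w) \<in> adj_rel G ^^ k}"

definition induced :: "('v, 'e) multigraph \<Rightarrow> 'v set \<Rightarrow> ('v, 'e) multigraph" where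
  "induced G W = \<lparr>verts = verts G \<inter> W,
                  edges = {e \<in> edges G. set_mset (ends G e) \<subseteq> W},
                  ends = ends G\<rparr>"

text \<open>A cycle is identified with its edge set, so that it has neither a starting point nor an
  orientation. Length 1 gives the loops and length 2 the pairs of parallel edges.\<close>

definition is_cycle :: "('v, 'e) multigraph \<Rightarrow> 'e set \<Rightarrow> bool" where
  "is_cycle G C \<longleftrightarrow>
     (\<exists>vs es. es \<noteq> [] \<and> length vs = length es \<and> distinct vs \<and> distinct es \<and>
        set vs \<subseteq> verts G \<and> set es \<subseteq> edges G \<and> C = set es \<and>
        (\<forall>i<length es. ends G (es ! i) = {#vs ! i, vs ! (Suc i mod length vs)#}))"

definition tangle_free :: "('v, 'e) multigraph \<Rightarrow> real \<Rightarrow> bool" where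
  "tangle_free G s \<longleftrightarrow>
     (\<forall>v\<in>verts G. \<forall>C C'. is_cycle (induced G (graph_ball G v s)) C \<longrightarrow>
        is_cycle (induced G (graph_ball G v s)) C' \<longrightarrow> C = C')"


section \<open>The space of square-summable functions and the min-max values\<close>

text \<open>An element of the real Hilbert space \<open>\<ell>\<^sup>2(V)\<close> is represented by a function on
  the whole vertex type that vanishes outside \<open>V\<close>.\<close>

global_interpretation fun_vs: vector_space "\<lambda>(c::real) (f :: 'v \<Rightarrow> real) x. c * f x"
  defines fun_subspace = fun_vs.subspace
    and fun_dim = fun_vs.dim
  by unfold_locales (auto simp: fun_eq_iff algebra_simps)

definition ell2 :: "'v set \<Rightarrow> ('v \<Rightarrow> real) set" where
  "ell2 V = {f. (\<forall>x. x \<notin> V \<longrightarrow> f x = 0) \<and> (\<lambda>x. (f x)\<^sup>2) summable_on V}"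

definition ell2_inner :: "'v set \<Rightarrow> ('v \<Rightarrow> real) \<Rightarrow> ('v \<Rightarrow> real) \<Rightarrow> real" where
  "ell2_inner V f g = (\<Sum>\<^sub>\<infinity>x\<in>V. f x * g x)"

definition ell2_norm :: "'v set \<Rightarrow> ('v \<Rightarrow> real) \<Rightarrow> real" where
  "ell2_norm V f = sqrt (ell2_inner V f f)"

definition adj_op :: "('v, 'e) multigraph \<Rightarrow> ('v \<Rightarrow> real) \<Rightarrow> ('v \<Rightarrow> real)" where
  "adj_op G f = (\<lambda>x. \<Sum>\<^sub>\<infinity>y\<in>verts G. adj G x y * f y)"

text \<open>Meaningful for graphs of bounded degree and \<open>1 \<le> i \<le> |V|\<close>: the sets whose supremum and
  infimum are taken are then nonempty and bounded, and \<open>fun_dim S = i\<close> forces \<open>S\<close> to be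
  finite-dimensional (an infinite-dimensional space has \<open>fun_dim\<close> equal to 0).\<close>

definition graph_lambda :: "nat \<Rightarrow> ('v, 'e) multigraph \<Rightarrow> real" where
  "graph_lambda i G =
     (SUP S \<in> {S. S \<subseteq> ell2 (verts G) \<and> fun_subspace S \<and> fun_dim S = i}.
        INF f \<in> {f \<in> S. ell2_norm (verts G) f = 1}. ell2_inner (verts G) f (adj_op G f))"


section \<open>The random graph\<close>

definition theta :: "nat \<Rightarrow> real \<Rightarrow> real" where
  "theta d \<mu> = (THE \<theta>. \<theta>\<^sup>2 - \<mu> * \<theta> + real d - 1 = 0 \<and> sqrt (real d - 1) < \<theta> \<and> \<theta> < real d - 1)"

definition keep_prob :: "nat \<Rightarrow> real \<Rightarrow> real" where
  "keep_prob d \<mu> = theta d \<mu> / (real d - 1)"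

definition perfect_matchings :: "'a set \<Rightarrow> 'a set set set" where
  "perfect_matchings X = {M. partition_on X M \<and> (\<forall>e\<in>M. card e = 2)}"

text \<open>The vertex set is \<open>{..<N}\<close>, the set of half-edges is \<open>{..<N} \<times> {..<d}\<close>, and an edge is the
  pair of half-edges that it matches. The outcome is the edge set of the percolated graph.
  For odd \<open>N * d\<close> there are no perfect matchings and the distribution is meaningless.\<close>

type_synonym hedge = "nat \<times> nat"

definition random_edges :: "nat \<Rightarrow> real \<Rightarrow> nat \<Rightarrow> hedge set set pmf" where
  "random_edges d \<mu> N =
     bind_pmf (pmf_of_set (perfect_matchings ({..<N} \<times> {..<d}))) (\<lambda>M.
       map_pmf (\<lambda>\<omega>. {e \<in> M. \<omega> e}) (Pi_pmf M False (\<lambda>_. bernoulli_pmf (keep_prob d \<mu>))))"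

definition core_graph :: "nat \<Rightarrow> hedge set set \<Rightarrow> (nat, hedge set) multigraph" where
  "core_graph N E = \<lparr>verts = {..<N}, edges = E, ends = (\<lambda>e. image_mset fst (mset_set e))\<rparr>"

text \<open>The extension \<open>T\<^sup>\<infinity> H\<close>. The vertex \<open>(v, [])\<close> is the vertex \<open>v\<close> of \<open>H\<close>; the vertex
  \<open>(v, [i])\<close> is the root of the \<open>i\<close>-th tree attached to \<open>v\<close>; and the children of a tree vertex
  \<open>(v, js)\<close> are the \<open>d - 1\<close> vertices \<open>(v, js @ [j])\<close>. A tree edge is named by its lower end point.\<close>

definition ext_verts :: "nat \<Rightarrow> ('v, 'e) multigraph \<Rightarrow> ('v \<times> nat list) set" where
  "ext_verts d H = {(v, js). v \<in> verts H \<and>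
     (js \<noteq> [] \<longrightarrow> hd js < d - degree H v \<and> set (tl js) \<subseteq> {..<d - 1})}"

definition tree_extension ::
    "nat \<Rightarrow> ('v, 'e) multigraph \<Rightarrow> ('v \<times> nat list, 'e + 'v \<times> nat list) multigraph" where
  "tree_extension d H =
     \<lparr>verts = ext_verts d H,
      edges = Inl ` edges H \<union> Inr ` {x \<in> ext_verts d H. snd x \<noteq> []},
      ends = case_sum (\<lambda>e. image_mset (\<lambda>v. (v, [])) (ends H e))
                      (\<lambda>(v, js). {#(v, butlast js), (v, js)#})\<rparr>"

definition inf_graph ::
    "nat \<Rightarrow> nat \<Rightarrow> hedge set set \<Rightarrow> (nat \<times> nat list, hedge set + nat \<times> nat list) multigraph" where
  "inf_graph d N E = tree_extension d (core_graph N E)"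

text \<open>A directed edge is an ordered pair of matched half-edges, so that a loop, too, has two
  orientations.\<close>

definition directed_core_edges :: "hedge set set \<Rightarrow> (hedge \<times> hedge) set" where
  "directed_core_edges E = {(h, h'). {h, h'} \<in> E}"

definition omega_bar :: "nat \<Rightarrow> real \<Rightarrow> nat \<Rightarrow> hedge set set \<Rightarrow> bool" where
  "omega_bar d \<mu> N E \<longleftrightarrow>
     tangle_free (inf_graph d N E) (1 / 6 * log (real d - 1) (real N)) \<and>
     real (card (directed_core_edges E)) \<ge> 1 / 2 * keep_prob d \<mu> * real d * real N"

end

theory Submission
  imports Defs "HOL-Real_Asymp.Real_Asymp"
begin

text \<open>Weighting the mixed terms along the edges of the attached trees bounds the quadratic form of
  \<open>s + (d - 1) / s\<close> minus the adjacency operator from below by the Bethe form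
  \<open>s\<^sup>2 - 1 - s A + D\<close> of the finite graph, so \<open>\<lambda>\<^sub>2 \<le> s + (d - 1) / s\<close> if this form is nonnegative on
  a hyperplane. If it is not, add a multiple of the square of the functional defining the hyperplane and
  let \<open>s\<close> grow: at the largest \<open>s\<close> for which the sum is not positive definite, a null vector lifts to
  an eigenvector with eigenvalue \<open>s\<close> of the nonbacktracking operator whose edge indicators are centred.

  The power \<open>l\<close> of this operator, with \<open>l\<close> a small multiple of \<open>ln N\<close>, is a sum over nonbacktracking
  walks. On \<open>omega_bar\<close> a walk through two cycles uses a pair that is not an edge and that lands close
  to a short cycle or to an earlier part of the walk; there are few such places, so these walks are negligible
  in Hilbert-Schmidt norm. The other walks form a symmetric kernel, which is bounded by the expected trace of
  its power \<open>2 m\<close> with \<open>m\<close> about \<open>ln (ln N)\<close>. Every edge that is used only once contributes a factor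
  \<open>1 / sqrt (d - 1)\<close> to the expectation (a finite difference of matching probabilities), and the
  closed chains are counted by recording the steps that deviate from the one predicted by the past; since each
  block of length \<open>l\<close> has at most one cycle, there are only about \<open>m\<^sup>2\<close> of those. Finally,
  \<open>s = sqrt (d - 1) * (1 + 1 / sqrt (ln (ln N)))\<close>.\<close>

section \<open>Percolated uniform matchings\<close>

text \<open>The rate comes from a balance. For s = r (1 + \<delta>), r = sqrt (d - 1), the first
  order in \<delta> cancels in s + (d - 1) / s, so the loss is about r \<delta>^2. The count of
  chains of 2 m blocks exceeds r^(2 m l) essentially by a factor N and a factor (ln N)^O(m^2),
  whereas s^(2 m l) gains (1 + \<delta>)^(2 m l). As l is of order ln N, the gain beats every fixed
  power of N once \<delta> m tends to infinity, and with m of order ln (ln N) the second factor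
  stays below every power of N; \<delta>^2 = 1 / ln (ln N) suffices. An edge used twice offers about
  d - 1 choices for two steps, that is r per step. An edge used once must make up for the missing
  step: hence the factor 1 / r required of the finite differences. The bound on the cycles of a
  block keeps the number of recorded deviations independent of l. It is imposed on the walks and not
  on the random graph, so that expectations stay computable. All exceptional events are estimated
  without conditioning, which costs only a factor 2, since \<open>omega_bar\<close> has probability
  at least 1/2 for large N.\<close>

definition is_matching :: "'a set set \<Rightarrow> bool" where
  "is_matching T \<longleftrightarrow> (\<forall>e\<in>T. card e = 2) \<and> disjoint T"

text \<open>The number of perfect matchings of n points: (n - 1)!! for even n, and 0 for odd
  n.\<close>

fun odd_fact :: "nat \<Rightarrow> nat" where
  "odd_fact 0 = 1"
| "odd_fact (Suc 0) = 0"
| "odd_fact (Suc (Suc n)) = Suc n * odd_fact n"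

lemma odd_fact_pos: "even n \<Longrightarrow> odd_fact n > 0"
  by (induction n rule: odd_fact.induct) auto

lemma finite_perfect_matchings: "finite X \<Longrightarrow> finite (perfect_matchings X)"
  by (rule finite_subset[of _ "Pow (Pow X)"]) (auto simp: perfect_matchings_def partition_on_def)

lemma perfect_matchings_iff:
  fixes X :: "'a set"
  shows "M \<in> perfect_matchings X \<longleftrightarrow> \<Union>M = X \<and> is_matching M"
proof -
  have ne: "{} \<notin> M" if "\<forall>e\<in>M. card e = 2" for M :: "'a set set"
  proof
    assume "{} \<in> M"
    with that have "card ({} :: 'a set) = 2" by (rule bspec)
    then show False by simp
  qed
  show ?thesis
  by (auto simp: perfect_matchings_def partition_on_def is_matching_def)
qed

lemma is_matching_subset: "is_matching M \<Longrightarrow> T \<subseteq> M \<Longrightarrow> is_matching T"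
  unfolding is_matching_def using pairwise_subset[of disjnt M T] subsetD[of T M] by simp

lemma is_matching_Un:
  assumes "is_matching A" "is_matching B" "\<Union>A \<inter> \<Union>B = {}"
  shows "is_matching (A \<union> B)"
proof -
  have "e \<inter> e' = {}" if "e \<in> A" "e' \<in> B" for e e' using assms(3) that by blast
  then have "disjnt e e'" "disjnt e' e" if "e \<in> A" "e' \<in> B" for e e'
    using that by (simp_all add: disjnt_def inf_commute[of e' e])
  then show ?thesis using assms(1,2) unfolding is_matching_def by (simp add: pairwise_def Ball_def)
qed

text \<open>Prescribed pairs leave an arbitrary matching of the other points; this turns joint edge
  probabilities into quotients of \<open>odd_fact\<close>.\<close>

lemma perfect_matchings_containing:
  assumes "is_matching T" "\<Union>T \<subseteq> X"
  shows "bij_betw (\<lambda>M. M - T) {M \<in> perfect_matchings X. T \<subseteq> M} (perfect_matchings (X - \<Union>T))"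
proof (rule bij_betwI[where g = "\<lambda>M. M \<union> T"])
  show "(\<lambda>M. M - T) \<in> {M \<in> perfect_matchings X. T \<subseteq> M} \<rightarrow> perfect_matchings (X - \<Union>T)"
  proof
    fix M assume "M \<in> {M \<in> perfect_matchings X. T \<subseteq> M}"
    then have M: "\<Union>M = X" "is_matching M" "T \<subseteq> M"
      by (auto simp: perfect_matchings_iff)
    have "\<Union>(M - T) = X - \<Union>T"
    proof
      show "\<Union>(M - T) \<subseteq> X - \<Union>T"
      proof
        fix x assume "x \<in> \<Union>(M - T)"
        then obtain e where e: "x \<in> e" "e \<in> M" "e \<notin> T" by blast
        have "x \<notin> e'" if "e' \<in> T" for e'
        proof -
          have "e \<inter> e' = {}" using M e that disjointD[of M e e'] by (metis is_matching_def subsetD)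
          then show ?thesis using e by blast
        qed
        then show "x \<in> X - \<Union>T" using e M(1) by blast
      qed
    qed (use M(1) in blast)
    then show "M - T \<in> perfect_matchings (X - \<Union>T)"
      using M by (auto simp: perfect_matchings_iff intro: is_matching_subset)
  qed
  show "(\<lambda>M. M \<union> T) \<in> perfect_matchings (X - \<Union>T) \<rightarrow> {M \<in> perfect_matchings X. T \<subseteq> M}"
  proof
    fix M assume "M \<in> perfect_matchings (X - \<Union>T)"
    then have M: "\<Union>M = X - \<Union>T" "is_matching M" by (auto simp: perfect_matchings_iff)
    have "is_matching (M \<union> T)" using M assms by (intro is_matching_Un) auto
    moreover have "\<Union>(M \<union> T) = X" using M assms by auto
    ultimately show "M \<union> T \<in> {M \<in> perfect_matchings X. T \<subseteq> M}" by (auto simp: perfect_matchings_iff)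
  qed
  show "(M - T) \<union> T = M" if "M \<in> {M \<in> perfect_matchings X. T \<subseteq> M}" for M using that by auto
  show "M \<union> T - T = M" if "M \<in> perfect_matchings (X - \<Union>T)" for M
  proof -
    have M: "\<Union>M = X - \<Union>T" "is_matching M" using that by (auto simp: perfect_matchings_iff)
    have "M \<inter> T = {}"
    proof -
      have "e = {}" if "e \<in> M" "e \<in> T" for e using M(1) that by auto
      moreover have "e \<noteq> {}" if "e \<in> T" for e
        using assms(1) that by (metis is_matching_def card.empty zero_neq_numeral)
      ultimately show ?thesis by blast
    qed
    then show ?thesis by auto
  qed
qed

text \<open>Classification by the partner y of a fixed point x.\<close>

lemma card_perfect_matchings:
  "finite X \<Longrightarrow> card (perfect_matchings X) = odd_fact (card X)"
proof (induction "card X" arbitrary: X rule: odd_fact.induct)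
  case 1
  have "M \<in> perfect_matchings {} \<longleftrightarrow> M = {}" for M :: "'a set set"
  by (fastforce simp: perfect_matchings_iff is_matching_def)
  then have "perfect_matchings X = {{}}" using 1 by auto
  then show ?case using 1 by simp
next
  case 2
  then have "card X = 1" by simp
  then obtain x where x: "X = {x}" by (rule card_1_singletonE)
  have "perfect_matchings X = {}"
  proof (rule ccontr)
    assume "perfect_matchings X \<noteq> {}"
    then obtain M where M: "\<Union>M = {x}" "\<forall>e\<in>M. card e = 2"
      by (auto simp: perfect_matchings_iff is_matching_def x)
    from M(1) obtain e where "e \<in> M" "x \<in> e" by auto
    with M have "e \<subseteq> {x}" "card e = 2" by auto
    then show False using card_mono[of "{x}" e] by simp
  qed
  moreover have "odd_fact (card X) = 0" using 2(1) by (metis odd_fact.simps(2))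
  ultimately show ?case by simp
next
  case (3 n X)
  then obtain x where x: "x \<in> X" by (metis card.empty nat.distinct(1) ex_in_conv)
  have eq: "perfect_matchings X = (\<Union>y\<in>X - {x}. {M \<in> perfect_matchings X. {{x,y}} \<subseteq> M})"
  proof (intro equalityI subsetI)
    fix M assume M: "M \<in> perfect_matchings X"
    then obtain e where e: "e \<in> M" "x \<in> e" "card e = 2" "e \<subseteq> X"
      using x by (auto simp: perfect_matchings_iff is_matching_def)
    then obtain y where "e = {x, y}" "y \<noteq> x"
      by (metis card_2_iff doubleton_eq_iff insertE singletonD)
    with e M show "M \<in> (\<Union>y\<in>X - {x}. {M \<in> perfect_matchings X. {{x,y}} \<subseteq> M})" by auto
  qed auto
  have "card (perfect_matchings X) = (\<Sum>y\<in>X - {x}. card {M \<in> perfect_matchings X. {{x,y}} \<subseteq> M})"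
  proof (subst eq, rule card_UN_disjoint)
    show "\<forall>i\<in>X - {x}. \<forall>j\<in>X - {x}. i \<noteq> j \<longrightarrow>
       {M \<in> perfect_matchings X. {{x, i}} \<subseteq> M} \<inter> {M \<in> perfect_matchings X. {{x, j}} \<subseteq> M} = {}"
    using disjointD by (auto simp: perfect_matchings_iff is_matching_def)
  qed (use 3 finite_perfect_matchings[of X] in auto)
  also have "\<dots> = (\<Sum>y\<in>X - {x}. odd_fact n)"
  proof (rule sum.cong[OF refl])
    fix y assume y: "y \<in> X - {x}"
    have "card {M \<in> perfect_matchings X. {{x,y}} \<subseteq> M} = card (perfect_matchings (X - \<Union>{{x,y}}))"
      using x y by (intro bij_betw_same_card[OF perfect_matchings_containing]) (auto simp: is_matching_def)
    also have "card (X - \<Union>{{x,y}}) = n" using x y 3(2,3) by auto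
    then have "card (perfect_matchings (X - \<Union>{{x,y}})) = odd_fact n"
      using 3(1)[of "X - \<Union>{{x,y}}"] 3(3) by simp
    finally show "card {M \<in> perfect_matchings X. {{x,y}} \<subseteq> M} = odd_fact n" .
  qed
  also have "\<dots> = odd_fact (card X)" using x by (simp flip: 3(2))
  finally show ?case .
qed

lemma card_Union_matching:
  assumes "is_matching T" "finite T"
  shows "card (\<Union>T) = 2 * card T"
proof -
  have "card (\<Union>T) = (\<Sum>e\<in>T. card e)"
    using assms by (intro card_Union_disjoint) (auto simp: is_matching_def intro: card_ge_0_finite)
  also have "\<dots> = 2 * card T" using assms by (simp add: is_matching_def)
  finally show ?thesis .
qed

lemma odd_fact_ratio:
  assumes "2 * k \<le> n" "even n"
  shows "real (odd_fact (n - 2 * k)) / real (odd_fact n) = (\<Prod>i<k. 1 / (real n - 1 - 2 * real i))"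
  using assms(1)
proof (induction k)
  case 0
  then show ?case using odd_fact_pos[OF assms(2)] by simp
next
  case (Suc k)
  obtain j where j: "n - 2 * k = Suc (Suc j)" using Suc.prems
    by (intro that[of "n - 2 * k - 2"]) simp
  have "n - 2 * Suc k = j" using j by simp
  moreover have "real n - 1 - 2 * real k = real (Suc j)" using j by linarith
  moreover have "real (odd_fact (n - 2 * k)) / real (odd_fact n) = (\<Prod>i<k. 1 / (real n - 1 - 2 * real i))"
    using Suc by simp
  moreover have "real (odd_fact (n - 2 * k)) = real (Suc j) * real (odd_fact j)" unfolding j by (simp add: algebra_simps)
  ultimately have "(\<Prod>i<Suc k. 1 / (real n - 1 - 2 * real i))
      = (real (Suc j) * real (odd_fact j)) / real (odd_fact n) * (1 / real (Suc j))" by simp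
  also have "\<dots> = real (odd_fact j) / real (odd_fact n)" by (simp del: of_nat_Suc)
  finally show ?case using \<open>n - 2 * Suc k = j\<close> by simp
qed

text \<open>The law of \<open>random_edges\<close> over an arbitrary ground set: the estimates for
  centred indicators do not see the vertices.\<close>

definition kept_edges :: "'a set \<Rightarrow> real \<Rightarrow> 'a set set pmf" where
  "kept_edges X p = bind_pmf (pmf_of_set (perfect_matchings X)) (\<lambda>M.
       map_pmf (\<lambda>\<omega>. {e \<in> M. \<omega> e}) (Pi_pmf M False (\<lambda>_. bernoulli_pmf p)))"

lemma random_edges_kept: "random_edges d \<mu> N = kept_edges ({..<N} \<times> {..<d}) (keep_prob d \<mu>)"
  by (simp add: random_edges_def kept_edges_def)

lemma perfect_matchings_nonempty:
  assumes "finite X" "even (card X)"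
  shows "perfect_matchings X \<noteq> {}"
  using card_perfect_matchings[OF assms(1)] odd_fact_pos[OF assms(2)] by auto

lemma finite_matching: "finite X \<Longrightarrow> M \<in> perfect_matchings X \<Longrightarrow> finite M"
  by (auto simp: perfect_matchings_iff intro: finite_UnionD)

lemma finite_set_Pi_pmf_bool: "finite M \<Longrightarrow> finite (set_pmf (Pi_pmf M False (\<lambda>_. bernoulli_pmf p)))"
  by (rule finite_subset[OF set_Pi_pmf_subset', of M]) auto

lemma set_kept_edges:
  assumes "finite X" "even (card X)" "E \<in> set_pmf (kept_edges X p)"
  shows "is_matching E" "\<Union>E \<subseteq> X" "finite E"
proof -
  obtain M where M: "M \<in> perfect_matchings X" "E \<subseteq> M"
    using assms perfect_matchings_nonempty[OF assms(1,2)]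
    by (auto simp: kept_edges_def finite_perfect_matchings)
  then show "is_matching E" "\<Union>E \<subseteq> X" "finite E"
    using finite_matching[OF assms(1) M(1)]
    by (auto simp: perfect_matchings_iff intro: is_matching_subset finite_subset)
qed

lemma finite_set_kept_edges:
  assumes "finite X" "even (card X)"
  shows "finite (set_pmf (kept_edges X p))"
  by (rule finite_subset[of _ "Pow (Pow X)"]) (use assms set_kept_edges(2)[OF assms] in \<open>blast | simp\<close>)+

text \<open>The probability that k given disjoint pairs are matched and kept: the i-th pair competes
  with n - 1 - 2 i possible partners.\<close>

definition match_prob :: "nat \<Rightarrow> real \<Rightarrow> nat \<Rightarrow> real" where
  "match_prob n p k = p ^ k * (\<Prod>i<k. 1 / (real n - 1 - 2 * real i))"

lemma prob_kept_edges:
  assumes X: "finite X" "even (card X)" and p: "0 \<le> p" "p \<le> 1" and T: "finite T"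
  shows "measure_pmf.prob (kept_edges X p) {E. T \<subseteq> E} =
    (if is_matching T \<and> \<Union>T \<subseteq> X then match_prob (card X) p (card T) else 0)"
proof -
  let ?PM = "perfect_matchings X"
  have fin: "finite ?PM" "?PM \<noteq> {}" using X by (auto simp: finite_perfect_matchings perfect_matchings_nonempty)
  have inner: "measure_pmf.prob (map_pmf (\<lambda>\<omega>. {e \<in> M. \<omega> e}) (Pi_pmf M False (\<lambda>_. bernoulli_pmf p))) {E. T \<subseteq> E}
      = (if T \<subseteq> M then p ^ card T else 0)" if "M \<in> ?PM" for M
  proof -
    have fM: "finite M" using that X finite_matching by auto
    have "measure_pmf.prob (map_pmf (\<lambda>\<omega>. {e \<in> M. \<omega> e}) (Pi_pmf M False (\<lambda>_. bernoulli_pmf p))) {E. T \<subseteq> E}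
      = measure_pmf.prob (Pi_pmf M False (\<lambda>_. bernoulli_pmf p)) {\<omega>. T \<subseteq> {e \<in> M. \<omega> e}}"
      by simp
    also have "\<dots> = (if T \<subseteq> M then p ^ card T else 0)"
    proof (cases "T \<subseteq> M")
      case True
      have "{\<omega>. T \<subseteq> {e \<in> M. \<omega> e}} = Pi M (\<lambda>e. if e \<in> T then {True} else UNIV)"
        using True by (auto split: if_splits)
      then have "measure_pmf.prob (Pi_pmf M False (\<lambda>_. bernoulli_pmf p)) {\<omega>. T \<subseteq> {e \<in> M. \<omega> e}}
        = (\<Prod>e\<in>M. measure_pmf.prob (bernoulli_pmf p) (if e \<in> T then {True} else UNIV))"
        using measure_Pi_pmf_Pi[OF fM] by simp
      also have "\<dots> = (\<Prod>e\<in>M. if e \<in> T then p else 1)"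
        using p by (intro prod.cong) (auto simp: measure_pmf_single)
      also have "\<dots> = p ^ card T"
        using True fM by (simp add: prod.If_cases Int_absorb1)
      finally show ?thesis using True by simp
    next
      case False
      then have "{\<omega>. T \<subseteq> {e \<in> M. \<omega> e}} = {}" by auto
      then show ?thesis using False by simp
    qed
    finally show ?thesis .
  qed
  have "measure_pmf.prob (kept_edges X p) {E. T \<subseteq> E} = measure_pmf.expectation (kept_edges X p) (indicator {E. T \<subseteq> E})"
    by simp
  also have "\<dots> = (\<Sum>M\<in>?PM. measure_pmf.expectation (map_pmf (\<lambda>\<omega>. {e \<in> M. \<omega> e}) (Pi_pmf M False (\<lambda>_. bernoulli_pmf p)))
       (indicator {E. T \<subseteq> E}) /\<^sub>R real (card ?PM))"
    unfolding kept_edges_def using fin finite_matching[OF X(1)]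
    by (intro pmf_expectation_bind_pmf_of_set) (auto intro!: finite_set_Pi_pmf_bool)
  also have "\<dots> = (\<Sum>M\<in>?PM. measure_pmf.prob (map_pmf (\<lambda>\<omega>. {e \<in> M. \<omega> e}) (Pi_pmf M False (\<lambda>_. bernoulli_pmf p)))
       {E. T \<subseteq> E} / real (card ?PM))"
    by (simp add: divide_inverse mult.commute del: measure_map_pmf integral_map_pmf)
  also have "\<dots> = (\<Sum>M\<in>?PM. (if T \<subseteq> M then p ^ card T else 0) / real (card ?PM))"
    by (intro sum.cong) (simp_all add: inner del: measure_map_pmf)
  also have "\<dots> = p ^ card T * real (card {M\<in>?PM. T \<subseteq> M}) / real (card ?PM)"
    using fin by (simp add: sum_divide_distrib[symmetric] sum.If_cases Int_def)
  also have "\<dots> = (if is_matching T \<and> \<Union>T \<subseteq> X then match_prob (card X) p (card T) else 0)"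
  proof (cases "is_matching T \<and> \<Union>T \<subseteq> X")
    case True
    have "card {M\<in>?PM. T \<subseteq> M} = card (perfect_matchings (X - \<Union>T))"
      using True by (intro bij_betw_same_card[OF perfect_matchings_containing]) auto
    also have "\<dots> = odd_fact (card (X - \<Union>T))" using X by (intro card_perfect_matchings) auto
    also have "card (X - \<Union>T) = card X - 2 * card T"
      using True X T card_Union_matching[of T] by (subst card_Diff_subset) (auto intro: finite_subset)
    finally have "card {M\<in>?PM. T \<subseteq> M} = odd_fact (card X - 2 * card T)" .
    moreover have "2 * card T \<le> card X"
      using True X T card_Union_matching[of T] card_mono[of X "\<Union>T"] by auto
    ultimately show ?thesis using True X odd_fact_ratio[of "card T" "card X"]
      by (simp add: match_prob_def card_perfect_matchings flip: times_divide_eq_right)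
  next
    case False
    then have "{M\<in>?PM. T \<subseteq> M} = {}" using is_matching_subset by (auto simp: perfect_matchings_iff)
    then show ?thesis using False by (simp only: if_False) simp
  qed
  finally show ?thesis .
qed

section \<open>Centred edge indicators\<close>

text \<open>With a = n - 1, \<open>fdiff a 0 k\<close> is the probability that k disjoint pairs are
  kept, divided by (p / a)^k; independence would make it 1. Its j-th forward difference in k belongs
  to k required edges and j centred ones.\<close>

fun fdiff :: "real \<Rightarrow> nat \<Rightarrow> nat \<Rightarrow> real" where
  "fdiff a 0 k = (\<Prod>i<k. a / (a - 2 * real i))"
| "fdiff a (Suc j) k = fdiff a j (Suc k) - fdiff a j k"

text \<open>The finite differences of the ratio between the matching probabilities and their independent
  counterparts satisfy a two-term recursion with small nonnegative coefficients.\<close>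

lemma fdiff_rec:
  assumes "a > 2 * real (k + j)"
  shows "a * fdiff a (Suc j) k = 2 * (real k * fdiff a j (Suc k) + real j * fdiff a (j - 1) (k + 2))"
  using assms
proof (induction j arbitrary: k)
  case 0
  have "a * (fdiff a 0 (Suc k) - fdiff a 0 k) = 2 * (real k * fdiff a 0 (Suc k))"
    using 0 by (simp add: field_simps)
  then show ?case by simp
next
  case (Suc j)
  \<comment> \<open>For j = 0 the truncated j - 1 is harmless, being multiplied by 0.\<close>
  have eq: "real j * fdiff a j (k+2) = real j * (fdiff a (j - 1) (k+3) - fdiff a (j - 1) (k+2))"
    by (cases j) (simp_all add: eval_nat_numeral)
  have "a * fdiff a (Suc (Suc j)) k = a * fdiff a (Suc j) (Suc k) - a * fdiff a (Suc j) k"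
    by (simp add: algebra_simps)
  also have "\<dots> = 2 * (real (Suc k) * fdiff a j (k+2) + real j * fdiff a (j - 1) (k + 3))
       - 2 * (real k * fdiff a j (Suc k) + real j * fdiff a (j - 1) (k + 2))"
    using Suc.IH[of k] Suc.IH[of "Suc k"] Suc.prems by (simp add: eval_nat_numeral)
  also have "\<dots> = 2 * (real (Suc k) * fdiff a j (k+2) - real k * fdiff a j (Suc k) + real j * fdiff a j (k+2))"
    unfolding eq by (simp add: algebra_simps)
  also have "\<dots> = 2 * (real k * (fdiff a j (k+2) - fdiff a j (Suc k)) + real (Suc j) * fdiff a j (k+2))"
    by (simp add: algebra_simps)
  also have "fdiff a j (k+2) - fdiff a j (Suc k) = fdiff a (Suc j) (Suc k)" by simp
  finally show ?case by simp
qed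

text \<open>Each factor is at most 1 / (1 - 2 K / a), and by Bernoulli 4 K^2 \<le> a keeps (1 - 2 K
  / a)^k above 1/2.\<close>

lemma fdiff_base_le:
  assumes "real k \<le> K" "4 * K\<^sup>2 \<le> a" "a \<ge> 1"
  shows "fdiff a 0 k \<le> 2"
proof (cases "k = 0")
  case False
  then have K1: "K \<ge> 1" using assms(1) by linarith
  have "K * 1 \<le> K * K" using K1 by (intro mult_left_mono) auto
  then have K2: "4 * K \<le> a" using assms(2) by (simp add: power2_eq_square)
  define x where "x = 2 * K / a"
  have x: "0 \<le> x" "x \<le> 1/2" using K1 K2 by (auto simp: x_def)
  have "1 - real k * x \<le> (1 - x) ^ k"
    using Bernoulli_inequality[of "-x" k] x by simp
  moreover have "real k * x \<le> 1/2"
  proof -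
    have "real k * x \<le> K * x" using assms x by (intro mult_right_mono) auto
    also have "\<dots> \<le> 1/2" using assms by (simp add: x_def power2_eq_square)
    finally show ?thesis .
  qed
  ultimately have pw: "1/2 \<le> (1 - x) ^ k" by linarith
  have "fdiff a 0 k \<le> (\<Prod>i<k. 1 / (1 - x))"
    unfolding fdiff.simps
  proof (intro prod_mono conjI)
    fix i assume "i \<in> {..<k}"
    then have i: "real i < K" using assms by simp
    show "0 \<le> a / (a - 2 * real i)" using i K2 by simp
    have "a * (1 - x) \<le> a - 2 * real i" using i assms by (simp add: x_def field_simps)
    then have "a / (a - 2 * real i) \<le> a / (a * (1 - x))"
      using x i K2 by (intro divide_left_mono) auto
    also have "\<dots> = 1 / (1 - x)" using assms by simp
    finally show "a / (a - 2 * real i) \<le> 1 / (1 - x)" .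
  qed
  also have "\<dots> = 1 / (1 - x) ^ k" by (simp add: power_one_over)
  also have "\<dots> \<le> 2" using pw by (simp add: field_simps)
  finally show ?thesis .
qed simp

text \<open>The recursion lowers the order by one or two at a gain of order K / a. The last
  hypothesis is exactly what closes the induction with a gain \<eta> per order; every fixed \<eta>
  is admissible once a is large compared with K.\<close>

lemma fdiff_bound:
  assumes "real (k + j) \<le> K" "4 * K\<^sup>2 \<le> a" "4 * K < a" "a \<ge> 1" "\<eta> > 0" "2 * K * (1 + \<eta>) \<le> a * \<eta>\<^sup>2"
  shows "0 \<le> fdiff a j k \<and> fdiff a j k \<le> 2 * \<eta> ^ j"
  using assms(1)
proof (induction j arbitrary: k rule: less_induct)
  case (less j)
  show ?case
  proof (cases j)
    case 0
    have "0 \<le> fdiff a 0 k" using less.prems assms by (auto intro!: prod_nonneg)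
    then show ?thesis using fdiff_base_le[of k K a] less.prems assms 0 by simp
  next
    case (Suc i)
    have K0: "K \<ge> 0" using less.prems by linarith
    have rec: "a * fdiff a j k = 2 * (real k * fdiff a i (Suc k) + real i * fdiff a (i - 1) (k + 2))"
      unfolding Suc using less.prems assms Suc by (intro fdiff_rec) simp
    have 1: "0 \<le> fdiff a i (Suc k)" "fdiff a i (Suc k) \<le> 2 * \<eta> ^ i"
      using less.IH[of i "Suc k"] less.prems Suc by auto
    have 2: "0 \<le> real i * fdiff a (i - 1) (k+2) \<and> real i * fdiff a (i - 1) (k+2) * \<eta> \<le> K * (2 * \<eta> ^ i)"
    proof (cases i)
      case 0 then show ?thesis using assms by simp
    next
      case (Suc i')
      have "0 \<le> fdiff a i' (k+2)" "fdiff a i' (k+2) \<le> 2 * \<eta> ^ i'"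
        using less.IH[of i' "k+2"] less.prems Suc \<open>j = Suc i\<close> by auto
      moreover have "real i \<le> K" using less.prems \<open>j = Suc i\<close> by simp
      ultimately have "real i * (fdiff a i' (k+2) * \<eta>) \<le> K * (2 * \<eta> ^ i' * \<eta>)"
        using assms(5) by (intro mult_mono mult_right_mono) auto
      then show ?thesis using \<open>0 \<le> fdiff a i' (k+2)\<close> Suc by (simp add: mult.commute[of \<eta>])
    qed
    have "a * fdiff a j k * \<eta> \<le> 2 * (K * (2 * \<eta> ^ i) * \<eta> + K * (2 * \<eta> ^ i))"
    proof -
      have "real k * fdiff a i (Suc k) \<le> K * (2 * \<eta> ^ i)"
        using 1 less.prems by (intro mult_mono) auto
      then have "real k * fdiff a i (Suc k) * \<eta> \<le> K * (2 * \<eta> ^ i) * \<eta>"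
        using assms(5) by (intro mult_right_mono) auto
      then show ?thesis unfolding rec using 2 by (simp add: algebra_simps)
    qed
    also have "\<dots> = 2 * \<eta> ^ i * (2 * K * (1 + \<eta>))" by (simp add: algebra_simps)
    also have "\<dots> \<le> 2 * \<eta> ^ i * (a * \<eta>\<^sup>2)" using assms by (intro mult_left_mono) auto
    finally have "(a * \<eta>) * fdiff a j k \<le> (a * \<eta>) * (2 * \<eta> ^ j)"
      by (simp add: Suc power2_eq_square algebra_simps)
    then have "fdiff a j k \<le> 2 * \<eta> ^ j" using assms by simp
    moreover have "0 \<le> a * fdiff a j k" unfolding rec using 1 2 by simp
    then have "0 \<le> fdiff a j k" using assms by (simp add: zero_le_mult_iff)
    ultimately show ?thesis by simp
  qed
qed

lemma match_prob_fdiff: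
  assumes "real n > 1"
  shows "match_prob n p k = (p / (real n - 1)) ^ k * fdiff (real n - 1) 0 k"
proof -
  have "(\<Prod>i<k. 1 / (real n - 1 - 2 * real i)) * (real n - 1) ^ k = fdiff (real n - 1) 0 k"
    by (simp add: prod_dividef)
  then show ?thesis using assms by (simp add: match_prob_def field_simps)
qed

abbreviation mixed :: "real \<Rightarrow> 'a set set \<Rightarrow> 'a set set \<Rightarrow> 'a set set \<Rightarrow> real" where
  "mixed c T F E \<equiv> of_bool (T \<subseteq> E) * (\<Prod>f\<in>F. of_bool (f \<in> E) - c)"

text \<open>Expanding one centred factor gives the difference between requiring the edge in addition
  and c times leaving it out, which is the recursion that defines \<open>fdiff\<close>.\<close>

lemma expectation_kept_edges_indicator:
  assumes X: "finite X" "even (card X)" "real (card X) > 1" and p: "0 \<le> p" "p \<le> 1"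
    and c: "c = p / (real (card X) - 1)"
    and fin: "finite F" "finite T" and match: "is_matching (T \<union> F)" "\<Union>(T \<union> F) \<subseteq> X" "T \<inter> F = {}"
  shows "measure_pmf.expectation (kept_edges X p) (mixed c T F)
    = c ^ (card T + card F) * fdiff (real (card X) - 1) (card F) (card T)"
  using fin match
proof (induction F arbitrary: T rule: finite_induct)
  case empty
  have "(\<lambda>E. mixed c T {} E) = indicator {E. T \<subseteq> E}"
    by auto
  then have "measure_pmf.expectation (kept_edges X p) (\<lambda>E. mixed c T {} E)
     = measure_pmf.expectation (kept_edges X p) (indicator {E. T \<subseteq> E})"
    by (simp only:)
  also have "\<dots> = measure_pmf.prob (kept_edges X p) {E. T \<subseteq> E}" by simp
  also have "\<dots> = match_prob (card X) p (card T)"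
    using empty X p by (subst prob_kept_edges) auto
  finally show ?case using X by (simp add: match_prob_fdiff c)
next
  case (insert f F)
  let ?P = "kept_edges X p"
  have int: "integrable ?P g" for g :: "_ \<Rightarrow> real"
    by (intro integrable_measure_pmf_finite finite_set_kept_edges X)
  have "measure_pmf.expectation ?P (\<lambda>E. mixed c T (insert f F) E)
    = measure_pmf.expectation ?P (\<lambda>E. mixed c (insert f T) F E
        - c * (mixed c T F E))"
    using insert by (intro Bochner_Integration.integral_cong refl) (auto simp: algebra_simps)
  also have "\<dots> = measure_pmf.expectation ?P (\<lambda>E. mixed c (insert f T) F E)
        - c * measure_pmf.expectation ?P (mixed c T F)"
    by (subst Bochner_Integration.integral_diff) (use int in auto)
  also have "measure_pmf.expectation ?P (\<lambda>E. mixed c (insert f T) F E)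
    = c ^ (card (insert f T) + card F) * fdiff (real (card X) - 1) (card F) (card (insert f T))"
    using insert by (intro insert.IH) auto
  also have "measure_pmf.expectation ?P (mixed c T F)
    = c ^ (card T + card F) * fdiff (real (card X) - 1) (card F) (card T)"
    using insert.prems by (intro insert.IH) (auto intro: is_matching_subset)
  also have "card (insert f T) = Suc (card T)" using insert by simp
  finally show ?case using insert.hyps by (simp add: algebra_simps)
qed

text \<open>An indicator takes only two values, so (1_f - c)^m = (-c)^m + ((1 - c)^m - (-c)^m) 1_f;
  this bounds the coefficient of the indicator.\<close>

lemma abs_centred_power_coeff:
  fixes c :: real
  assumes "0 \<le> c" "c \<le> 1" "m \<ge> 1"
  shows "\<bar>(1 - c) ^ m - (-c) ^ m\<bar> \<le> 1"
proof -
  obtain k where m: "m = Suc k" using assms by (cases m) auto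
  have "\<bar>(1 - c) ^ m - (-c) ^ m\<bar> \<le> (1 - c) ^ m + c ^ m"
    using abs_triangle_ineq4[of "(1-c)^m" "(-c)^m"] assms by simp
  also have "\<dots> \<le> (1 - c) + c"
    unfolding m using assms by (intro add_mono) (auto simp: mult_left_le power_le_one)
  finally show ?thesis by simp
qed

text \<open>The constant c is the exact probability of a given pair, K bounds the number of distinct
  edges in a product, and \<eta> is the gain per edge that occurs once.\<close>

locale centred_model =
  fixes X :: "'a set" and p c \<eta> K :: real
  assumes X: "finite X" "even (card X)" and n1: "real (card X) > 1"
    and p: "0 \<le> p" "p \<le> 1" and c: "c = p / (real (card X) - 1)"
    and K: "4 * K\<^sup>2 \<le> real (card X) - 1" "4 * K < real (card X) - 1" "real (card X) \<ge> 2"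
    and \<eta>: "\<eta> > 0" "2 * K * (1 + \<eta>) \<le> (real (card X) - 1) * \<eta>\<^sup>2"
begin

lemma c01: "0 \<le> c" "c \<le> 1" "c \<le> 1 / (real (card X) - 1)"
proof -
  show "0 \<le> c" using p n1 by (simp add: c)
  show c1: "c \<le> 1 / (real (card X) - 1)" unfolding c using p n1 by (intro divide_right_mono) auto
  have "1 / (real (card X) - 1) \<le> 1" using K(3) by simp
  then show "c \<le> 1" using c1 by linarith
qed

lemma integrable_kept [simp]: "integrable (kept_edges X p) (g :: _ \<Rightarrow> real)"
  by (intro integrable_measure_pmf_finite finite_set_kept_edges X)

text \<open>T contains required edges, F edges that are centred once and are disjoint from all
  others, R edges with arbitrary powers. Expanding the power of an edge of R either moves the edge
  into T or removes it at the price (-c)^m; the gain \<eta> comes from F alone.\<close>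

lemma expectation_mixed:
  assumes "finite F" "finite T" "finite R" "\<And>f. f \<in> R \<Longrightarrow> m f \<ge> 1"
    and F: "is_matching F" "\<Union>F \<subseteq> X" and dis: "\<And>f. f \<in> T \<union> R \<Longrightarrow> f \<inter> \<Union>F = {}"
    and dis2: "T \<inter> R = {}" "T \<inter> F = {}" "R \<inter> F = {}" and size: "real (card T + card F + card R) \<le> K"
  shows "\<bar>measure_pmf.expectation (kept_edges X p)
      (\<lambda>E. mixed c T F E * (\<Prod>f\<in>R. (of_bool (f \<in> E) - c) ^ m f))\<bar>
    \<le> 2 * c ^ (card T + card F + card R) * \<eta> ^ card F * (\<Prod>f\<in>R. 1 + c ^ (m f - 1))"
  using assms(3,2,4) dis dis2 size
proof (induction R arbitrary: T rule: finite_induct)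
  case empty
  show ?case
  proof (cases "is_matching T \<and> \<Union>T \<subseteq> X")
    case True
    have "\<Union>T \<inter> \<Union>F = {}" using empty.prems by blast
    then have mat: "is_matching (T \<union> F)" "\<Union>(T \<union> F) \<subseteq> X" using True F by (auto intro: is_matching_Un)
    have "measure_pmf.expectation (kept_edges X p) (mixed c T F)
      = c ^ (card T + card F) * fdiff (real (card X) - 1) (card F) (card T)"
      using mat empty.prems assms(1) X n1 p c by (intro expectation_kept_edges_indicator) auto
    moreover have "0 \<le> fdiff (real (card X) - 1) (card F) (card T) \<and> fdiff (real (card X) - 1) (card F) (card T) \<le> 2 * \<eta> ^ card F"
      using empty.prems K \<eta> by (intro fdiff_bound[where K = K]) auto
    ultimately have "\<bar>measure_pmf.expectation (kept_edges X p) (mixed c T F)\<bar>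
      \<le> c ^ (card T + card F) * (2 * \<eta> ^ card F)"
      using c01(1) by (simp only: abs_mult) (intro mult_mono; simp)
    then show ?thesis by simp
  next
    case False
    have "measure_pmf.expectation (kept_edges X p) (mixed c T F)
      = measure_pmf.expectation (kept_edges X p) (\<lambda>E. 0)"
    proof (intro integral_cong_AE AE_pmfI)
      fix E assume E: "E \<in> set_pmf (kept_edges X p)"
      then have "\<not> T \<subseteq> E" using False set_kept_edges(1,2)[OF X E] is_matching_subset by blast
      then show "mixed c T F E = 0" by simp
    qed auto
    then show ?thesis using c01 \<eta> by simp
  qed
next
  case (insert f R)
  let ?P = "kept_edges X p"
  let ?W = "\<lambda>T E. mixed c T F E * (\<Prod>f\<in>R. (of_bool (f \<in> E) - c) ^ m f)"
  define \<alpha> where "\<alpha> = (1 - c) ^ m f - (-c) ^ m f"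
  define \<beta> where "\<beta> = (-c) ^ m f"
  define B where "B = 2 * c ^ (card T + card F + card R) * \<eta> ^ card F * (\<Prod>f\<in>R. 1 + c ^ (m f - 1))"
  have mf: "m f \<ge> 1" using insert by simp
  have "measure_pmf.expectation ?P (\<lambda>E. mixed c T F E * (\<Prod>f\<in>insert f R. (of_bool (f \<in> E) - c) ^ m f))
    = measure_pmf.expectation ?P (\<lambda>E. \<alpha> * ?W (insert f T) E + \<beta> * ?W T E)"
  proof (intro Bochner_Integration.integral_cong refl)
    fix E
    have aux: "y * g * (x * r) = \<alpha> * (u * g * r) + \<beta> * (y * g * r)"
      if "x * y = \<alpha> * u + \<beta> * y" for x y u g r :: real
    proof -
      have "y * g * (x * r) = (x * y) * (g * r)" by simp
      then show ?thesis unfolding that by (simp add: algebra_simps)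
    qed
    have "(of_bool (f \<in> E) - c) ^ m f * of_bool (T \<subseteq> E) = \<alpha> * of_bool (insert f T \<subseteq> E) + \<beta> * of_bool (T \<subseteq> E)"
      by (simp add: \<alpha>_def \<beta>_def)
    moreover have "(\<Prod>f\<in>insert f R. (of_bool (f \<in> E) - c) ^ m f) = (of_bool (f \<in> E) - c) ^ m f * (\<Prod>f\<in>R. (of_bool (f \<in> E) - c) ^ m f)"
      using insert.hyps by simp
    ultimately show "mixed c T F E * (\<Prod>f\<in>insert f R. (of_bool (f \<in> E) - c) ^ m f)
      = \<alpha> * ?W (insert f T) E + \<beta> * ?W T E"
      by (simp only: aux)
  qed
  also have "\<dots> = \<alpha> * measure_pmf.expectation ?P (?W (insert f T)) + \<beta> * measure_pmf.expectation ?P (?W T)"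
    by simp
  finally have eq: "measure_pmf.expectation ?P (\<lambda>E. mixed c T F E * (\<Prod>f\<in>insert f R. (of_bool (f \<in> E) - c) ^ m f))
    = \<alpha> * measure_pmf.expectation ?P (?W (insert f T)) + \<beta> * measure_pmf.expectation ?P (?W T)" .
  have "\<bar>\<alpha> * measure_pmf.expectation ?P (?W (insert f T)) + \<beta> * measure_pmf.expectation ?P (?W T)\<bar>
    \<le> \<bar>\<alpha>\<bar> * \<bar>measure_pmf.expectation ?P (?W (insert f T))\<bar> + \<bar>\<beta>\<bar> * \<bar>measure_pmf.expectation ?P (?W T)\<bar>"
    unfolding abs_mult[symmetric] by (rule abs_triangle_ineq)
  also have "\<dots> \<le> 1 * (c * B) + c ^ m f * B"
  proof (intro add_mono mult_mono)
    show "\<bar>\<alpha>\<bar> \<le> 1" unfolding \<alpha>_def using c01 mf by (intro abs_centred_power_coeff)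
    show "\<bar>\<beta>\<bar> \<le> c ^ m f" using c01 by (simp add: \<beta>_def power_abs)
    have "\<bar>measure_pmf.expectation ?P (?W (insert f T))\<bar> \<le> 2 * c ^ (card (insert f T) + card F + card R) * \<eta> ^ card F * (\<Prod>f\<in>R. 1 + c ^ (m f - 1))"
      using insert.prems insert.hyps by (intro insert.IH) auto
    also have "card (insert f T) = Suc (card T)" using insert by simp
    finally show "\<bar>measure_pmf.expectation ?P (?W (insert f T))\<bar> \<le> c * B" by (simp add: B_def)
    show "\<bar>measure_pmf.expectation ?P (?W T)\<bar> \<le> B" unfolding B_def
      using insert.prems insert.hyps by (intro insert.IH) auto
  qed (use c01 in auto)
  also have "\<dots> = c * (1 + c ^ (m f - 1)) * B" using mf by (cases "m f") (simp_all add: algebra_simps)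
  also have "\<dots> = 2 * c ^ (card T + card F + card (insert f R)) * \<eta> ^ card F * (\<Prod>f\<in>insert f R. 1 + c ^ (m f - 1))"
    using insert.hyps by (simp add: B_def)
  finally show ?case unfolding eq .
qed

text \<open>The edges of A may share half-edges with one another. They pay a factor 2 and gain no
  \<eta>; all others form a matching away from them.\<close>

lemma expectation_centred_product:
  assumes F: "finite F" "real (card F) \<le> K" and m: "\<And>f. f \<in> F \<Longrightarrow> m f \<ge> 1"
    and A: "A \<subseteq> F" and match: "is_matching (F - A)" "\<Union>(F - A) \<subseteq> X"
    and dis: "\<And>f. f \<in> A \<Longrightarrow> f \<inter> \<Union>(F - A) = {}"
  shows "\<bar>measure_pmf.expectation (kept_edges X p) (\<lambda>E. \<Prod>f\<in>F. (of_bool (f \<in> E) - c) ^ m f)\<bar>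
    \<le> 4 * 2 ^ card A * c ^ card F * \<eta> ^ card {f \<in> F - A. m f = 1}"
proof -
  define F1 where "F1 = {f \<in> F - A. m f = 1}"
  define F2 where "F2 = {f \<in> F - A. m f \<noteq> 1}"
  have fin: "finite F1" "finite F2" "finite A" using F A by (auto simp: F1_def F2_def intro: finite_subset)
  have part: "F = F1 \<union> (A \<union> F2)" "F1 \<inter> (A \<union> F2) = {}" "A \<inter> F2 = {}" using A by (auto simp: F1_def F2_def)
  have card: "card F = card F1 + card (A \<union> F2)" using part fin by (metis card_Un_disjoint finite_UnI)
  have "(\<Prod>f\<in>F. (of_bool (f \<in> E) - c) ^ m f) =
     of_bool ({} \<subseteq> E) * (\<Prod>f\<in>F1. of_bool (f \<in> E) - c) * (\<Prod>f\<in>A \<union> F2. (of_bool (f \<in> E) - c) ^ m f)" for E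
  proof -
    have "(\<Prod>f\<in>F. (of_bool (f \<in> E) - c) ^ m f) = (\<Prod>f\<in>F1. (of_bool (f \<in> E) - c) ^ m f) * (\<Prod>f\<in>A \<union> F2. (of_bool (f \<in> E) - c) ^ m f)"
      using part(2) fin by (subst part(1), subst prod.union_disjoint) auto
    also have "(\<Prod>f\<in>F1. (of_bool (f \<in> E) - c) ^ m f) = (\<Prod>f\<in>F1. of_bool (f \<in> E) - c)"
      by (intro prod.cong) (auto simp: F1_def)
    finally show ?thesis by simp
  qed
  then have "\<bar>measure_pmf.expectation (kept_edges X p) (\<lambda>E. \<Prod>f\<in>F. (of_bool (f \<in> E) - c) ^ m f)\<bar>
    = \<bar>measure_pmf.expectation (kept_edges X p)
      (\<lambda>E. of_bool ({} \<subseteq> E) * (\<Prod>f\<in>F1. of_bool (f \<in> E) - c) * (\<Prod>f\<in>A \<union> F2. (of_bool (f \<in> E) - c) ^ m f))\<bar>"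
    by simp
  also have "\<dots> \<le> 2 * c ^ (card ({} :: 'a set set) + card F1 + card (A \<union> F2)) * \<eta> ^ card F1 * (\<Prod>f\<in>A \<union> F2. 1 + c ^ (m f - 1))"
  proof (rule expectation_mixed)
    show "is_matching F1" by (rule is_matching_subset[OF match(1)]) (auto simp: F1_def)
    show "\<Union>F1 \<subseteq> X" using match(2) by (auto simp: F1_def)
    show "f \<inter> \<Union>F1 = {}" if "f \<in> {} \<union> (A \<union> F2)" for f
    proof (cases "f \<in> A")
      case True then show ?thesis using dis[of f] by (auto simp: F1_def)
    next
      case False
      then have f: "f \<in> F - A" "f \<notin> F1" using that part by auto
      have "f \<inter> g = {}" if "g \<in> F1" for g
      proof (rule disjointD)
        show "disjoint (F - A)" using match by (simp add: is_matching_def)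
      qed (use f that in \<open>auto simp: F1_def\<close>)
      then show ?thesis by blast
    qed
    show "real (card ({} :: 'a set set) + card F1 + card (A \<union> F2)) \<le> K" using F card by simp
  qed (use fin part m in auto)
  also have "(\<Prod>f\<in>A \<union> F2. 1 + c ^ (m f - 1)) = (\<Prod>f\<in>A. 1 + c ^ (m f - 1)) * (\<Prod>f\<in>F2. 1 + c ^ (m f - 1))"
    using part fin by (intro prod.union_disjoint) auto
  also have "2 * c ^ (card ({} :: 'a set set) + card F1 + card (A \<union> F2)) * \<eta> ^ card F1 * ((\<Prod>f\<in>A. 1 + c ^ (m f - 1)) * (\<Prod>f\<in>F2. 1 + c ^ (m f - 1)))
     \<le> 2 * c ^ (card ({} :: 'a set set) + card F1 + card (A \<union> F2)) * \<eta> ^ card F1 * (2 ^ card A * 2)"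
  proof (intro mult_left_mono mult_mono)
    have "(\<Prod>f\<in>A. 1 + c ^ (m f - 1)) \<le> (\<Prod>f\<in>A. 2)"
      using c01 by (intro prod_mono) (auto simp: power_le_one)
    then show "(\<Prod>f\<in>A. 1 + c ^ (m f - 1)) \<le> 2 ^ card A" by simp
    \<comment> \<open>An edge outside A that occurs at least twice costs only 1 + c, and there are
      at most K of them with K c \<le> 1/4.\<close>
    have "(\<Prod>f\<in>F2. 1 + c ^ (m f - 1)) \<le> (\<Prod>f\<in>F2. 1 + c)"
    proof (intro prod_mono conjI)
      fix f assume f: "f \<in> F2"
      then have "m f \<ge> 2" using m[of f] by (auto simp: F2_def)
      then have "c ^ (m f - 1) \<le> c ^ 1" using c01 by (intro power_decreasing) auto
      then show "1 + c ^ (m f - 1) \<le> 1 + c" by simp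
    qed (use c01 in auto)
    also have "\<dots> = (1 + c) ^ card F2" by simp
    also have "\<dots> \<le> exp c ^ card F2" using c01 by (intro power_mono exp_ge_add_one_self) auto
    also have "\<dots> = exp (real (card F2) * c)" by (simp add: exp_of_nat_mult)
    also have "\<dots> \<le> exp (1/4)"
    proof -
      have "card F2 \<le> card F" using part F by (intro card_mono) auto
      then have "real (card F2) \<le> K" using F by linarith
      then have "real (card F2) * c \<le> K * (1 / (real (card X) - 1))" using c01 by (intro mult_mono) auto
      also have "\<dots> \<le> 1/4" using K by simp
      finally show ?thesis by simp
    qed
    also have "exp (1/4) \<le> (2::real)" using exp_bound_half[of "1/4::real"] by simp
    finally show "(\<Prod>f\<in>F2. 1 + c ^ (m f - 1)) \<le> 2" .
  qed (use c01 \<eta> in \<open>auto intro!: prod_nonneg\<close>)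
  finally show ?thesis unfolding card F1_def[symmetric] by (simp add: mult_ac)
qed

end

section \<open>Chains of darts\<close>

type_synonym dart = "hedge \<times> hedge"

definition dart_edge :: "dart \<Rightarrow> hedge set" where "dart_edge x = {fst x, snd x}"
definition src :: "dart \<Rightarrow> nat" where "src x = fst (fst x)"
definition dst :: "dart \<Rightarrow> nat" where "dst x = fst (snd x)"

lemma swap_simps [simp]: "fst (prod.swap x) = snd x" "snd (prod.swap x) = fst x"
  "src (prod.swap x) = dst x" "dst (prod.swap x) = src x" "dart_edge (prod.swap x) = dart_edge x"
  by (cases x; auto simp: src_def dst_def dart_edge_def)+

lemma dart_edge_eq: "dart_edge x = dart_edge y \<longleftrightarrow> x = y \<or> x = prod.swap y"
  by (cases x; cases y) (auto simp: dart_edge_def doubleton_eq_iff)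

text \<open>A chain is a concatenation of nonbacktracking walks of length \<open>l\<close>, each of which starts with
  the half-edge at which the previous one stopped.\<close>

definition chain :: "nat \<Rightarrow> dart list \<Rightarrow> bool" where
  "chain l w \<longleftrightarrow> (\<forall>t. 0 < t \<and> t < length w \<longrightarrow>
     (if l dvd t then fst (w ! t) = snd (w ! (t - 1))
      else src (w ! t) = dst (w ! (t - 1)) \<and> fst (w ! t) \<noteq> snd (w ! (t - 1))))"

definition visited :: "dart list \<Rightarrow> nat \<Rightarrow> nat set" where
  "visited w t = insert (src (w ! 0)) ((\<lambda>i. dst (w ! i)) ` {..<t})"

definition new_step :: "dart list \<Rightarrow> nat \<Rightarrow> bool" where
  "new_step w t \<longleftrightarrow> (\<forall>i<t. dart_edge (w ! i) \<noteq> dart_edge (w ! t))"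

definition fresh_step :: "dart list \<Rightarrow> nat \<Rightarrow> bool" where
  "fresh_step w t \<longleftrightarrow> new_step w t \<and> dst (w ! t) \<notin> visited w t"

text \<open>The closing steps count the independent cycles of the visited subgraph, see
  \<open>card_closings_euler\<close>.\<close>

definition closing_step :: "dart list \<Rightarrow> nat \<Rightarrow> bool" where
  "closing_step w t \<longleftrightarrow> new_step w t \<and> dst (w ! t) \<in> visited w t"

definition first_visit :: "dart list \<Rightarrow> nat \<Rightarrow> nat" where
  "first_visit w t = (LEAST i. dart_edge (w ! i) = dart_edge (w ! t))"

lemma new_step_iff: "new_step w t \<longleftrightarrow> fresh_step w t \<or> closing_step w t"
  by (auto simp: fresh_step_def closing_step_def)

lemma first_visit:
  "dart_edge (w ! first_visit w t) = dart_edge (w ! t)" "first_visit w t \<le> t" "new_step w (first_visit w t)"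
proof -
  show 1: "dart_edge (w ! first_visit w t) = dart_edge (w ! t)"
    unfolding first_visit_def by (rule LeastI[of _ t]) simp
  show "first_visit w t \<le> t" unfolding first_visit_def by (rule Least_le) simp
  show "new_step w (first_visit w t)" unfolding new_step_def 1
    by (auto simp: first_visit_def dest: not_less_Least)
qed

lemma first_visit_new: "new_step w t \<Longrightarrow> first_visit w t = t"
  using first_visit(1,2)[of w t] by (auto simp: new_step_def order_le_less)

lemma first_visit_less: "\<not> new_step w t \<Longrightarrow> first_visit w t < t"
  using first_visit[of w t] by (metis le_neq_implies_less)

lemma first_visit_eqI: "new_step w i \<Longrightarrow> dart_edge (w ! i) = dart_edge (w ! t) \<Longrightarrow> first_visit w t = i"
  using first_visit[of w t] by (metis new_step_def linorder_neqE_nat)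

lemma first_visit_cases:
  obtains "w ! t = w ! first_visit w t" | "w ! t = prod.swap (w ! first_visit w t)"
  using first_visit(1)[of w t] dart_edge_eq by metis

lemma new_step_inj: "inj_on (\<lambda>t. dart_edge (w ! t)) {t. new_step w t}"
  by (rule inj_onI) (metis first_visit_eqI mem_Collect_eq)

lemma fresh_step_inj: "inj_on (\<lambda>t. dst (w ! t)) {t. fresh_step w t}"
proof (rule inj_onI)
  fix s t assume *: "s \<in> {t. fresh_step w t}" "t \<in> {t. fresh_step w t}" "dst (w ! s) = dst (w ! t)"
  then show "s = t"
  proof (cases s t rule: linorder_cases)
    case less
    then have "dst (w ! s) \<in> visited w t" by (auto simp: visited_def)
    then show ?thesis using * by (simp add: fresh_step_def)
  next
    case greater
    then have "dst (w ! t) \<in> visited w s" by (auto simp: visited_def)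
    then show ?thesis using * by (simp add: fresh_step_def)
  qed
qed

lemma new_step_edges: "(\<lambda>t. dart_edge (w ! t)) ` {t. t < length w \<and> new_step w t} = dart_edge ` set w"
proof (intro equalityI subsetI)
  fix f assume "f \<in> dart_edge ` set w"
  then obtain t where t: "t < length w" "f = dart_edge (w ! t)" by (auto simp: in_set_conv_nth)
  have "f = dart_edge (w ! first_visit w t)" "first_visit w t < length w" "new_step w (first_visit w t)"
    using first_visit[of w t] t by auto
  then show "f \<in> (\<lambda>t. dart_edge (w ! t)) ` {t. t < length w \<and> new_step w t}" by auto
qed auto

lemma card_edges: "card (dart_edge ` set w) = card {t. t < length w \<and> new_step w t}"
  unfolding new_step_edges[symmetric]
  by (rule card_image) (rule inj_on_subset[OF new_step_inj], auto)

lemma card_visited: "card (visited w t) = Suc (card {i. i < t \<and> dst (w ! i) \<notin> visited w i})"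
proof (induction t)
  case 0 then show ?case by (simp add: visited_def)
next
  case (Suc t)
  have v: "visited w (Suc t) = insert (dst (w ! t)) (visited w t)"
    by (auto simp: visited_def lessThan_Suc)
  have "{i. i < Suc t \<and> dst (w ! i) \<notin> visited w i} =
    (if dst (w ! t) \<notin> visited w t then insert t {i. i < t \<and> dst (w ! i) \<notin> visited w i}
     else {i. i < t \<and> dst (w ! i) \<notin> visited w i})"
    by (auto simp: less_Suc_eq)
  moreover have "finite (visited w t)" by (simp add: visited_def)
  ultimately show ?case using Suc unfolding v by (simp add: insert_absorb)
qed

section \<open>Branch vertices of a chain and conflicts between its edges\<close>

locale chain_walk =
  fixes l :: nat and w :: "dart list"
  assumes chain: "chain l w"
begin

lemma src_dst: "0 < t \<Longrightarrow> t < length w \<Longrightarrow> src (w ! t) = dst (w ! (t - 1))"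
  using chain unfolding chain_def by (metis dst_def src_def)

lemma nb: "0 < t \<Longrightarrow> t < length w \<Longrightarrow> \<not> l dvd t \<Longrightarrow> fst (w ! t) \<noteq> snd (w ! (t - 1))"
  using chain unfolding chain_def by auto

lemma src_visited: "t < length w \<Longrightarrow> src (w ! t) \<in> visited w t"
  using src_dst[of t] by (cases "t = 0") (auto simp: visited_def)

lemma dst_visited: "s < t \<Longrightarrow> dst (w ! s) \<in> visited w t"
  by (auto simp: visited_def)

lemma visited_mono: "s \<le> t \<Longrightarrow> visited w s \<subseteq> visited w t"
  by (auto simp: visited_def)

lemma src_visited': "s \<le> t \<Longrightarrow> s < length w \<Longrightarrow> src (w ! s) \<in> visited w t"
  using src_visited visited_mono by blast

lemma old_dst_visited:
  assumes "\<not> new_step w t" "t < length w"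
  shows "dst (w ! t) \<in> visited w t"
proof -
  let ?i = "first_visit w t"
  have i: "?i < t" using assms first_visit_less by auto
  consider "w ! t = w ! ?i" | "w ! t = prod.swap (w ! ?i)" by (rule first_visit_cases)
  then show ?thesis
    using i assms src_visited'[of ?i t] dst_visited[of ?i t] by cases auto
qed

lemma fresh_iff: "t < length w \<Longrightarrow> fresh_step w t \<longleftrightarrow> dst (w ! t) \<notin> visited w t"
  using old_dst_visited by (auto simp: fresh_step_def)

text \<open>The only old half-edge at a vertex that was just discovered is the one of arrival.\<close>

lemma new_after_fresh:
  assumes "0 < t" "t < length w" "\<not> l dvd t" "fresh_step w (t - 1)"
  shows "new_step w t"
proof (rule ccontr)
  assume old: "\<not> new_step w t"
  let ?i = "first_visit w t"
  have i: "?i < t" "?i \<le> t - 1" using old first_visit_less[of w t] by auto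
  have v: "src (w ! t) = dst (w ! (t - 1))" using src_dst assms by auto
  have nv: "dst (w ! (t - 1)) \<notin> visited w (t - 1)" using assms by (simp add: fresh_step_def)
  consider "w ! t = w ! ?i" | "w ! t = prod.swap (w ! ?i)" by (rule first_visit_cases)
  then show False
  proof cases
    case 1
    then show False using nv v src_visited'[of ?i "t - 1"] i assms by (metis le_less_trans less_imp_diff_less)
  next
    case 2
    then have "dst (w ! ?i) = dst (w ! (t - 1))" using v by simp
    then have "?i = t - 1" using nv dst_visited[of ?i "t - 1"] i by (metis le_neq_implies_less)
    then have "fst (w ! t) = snd (w ! (t - 1))" using 2 by simp
    then show False using nb assms by auto
  qed
qed

definition closings :: "nat set" where "closings = {t. t < length w \<and> closing_step w t}"
definition departures :: "nat set" where
  "departures = {t. t < length w \<and> new_step w t \<and> (l dvd t \<or> \<not> fresh_step w (t - 1))}"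
text \<open>At any other vertex the visited graph looks like the interior of a path: there is at
  most one new arrival, and a new departure follows directly upon it. The start of a nonempty chain
  is a branch vertex, because l divides 0.\<close>

definition branch :: "nat set" where
  "branch = (\<lambda>t. dst (w ! t)) ` closings \<union> (\<lambda>t. src (w ! t)) ` departures"
definition breaks :: "nat set" where "breaks = {t. t < length w \<and> l dvd t}"

lemma finite_sets [simp]: "finite closings" "finite departures" "finite branch" "finite breaks"
  by (auto simp: closings_def departures_def branch_def breaks_def)

end

text \<open>Rises and falls of P alternate and begin with a fall, as P holds at 0. The induction
  shows that their numbers differ by one exactly if P fails at the end.\<close>

lemma card_falls_le:
  assumes "P (0::nat)"
  shows "card {t. 0 < t \<and> t < L \<and> P t \<and> \<not> P (t - 1)} \<le> card {t. 0 < t \<and> t < L \<and> \<not> P t \<and> P (t - 1)}"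
proof -
  let ?A = "\<lambda>L. {t. 0 < t \<and> t < L \<and> P t \<and> \<not> P (t - 1)}"
  let ?B = "\<lambda>L. {t. 0 < t \<and> t < L \<and> \<not> P t \<and> P (t - 1)}"
  have "card (?B (Suc n)) = card (?A (Suc n)) + (if P n then 0 else 1)" for n
  proof (induction n)
    case 0
    have "?A (Suc 0) = {}" "?B (Suc 0) = {}" by auto
    then show ?case using assms by (simp only: card.empty) simp
  next
    case (Suc n)
    have "?A (Suc (Suc n)) = (if P (Suc n) \<and> \<not> P n then insert (Suc n) (?A (Suc n)) else ?A (Suc n))"
      "?B (Suc (Suc n)) = (if \<not> P (Suc n) \<and> P n then insert (Suc n) (?B (Suc n)) else ?B (Suc n))"
      by (auto simp: less_Suc_eq)
    moreover have "finite (?A (Suc n))" "finite (?B (Suc n))" by auto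
    ultimately show ?case using Suc by (auto split: if_splits)
  qed
  then show ?thesis by (cases L) auto
qed

context chain_walk
begin

text \<open>Apart from breaks and successors of closing steps, a departure is a change from an old
  step to a new one. Such changes are no more frequent than the opposite ones, and by
  \<open>new_after_fresh\<close> those occur only at breaks and after closing steps.\<close>

lemma card_departures: "card departures \<le> 2 * card breaks + 2 * card closings"
proof -
  let ?D = "{t. 0 < t \<and> t < length w \<and> new_step w t \<and> \<not> new_step w (t - 1)}"
  let ?S = "{t. 0 < t \<and> t < length w \<and> \<not> new_step w t \<and> new_step w (t - 1)}"
  have sub: "departures \<subseteq> breaks \<union> Suc ` closings \<union> ?D"
  proof
    fix t assume t: "t \<in> departures"
    show "t \<in> breaks \<union> Suc ` closings \<union> ?D"
    proof (cases "l dvd t \<or> \<not> new_step w (t - 1)")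
      case True
      then show ?thesis using t by (cases "t = 0") (auto simp: departures_def breaks_def)
    next
      case False
      then have "t \<noteq> 0" by (metis dvd_0_right)
      then have "t - 1 \<in> closings" using t False by (auto simp: departures_def closings_def new_step_iff)
      moreover have "t = Suc (t - 1)" using \<open>t \<noteq> 0\<close> by simp
      ultimately show ?thesis by blast
    qed
  qed
  have sub2: "?S \<subseteq> breaks \<union> Suc ` closings"
  proof
    fix t assume t: "t \<in> ?S"
    show "t \<in> breaks \<union> Suc ` closings"
    proof (cases "l dvd t")
      case False
      then have "t - 1 \<in> closings" using t new_after_fresh[of t] by (auto simp: closings_def new_step_iff)
      moreover have "t = Suc (t - 1)" using t by simp
      ultimately show ?thesis by blast
    qed (use t in \<open>auto simp: breaks_def\<close>)
  qed
  have "card ?D \<le> card ?S" by (rule card_falls_le) (simp add: new_step_def)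
  also have "\<dots> \<le> card (breaks \<union> Suc ` closings)" by (rule card_mono[OF _ sub2]) simp
  finally have D: "card ?D \<le> card (breaks \<union> Suc ` closings)" .
  have b: "card (breaks \<union> Suc ` closings) \<le> card breaks + card closings"
    by (metis card_Un_le card_image inj_Suc)
  have "card departures \<le> card (breaks \<union> Suc ` closings \<union> ?D)" by (rule card_mono[OF _ sub]) simp
  also have "\<dots> \<le> card (breaks \<union> Suc ` closings) + card ?D" by (rule card_Un_le)
  finally show ?thesis using D b by linarith
qed

lemma card_branch: "card branch \<le> 2 * card breaks + 3 * card closings"
proof -
  have "card branch \<le> card ((\<lambda>t. dst (w ! t)) ` closings) + card ((\<lambda>t. src (w ! t)) ` departures)"
    unfolding branch_def by (rule card_Un_le)
  also have "\<dots> \<le> card closings + card departures"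
    by (intro add_mono card_image_le) auto
  finally show ?thesis using card_departures by linarith
qed

definition arrivals where "arrivals = {t. t < length w \<and> new_step w t \<and> dst (w ! t) \<in> branch}"
definition exits where "exits = {t. t < length w \<and> new_step w t \<and> src (w ! t) \<in> branch}"

lemma finite_incidences [simp]: "finite arrivals" "finite exits"
  by (auto simp: arrivals_def exits_def)

text \<open>A vertex is the target of at most one fresh step, and a new step that is not a departure
  is preceded by a fresh arrival at its source, hence determined by it. So every branch vertex adds
  at most one arrival and one exit to the closings and departures.\<close>

lemma card_incidences: "card arrivals + card exits \<le> 6 * card breaks + 9 * card closings"
proof -
  have "card (arrivals - closings) \<le> card branch"
  proof (rule card_inj_on_le)
    show "inj_on (\<lambda>t. dst (w ! t)) (arrivals - closings)"
      by (rule inj_on_subset[OF fresh_step_inj]) (auto simp: arrivals_def closings_def new_step_iff)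
  qed (auto simp: arrivals_def)
  moreover have "card arrivals \<le> card ((arrivals - closings) \<union> closings)" by (rule card_mono) auto
  ultimately have a: "card arrivals \<le> card branch + card closings"
    using card_Un_le[of "arrivals - closings" closings] by linarith
  have "card (exits - departures) \<le> card branch"
  proof (rule card_inj_on_le)
    show "inj_on (\<lambda>t. src (w ! t)) (exits - departures)"
    proof (rule inj_onI)
      fix s t assume st: "s \<in> exits - departures" "t \<in> exits - departures" "src (w ! s) = src (w ! t)"
      then have *: "\<not> l dvd s" "\<not> l dvd t" "fresh_step w (s - 1)" "fresh_step w (t - 1)" "s < length w" "t < length w"
        by (auto simp: exits_def departures_def)
      then have "0 < s" "0 < t" by (auto intro!: Nat.gr0I)
      then have "dst (w ! (s - 1)) = dst (w ! (t - 1))" using st(3) * src_dst by metis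
      then have "s - 1 = t - 1" using * fresh_step_inj[of w] by (simp add: inj_on_def)
      then show "s = t" using \<open>0 < s\<close> \<open>0 < t\<close> by simp
    qed
  qed (auto simp: exits_def)
  moreover have "card exits \<le> card ((exits - departures) \<union> departures)" by (rule card_mono) auto
  ultimately have e: "card exits \<le> card branch + card departures"
    using card_Un_le[of "exits - departures" departures] by linarith
  show ?thesis using a e card_branch card_departures by linarith
qed

lemma not_branch:
  assumes "v \<notin> branch"
  shows "new_step w t \<Longrightarrow> t < length w \<Longrightarrow> dst (w ! t) = v \<Longrightarrow> fresh_step w t"
    and "new_step w t \<Longrightarrow> t < length w \<Longrightarrow> src (w ! t) = v \<Longrightarrow>
      0 < t \<and> \<not> l dvd t \<and> fresh_step w (t - 1) \<and> dst (w ! (t - 1)) = v"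
proof -
  show "fresh_step w t" if "new_step w t" "t < length w" "dst (w ! t) = v"
    using that assms by (auto simp: branch_def closings_def new_step_iff)
  assume t: "new_step w t" "t < length w" "src (w ! t) = v"
  then have "\<not> l dvd t" "fresh_step w (t - 1)" using assms by (auto simp: branch_def departures_def)
  moreover from this have "0 < t" by (auto intro!: Nat.gr0I)
  ultimately show "0 < t \<and> \<not> l dvd t \<and> fresh_step w (t - 1) \<and> dst (w ! (t - 1)) = v"
    using t src_dst by metis
qed

lemma not_branch_unique:
  assumes "v \<notin> branch" "i < length w" "j < length w" "new_step w i" "new_step w j"
  shows "dst (w ! i) = v \<Longrightarrow> dst (w ! j) = v \<Longrightarrow> i = j"
    and "dst (w ! i) = v \<Longrightarrow> src (w ! j) = v \<Longrightarrow> j = Suc i \<and> \<not> l dvd j"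
    and "src (w ! i) = v \<Longrightarrow> src (w ! j) = v \<Longrightarrow> i = j"
proof -
  have fr: "s = t" if "fresh_step w s" "fresh_step w t" "dst (w ! s) = dst (w ! t)" for s t
    using that fresh_step_inj[of w] by (simp add: inj_on_def)
  show "i = j" if "dst (w ! i) = v" "dst (w ! j) = v"
    using that assms not_branch(1)[OF assms(1)] fr by metis
  show "j = Suc i \<and> \<not> l dvd j" if "dst (w ! i) = v" "src (w ! j) = v"
    using that assms not_branch[OF assms(1)] fr by (metis Suc_pred')
  show "i = j" if "src (w ! i) = v" "src (w ! j) = v"
    using that assms not_branch(2)[OF assms(1), of i] not_branch(2)[OF assms(1), of j] fr[of "i - 1" "j - 1"]
    by (metis Suc_pred')
qed

text \<open>Only edges at a branch vertex can be degenerate or share a half-edge with another edge;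
  they form the set A of \<open>expectation_centred_product\<close>.\<close>

definition conflicts :: "hedge set set" where
  "conflicts = {f \<in> dart_edge ` set w. \<exists>h\<in>f. fst h \<in> branch}"

lemma card_conflicts: "card conflicts \<le> 6 * card breaks + 9 * card closings"
proof -
  have "conflicts \<subseteq> (\<lambda>t. dart_edge (w ! t)) ` (arrivals \<union> exits)"
  proof
    fix f assume f: "f \<in> conflicts"
    then obtain t where t: "t < length w" "new_step w t" "f = dart_edge (w ! t)"
      unfolding conflicts_def new_step_edges[symmetric] by auto
    then have "t \<in> arrivals \<union> exits"
      using f by (auto simp: conflicts_def arrivals_def exits_def dart_edge_def src_def dst_def)
    then show "f \<in> (\<lambda>t. dart_edge (w ! t)) ` (arrivals \<union> exits)" using t by auto
  qed
  then have "card conflicts \<le> card (arrivals \<union> exits)"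
    by (meson surj_card_le finite_UnI finite_incidences)
  also have "\<dots> \<le> card arrivals + card exits" by (rule card_Un_le)
  finally show ?thesis using card_incidences by linarith
qed

text \<open>Off \<open>branch\<close> a vertex has one new arrival and one new departure, and these
  use different half-edges because the walk does not backtrack.\<close>

lemma shared_half_edge_conflict:
  assumes "f \<in> dart_edge ` set w" "f' \<in> dart_edge ` set w" "f \<noteq> f'" "h \<in> f" "h \<in> f'"
  shows "fst h \<in> branch"
proof (rule ccontr)
  assume nb': "fst h \<notin> branch"
  obtain i where i: "i < length w" "new_step w i" "f = dart_edge (w ! i)"
    using assms(1) unfolding new_step_edges[symmetric] by auto
  obtain j where j: "j < length w" "new_step w j" "f' = dart_edge (w ! j)"
    using assms(2) unfolding new_step_edges[symmetric] by auto
  have ij: "i \<noteq> j" using assms(3) i j by auto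
  have aux: False if "i < length w" "j < length w" "new_step w i" "new_step w j" "snd (w ! i) = h" "fst (w ! j) = h" for i j
  proof -
    have "j = Suc i" "\<not> l dvd j" using not_branch_unique(2)[OF nb' that(1-4)] that(5,6) by (auto simp: src_def dst_def)
    then show False using nb[of j] that by simp
  qed
  have "fst (w ! i) = h \<or> snd (w ! i) = h" "fst (w ! j) = h \<or> snd (w ! j) = h"
    using i j assms by (auto simp: dart_edge_def)
  moreover have "\<not> (fst (w ! i) = h \<and> fst (w ! j) = h)"
    using not_branch_unique(3)[OF nb' i(1) j(1) i(2) j(2)] ij by (auto simp: src_def)
  moreover have "\<not> (snd (w ! i) = h \<and> snd (w ! j) = h)"
    using not_branch_unique(1)[OF nb' i(1) j(1) i(2) j(2)] ij by (auto simp: dst_def)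
  ultimately show False using aux[OF i(1) j(1) i(2) j(2)] aux[OF j(1) i(1) j(2) i(2)] by auto
qed

lemma degenerate_edge_conflict:
  assumes "f \<in> dart_edge ` set w" "card f \<noteq> 2"
  shows "f \<in> conflicts"
proof -
  obtain i where i: "i < length w" "new_step w i" "f = dart_edge (w ! i)"
    using assms(1) unfolding new_step_edges[symmetric] by auto
  have eq: "fst (w ! i) = snd (w ! i)" using assms(2) i by (auto simp: dart_edge_def card_insert_if split: if_splits)
  then have "src (w ! i) = dst (w ! i)" by (simp add: src_def dst_def)
  then have "dst (w ! i) \<in> visited w i" using src_visited i by metis
  then have "i \<in> closings" using i by (simp add: closings_def closing_step_def)
  then have "fst (snd (w ! i)) \<in> branch" by (auto simp: branch_def dst_def)
  then show ?thesis using i by (auto simp: conflicts_def dart_edge_def)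
qed

lemma matching_off_conflicts:
  "is_matching (dart_edge ` set w - conflicts)"
  "f \<in> conflicts \<Longrightarrow> f \<inter> \<Union>(dart_edge ` set w - conflicts) = {}"
proof -
  have dis: "f \<inter> g = {}" if "f \<in> dart_edge ` set w" "g \<in> dart_edge ` set w - conflicts" "f \<noteq> g" for f g
  proof (rule ccontr)
    assume "f \<inter> g \<noteq> {}"
    then obtain h where h: "h \<in> f" "h \<in> g" by auto
    then have "fst h \<in> branch" using shared_half_edge_conflict[of f g h] that by auto
    then have "g \<in> conflicts" using that h by (auto simp: conflicts_def)
    then show False using that by auto
  qed
  show "is_matching (dart_edge ` set w - conflicts)"
    unfolding is_matching_def pairwise_def disjnt_def using degenerate_edge_conflict dis by blast
  show "f \<inter> \<Union>(dart_edge ` set w - conflicts) = {}" if "f \<in> conflicts"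
  proof -
    have "f \<inter> g = {}" if "g \<in> dart_edge ` set w - conflicts" for g
      using dis[of f g] that \<open>f \<in> conflicts\<close> by (auto simp: conflicts_def)
    then show ?thesis by blast
  qed
qed

end

text \<open>The walk continues differently than after an earlier occurrence of the same dart. These
  are the steps at which a prediction by repetition can fail.\<close>

definition switch :: "dart list \<Rightarrow> nat \<Rightarrow> bool" where
  "switch w t \<longleftrightarrow> 0 < t \<and> t < length w \<and>
     (\<exists>s<t - 1. w ! s = w ! (t - 1) \<and> w ! Suc s \<noteq> w ! t)"

context chain_walk
begin

lemma fresh_stretch:
  assumes len: "length w \<le> l" and a: "a = 0 \<or> new_step w a" and t: "a \<le> t" "t < length w"
    and nc: "\<And>i. a \<le> i \<Longrightarrow> i \<le> t \<Longrightarrow> \<not> closing_step w i"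
  shows "fresh_step w t"
  using t nc
proof (induction t rule: dec_induct)
  case base
  have "new_step w a" using a by (auto simp: new_step_def)
  then show ?case using base by (auto simp: new_step_iff)
next
  case (step t)
  have "\<not> l dvd Suc t" using step.prems(1) len by (auto dest: dvd_imp_le)
  then have "new_step w (Suc t)" using new_after_fresh[of "Suc t"] step by simp
  then show ?case using step.prems(2)[of "Suc t"] step.hyps by (auto simp: new_step_iff)
qed

text \<open>A walk with a single closing step is a path up to that step. Afterwards it winds around the
  cycle, possibly returns along the initial path, and possibly leaves it for good.\<close>

lemma card_switches:
  assumes len: "length w \<le> l" and one: "card closings \<le> 1"
  shows "card {t. switch w t} \<le> 2"
proof (cases "closings = {}")
  case True
  have fr: "fresh_step w t" if "t < length w" for t
    by (rule fresh_stretch[OF len, of 0]) (use that True in \<open>auto simp: closings_def\<close>)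
  have "\<not> switch w t" for t
  using fr[of "t - 1"] by (fastforce simp: switch_def fresh_step_def new_step_def)
  then show ?thesis by simp
next
  case False
  then have "card closings > 0" by (simp add: card_gt_0_iff)
  then have "card closings = 1" using one by linarith
  then obtain x where x: "closings = {x}" by (auto simp: card_1_singleton_iff)
  then have xl: "x < length w" and xc: "closing_step w x" by (auto simp: closings_def)
  have not_closing: "\<not> closing_step w t" if "t < length w" "t \<noteq> x" for t
    using that x by (auto simp: closings_def)
  have nb': "\<not> l dvd t" if "0 < t" "t < length w" for t using that len by (auto dest: dvd_imp_le)
  have pre: "fresh_step w t" if "t < x" for t
    by (rule fresh_stretch[OF len, of 0]) (use that xl not_closing in auto)
  have new_le: "new_step w t" if "t \<le> x" for t
    using that pre xc by (cases "t = x") (auto simp: new_step_iff)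
  \<comment> \<open>The time at which the walk leaves the known edges for good, or its length if it
    never does.\<close>
  define y where "y = (LEAST t. x < t \<and> (t = length w \<or> new_step w t))"
  have y: "x < y \<and> (y = length w \<or> new_step w y)"
    unfolding y_def by (rule LeastI[of _ "length w"]) (use xl in simp)
  have yl: "y \<le> length w" unfolding y_def by (rule Least_le) (use xl in simp)
  have old: "\<not> new_step w t" if "x < t" "t < y" for t
    using not_less_Least[of t "\<lambda>t. x < t \<and> (t = length w \<or> new_step w t)"] that by (auto simp: y_def)
  have post: "fresh_step w t" if "y \<le> t" "t < length w" for t
    by (rule fresh_stretch[OF len _ that]) (use that y not_closing in auto)
  have new_old: "x < s \<and> s < y" if "\<not> new_step w s" "s < length w" for s
    using that new_le[of s] post[of s] by (auto simp: new_step_iff not_le[symmetric])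
  define u where "u i = (if i = 0 then src (w ! 0) else dst (w ! (i - 1)))" for i
  have src_u: "src (w ! i) = u i" if "i \<le> x" for i
    using that src_dst[of i] xl by (auto simp: u_def)
  have dst_u: "dst (w ! i) = u (Suc i)" for i by (simp add: u_def)
  have vis: "visited w i = u ` {..i}" for i
  proof (induction i)
    case (Suc i)
    have "visited w (Suc i) = insert (dst (w ! i)) (visited w i)" by (auto simp: visited_def lessThan_Suc)
    then show ?case using Suc dst_u[of i] by (simp add: atMost_Suc)
  qed (simp add: visited_def u_def)
  have inj: "i = j" if "i \<le> x" "j \<le> x" "u i = u j" for i j
  proof -
    have *: False if "i < j" "j \<le> x" "u i = u j" for i j
    proof -
      have "u j = dst (w ! (j - 1))" using that by (simp add: u_def)
      then have "u j \<notin> visited w (j - 1)" using pre[of "j - 1"] that by (simp add: fresh_step_def)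
      moreover have "u i \<in> visited w (j - 1)" unfolding vis using \<open>i < j\<close> by auto
      ultimately show False using that by simp
    qed
    show ?thesis using *[of i j] *[of j i] that by (cases i j rule: linorder_cases) auto
  qed
  have "dst (w ! x) \<in> visited w x" using xc by (simp add: closing_step_def)
  then obtain s where s: "s \<le> x" "dst (w ! x) = u s" unfolding vis by auto
  have index: "i = j" if "i \<le> x" "j \<le> x" "dart_edge (w ! i) = dart_edge (w ! j)" for i j
    using new_step_inj[of w] new_le that by (simp add: inj_on_def)
  \<comment> \<open>Before y each step reuses one of the first x + 1 edges in one of the two
    directions; the inequalities of half-edges express that it does not backtrack.\<close>
  have step: "(\<exists>j\<le>x. w ! t = w ! j \<and> u j = dst (w ! (t - 1)) \<and> fst (w ! j) \<noteq> snd (w ! (t - 1))) \<or>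
      (\<exists>j\<le>x. w ! t = prod.swap (w ! j) \<and> dst (w ! j) = dst (w ! (t - 1)) \<and> snd (w ! j) \<noteq> snd (w ! (t - 1)))"
    if t: "x < t" "t < y" for t
  proof -
    have tl: "t < length w" "0 < t" using t yl by auto
    let ?j = "first_visit w t"
    have "?j < t" using first_visit_less old t by auto
    then have "?j < y" using t by simp
    then have j: "?j \<le> x" using first_visit(3)[of w t] old[of ?j] by force
    have n: "src (w ! t) = dst (w ! (t - 1))" "fst (w ! t) \<noteq> snd (w ! (t - 1))"
      using src_dst nb nb' tl by auto
    consider "w ! t = w ! ?j" | "w ! t = prod.swap (w ! ?j)" by (rule first_visit_cases)
    then show ?thesis
    proof cases
      case 1
      then have "u ?j = dst (w ! (t - 1))" "fst (w ! ?j) \<noteq> snd (w ! (t - 1))"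
        using n src_u[OF j] by auto
      then show ?thesis using 1 j by blast
    next
      case 2
      then have "dst (w ! ?j) = dst (w ! (t - 1))" "snd (w ! ?j) \<noteq> snd (w ! (t - 1))"
        using n by auto
      then show ?thesis using 2 j by blast
    qed
  qed
  have tr1: "w ! t = w ! Suc i" if t: "x < t" "t < y" and i: "s \<le> i" "i < x" "w ! (t - 1) = w ! i" for t i
    using step[OF t]
  proof (elim disjE exE conjE)
    fix j assume j: "j \<le> x" "w ! t = w ! j" "u j = dst (w ! (t - 1))"
    then have "u j = u (Suc i)" using i dst_u[of i] by simp
    then have "j = Suc i" using i j inj[of j "Suc i"] by simp
    then show ?thesis using j by simp
  next
    fix j assume j: "j \<le> x" "dst (w ! j) = dst (w ! (t - 1))" "snd (w ! j) \<noteq> snd (w ! (t - 1))"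
    then have "dst (w ! j) = u (Suc i)" using i dst_u[of i] by simp
    moreover have "j \<noteq> i" using j i by auto
    ultimately show ?thesis
    proof (cases "j = x")
      case True
      then have "s = Suc i" using s \<open>dst (w ! j) = u (Suc i)\<close> inj[of s "Suc i"] i by simp
      then show ?thesis using i by simp
    next
      case False
      then have "Suc j = Suc i" using inj[of "Suc j" "Suc i"] \<open>dst (w ! j) = u (Suc i)\<close> dst_u[of j] j i by simp
      then show ?thesis using \<open>j \<noteq> i\<close> by simp
    qed
  qed
  have tr2: "w ! t = w ! s \<or> (0 < s \<and> w ! t = prod.swap (w ! (s - 1)))" if t: "x < t" "t < y" and i: "w ! (t - 1) = w ! x" for t
    using step[OF t]
  proof (elim disjE exE conjE)
    fix j assume j: "j \<le> x" "w ! t = w ! j" "u j = dst (w ! (t - 1))"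
    then have "j = s" using i s inj[of j s] by simp
    then show ?thesis using j by simp
  next
    fix j assume j: "j \<le> x" "w ! t = prod.swap (w ! j)" "dst (w ! j) = dst (w ! (t - 1))" "snd (w ! j) \<noteq> snd (w ! (t - 1))"
    then have "j < x" using i by (metis le_neq_implies_less)
    then have "Suc j = s" using inj[of "Suc j" s] j i s dst_u[of j] by simp
    then show ?thesis using j by auto
  qed
  have tr3: "0 < i \<and> w ! t = prod.swap (w ! (i - 1))"
    if t: "x < t" "t < y" and i: "i < s" "w ! (t - 1) = prod.swap (w ! i)" for t i
    using step[OF t]
  proof (elim disjE exE conjE)
    fix j assume j: "j \<le> x" "u j = dst (w ! (t - 1))" "fst (w ! j) \<noteq> snd (w ! (t - 1))"
    then have "u j = u i" using i s src_u[of i] by simp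
    then have "j = i" using inj[of j i] i s j by simp
    then show ?thesis using j i by simp
  next
    fix j assume j: "j \<le> x" "w ! t = prod.swap (w ! j)" "dst (w ! j) = dst (w ! (t - 1))"
    then have d: "dst (w ! j) = u i" using i s src_u[of i] by simp
    then have "j \<noteq> x" using s i inj[of s i] by auto
    then have "Suc j = i" using d inj[of "Suc j" i] i s j dst_u[of j] by simp
    then show ?thesis using j by auto
  qed
  \<comment> \<open>The darts \<open>w ! s\<close>, ..., \<open>w ! x\<close> make up the cycle,
    always traversed in the direction of the first turn; \<open>bwd\<close> is the initial path
    traversed backwards. Once on the way back, the walk stays there until y.\<close>
  define fwd where "fwd d \<longleftrightarrow> (\<exists>i. s \<le> i \<and> i \<le> x \<and> d = w ! i)" for d
  define bwd where "bwd d \<longleftrightarrow> (\<exists>i<s. d = prod.swap (w ! i))" for d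
  have fb: "\<not> (fwd d \<and> bwd d)" for d
  proof
    assume "fwd d \<and> bwd d"
    then obtain i j where ij: "s \<le> i" "i \<le> x" "j < s" "w ! i = prod.swap (w ! j)" by (auto simp: fwd_def bwd_def)
    then have "dart_edge (w ! i) = dart_edge (w ! j)" by simp
    then show False using index[of i j] ij by simp
  qed
  have bstep: "bwd (w ! t)" if "x < t" "t < y" "bwd (w ! (t - 1))" for t
    using that tr3[of t] unfolding bwd_def by (meson less_imp_diff_less)
  have inv: "fwd (w ! t) \<or> bwd (w ! t)" if "x \<le> t" "t < y" for t
    using that
  proof (induction t rule: dec_induct)
    case base then show ?case using s by (auto simp: fwd_def)
  next
    case (step t)
    then have IH: "fwd (w ! t) \<or> bwd (w ! t)" by simp
    show ?case
    proof (cases "bwd (w ! t)")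
      case True
      then show ?thesis using bstep[of "Suc t"] step by simp
    next
      case False
      then obtain i where i: "s \<le> i" "i \<le> x" "w ! t = w ! i" using IH by (auto simp: fwd_def)
      show ?thesis
      proof (cases "i = x")
        case True
        then have "w ! Suc t = w ! s \<or> (0 < s \<and> w ! Suc t = prod.swap (w ! (s - 1)))"
          using tr2[of "Suc t"] step i by simp
        then show ?thesis unfolding fwd_def bwd_def using s
          by (metis diff_less le_refl zero_less_one)
      next
        case False
        then have "w ! Suc t = w ! Suc i" using tr1[of "Suc t" i] step i by simp
        then show ?thesis unfolding fwd_def using i False by (metis Suc_leI le_SucI le_neq_implies_less)
      qed
    qed
  qed
  have bpers: "bwd (w ! t')" if "x \<le> t" "t \<le> t'" "t' < y" "bwd (w ! t)" for t t'
    using that(2,3)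
  proof (induction t' rule: dec_induct)
    case (step t')
    then show ?case using bstep[of "Suc t'"] that(1) by simp
  qed (use that in simp)
  \<comment> \<open>Before y the successor of a dart is forced except after the closing dart
    \<open>w ! x\<close>; so the only possible switch leads from the cycle to the way back.\<close>
  have sw: "fwd (w ! (t - 1)) \<and> bwd (w ! t)" "x < t - 1" if sw: "switch w t" "t < y" for t
  proof -
    obtain q where q: "0 < t" "t < length w" "q < t - 1" "w ! q = w ! (t - 1)" "w ! Suc q \<noteq> w ! t"
      using sw by (auto simp: switch_def)
    then have "\<not> new_step w (t - 1)" unfolding new_step_def by metis
    then show tx: "x < t - 1" using new_old q by auto
    have qx: "x < Suc q \<and> Suc q < y" if "\<not> q < x" using that q \<open>t < y\<close> by auto
    show "fwd (w ! (t - 1)) \<and> bwd (w ! t)"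
    proof (cases "bwd (w ! (t - 1))")
      case True
      then obtain i where i: "i < s" "w ! (t - 1) = prod.swap (w ! i)" by (auto simp: bwd_def)
      have "\<not> q < x"
      proof
        assume "q < x"
        moreover have "dart_edge (w ! q) = dart_edge (w ! i)" using q i by simp
        ultimately have "q = i" using index[of q i] i s by simp
        then have "src (w ! i) = dst (w ! i)" using q i by (metis swap_simps(3))
        then have "u i = u (Suc i)" using src_u[of i] dst_u[of i] i s by simp
        then show False using inj[of i "Suc i"] i s by simp
      qed
      then have "w ! Suc q = w ! t" using tr3[of t i] tr3[of "Suc q" i] q \<open>t < y\<close> i by simp
      then show ?thesis using q by simp
    next
      case False
      then have f: "fwd (w ! (t - 1))" using inv[of "t - 1"] tx \<open>t < y\<close> by auto
      then obtain i where i: "s \<le> i" "i \<le> x" "w ! (t - 1) = w ! i" by (auto simp: fwd_def)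
      show ?thesis
      proof (cases "i = x")
        case False
        then have wt: "w ! t = w ! Suc i" using tr1[of t i] i tx \<open>t < y\<close> by simp
        have "w ! Suc q = w ! Suc i"
        proof (cases "q < x")
          case True
          then have "q = i" using index[of q i] q i by simp
          then show ?thesis by simp
        next
          case False
          then show ?thesis using tr1[of "Suc q" i] qx q i \<open>i \<noteq> x\<close> by simp
        qed
        then show ?thesis using wt q by simp
      next
        case True
        have "q \<ge> x" using index[of q x] q i True by (metis less_imp_le linorder_not_less)
        then have 1: "w ! Suc q = w ! s \<or> (0 < s \<and> w ! Suc q = prod.swap (w ! (s - 1)))"
          using tr2[of "Suc q"] qx q i True by simp
        have 2: "w ! t = w ! s \<or> (0 < s \<and> w ! t = prod.swap (w ! (s - 1)))"
          using tr2[of t] tx \<open>t < y\<close> i True by simp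
        have "bwd (w ! t)"
        proof (rule ccontr)
          assume "\<not> bwd (w ! t)"
          then have "w ! t = w ! s" using 2 unfolding bwd_def by (metis diff_less zero_less_one)
          then have "bwd (w ! Suc q)" using 1 q(5) unfolding bwd_def by (metis diff_less zero_less_one)
          then have "bwd (w ! (t - 1))" using bpers[of "Suc q" "t - 1"] q \<open>q \<ge> x\<close> \<open>t < y\<close> by simp
          then show False using False by simp
        qed
        then show ?thesis using f by simp
      qed
    qed
  qed
  have uniq: "t = t'" if "switch w t" "t < y" "switch w t'" "t' < y" for t t'
  proof -
    have *: False if "switch w t" "t < y" "switch w t'" "t' < y" "t < t'" for t t'
    proof -
      have "bwd (w ! (t' - 1))" using bpers[of t "t' - 1"] sw[OF that(1,2)] that by simp
      then show False using sw(1)[OF that(3,4)] fb by blast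
    qed
    show ?thesis using *[of t t'] *[of t' t] that by (cases t t' rule: linorder_cases) auto
  qed
  \<comment> \<open>A switch at t needs an old dart at t - 1, hence t \<le> y.\<close>
  have "{t. switch w t} \<subseteq> insert y {t. switch w t \<and> t < y}"
  using new_old by (fastforce simp: switch_def new_step_def)
  moreover have "card {t. switch w t \<and> t < y} \<le> 1"
    using uniq by (intro card_le_Suc0_iff_eq[THEN iffD2, simplified One_nat_def[symmetric]]) auto
  moreover have "card (insert y {t. switch w t \<and> t < y}) \<le> Suc (card {t. switch w t \<and> t < y})"
    by (rule card_insert_le_m1[of _ _, simplified]) auto
  ultimately show ?thesis
    using card_mono[of "insert y {t. switch w t \<and> t < y}" "{t. switch w t}"] by simp
qed

end

section \<open>Skeletons of chains\<close>

datatype kind = Fresh | Closing | Old nat bool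

definition step_kind :: "dart list \<Rightarrow> nat \<Rightarrow> kind" where
  "step_kind w t = (if fresh_step w t then Fresh else if closing_step w t then Closing
     else Old (first_visit w t) (w ! t = w ! first_visit w t))"

definition skeleton :: "dart list \<Rightarrow> kind list" where
  "skeleton w = map (step_kind w) [0..<length w]"

text \<open>A new step is its own first visit in positive orientation. With this convention equality
  of darts can be read off the skeleton, by \<open>step_id_eq_iff\<close>.\<close>

fun kind_id :: "nat \<Rightarrow> kind \<Rightarrow> nat \<times> bool" where
  "kind_id t (Old i b) = (i, b)"
| "kind_id t k = (t, True)"

definition step_id :: "dart list \<Rightarrow> nat \<Rightarrow> nat \<times> bool" where
  "step_id w t = (first_visit w t, w ! t = w ! first_visit w t)"

lemma length_skeleton [simp]: "length (skeleton w) = length w" by (simp add: skeleton_def)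
lemma nth_skeleton [simp]: "t < length w \<Longrightarrow> skeleton w ! t = step_kind w t" by (simp add: skeleton_def)

lemma kind_id_step_kind: "kind_id t (step_kind w t) = step_id w t"
  by (auto simp: step_kind_def step_id_def first_visit_new new_step_iff)

lemma step_kind_old: "\<not> new_step w t \<Longrightarrow> step_kind w t = case_prod Old (step_id w t)"
  by (auto simp: step_kind_def step_id_def new_step_iff)

lemma step_id_eq_iff: "step_id w s = step_id w t \<longleftrightarrow> w ! s = w ! t"
proof
  assume eq: "step_id w s = step_id w t"
  then have fv: "first_visit w s = first_visit w t"
    and b: "w ! s = w ! first_visit w s \<longleftrightarrow> w ! t = w ! first_visit w t" by (auto simp: step_id_def)
  show "w ! s = w ! t"
  proof (cases "w ! s = w ! first_visit w s")
    case True
    then show ?thesis using b fv by metis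
  next
    case False
    then have "w ! s = prod.swap (w ! first_visit w s)" by (metis first_visit_cases)
    moreover have "w ! t = prod.swap (w ! first_visit w t)" using False b by (metis first_visit_cases)
    ultimately show ?thesis using fv by simp
  qed
qed (simp add: step_id_def first_visit_def)

text \<open>The prediction for the step after the prefix \<open>\<rho>\<close>: new steps are followed by fresh ones; an old
  step is followed by the step that came after its latest occurrence in the same block or, failing that,
  by the one that the first visit of its edge suggests.\<close>

definition predict :: "nat \<Rightarrow> kind list \<Rightarrow> kind" where
  "predict l \<rho> = (let t = length \<rho>; I = (\<lambda>s. kind_id s (\<rho> ! s)); S = {s. s < t - 1 \<and> (t - 1) div l * l \<le> s \<and> I s = I (t - 1)} in
     case \<rho> ! (t - 1) of
       Old i b \<Rightarrow> (if S \<noteq> {} then case_prod Old (I (Suc (Max S)))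
          else if b then case_prod Old (I (Suc i)) else (case I (i - 1) of (j, b') \<Rightarrow> Old j (\<not> b')))
     | _ \<Rightarrow> Fresh)"

text \<open>Block starts are always recorded: repetition is looked for within one block only, and a
  new block is free to backtrack.\<close>

definition surprises :: "nat \<Rightarrow> kind list \<Rightarrow> nat set" where
  "surprises l \<sigma> = {t. t < length \<sigma> \<and> (l dvd t \<or> \<sigma> ! t \<noteq> predict l (take t \<sigma>))}"

text \<open>A prediction depends on the prefix alone, so the skeleton can be decoded from left to
  right.\<close>

lemma surprises_determine:
  assumes "length \<sigma> = length \<sigma>'"
    and eq: "(\<lambda>t. (t, \<sigma> ! t)) ` surprises l \<sigma> = (\<lambda>t. (t, \<sigma>' ! t)) ` surprises l \<sigma>'"
  shows "\<sigma> = \<sigma>'"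
proof (rule nth_equalityI[OF assms(1)])
  have S: "surprises l \<sigma> = surprises l \<sigma>'"
    using arg_cong[OF eq, of "image fst"] by (simp add: image_image)
  fix t assume "t < length \<sigma>"
  then show "\<sigma> ! t = \<sigma>' ! t"
  proof (induction t rule: less_induct)
    case (less t)
    show ?case
    proof (cases "t \<in> surprises l \<sigma>")
      case True
      then have "(t, \<sigma> ! t) \<in> (\<lambda>t. (t, \<sigma>' ! t)) ` surprises l \<sigma>'" unfolding eq[symmetric] by blast
      then show ?thesis by auto
    next
      case False
      have "take t \<sigma> = take t \<sigma>'" using less assms by (intro nth_take_lemma) auto
      moreover have "\<sigma> ! t = predict l (take t \<sigma>)" using False less.prems unfolding surprises_def by blast
      moreover have "\<sigma>' ! t = predict l (take t \<sigma>')"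
        using False[unfolded S] less.prems assms(1) unfolding surprises_def by auto
      ultimately show ?thesis by simp
    qed
  qed
qed

lemma card_bounded_subsets:
  assumes "finite A"
  shows "card {S. S \<subseteq> A \<and> card S \<le> k} \<le> (card A + 1) ^ k"
proof (induction k)
  case 0
  have "S = {}" if "S \<subseteq> A" "card S \<le> 0" for S
    using that finite_subset[OF that(1) assms] by simp
  then have "{S. S \<subseteq> A \<and> card S \<le> 0} \<subseteq> {{}}" by blast
  then have "card {S. S \<subseteq> A \<and> card S \<le> 0} \<le> card {{} :: 'a set}" by (rule card_mono[rotated]) simp
  then show ?case by simp
next
  case (Suc k)
  let ?F = "{S. S \<subseteq> A \<and> card S \<le> k}"
  let ?O = "insert None (Some ` A)"
  let ?f = "\<lambda>(S, a). case a of None \<Rightarrow> S | Some a \<Rightarrow> insert a S"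
  have "{S. S \<subseteq> A \<and> card S \<le> Suc k} \<subseteq> ?f ` (?F \<times> ?O)"
  proof
    fix S assume S: "S \<in> {S. S \<subseteq> A \<and> card S \<le> Suc k}"
    show "S \<in> ?f ` (?F \<times> ?O)"
    proof (cases "card S \<le> k")
      case True
      then show ?thesis using S by (intro image_eqI[of _ _ "(S, None)"]) auto
    next
      case False
      then have "S \<noteq> {}" by auto
      then obtain a where a: "a \<in> S" by auto
      have "finite S" using S assms finite_subset by auto
      then have "card (S - {a}) \<le> k" using S a by auto
      then show ?thesis using S a by (intro image_eqI[of _ _ "(S - {a}, Some a)"]) auto
    qed
  qed
  moreover have fin: "finite (?F \<times> ?O)" using assms by auto
  ultimately have "card {S. S \<subseteq> A \<and> card S \<le> Suc k} \<le> card (?F \<times> ?O)"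
    by (meson surj_card_le)
  also have "\<dots> = card ?F * (card A + 1)"
    using assms by (simp add: card_image)
  also have "\<dots> \<le> (card A + 1) ^ k * (card A + 1)" using Suc by (intro mult_right_mono) auto
  finally show ?case by (simp add: mult.commute)
qed

definition kinds :: "nat \<Rightarrow> kind set" where
  "kinds L = {Fresh, Closing} \<union> (\<lambda>(i, b). Old i b) ` ({..<L} \<times> UNIV)"

lemma finite_kinds [simp]: "finite (kinds L)" by (simp add: kinds_def)

lemma card_kinds: "card (kinds L) \<le> 2 * L + 2"
proof -
  have "card (kinds L) \<le> card {Fresh, Closing} + card ((\<lambda>(i, b). Old i b) ` ({..<L} \<times> (UNIV :: bool set)))"
    unfolding kinds_def by (rule card_Un_le)
  also have "card ((\<lambda>(i, b). Old i b) ` ({..<L} \<times> (UNIV :: bool set))) \<le> card ({..<L} \<times> (UNIV :: bool set))"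
    by (rule card_image_le) simp
  finally show ?thesis by simp
qed

lemma set_skeleton: "set (skeleton w) \<subseteq> kinds (length w)"
proof
  fix k assume "k \<in> set (skeleton w)"
  then obtain t where "t < length w" "k = step_kind w t" by (auto simp: skeleton_def)
  then show "k \<in> kinds (length w)"
    using first_visit(2)[of w t] by (auto simp: step_kind_def kinds_def)
qed

text \<open>A skeleton is encoded by the set of its surprises, pairs of a time and a kind. There are
  at most L (2 L + 2) such pairs, whence the base 4 (L + 1)^2.\<close>

lemma card_skeletons:
  assumes "\<And>\<sigma>. \<sigma> \<in> \<Sigma> \<Longrightarrow> length \<sigma> = L \<and> set \<sigma> \<subseteq> kinds L \<and> card (surprises l \<sigma>) \<le> k"
  shows "finite \<Sigma>" "card \<Sigma> \<le> (4 * (L + 1)\<^sup>2) ^ k"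
proof -
  let ?A = "{..<L} \<times> kinds L"
  let ?f = "\<lambda>\<sigma>. (\<lambda>t. (t, \<sigma> ! t)) ` surprises l \<sigma>"
  have inj: "inj_on ?f \<Sigma>"
    using assms by (auto intro!: inj_onI surprises_determine[where l = l])
  have sub: "?f ` \<Sigma> \<subseteq> {S. S \<subseteq> ?A \<and> card S \<le> k}"
  proof
    fix S assume "S \<in> ?f ` \<Sigma>"
    then obtain \<sigma> where \<sigma>: "\<sigma> \<in> \<Sigma>" "S = ?f \<sigma>" by auto
    have fin: "finite (surprises l \<sigma>)" by (auto simp: surprises_def)
    have "card S \<le> card (surprises l \<sigma>)" unfolding \<sigma>(2) by (rule card_image_le[OF fin])
    then have "card S \<le> k" using assms[OF \<sigma>(1)] by simp
    moreover have "S \<subseteq> ?A" using assms[OF \<sigma>(1)] \<sigma>(2) by (auto simp: surprises_def)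
    ultimately show "S \<in> {S. S \<subseteq> ?A \<and> card S \<le> k}" by simp
  qed
  have fin: "finite {S. S \<subseteq> ?A \<and> card S \<le> k}" by simp
  show "finite \<Sigma>" using inj sub fin by (meson finite_imageD finite_subset)
  have "card \<Sigma> = card (?f ` \<Sigma>)" using inj by (simp add: card_image)
  also have "\<dots> \<le> card {S. S \<subseteq> ?A \<and> card S \<le> k}" by (rule card_mono[OF fin sub])
  also have "\<dots> \<le> (card ?A + 1) ^ k" by (rule card_bounded_subsets) simp
  also have "\<dots> \<le> (4 * (L + 1)\<^sup>2) ^ k"
  proof (rule power_mono)
    have "card ?A \<le> L * (2 * L + 2)" using mult_left_mono[OF card_kinds[of L], of L] by simp
    then show "card ?A + 1 \<le> 4 * (L + 1)\<^sup>2" by (simp add: power2_eq_square)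
  qed simp
  finally show "card \<Sigma> \<le> (4 * (L + 1)\<^sup>2) ^ k" .
qed

section \<open>Surprises in chains whose blocks have at most one cycle\<close>

definition block :: "nat \<Rightarrow> dart list \<Rightarrow> nat \<Rightarrow> dart list" where
  "block l w j = take l (drop (j * l) w)"

lemma (in chain_walk) chain_block: "chain l (block l w j)"
  unfolding chain_def
proof (intro allI impI)
  fix t assume t: "0 < t \<and> t < length (block l w j)"
  then have tl: "t < l" "j * l + t < length w" by (auto simp: block_def)
  have "\<not> l dvd t" using t tl by auto
  moreover from this have "\<not> l dvd j * l + t" by simp
  ultimately show "if l dvd t then fst (block l w j ! t) = snd (block l w j ! (t - 1))
         else src (block l w j ! t) = dst (block l w j ! (t - 1)) \<and> fst (block l w j ! t) \<noteq> snd (block l w j ! (t - 1))"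
    using src_dst[of "j * l + t"] nb[of "j * l + t"] t by (auto simp: block_def)
qed

locale block_chain = chain_walk +
  fixes M :: nat
  assumes l0: "0 < l" and len: "length w = M * l"
    and blocks: "\<And>j. j < M \<Longrightarrow> card (chain_walk.closings (block l w j)) \<le> 1"
begin

lemma card_breaks: "card breaks = M"
proof -
  have "breaks = (\<lambda>j. j * l) ` {..<M}"
    using l0 by (auto simp: breaks_def len)
  then show ?thesis using l0 by (simp add: card_image inj_on_def)
qed

lemma length_block: "j < M \<Longrightarrow> length (block l w j) = l"
proof -
  assume "j < M"
  then have "Suc j * l \<le> M * l" by (intro mult_right_mono) auto
  then show ?thesis by (simp add: block_def len)
qed

lemma nth_block: "j < M \<Longrightarrow> r < l \<Longrightarrow> block l w j ! r = w ! (j * l + r)"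
  using length_block[of j] by (simp add: block_def)

lemma block_switches: "j < M \<Longrightarrow> card {t. switch (block l w j) t} \<le> 2"
proof -
  assume j: "j < M"
  interpret b: chain_walk l "block l w j" by unfold_locales (rule chain_block)
  show ?thesis using length_block[OF j] blocks[OF j] by (intro b.card_switches) auto
qed

text \<open>An old step through a vertex outside \<open>branch\<close> can only follow the unique
  new path through that vertex: forwards to the step after i, or backwards to the reverse of the
  step before i.\<close>

lemma predict_off_branch:
  assumes t: "0 < t" "t < length w" "\<not> l dvd t" "\<not> new_step w t" "\<not> new_step w (t - 1)"
    and v: "dst (w ! (t - 1)) \<notin> branch"
  defines "i \<equiv> first_visit w (t - 1)"
  shows "step_id w t = (if w ! (t - 1) = w ! i then step_id w (Suc i)
     else (fst (step_id w (i - 1)), \<not> snd (step_id w (i - 1))))"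
proof -
  let ?v = "dst (w ! (t - 1))"
  define j where "j = first_visit w t"
  have i: "i < t - 1" "new_step w i" "i < length w"
    using first_visit_less[OF t(5)] first_visit(3)[of w "t - 1"] t by (auto simp: i_def)
  have j: "j < t" "new_step w j" "j < length w"
    using first_visit_less[OF t(4)] first_visit(3)[of w t] t by (auto simp: j_def)
  have n: "src (w ! t) = ?v" "fst (w ! t) \<noteq> snd (w ! (t - 1))"
    using src_dst nb t by auto
  have cj: "w ! t = w ! j \<or> w ! t = prod.swap (w ! j)" unfolding j_def by (rule first_visit_cases[of w t]) auto
  have id: "step_id w t = (j, w ! t = w ! j)" by (simp add: step_id_def j_def)
  have new_id: "step_id w k = (k, True)" if "new_step w k" for k
    using first_visit_new[OF that] by (simp add: step_id_def)
  show ?thesis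
  proof (cases "w ! (t - 1) = w ! i")
    case True
    then have di: "dst (w ! i) = ?v" by simp
    have "w ! t \<noteq> prod.swap (w ! j) \<or> w ! t = w ! j"
    proof (rule ccontr)
      assume "\<not> ?thesis"
      then have sw: "w ! t = prod.swap (w ! j)" by simp
      then have "dst (w ! j) = ?v" using n by simp
      then have "i = j" using not_branch_unique(1)[OF v i(3) j(3) i(2) j(2)] di by simp
      then show False using n sw True by simp
    qed
    then have wt: "w ! t = w ! j" using cj by auto
    then have "src (w ! j) = ?v" using n by simp
    then have "j = Suc i" using not_branch_unique(2)[OF v i(3) j(3) i(2) j(2)] di by simp
    then show ?thesis using True id wt new_id[OF j(2)] by simp
  next
    case False
    then have sw: "w ! (t - 1) = prod.swap (w ! i)" unfolding i_def by (metis first_visit_cases)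
    then have si: "src (w ! i) = ?v" by simp
    have "w ! t \<noteq> w ! j"
    proof
      assume wt: "w ! t = w ! j"
      then have "src (w ! j) = ?v" using n by simp
      then have "i = j" using not_branch_unique(3)[OF v i(3) j(3) i(2) j(2)] si by simp
      then show False using n sw wt by simp
    qed
    then have wt: "w ! t = prod.swap (w ! j)" using cj by auto
    then have "dst (w ! j) = ?v" using n by simp
    then have "i = Suc j" using not_branch_unique(2)[OF v j(3) i(3) j(2) i(2)] si by simp
    then show ?thesis using False id \<open>w ! t \<noteq> w ! j\<close> new_id[OF j(2)] by simp
  qed
qed

text \<open>The times just after the first occurrence in block j of an old dart that leads to a
  branch vertex: here neither repetition nor the local structure tells how the walk continues. The
  darts in question are arrivals or reversed exits, so each block has O(M) of these times, apart
  from those due to closing steps; this is the source of the exponent M^2.\<close>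

definition revisits :: "nat \<Rightarrow> nat set" where
  "revisits j = {t. j * l < t \<and> t < Suc j * l \<and> \<not> new_step w (t - 1) \<and> dst (w ! (t - 1)) \<in> branch \<and>
     (\<forall>s. j * l \<le> s \<and> s < t - 1 \<longrightarrow> w ! s \<noteq> w ! (t - 1))}"

lemma card_revisits:
  assumes "j < M"
  shows "card (revisits j) \<le> 6 * M + 9 * card closings"
proof -
  have inj: "inj_on (\<lambda>t. w ! (t - 1)) (revisits j)"
  proof (rule inj_onI)
    fix s t assume st: "s \<in> revisits j" "t \<in> revisits j" "w ! (s - 1) = w ! (t - 1)"
    have *: False if "s < t" "s \<in> revisits j" "t \<in> revisits j" "w ! (s - 1) = w ! (t - 1)" for s t
    proof -
      have "j * l \<le> s - 1" "s - 1 < t - 1" using that by (auto simp: revisits_def)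
      then show False using that by (auto simp: revisits_def)
    qed
    show "s = t" using *[of s t] *[of t s] st by (cases s t rule: linorder_cases) auto
  qed
  have sub: "(\<lambda>t. w ! (t - 1)) ` revisits j \<subseteq> (!) w ` arrivals \<union> (\<lambda>t. prod.swap (w ! t)) ` exits"
  proof
    fix d assume "d \<in> (\<lambda>t. w ! (t - 1)) ` revisits j"
    then obtain t where t: "t \<in> revisits j" "d = w ! (t - 1)" by auto
    let ?i = "first_visit w (t - 1)"
    have "Suc j * l \<le> M * l" using assms by (intro mult_right_mono) auto
    then have "t < length w" using t by (auto simp: revisits_def len)
    then have i: "?i < length w" "new_step w ?i" using first_visit(2,3)[of w "t - 1"] by auto
    have b: "dst d \<in> branch" using t by (simp add: revisits_def)
    consider "d = w ! ?i" | "d = prod.swap (w ! ?i)" using first_visit_cases[of w "t - 1"] t(2) by metis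
    then show "d \<in> (!) w ` arrivals \<union> (\<lambda>t. prod.swap (w ! t)) ` exits"
    proof cases
      case 1
      then have "?i \<in> arrivals" using i b by (simp add: arrivals_def)
      then show ?thesis using 1 by blast
    next
      case 2
      then have "?i \<in> exits" using i b by (simp add: exits_def)
      then show ?thesis using 2 by blast
    qed
  qed
  have "card (revisits j) = card ((\<lambda>t. w ! (t - 1)) ` revisits j)" using inj by (simp add: card_image)
  also have "\<dots> \<le> card ((!) w ` arrivals \<union> (\<lambda>t. prod.swap (w ! t)) ` exits)"
    by (rule card_mono[OF _ sub]) simp
  also have "\<dots> \<le> card arrivals + card exits"
    by (rule order.trans[OF card_Un_le]) (intro add_mono card_image_le; simp)
  finally show ?thesis using card_incidences card_breaks by simp
qed

text \<open>Away from breaks, closings and departures, a new step is followed by a fresh one. After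
  an old dart that occurred earlier in the block the prediction fails only at a switch; after an old
  dart that is new to the block it fails only at a branch vertex.\<close>

lemma surprises_subset:
  "surprises l (skeleton w) \<subseteq> breaks \<union> closings \<union> Suc ` closings \<union> departures
     \<union> (\<Union>j<M. (\<lambda>r. j * l + r) ` {r. switch (block l w j) r}) \<union> (\<Union>j<M. revisits j)"
proof
  fix t assume t: "t \<in> surprises l (skeleton w)"
  let ?\<rho> = "take t (skeleton w)"
  have tl: "t < length w" using t by (simp add: surprises_def)
  show "t \<in> breaks \<union> closings \<union> Suc ` closings \<union> departures
     \<union> (\<Union>j<M. (\<lambda>r. j * l + r) ` {r. switch (block l w j) r}) \<union> (\<Union>j<M. revisits j)"
  proof (rule ccontr)
    assume not: "\<not> ?thesis"
    have nd: "\<not> l dvd t" using not tl by (auto simp: breaks_def)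
    have t0: "0 < t" using nd by (auto intro!: Nat.gr0I)
    have nc: "\<not> closing_step w t" using not tl by (auto simp: closings_def)
    have nc': "\<not> closing_step w (t - 1)"
    proof
      assume "closing_step w (t - 1)"
      then have "Suc (t - 1) \<in> Suc ` closings" using tl by (auto simp: closings_def)
      then show False using not t0 by simp
    qed
    have surprise: "step_kind w t \<noteq> predict l ?\<rho>" using t nd by (auto simp: surprises_def)
    have len\<rho>: "length ?\<rho> = t" using tl by simp
    have nth\<rho>: "?\<rho> ! s = step_kind w s" if "s < t" for s using that tl by simp
    show False
    proof (cases "new_step w (t - 1)")
      case True
      then have fr: "fresh_step w (t - 1)" using nc' by (auto simp: new_step_iff)
      then have "fresh_step w t" using new_after_fresh t0 tl nd nc by (auto simp: new_step_iff)
      then have "step_kind w t = Fresh" by (simp add: step_kind_def)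
      moreover have "predict l ?\<rho> = Fresh"
        using nth\<rho>[of "t - 1"] t0 fr unfolding predict_def Let_def len\<rho> by (simp add: step_kind_def)
      ultimately show False using surprise by simp
    next
      case False
      have old: "\<not> new_step w t"
      using tl False not by (auto simp: departures_def new_step_iff)
      define j where "j = t div l"
      define r where "r = t mod l"
      have tjr: "t = j * l + r" by (simp add: j_def r_def)
      have r: "0 < r" "r < l" using nd l0 by (auto simp: r_def mod_greater_zero_iff_not_dvd)
      have jM: "j < M" using tl unfolding j_def len by (simp add: less_mult_imp_div_less)
      have jdiv: "(t - 1) div l = j"
      proof -
        have "t - 1 = j * l + (r - 1)" using tjr r by simp
        then show ?thesis using r by (simp only: div_mult_self3 div_less less_imp_diff_less)
      qed
      define S where "S = {s. s < t - 1 \<and> j * l \<le> s \<and> w ! s = w ! (t - 1)}"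
      have S_eq: "{s. s < t - 1 \<and> (t - 1) div l * l \<le> s \<and> kind_id s (?\<rho> ! s) = kind_id (t - 1) (?\<rho> ! (t - 1))} = S"
        unfolding jdiv S_def using nth\<rho> t0
        by (auto simp: kind_id_step_kind step_id_eq_iff simp del: nth_take)
      have pred: "predict l ?\<rho> = (if S \<noteq> {} then case_prod Old (step_id w (Suc (Max S)))
          else if w ! (t - 1) = w ! first_visit w (t - 1) then case_prod Old (step_id w (Suc (first_visit w (t - 1))))
          else case_prod (\<lambda>j b'. Old j (\<not> b')) (step_id w (first_visit w (t - 1) - 1)))"
      proof -
        have k: "?\<rho> ! (t - 1) = Old (first_visit w (t - 1)) (w ! (t - 1) = w ! first_visit w (t - 1))"
          using nth\<rho>[of "t - 1"] t0 False by (simp add: step_kind_old step_id_def)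
        have fv: "Suc (first_visit w (t - 1)) < t" using first_visit_less[OF False] by simp
        have mx: "Suc (Max S) < t" if "S \<noteq> {}"
        proof -
          have "Max S \<in> S" using that by (intro Max_in) (auto simp: S_def)
          then have "Max S < t - 1" unfolding S_def by blast
          then show ?thesis by simp
        qed
        have id: "kind_id s (?\<rho> ! s) = step_id w s" if "s < t" for s
          using nth\<rho>[OF that] by (simp add: kind_id_step_kind)
        show ?thesis
          unfolding predict_def Let_def len\<rho> S_eq
          using k fv mx id[of "Suc (Max S)"] id[of "Suc (first_visit w (t - 1))"] id[of "first_visit w (t - 1) - 1"]
          by (simp del: nth_take)
      qed
      have kt: "step_kind w t = case_prod Old (step_id w t)" by (rule step_kind_old[OF old])
      show False
      proof (cases "S = {}")
        case False
        then have "Max S \<in> S" by (intro Max_in) (auto simp: S_def)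
        then have s: "Max S < t - 1" "j * l \<le> Max S" "w ! Max S = w ! (t - 1)" by (auto simp: S_def)
        have "step_id w t \<noteq> step_id w (Suc (Max S))" using surprise pred False kt by auto
        then have ne: "w ! Suc (Max S) \<noteq> w ! t" using step_id_eq_iff[of w t "Suc (Max S)"] by auto
        obtain q where q: "Max S = j * l + q" using s(2) le_Suc_ex by blast
        have qr: "q < r - 1" using s(1) tjr q by simp
        have "switch (block l w j) r"
          unfolding switch_def
        proof (intro conjI exI[of _ q])
          show "block l w j ! q = block l w j ! (r - 1)"
            using nth_block[OF jM, of q] nth_block[OF jM, of "r - 1"] qr r s(3) q tjr by simp
          show "block l w j ! Suc q \<noteq> block l w j ! r"
            using nth_block[OF jM, of "Suc q"] nth_block[OF jM, of "r"] qr r ne q tjr by simp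
        qed (use r qr length_block[OF jM] in auto)
        then show False using not jM tjr by auto
      next
        case True
        have "dst (w ! (t - 1)) \<in> branch"
        proof (rule ccontr)
          assume nb': "dst (w ! (t - 1)) \<notin> branch"
          show False
            using predict_off_branch[OF t0 tl nd old False nb'] surprise pred True kt
            by (auto split: if_splits prod.splits)
        qed
        then have "t \<in> revisits j"
          using True tjr r False by (auto simp: revisits_def S_def)
        then show False using not jM by auto
      qed
    qed
  qed
qed

lemma card_surprises:
  "card (surprises l (skeleton w)) \<le> 5 * M + 6 * M * M + (4 + 9 * M) * card closings"
proof -
  have finsw: "finite {r. switch (block l w j) r}" for j by (auto simp: switch_def)
  have finre: "finite (revisits j)" for j by (auto simp: revisits_def)
  have "card (surprises l (skeleton w)) \<le> card (breaks \<union> closings \<union> Suc ` closings \<union> departures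
     \<union> (\<Union>j<M. (\<lambda>r. j * l + r) ` {r. switch (block l w j) r}) \<union> (\<Union>j<M. revisits j))"
    by (rule card_mono[OF _ surprises_subset]) (use finsw finre in auto)
  also have "\<dots> \<le> card breaks + card closings + card (Suc ` closings) + card departures
     + card (\<Union>j<M. (\<lambda>r. j * l + r) ` {r. switch (block l w j) r}) + card (\<Union>j<M. revisits j)"
    by (intro order.trans[OF card_Un_le] add_mono order.refl)
  also have "card (\<Union>j<M. (\<lambda>r. j * l + r) ` {r. switch (block l w j) r}) \<le> (\<Sum>j<M. 2)"
  proof (rule order.trans[OF card_UN_le], simp, rule sum_mono)
    fix j assume "j \<in> {..<M}"
    then show "card ((\<lambda>r. j * l + r) ` {r. switch (block l w j) r}) \<le> 2"
      using card_image_le[OF finsw[of j], of "\<lambda>r. j * l + r"] block_switches[of j] by simp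
  qed
  also have "card (\<Union>j<M. revisits j) \<le> (\<Sum>j<M. 6 * M + 9 * card closings)"
    by (rule order.trans[OF card_UN_le], simp, rule sum_mono) (use card_revisits in auto)
  also have "card (Suc ` closings) = card closings" by (simp add: card_image)
  finally have "card (surprises l (skeleton w)) \<le> M + card closings + card closings + card departures + 2 * M
     + M * (6 * M + 9 * card closings)" using card_breaks by simp
  moreover have "card departures \<le> 2 * M + 2 * card closings" using card_departures card_breaks by simp
  ultimately show ?thesis by (simp add: algebra_simps)
qed

end

lemma first_visit_cong:
  assumes "\<And>i. i \<le> t \<Longrightarrow> w ! i = w' ! i"
  shows "first_visit w t = first_visit w' t"
proof (rule sym, rule first_visit_eqI)
  have le: "first_visit w t \<le> t" by (rule first_visit)
  show "new_step w' (first_visit w t)"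
    using first_visit(3)[of w t] le assms by (auto simp: new_step_def)
  show "dart_edge (w' ! first_visit w t) = dart_edge (w' ! t)"
    using first_visit(1)[of w t] le assms by simp
qed

lemma step_kind_cong:
  assumes "\<And>i. i \<le> t \<Longrightarrow> w ! i = w' ! i"
  shows "step_kind w t = step_kind w' t"
  using assms first_visit_cong[OF assms] first_visit(2)[of w t] by (auto simp: new_step_def visited_def step_kind_def fresh_step_def closing_step_def)

lemma skeleton_snoc: "skeleton (u @ [x]) = skeleton u @ [step_kind (u @ [x]) (length u)]"
proof -
  have "step_kind (u @ [x]) t = step_kind u t" if "t < length u" for t
    using that by (intro step_kind_cong) (simp add: nth_append)
  then show ?thesis by (simp add: skeleton_def)
qed

lemma chainD:
  assumes "chain l w" "0 < t" "t < length w"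
  shows "if l dvd t then fst (w ! t) = snd (w ! (t - 1))
      else src (w ! t) = dst (w ! (t - 1)) \<and> fst (w ! t) \<noteq> snd (w ! (t - 1))"
  using assms unfolding chain_def by blast

lemma chain_snocD:
  assumes "chain l (u @ [x])"
  shows "chain l u"
    "u \<noteq> [] \<Longrightarrow> (if l dvd length u then fst x = snd (last u) else src x = dst (last u) \<and> fst x \<noteq> snd (last u))"
proof -
  show "chain l u"
    unfolding chain_def
  proof (intro allI impI)
    fix t assume t: "0 < t \<and> t < length u"
    then have "t < length (u @ [x])" "(u @ [x]) ! t = u ! t" "(u @ [x]) ! (t - 1) = u ! (t - 1)"
      by (auto simp: nth_append)
    then show "if l dvd t then fst (u ! t) = snd (u ! (t - 1)) else src (u ! t) = dst (u ! (t - 1)) \<and> fst (u ! t) \<noteq> snd (u ! (t - 1))"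
      using chainD[OF assms, of t] t by metis
  qed
  assume u: "u \<noteq> []"
  then have "(u @ [x]) ! (length u - 1) = last u" by (simp add: nth_append last_conv_nth)
  moreover have "(u @ [x]) ! length u = x" by simp
  ultimately show "if l dvd length u then fst x = snd (last u) else src x = dst (last u) \<and> fst x \<noteq> snd (last u)"
    using chainD[OF assms, of "length u"] u by (metis length_append_singleton length_greater_0_conv lessI)
qed

section \<open>Counting chains with a given skeleton\<close>

locale half_edges =
  fixes N d :: nat
  assumes N: "0 < N" and d: "2 \<le> d"
begin

definition X :: "hedge set" where "X = {..<N} \<times> {..<d}"
definition n :: real where "n = real (N * d)"

lemma finite_X [simp]: "finite X" and card_X: "card X = N * d"
  by (simp_all add: X_def)

lemma Nd_pos: "1 \<le> N * d" using N d by simp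

lemma n_pos: "1 \<le> n" "0 < n" using Nd_pos unfolding n_def by linarith+

lemma card_other_half_edges: "x \<in> X \<Longrightarrow> card {h \<in> X. fst h = fst x \<and> h \<noteq> x} = d - 1"
proof -
  assume x: "x \<in> X"
  have "{h \<in> X. fst h = fst x \<and> h \<noteq> x} = Pair (fst x) ` ({..<d} - {snd x})"
    using x by (auto simp: X_def)
  then show ?thesis using x by (simp add: card_image inj_on_def X_def mem_Times_iff)
qed

definition walks :: "nat \<Rightarrow> kind list \<Rightarrow> dart list set" where
  "walks l \<sigma> = {w. chain l w \<and> set w \<subseteq> X \<times> X \<and> skeleton w = \<sigma>}"

lemma finite_walks [simp]: "finite (walks l \<sigma>)"
proof (rule finite_subset)
  show "walks l \<sigma> \<subseteq> {w. set w \<subseteq> X \<times> X \<and> length w = length \<sigma>}" by (auto simp: walks_def)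
qed (auto intro: finite_lists_length_eq)

text \<open>Bounds for the number of continuations: d - 1 half-edges to leave by, times all
  half-edges for a fresh landing, or times those at the at most L + 1 visited vertices for a closing
  one. An old step is determined by its kind.\<close>

definition cost :: "nat \<Rightarrow> kind \<Rightarrow> nat" where
  "cost L k = (case k of Fresh \<Rightarrow> (d - 1) * (N * d) | Closing \<Rightarrow> (d - 1) * (d * (L + 1)) | Old _ _ \<Rightarrow> 1)"

lemma card_extensions:
  assumes u: "u \<noteq> []" "length u \<le> L" "set u \<subseteq> X \<times> X"
  shows "card {x \<in> X \<times> X. chain l (u @ [x]) \<and> step_kind (u @ [x]) (length u) = k} \<le> cost L k"
proof -
  let ?T = "{x \<in> X \<times> X. chain l (u @ [x]) \<and> step_kind (u @ [x]) (length u) = k}"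
  let ?h = "snd (last u)"
  have hX: "?h \<in> X" using u last_in_set[OF u(1)] by (metis mem_Sigma_iff prod.collapse subsetD)
  \<comment> \<open>At a block boundary the half-edge is prescribed by the previous step; elsewhere
    it is one of the d - 1 other half-edges at the same vertex.\<close>
  define H where "H = (if l dvd length u then {?h} else {h \<in> X. fst h = fst ?h \<and> h \<noteq> ?h})"
  have cH: "card H \<le> d - 1" using card_other_half_edges[OF hX] d by (auto simp: H_def)
  have fH: "finite H" by (simp add: H_def)
  have TH: "fst x \<in> H" if "x \<in> ?T" for x
    using that chain_snocD(2)[of l u x] u(1) by (auto simp: H_def src_def dst_def split: if_splits)
  show ?thesis
  proof (cases k)
    case Fresh
    have "?T \<subseteq> H \<times> X" using TH by auto
    then have "card ?T \<le> card (H \<times> X)" using fH by (intro card_mono) auto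
    also have "\<dots> \<le> (d - 1) * (N * d)" using cH by (simp add: card_cartesian_product card_X)
    finally show ?thesis using Fresh by (simp add: cost_def)
  next
    case Closing
    let ?V = "visited u (length u)"
    have vis: "visited (u @ [x]) (length u) = ?V" for x
      using u(1) by (auto simp: visited_def nth_append)
    have fV: "finite ?V" by (simp add: visited_def)
    have cV: "card ?V \<le> L + 1"
    proof -
      have "card {i. i < length u \<and> dst (u ! i) \<notin> visited u i} \<le> card {..<length u}" by (rule card_mono) auto
      then show ?thesis using u by (simp add: card_visited)
    qed
    have "?T \<subseteq> H \<times> (?V \<times> {..<d})"
    proof
      fix x assume x: "x \<in> ?T"
      then have "dst x \<in> ?V" using Closing vis[of x]
        by (auto simp: step_kind_def closing_step_def split: if_splits)
      then show "x \<in> H \<times> (?V \<times> {..<d})" using TH[OF x] x by (auto simp: X_def dst_def)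
    qed
    then have "card ?T \<le> card (H \<times> (?V \<times> {..<d}))" using fH fV by (intro card_mono) auto
    also have "\<dots> \<le> (d - 1) * ((L + 1) * d)"
      unfolding card_cartesian_product using cH cV by (intro mult_mono) auto
    finally show ?thesis using Closing by (simp add: cost_def algebra_simps)
  next
    case (Old i b)
    have "?T \<subseteq> {if b then u ! i else prod.swap (u ! i)}"
    proof
      fix x assume x: "x \<in> ?T"
      let ?w = "u @ [x]" and ?t = "length u"
      have k: "step_kind ?w ?t = Old i b" using x Old by simp
      then have old: "\<not> new_step ?w ?t" by (auto simp: step_kind_def new_step_iff split: if_splits)
      then have i: "i = first_visit ?w ?t" "b \<longleftrightarrow> ?w ! ?t = ?w ! i" using k by (auto simp: step_kind_old step_id_def)
      have "i < ?t" using first_visit_less[OF old] i by simp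
      then have "?w ! i = u ! i" by (simp add: nth_append)
      moreover have "?w ! ?t = x" by simp
      moreover have "?w ! ?t = ?w ! i \<or> ?w ! ?t = prod.swap (?w ! i)" unfolding i(1) by (metis first_visit_cases)
      ultimately show "x \<in> {if b then u ! i else prod.swap (u ! i)}" using i(2) by auto
    qed
    then have "card ?T \<le> card {if b then u ! i else prod.swap (u ! i)}" by (intro card_mono) auto
    then show ?thesis using Old by (simp add: cost_def)
  qed
qed

lemma card_initial: "card {x \<in> X \<times> X. step_kind [x] 0 = k} \<le> N * d * cost L k"
proof (cases k)
  case Fresh
  have "card {x \<in> X \<times> X. step_kind [x] 0 = k} \<le> card (X \<times> X)" by (intro card_mono) auto
  also have "\<dots> = (N * d) * (1 * (N * d))" by (simp add: card_X)
  also have "\<dots> \<le> (N * d) * ((d - 1) * (N * d))" using d by (intro mult_left_mono mult_right_mono) auto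
  finally show ?thesis using Fresh by (simp add: cost_def)
next
  case Closing
  have "{x \<in> X \<times> X. step_kind [x] 0 = k} \<subseteq> (\<lambda>(h, j). (h, (fst h, j))) ` (X \<times> {..<d})"
  proof
    fix x assume "x \<in> {x \<in> X \<times> X. step_kind [x] 0 = k}"
    then have x: "x \<in> X \<times> X" "dst x = src x"
      using Closing by (auto simp: step_kind_def closing_step_def visited_def split: if_splits)
    then have "x = (\<lambda>(h, j). (h, (fst h, j))) (fst x, snd (snd x))"
      by (auto simp: src_def dst_def)
    moreover have "(fst x, snd (snd x)) \<in> X \<times> {..<d}" using x(1) by (auto simp: X_def)
    ultimately show "x \<in> (\<lambda>(h, j). (h, (fst h, j))) ` (X \<times> {..<d})" by blast
  qed
  then have "card {x \<in> X \<times> X. step_kind [x] 0 = k} \<le> card (X \<times> {..<d})"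
    by (rule surj_card_le[rotated]) simp
  also have "\<dots> = (N * d) * (1 * (d * 1))" by (simp add: card_X)
  also have "\<dots> \<le> (N * d) * ((d - 1) * (d * (L + 1)))" using d by (intro mult_mono) auto
  finally show ?thesis using Closing by (simp add: cost_def)
next
  case (Old i b)
  have "step_kind [x] 0 \<noteq> k" for x
  proof -
    have "new_step [x] 0" by (simp add: new_step_def)
    then show ?thesis using Old by (auto simp: step_kind_def new_step_iff)
  qed
  then have "{x \<in> X \<times> X. step_kind [x] 0 = k} = {}" by blast
  then show ?thesis by (simp only: card.empty)
qed

lemma card_walks:
  "length \<sigma> \<le> L \<Longrightarrow> card (walks l \<sigma>) \<le> N * d * prod_list (map (cost L) \<sigma>)"
proof (induction \<sigma> rule: rev_induct)
  case Nil
  have "walks l [] \<subseteq> {[]}" by (auto simp: walks_def skeleton_def)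
  then have "card (walks l []) \<le> card {[] :: dart list}" by (intro card_mono) auto
  then have "card (walks l []) \<le> 1" by simp
  then have "card (walks l []) \<le> N * d" using Nd_pos by (rule order.trans)
  then show ?case by simp
next
  case (snoc k \<sigma>)
  show ?case
  proof (cases "\<sigma> = []")
    case True
    have "walks l (\<sigma> @ [k]) \<subseteq> (\<lambda>x. [x]) ` {x \<in> X \<times> X. step_kind [x] 0 = k}"
    proof
      fix w assume w: "w \<in> walks l (\<sigma> @ [k])"
      then have "length (skeleton w) = length [k]" using True by (simp add: walks_def)
      then obtain x where "w = [x]" by (auto simp: length_Suc_conv)
      then show "w \<in> (\<lambda>x. [x]) ` {x \<in> X \<times> X. step_kind [x] 0 = k}"
        using w by (auto simp: walks_def skeleton_def)
    qed
    then have "card (walks l (\<sigma> @ [k])) \<le> card {x \<in> X \<times> X. step_kind [x] 0 = k}"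
      by (rule surj_card_le[rotated]) simp
    also have "\<dots> \<le> N * d * cost L k" by (rule card_initial)
    finally show ?thesis using True by simp
  next
    case False
    let ?T = "\<lambda>u. {x \<in> X \<times> X. chain l (u @ [x]) \<and> step_kind (u @ [x]) (length u) = k}"
    have "walks l (\<sigma> @ [k]) \<subseteq> (\<Union>u\<in>walks l \<sigma>. (\<lambda>x. u @ [x]) ` ?T u)"
    proof
      fix w assume w: "w \<in> walks l (\<sigma> @ [k])"
      then have "w \<noteq> []" by (auto simp: walks_def skeleton_def)
      then obtain u x where ux: "w = u @ [x]" by (metis rev_exhaust)
      have "u \<in> walks l \<sigma>" using w chain_snocD(1)[of l u x] by (auto simp: ux walks_def skeleton_snoc)
      moreover have "x \<in> ?T u" using w by (auto simp: ux walks_def skeleton_snoc)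
      ultimately show "w \<in> (\<Union>u\<in>walks l \<sigma>. (\<lambda>x. u @ [x]) ` ?T u)" using ux by blast
    qed
    then have "card (walks l (\<sigma> @ [k])) \<le> card (\<Union>u\<in>walks l \<sigma>. (\<lambda>x. u @ [x]) ` ?T u)"
      by (intro card_mono) auto
    also have "\<dots> \<le> (\<Sum>u\<in>walks l \<sigma>. card ((\<lambda>x. u @ [x]) ` ?T u))" by (rule card_UN_le) simp
    also have "\<dots> \<le> (\<Sum>u\<in>walks l \<sigma>. cost L k)"
    proof (rule sum_mono)
      fix u assume u: "u \<in> walks l \<sigma>"
      then have len: "length u = length \<sigma>" by (auto simp: walks_def)
      have "card ((\<lambda>x. u @ [x]) ` ?T u) \<le> card (?T u)" by (rule card_image_le) simp
      also have "\<dots> \<le> cost L k"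
      proof (rule card_extensions)
        show "u \<noteq> []" using len False by auto
      qed (use u len snoc.prems in \<open>auto simp: walks_def\<close>)
      finally show "card ((\<lambda>x. u @ [x]) ` ?T u) \<le> cost L k" .
    qed
    also have "\<dots> = card (walks l \<sigma>) * cost L k" by simp
    also have "\<dots> \<le> (N * d * prod_list (map (cost L) \<sigma>)) * cost L k"
      using snoc by (intro mult_right_mono) auto
    finally show ?thesis by simp
  qed
qed

definition news :: "kind list \<Rightarrow> nat" where "news \<sigma> = length (filter (\<lambda>k. k = Fresh \<or> k = Closing) \<sigma>)"
definition closes :: "kind list \<Rightarrow> nat" where "closes \<sigma> = length (filter (\<lambda>k. k = Closing) \<sigma>)"

text \<open>If every distinct edge is weighted by 1 / ((d - 1) n), a fresh step has total weight 1
  and a closing step only d (L + 1) / n.\<close>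

lemma prod_cost:
  "real (prod_list (map (cost L) \<sigma>)) * (1 / ((real d - 1) * n)) ^ news \<sigma> = (real d * (real L + 1) / n) ^ closes \<sigma>"
proof -
  define \<kappa> where "\<kappa> = 1 / ((real d - 1) * n)"
  define \<rho> where "\<rho> = real d * (real L + 1) / n"
  have d1: "real (d - 1) = real d - 1" "real d - 1 \<noteq> 0" "n \<noteq> 0" using d n_pos by auto
  have F: "real (cost L Fresh) * \<kappa> = 1"
  proof -
    have "real (cost L Fresh) = (real d - 1) * n" using d1(1) by (simp add: cost_def n_def)
    then show ?thesis using d1 by (simp add: \<kappa>_def)
  qed
  have C: "real (cost L Closing) * \<kappa> = \<rho>"
  proof -
    have "real (cost L Closing) = (real d - 1) * (real d * (real L + 1))"
      unfolding cost_def by (simp only: kind.case of_nat_mult d1(1) of_nat_add of_nat_1)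
    then show ?thesis using d1 by (simp add: \<kappa>_def \<rho>_def)
  qed
  have "real (prod_list (map (cost L) \<sigma>)) * \<kappa> ^ news \<sigma> = \<rho> ^ closes \<sigma>"
  proof (induction \<sigma>)
    case (Cons k \<sigma>)
    show ?case
    proof (cases k)
      case Fresh
      then have "real (prod_list (map (cost L) (k # \<sigma>))) * \<kappa> ^ news (k # \<sigma>)
         = (real (cost L Fresh) * \<kappa>) * (real (prod_list (map (cost L) \<sigma>)) * \<kappa> ^ news \<sigma>)"
        by (simp add: news_def)
      then show ?thesis using Cons Fresh F by (simp add: closes_def)
    next
      case Closing
      then have "real (prod_list (map (cost L) (k # \<sigma>))) * \<kappa> ^ news (k # \<sigma>)
         = (real (cost L Closing) * \<kappa>) * (real (prod_list (map (cost L) \<sigma>)) * \<kappa> ^ news \<sigma>)"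
        by (simp add: news_def)
      then show ?thesis using Cons Closing C by (simp add: closes_def)
    next
      case (Old i b)
      then show ?thesis using Cons by (simp add: cost_def news_def closes_def)
    qed
  qed (simp add: news_def closes_def)
  then show ?thesis unfolding \<kappa>_def \<rho>_def .
qed

lemma news_skeleton: "news (skeleton w) = card (dart_edge ` set w)"
proof -
  have "news (skeleton w) = card {t. t < length w \<and> (step_kind w t = Fresh \<or> step_kind w t = Closing)}"
    unfolding news_def length_filter_conv_card by (rule arg_cong[of _ _ card]) auto
  also have "\<dots> = card {t. t < length w \<and> new_step w t}"
    by (rule arg_cong[of _ _ card]) (auto simp: step_kind_def new_step_iff)
  finally show ?thesis by (simp add: card_edges)
qed

lemma closes_skeleton: "closes (skeleton w) = card {t. t < length w \<and> closing_step w t}"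
  unfolding closes_def length_filter_conv_card
  by (rule arg_cong[of _ _ card]) (auto simp: step_kind_def fresh_step_def closing_step_def split: if_splits)

definition block_chains :: "nat \<Rightarrow> nat \<Rightarrow> dart list set" where
  "block_chains l M = {w. chain l w \<and> set w \<subseteq> X \<times> X \<and> length w = M * l \<and>
     (\<forall>j<M. card (chain_walk.closings (block l w j)) \<le> 1)}"

lemma finite_block_chains [simp]: "finite (block_chains l M)"
proof (rule finite_subset)
  show "block_chains l M \<subseteq> {w. set w \<subseteq> X \<times> X \<and> length w = M * l}" by (auto simp: block_chains_def)
qed (auto intro: finite_lists_length_eq)

text \<open>The chains are grouped by skeleton and the skeletons by their number a of closing steps.
  Each closing step brings at most 9 further conflicts and 4 + 9 M further surprises but a weight of
  order L / n; by the last hypothesis it still contributes at most 1/2, and the sum over a is a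
  geometric series.\<close>

lemma sum_block_chains:
  fixes C :: real
  assumes l: "0 < l" and C: "1 \<le> C" and L: "L = M * l" and Q: "Q = 4 * (real L + 1)\<^sup>2"
    and small: "Q ^ (4 + 9 * M) * C ^ 9 * (real d * (real L + 1)) \<le> n / 2"
  shows "(\<Sum>w\<in>block_chains l M. (1 / ((real d - 1) * n)) ^ card (dart_edge ` set w) * C ^ card (chain_walk.conflicts l w))
    \<le> 2 * n * C ^ (6 * M) * Q ^ (5 * M + 6 * M * M)"
proof -
  define \<kappa> where "\<kappa> = 1 / ((real d - 1) * n)"
  define \<rho> where "\<rho> = real d * (real L + 1) / n"
  let ?Ch = "block_chains l M"
  let ?\<Sigma> = "skeleton ` ?Ch"
  have \<kappa>0: "0 \<le> \<kappa>" using d n_pos by (simp add: \<kappa>_def)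
  have \<rho>0: "0 \<le> \<rho>" using n_pos by (simp add: \<rho>_def)
  have bc: "block_chain l w M" if "w \<in> ?Ch" for w
    using that l by unfold_locales (auto simp: block_chains_def)
  have conf: "card (chain_walk.conflicts l w) \<le> 6 * M + 9 * closes (skeleton w)" if "w \<in> ?Ch" for w
  proof -
    interpret block_chain l w M by (rule bc[OF that])
    show ?thesis using card_conflicts card_breaks by (simp add: closes_skeleton closings_def)
  qed
  have surp: "card (surprises l \<sigma>) \<le> 5 * M + 6 * M * M + (4 + 9 * M) * closes \<sigma>" if "\<sigma> \<in> ?\<Sigma>" for \<sigma>
  proof -
    from that obtain w where w: "w \<in> ?Ch" "\<sigma> = skeleton w" by auto
    interpret block_chain l w M by (rule bc[OF w(1)])
    show ?thesis using card_surprises w by (simp add: closes_skeleton closings_def)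
  qed
  have len: "length \<sigma> = L" "set \<sigma> \<subseteq> kinds L" if "\<sigma> \<in> ?\<Sigma>" for \<sigma>
    using that set_skeleton by (fastforce simp: block_chains_def L)+
  have fin\<Sigma>: "finite ?\<Sigma>" by simp
  have "(\<Sum>w\<in>?Ch. \<kappa> ^ card (dart_edge ` set w) * C ^ card (chain_walk.conflicts l w))
    \<le> (\<Sum>w\<in>?Ch. \<kappa> ^ news (skeleton w) * C ^ (6 * M + 9 * closes (skeleton w)))"
    unfolding news_skeleton
    using conf C \<kappa>0 by (intro sum_mono mult_left_mono power_increasing) auto
  also have "\<dots> = (\<Sum>\<sigma>\<in>?\<Sigma>. \<Sum>w\<in>{w \<in> ?Ch. skeleton w = \<sigma>}. \<kappa> ^ news (skeleton w) * C ^ (6 * M + 9 * closes (skeleton w)))"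
    by (rule sum.image_gen) simp
  also have "\<dots> \<le> (\<Sum>\<sigma>\<in>?\<Sigma>. n * C ^ (6 * M) * (C ^ 9 * \<rho>) ^ closes \<sigma>)"
  proof (rule sum_mono)
    fix \<sigma> assume \<sigma>: "\<sigma> \<in> ?\<Sigma>"
    have "(\<Sum>w\<in>{w \<in> ?Ch. skeleton w = \<sigma>}. \<kappa> ^ news (skeleton w) * C ^ (6 * M + 9 * closes (skeleton w)))
      = real (card {w \<in> ?Ch. skeleton w = \<sigma>}) * (\<kappa> ^ news \<sigma> * C ^ (6 * M + 9 * closes \<sigma>))"
      by simp
    also have "\<dots> \<le> real (N * d * prod_list (map (cost L) \<sigma>)) * (\<kappa> ^ news \<sigma> * C ^ (6 * M + 9 * closes \<sigma>))"
    proof (intro mult_right_mono)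
      have "card {w \<in> ?Ch. skeleton w = \<sigma>} \<le> card (walks l \<sigma>)"
        by (intro card_mono finite_walks) (auto simp: walks_def block_chains_def)
      also have "\<dots> \<le> N * d * prod_list (map (cost L) \<sigma>)" using len[OF \<sigma>] by (intro card_walks) simp
      finally show "real (card {w \<in> ?Ch. skeleton w = \<sigma>}) \<le> real (N * d * prod_list (map (cost L) \<sigma>))"
        by (rule of_nat_mono)
    qed (use \<kappa>0 C in auto)
    also have "C ^ (6 * M + 9 * closes \<sigma>) = C ^ (6 * M) * (C ^ 9) ^ closes \<sigma>" by (simp only: power_add power_mult)
    also have "real (N * d * prod_list (map (cost L) \<sigma>)) * (\<kappa> ^ news \<sigma> * (C ^ (6 * M) * (C ^ 9) ^ closes \<sigma>))
      = n * C ^ (6 * M) * (C ^ 9) ^ closes \<sigma> * (real (prod_list (map (cost L) \<sigma>)) * \<kappa> ^ news \<sigma>)"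
      by (simp add: n_def)
    also have "\<dots> = n * C ^ (6 * M) * (C ^ 9 * \<rho>) ^ closes \<sigma>"
      unfolding \<kappa>_def prod_cost \<rho>_def by (simp only: power_mult_distrib mult_ac)
    finally show "(\<Sum>w\<in>{w \<in> ?Ch. skeleton w = \<sigma>}. \<kappa> ^ news (skeleton w) * C ^ (6 * M + 9 * closes (skeleton w)))
      \<le> n * C ^ (6 * M) * (C ^ 9 * \<rho>) ^ closes \<sigma>" .
  qed
  also have "\<dots> = (\<Sum>a\<in>closes ` ?\<Sigma>. \<Sum>\<sigma>\<in>{\<sigma> \<in> ?\<Sigma>. closes \<sigma> = a}. n * C ^ (6 * M) * (C ^ 9 * \<rho>) ^ closes \<sigma>)"
    by (rule sum.image_gen) simp
  also have "\<dots> \<le> (\<Sum>a\<in>closes ` ?\<Sigma>. n * C ^ (6 * M) * Q ^ (5 * M + 6 * M * M) * (1/2) ^ a)"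
  proof (rule sum_mono)
    fix a
    let ?S = "{\<sigma> \<in> ?\<Sigma>. closes \<sigma> = a}"
    let ?k = "5 * M + 6 * M * M + (4 + 9 * M) * a"
    have "card ?S \<le> (4 * (L + 1)\<^sup>2) ^ ?k"
      using len surp by (intro card_skeletons(2)[where l = l]) auto
    then have "real (card ?S) \<le> real ((4 * (L + 1)\<^sup>2) ^ ?k)" by (rule of_nat_mono)
    then have cS: "real (card ?S) \<le> Q ^ ?k" by (simp add: Q add.commute)
    have "(\<Sum>\<sigma>\<in>?S. n * C ^ (6 * M) * (C ^ 9 * \<rho>) ^ closes \<sigma>) = real (card ?S) * (n * C ^ (6 * M) * (C ^ 9 * \<rho>) ^ a)"
      by simp
    also have "\<dots> \<le> Q ^ ?k * (n * C ^ (6 * M) * (C ^ 9 * \<rho>) ^ a)"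
      using cS C \<rho>0 n_pos by (intro mult_right_mono mult_nonneg_nonneg zero_le_power) auto
    also have "Q ^ ?k = Q ^ (5 * M + 6 * M * M) * (Q ^ (4 + 9 * M)) ^ a"
      by (simp only: power_add[of Q "5 * M + 6 * M * M"] power_mult)
    also have "Q ^ (5 * M + 6 * M * M) * (Q ^ (4 + 9 * M)) ^ a * (n * C ^ (6 * M) * (C ^ 9 * \<rho>) ^ a)
      = n * C ^ (6 * M) * Q ^ (5 * M + 6 * M * M) * (Q ^ (4 + 9 * M) * C ^ 9 * \<rho>) ^ a"
      unfolding power_mult_distrib by (simp only: mult_ac)
    also have "\<dots> \<le> n * C ^ (6 * M) * Q ^ (5 * M + 6 * M * M) * (1/2) ^ a"
    proof (intro mult_left_mono power_mono)
      show "Q ^ (4 + 9 * M) * C ^ 9 * \<rho> \<le> 1 / 2"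
        using small n_pos by (simp add: \<rho>_def field_simps)
    qed (use Q C \<rho>0 n_pos in auto)
    finally show "(\<Sum>\<sigma>\<in>?S. n * C ^ (6 * M) * (C ^ 9 * \<rho>) ^ closes \<sigma>) \<le> n * C ^ (6 * M) * Q ^ (5 * M + 6 * M * M) * (1/2) ^ a" .
  qed
  also have "\<dots> = n * C ^ (6 * M) * Q ^ (5 * M + 6 * M * M) * (\<Sum>a\<in>closes ` ?\<Sigma>. (1/2) ^ a)"
    by (simp add: sum_distrib_left)
  also have "\<dots> \<le> n * C ^ (6 * M) * Q ^ (5 * M + 6 * M * M) * 2"
  proof (rule mult_left_mono)
    have "(\<Sum>a\<in>closes ` ?\<Sigma>. (1/2) ^ a) \<le> (\<Sum>a. (1/2 :: real) ^ a)"
      by (intro sum_le_suminf) auto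
    also have "\<dots> = 2" by (subst suminf_geometric) auto
    finally show "(\<Sum>a\<in>closes ` ?\<Sigma>. (1/2 :: real) ^ a) \<le> 2" .
  qed (use Q C n_pos in auto)
  finally show ?thesis unfolding \<kappa>_def by simp
qed

end

section \<open>Symmetric kernels on finite sets\<close>

definition kapply :: "'a set \<Rightarrow> ('a \<Rightarrow> 'a \<Rightarrow> real) \<Rightarrow> ('a \<Rightarrow> real) \<Rightarrow> 'a \<Rightarrow> real" where
  "kapply X G y h = (\<Sum>g\<in>X. G h g * y g)"

fun kpow :: "'a set \<Rightarrow> ('a \<Rightarrow> 'a \<Rightarrow> real) \<Rightarrow> nat \<Rightarrow> 'a \<Rightarrow> 'a \<Rightarrow> real" where
  "kpow X G 0 h g = (if h = g then 1 else 0)"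
| "kpow X G (Suc k) h g = (\<Sum>j\<in>X. kpow X G k h j * G j g)"

definition sqnorm :: "'a set \<Rightarrow> ('a \<Rightarrow> real) \<Rightarrow> real" where
  "sqnorm X y = (\<Sum>h\<in>X. (y h)\<^sup>2)"

lemma sqnorm_nonneg: "0 \<le> sqnorm X y" by (simp add: sqnorm_def sum_nonneg)

context
  fixes X :: "'a set" and G :: "'a \<Rightarrow> 'a \<Rightarrow> real"
  assumes fin: "finite X"
begin

lemma kpow_1: "h \<in> X \<Longrightarrow> kpow X G (Suc 0) h g = G h g"
  using fin by (simp add: if_distrib[where f = "\<lambda>x. x * _"] cong: if_cong)

lemma kpow_add: "g \<in> X \<Longrightarrow> kpow X G (a + b) h g = (\<Sum>j\<in>X. kpow X G a h j * kpow X G b j g)"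
proof (induction b arbitrary: g)
  case 0
  then show ?case using fin by (simp add: if_distrib cong: if_cong)
next
  case (Suc b)
  have "kpow X G (a + Suc b) h g = (\<Sum>i\<in>X. (\<Sum>j\<in>X. kpow X G a h j * kpow X G b j i) * G i g)"
    using Suc.IH by simp
  also have "\<dots> = (\<Sum>i\<in>X. \<Sum>j\<in>X. kpow X G a h j * (kpow X G b j i * G i g))"
    by (simp add: sum_distrib_right mult.assoc)
  also have "\<dots> = (\<Sum>j\<in>X. \<Sum>i\<in>X. kpow X G a h j * (kpow X G b j i * G i g))" by (rule sum.swap)
  finally show ?case by (simp add: sum_distrib_left)
qed

lemma kapply_funpow: "h \<in> X \<Longrightarrow> (kapply X G ^^ k) y h = kapply X (kpow X G k) y h"
proof (induction k arbitrary: y)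
  case 0
  then show ?case using fin by (simp add: kapply_def if_distrib[where f = "\<lambda>x. x * _"] cong: if_cong)
next
  case (Suc k)
  have "(kapply X G ^^ Suc k) y h = kapply X (kpow X G k) (kapply X G y) h"
    using Suc by (simp only: funpow_Suc_right o_apply)
  also have "\<dots> = (\<Sum>j\<in>X. \<Sum>g\<in>X. kpow X G k h j * G j g * y g)"
    by (simp add: kapply_def sum_distrib_left mult.assoc)
  also have "\<dots> = (\<Sum>g\<in>X. \<Sum>j\<in>X. kpow X G k h j * G j g * y g)" by (rule sum.swap)
  also have "\<dots> = kapply X (kpow X G (Suc k)) y h" by (simp add: kapply_def sum_distrib_right)
  finally show ?case .
qed

lemma sqnorm_kapply_le: "sqnorm X (kapply X G y) \<le> (\<Sum>h\<in>X. \<Sum>g\<in>X. (G h g)\<^sup>2) * sqnorm X y"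
proof -
  have "sqnorm X (kapply X G y) \<le> (\<Sum>h\<in>X. (\<Sum>g\<in>X. (G h g)\<^sup>2) * (\<Sum>g\<in>X. (y g)\<^sup>2))"
    unfolding sqnorm_def kapply_def by (intro sum_mono Cauchy_Schwarz_ineq_sum)
  then show ?thesis by (simp add: sqnorm_def sum_distrib_right)
qed

context
  assumes sym: "\<And>h g. h \<in> X \<Longrightarrow> g \<in> X \<Longrightarrow> G h g = G g h"
begin

lemma kpow_sym: "h \<in> X \<Longrightarrow> g \<in> X \<Longrightarrow> kpow X G k h g = kpow X G k g h"
proof (induction k arbitrary: h g)
  case (Suc k)
  have "kpow X G (Suc k) h g = (\<Sum>j\<in>X. G g j * kpow X G k j h)"
    using Suc sym by (auto simp: mult.commute)
  also have "\<dots> = (\<Sum>j\<in>X. kpow X G (Suc 0) g j * kpow X G k j h)"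
    using Suc kpow_1 by (auto simp del: kpow.simps)
  also have "\<dots> = kpow X G (Suc k) g h" using kpow_add[of h "Suc 0" k g] Suc by (simp del: kpow.simps)
  finally show ?case .
qed auto

lemma kapply_adjoint: "(\<Sum>h\<in>X. kapply X G x h * y h) = (\<Sum>h\<in>X. x h * kapply X G y h)"
proof -
  have "(\<Sum>h\<in>X. kapply X G x h * y h) = (\<Sum>h\<in>X. \<Sum>g\<in>X. G h g * x g * y h)"
    by (simp add: kapply_def sum_distrib_right)
  also have "\<dots> = (\<Sum>g\<in>X. \<Sum>h\<in>X. G h g * x g * y h)" by (rule sum.swap)
  also have "\<dots> = (\<Sum>g\<in>X. \<Sum>h\<in>X. x g * (G g h * y h))"
    using sym by (intro sum.cong) auto
  finally show ?thesis by (simp add: kapply_def sum_distrib_left)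
qed

lemma frobenius_kpow: "(\<Sum>h\<in>X. \<Sum>g\<in>X. (kpow X G k h g)\<^sup>2) = (\<Sum>h\<in>X. kpow X G (2 * k) h h)"
proof (rule sum.cong[OF refl])
  fix h assume h: "h \<in> X"
  have "kpow X G (k + k) h h = (\<Sum>g\<in>X. kpow X G k h g * kpow X G k g h)" by (rule kpow_add[OF h])
  also have "\<dots> = (\<Sum>g\<in>X. (kpow X G k h g)\<^sup>2)"
    using kpow_sym h by (intro sum.cong refl) (simp add: power2_eq_square)
  finally show "(\<Sum>g\<in>X. (kpow X G k h g)\<^sup>2) = kpow X G (2 * k) h h" by (simp add: mult_2)
qed

text \<open>The squared norms of the iterates of a symmetric kernel form a log-convex sequence.\<close>

lemma sqnorm_kapply_power:
  assumes k: "0 < k"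
  shows "sqnorm X (kapply X G y) ^ k \<le> (\<Sum>h\<in>X. kpow X G (2 * k) h h) * sqnorm X y ^ k"
proof -
  define b where "b k = sqnorm X ((kapply X G ^^ k) y)" for k
  have b0: "0 \<le> b k" for k by (simp add: b_def sqnorm_nonneg)
  \<comment> \<open>By symmetry, b (k + 1) is the inner product of the iterates of order k and k +
    2.\<close>
  have conv: "(b (Suc k))\<^sup>2 \<le> b k * b (Suc (Suc k))" for k
  proof -
    let ?u = "(kapply X G ^^ k) y"
    have "b (Suc k) = (\<Sum>h\<in>X. ?u h * kapply X G (kapply X G ?u) h)"
      unfolding b_def sqnorm_def using kapply_adjoint[of ?u "kapply X G ?u"] by (simp add: power2_eq_square)
    then have "(b (Suc k))\<^sup>2 \<le> (\<Sum>h\<in>X. (?u h)\<^sup>2) * (\<Sum>h\<in>X. (kapply X G (kapply X G ?u) h)\<^sup>2)"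
      using Cauchy_Schwarz_ineq_sum by simp
    then show ?thesis by (simp add: b_def sqnorm_def)
  qed
  \<comment> \<open>The quotients b (k + 1) / b k are at least b 1 / b 0; they are written as
    products because some b may vanish.\<close>
  have mono: "b 1 * b k \<le> b 0 * b (Suc k)" for k
  proof (induction k)
    case (Suc k)
    show ?case
    proof (cases "b (Suc k) = 0")
      case False
      then have pos: "b (Suc k) > 0" using b0[of "Suc k"] by simp
      have "b (Suc k) * (b 1 * b (Suc k)) = b 1 * (b (Suc k))\<^sup>2" by (simp add: power2_eq_square)
      also have "\<dots> \<le> b 1 * (b k * b (Suc (Suc k)))" using conv b0 by (intro mult_left_mono) auto
      also have "\<dots> = (b 1 * b k) * b (Suc (Suc k))" by simp
      also have "\<dots> \<le> (b 0 * b (Suc k)) * b (Suc (Suc k))" using Suc b0 by (intro mult_right_mono) auto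
      finally have "b (Suc k) * (b 1 * b (Suc k)) \<le> b (Suc k) * (b 0 * b (Suc (Suc k)))" by (simp add: mult_ac)
      then show ?thesis using pos by simp
    qed (use b0 in simp)
  qed simp
  have pw: "b 1 ^ k * b 0 \<le> b k * b 0 ^ k" for k
  proof (induction k)
    case (Suc k)
    have "b 1 ^ Suc k * b 0 = b 1 * (b 1 ^ k * b 0)" by simp
    also have "\<dots> \<le> b 1 * (b k * b 0 ^ k)" using Suc b0 by (intro mult_left_mono) auto
    also have "\<dots> = (b 1 * b k) * b 0 ^ k" by simp
    also have "\<dots> \<le> (b 0 * b (Suc k)) * b 0 ^ k" using mono b0 by (intro mult_right_mono) auto
    finally show ?case by (simp add: mult_ac)
  qed simp
  have bk: "b k \<le> (\<Sum>h\<in>X. kpow X G (2 * k) h h) * b 0" for k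
  proof -
    have "b k = sqnorm X (kapply X (kpow X G k) y)"
      unfolding b_def sqnorm_def using kapply_funpow by (intro sum.cong) auto
    also have "\<dots> \<le> (\<Sum>h\<in>X. \<Sum>g\<in>X. (kpow X G k h g)\<^sup>2) * sqnorm X y"
    proof -
      have "sqnorm X (kapply X (kpow X G k) y) \<le> (\<Sum>h\<in>X. (\<Sum>g\<in>X. (kpow X G k h g)\<^sup>2) * (\<Sum>g\<in>X. (y g)\<^sup>2))"
        unfolding sqnorm_def kapply_def by (intro sum_mono Cauchy_Schwarz_ineq_sum)
      then show ?thesis by (simp add: sqnorm_def sum_distrib_right)
    qed
    finally show ?thesis unfolding frobenius_kpow by (simp add: b_def)
  qed
  have "b 1 ^ k \<le> (\<Sum>h\<in>X. kpow X G (2 * k) h h) * b 0 ^ k"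
  proof (cases "b 0 = 0")
    case True
    then have "b 1 = 0" using bk[of 1] b0[of 1] by simp
    then show ?thesis using True k by (simp add: zero_power)
  next
    case False
    then have pos: "b 0 > 0" using b0[of 0] by simp
    have "b 1 ^ k * b 0 \<le> ((\<Sum>h\<in>X. kpow X G (2 * k) h h) * b 0) * b 0 ^ k"
      using pw[of k] bk b0 by (meson mult_right_mono order.trans zero_le_power)
    then have "b 0 * b 1 ^ k \<le> b 0 * ((\<Sum>h\<in>X. kpow X G (2 * k) h h) * b 0 ^ k)" by (simp add: mult_ac)
    then show ?thesis using pos by simp
  qed
  then show ?thesis by (simp add: b_def)
qed

end

end

section \<open>The trace of the centred walk kernel\<close>

definition multiplicity_of :: "dart list \<Rightarrow> hedge set \<Rightarrow> nat" where
  "multiplicity_of w f = length (filter (\<lambda>x. dart_edge x = f) w)"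

lemma prod_list_multiplicity:
  assumes "finite F" "dart_edge ` set w \<subseteq> F"
  shows "prod_list (map (\<lambda>x. g (dart_edge x)) w) = (\<Prod>f\<in>F. (g f :: real) ^ multiplicity_of w f)"
  using assms(2)
proof (induction w)
  case (Cons x w)
  have "(\<Prod>f\<in>F. g f ^ multiplicity_of (x # w) f)
    = (\<Prod>f\<in>F. (if f = dart_edge x then g f else 1) * g f ^ multiplicity_of w f)"
    by (intro prod.cong) (auto simp: multiplicity_of_def)
  also have "\<dots> = g (dart_edge x) * (\<Prod>f\<in>F. g f ^ multiplicity_of w f)"
    using assms(1) Cons.prems by (simp add: prod.distrib)
  finally show ?case using Cons by simp
qed (simp add: multiplicity_of_def)

lemma sum_multiplicity:
  assumes "finite F" "dart_edge ` set w \<subseteq> F"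
  shows "(\<Sum>f\<in>F. multiplicity_of w f) = length w"
  using assms(2)
proof (induction w)
  case (Cons x w)
  have "(\<Sum>f\<in>F. multiplicity_of (x # w) f) = (\<Sum>f\<in>F. (if f = dart_edge x then 1 else 0) + multiplicity_of w f)"
    by (intro sum.cong) (auto simp: multiplicity_of_def)
  also have "\<dots> = 1 + (\<Sum>f\<in>F. multiplicity_of w f)"
    using assms(1) Cons.prems by (simp add: sum.distrib)
  finally show ?case using Cons by simp
qed (simp add: multiplicity_of_def)

lemma multiplicity_pos: "f \<in> dart_edge ` set w \<Longrightarrow> 1 \<le> multiplicity_of w f"
  by (auto simp: multiplicity_of_def Suc_le_eq filter_empty_conv)

text \<open>The gain \<eta> is fixed at the value that exactly compensates an edge used once, see
  \<open>expectation_chain\<close>; for large N the finite differences would be smaller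
  still.\<close>

locale trace_model = half_edges N d + centred_model X p c \<eta> K
  for N d :: nat and p c \<eta> K :: real +
  assumes \<eta>_eq: "\<eta> = 1 / sqrt (real d - 1)" and cn: "c \<le> 1 / n" and d3: "3 \<le> d"
begin

definition weight :: "hedge set set \<Rightarrow> dart \<Rightarrow> real" where
  "weight E x = of_bool (dart_edge x \<in> E) - c"

definition walk_weight :: "hedge set set \<Rightarrow> dart list \<Rightarrow> real" where
  "walk_weight E w = prod_list (map (weight E) w)"

abbreviation r where "r \<equiv> sqrt (real d - 1)"

lemma r_ge_1: "1 \<le> r" "r\<^sup>2 = real d - 1" using d3 by auto

text \<open>Every edge is used twice or counts among the single ones, so twice the number e of edges
  is at most the length plus the number of single edges. Each single edge without conflict yields 1
  / r, which turns c^e into r^length / ((d - 1) n)^e; a conflicting edge pays 2 r instead, 2 for the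
  expansion of its power and r for the missing gain.\<close>

lemma expectation_chain:
  assumes w: "chain l w" "set w \<subseteq> X \<times> X" "real (length w) \<le> K"
  shows "\<bar>measure_pmf.expectation (kept_edges X p) (\<lambda>E. walk_weight E w)\<bar>
    \<le> 4 * r ^ length w * ((1 / ((real d - 1) * n)) ^ card (dart_edge ` set w) * (2 * r) ^ card (chain_walk.conflicts l w))"
proof -
  interpret chain_walk l w by unfold_locales (rule w)
  let ?F = "dart_edge ` set w" and ?m = "multiplicity_of w"
  let ?A = "conflicts"
  define e where "e = card ?F"
  define z where "z = card {f \<in> ?F - ?A. ?m f = 1}"
  define e1 where "e1 = card {f \<in> ?F. ?m f = 1}"
  have A: "?A \<subseteq> ?F" by (auto simp: conflicts_def)
  have finA: "finite ?A" using A by (rule finite_subset) simp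
  have X_sub: "\<Union>?F \<subseteq> X" using w(2) by (auto simp: dart_edge_def)
  have eL: "e \<le> length w" unfolding e_def by (rule order.trans[OF card_image_le card_length]) simp
  have e1z: "e1 \<le> z + card ?A"
  proof -
    have "e1 \<le> card ({f \<in> ?F - ?A. ?m f = 1} \<union> ?A)" unfolding e1_def using finA by (intro card_mono) auto
    also have "\<dots> \<le> z + card ?A" unfolding z_def by (rule card_Un_le)
    finally show ?thesis .
  qed
  have "2 * e \<le> (\<Sum>f\<in>?F. ?m f + (if ?m f = 1 then 1 else 0))"
  proof -
    have "(\<Sum>f\<in>?F. 2) \<le> (\<Sum>f\<in>?F. ?m f + (if ?m f = 1 then 1 else 0))"
      using multiplicity_pos by (intro sum_mono) (fastforce)
    then show ?thesis by (simp add: e_def)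
  qed
  also have "\<dots> = length w + e1"
    by (simp add: sum.distrib sum_multiplicity e1_def sum.If_cases Int_def)
  finally have le: "2 * e \<le> length w + z + card ?A" using e1z by linarith
  have "measure_pmf.expectation (kept_edges X p) (\<lambda>E. walk_weight E w)
    = measure_pmf.expectation (kept_edges X p) (\<lambda>E. \<Prod>f\<in>?F. (of_bool (f \<in> E) - c) ^ ?m f)"
    unfolding walk_weight_def weight_def by (subst prod_list_multiplicity[OF finite_imageI[OF finite_set] order.refl]) simp
  also have "\<bar>\<dots>\<bar> \<le> 4 * 2 ^ card ?A * c ^ card ?F * \<eta> ^ card {f \<in> ?F - ?A. ?m f = 1}"
  proof (rule expectation_centred_product)
    show "real (card ?F) \<le> K" using eL w(3) by (simp add: e_def)
    show "\<And>f. f \<in> ?F \<Longrightarrow> 1 \<le> ?m f" by (rule multiplicity_pos)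
    show "\<Union>(?F - ?A) \<subseteq> X" using X_sub by blast
  qed (use A matching_off_conflicts in auto)
  also have "\<dots> = 4 * 2 ^ card ?A * c ^ e * \<eta> ^ z" by (simp add: e_def z_def)
  also have "\<dots> \<le> 4 * 2 ^ card ?A * (1 / n) ^ e * \<eta> ^ z"
    using c01 cn \<eta> by (intro mult_right_mono mult_left_mono power_mono) auto
  also have "\<eta> ^ z \<le> r ^ (length w + card ?A) / r ^ (2 * e)"
  proof -
    have "r ^ (2 * e) \<le> r ^ (length w + card ?A + z)"
      using le r_ge_1 by (intro power_increasing) auto
    then have "r ^ (2 * e) \<le> r ^ (length w + card ?A) * r ^ z" by (simp add: power_add)
    moreover have "0 < r" using r_ge_1 by linarith
    ultimately show ?thesis unfolding \<eta>_eq by (simp add: field_simps)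
  qed
  also have "r ^ (2 * e) = (real d - 1) ^ e" using r_ge_1 by (simp add: power_mult)
  also have "4 * 2 ^ card ?A * (1 / n) ^ e * (r ^ (length w + card ?A) / (real d - 1) ^ e)
    = 4 * r ^ length w * ((1 / ((real d - 1) * n)) ^ e * (2 * r) ^ card ?A)"
    by (simp add: power_add power_mult_distrib power_divide mult_ac)
  finally show ?thesis using n_pos by (simp add: e_def)
qed

definition endpoints :: "nat \<Rightarrow> nat \<Rightarrow> hedge \<Rightarrow> hedge \<Rightarrow> dart list set" where
  "endpoints l M h g = {w \<in> block_chains l M. fst (hd w) = h \<and> snd (last w) = g}"

text \<open>Indexed by half-edges, so that powers of the kernel glue walks at a common half-edge;
  this is the rule of \<open>chain\<close> at multiples of l.\<close>

definition kernel :: "nat \<Rightarrow> hedge set set \<Rightarrow> hedge \<Rightarrow> hedge \<Rightarrow> real" where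
  "kernel l E h g = (\<Sum>w\<in>endpoints l 1 h g. walk_weight E w)"

lemma finite_endpoints [simp]: "finite (endpoints l M h g)" by (simp add: endpoints_def)

lemma block_append_left: "length u = M * l \<Longrightarrow> j < M \<Longrightarrow> block l (u @ v) j = block l u j"
proof -
  assume a: "length u = M * l" "j < M"
  then have "Suc j * l \<le> M * l" by (intro mult_right_mono) auto
  then have "l - (length u - j * l) = 0" using a by simp
  then show ?thesis by (simp add: block_def)
qed

lemma block_append_right: "length u = M * l \<Longrightarrow> length v = l \<Longrightarrow> block l (u @ v) M = block l v 0"
  by (simp add: block_def)

lemma chain_append:
  assumes "chain l u" "chain l v" "length u = M * l" "0 < M" "0 < l" "length v = l" "snd (last u) = fst (hd v)"
  shows "chain l (u @ v)"
  unfolding chain_def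
proof (intro allI impI)
  fix t assume t: "0 < t \<and> t < length (u @ v)"
  consider "t < length u" | "t = length u" | "length u < t" by linarith
  then show "if l dvd t then fst ((u @ v) ! t) = snd ((u @ v) ! (t - 1))
      else src ((u @ v) ! t) = dst ((u @ v) ! (t - 1)) \<and> fst ((u @ v) ! t) \<noteq> snd ((u @ v) ! (t - 1))"
  proof cases
    case 1
    then have "(u @ v) ! t = u ! t" "(u @ v) ! (t - 1) = u ! (t - 1)" by (auto simp: nth_append)
    then show ?thesis using chainD[OF assms(1), of t] t 1 by metis
  next
    case 2
    have ne: "u \<noteq> []" "v \<noteq> []" using assms by auto
    have "(u @ v) ! t = hd v" "(u @ v) ! (t - 1) = last u"
      using ne 2 by (auto simp: nth_append hd_conv_nth last_conv_nth)
    then show ?thesis using 2 assms by simp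
  next
    case 3
    then obtain s where s: "t = length u + s" "0 < s" by (metis less_imp_add_positive)
    then have "(u @ v) ! t = v ! s" "(u @ v) ! (t - 1) = v ! (s - 1)" by (auto simp: nth_append)
    moreover have "l dvd t \<longleftrightarrow> l dvd s" using s assms(3) by simp
    moreover have "s < length v" using s t by simp
    ultimately show ?thesis using chainD[OF assms(2), of s] s by metis
  qed
qed

lemma chain_append_split:
  assumes "chain l (u @ v)" "length u = M * l" "0 < M" "0 < l" "length v = l"
  shows "chain l u" "chain l v" "snd (last u) = fst (hd v)"
proof -
  show "chain l u"
    unfolding chain_def
  proof (intro allI impI)
    fix t assume t: "0 < t \<and> t < length u"
    then have "t < length (u @ v)" "(u @ v) ! t = u ! t" "(u @ v) ! (t - 1) = u ! (t - 1)"
      by (auto simp: nth_append)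
    then show "if l dvd t then fst (u ! t) = snd (u ! (t - 1)) else src (u ! t) = dst (u ! (t - 1)) \<and> fst (u ! t) \<noteq> snd (u ! (t - 1))"
      using chainD[OF assms(1), of t] t by metis
  qed
  show "chain l v"
    unfolding chain_def
  proof (intro allI impI)
    fix s assume s: "0 < s \<and> s < length v"
    then have "(u @ v) ! (length u + s) = v ! s" "(u @ v) ! (length u + s - 1) = v ! (s - 1)" by (auto simp: nth_append)
    moreover have "l dvd length u + s \<longleftrightarrow> l dvd s" using assms(2) by simp
    moreover have "0 < length u + s" "length u + s < length (u @ v)" using s by auto
    ultimately show "if l dvd s then fst (v ! s) = snd (v ! (s - 1)) else src (v ! s) = dst (v ! (s - 1)) \<and> fst (v ! s) \<noteq> snd (v ! (s - 1))"
      using chainD[OF assms(1), of "length u + s"] by metis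
  qed
  have ne: "u \<noteq> []" "v \<noteq> []" using assms by auto
  have "(u @ v) ! length u = hd v" "(u @ v) ! (length u - 1) = last u"
    using ne by (auto simp: nth_append hd_conv_nth last_conv_nth)
  then show "snd (last u) = fst (hd v)" using chainD[OF assms(1), of "length u"] assms by simp
qed

lemma endpoints_Suc:
  assumes l: "0 < l" and M: "0 < M"
  shows "(\<Sum>w\<in>endpoints l (Suc M) h g. walk_weight E w)
    = (\<Sum>j\<in>X. (\<Sum>u\<in>endpoints l M h j. walk_weight E u) * (\<Sum>v\<in>endpoints l 1 j g. walk_weight E v))"
proof -
  let ?S = "SIGMA j:X. endpoints l M h j \<times> endpoints l 1 j g"
  have "(\<Sum>j\<in>X. (\<Sum>u\<in>endpoints l M h j. walk_weight E u) * (\<Sum>v\<in>endpoints l 1 j g. walk_weight E v))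
    = (\<Sum>j\<in>X. \<Sum>(u, v)\<in>endpoints l M h j \<times> endpoints l 1 j g. walk_weight E u * walk_weight E v)"
    by (simp add: sum_product sum.cartesian_product)
  also have "\<dots> = (\<Sum>(j, u, v)\<in>?S. walk_weight E u * walk_weight E v)"
    by (subst sum.Sigma) auto
  also have "\<dots> = (\<Sum>w\<in>endpoints l (Suc M) h g. walk_weight E w)"
  proof (rule sum.reindex_bij_witness[where
      j = "\<lambda>(j, u, v). u @ v" and i = "\<lambda>w. (snd (w ! (M * l - 1)), take (M * l) w, drop (M * l) w)"])
    fix a assume a: "a \<in> ?S"
    obtain j u v where juv: "a = (j, u, v)" by (cases a)
    have u: "chain l u" "set u \<subseteq> X \<times> X" "length u = M * l" "fst (hd u) = h" "snd (last u) = j"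
       "\<And>i. i < M \<Longrightarrow> card (chain_walk.closings (block l u i)) \<le> 1"
      using a juv by (auto simp: endpoints_def block_chains_def)
    have v: "chain l v" "set v \<subseteq> X \<times> X" "length v = l" "fst (hd v) = j" "snd (last v) = g"
       "card (chain_walk.closings (block l v 0)) \<le> 1"
      using a juv by (auto simp: endpoints_def block_chains_def)
    have ne: "u \<noteq> []" "v \<noteq> []" using u v l M by auto
    have "M * l - 1 < M * l" using l M by simp
    then have "(u @ v) ! (M * l - 1) = last u" using u(3) ne by (simp add: nth_append last_conv_nth)
    then show "(\<lambda>w. (snd (w ! (M * l - 1)), take (M * l) w, drop (M * l) w)) ((\<lambda>(j, u, v). u @ v) a) = a"
      using juv u by simp
    have "card (chain_walk.closings (block l (u @ v) i)) \<le> 1" if "i < Suc M" for i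
      using that u(3,6) v(3,6) block_append_left[of u M l i v] block_append_right[of u M l v]
      by (cases "i = M") auto
    moreover have "chain l (u @ v)" using u v l M by (intro chain_append[where M = M]) auto
    ultimately show "(\<lambda>(j, u, v). u @ v) a \<in> endpoints l (Suc M) h g"
      using u v ne by (auto simp: juv endpoints_def block_chains_def)
    show "walk_weight E ((\<lambda>(j, u, v). u @ v) a) = (case a of (j, u, v) \<Rightarrow> walk_weight E u * walk_weight E v)"
      by (simp add: juv walk_weight_def)
  next
    fix w assume w: "w \<in> endpoints l (Suc M) h g"
    let ?u = "take (M * l) w" and ?v = "drop (M * l) w"
    have w': "chain l (?u @ ?v)" "set w \<subseteq> X \<times> X" "length w = l + M * l" "fst (hd w) = h" "snd (last w) = g"
       "\<And>i. i < Suc M \<Longrightarrow> card (chain_walk.closings (block l (?u @ ?v) i)) \<le> 1"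
      using w by (auto simp: endpoints_def block_chains_def)
    have len: "length ?u = M * l" "length ?v = l" using w' by auto
    have ne: "?u \<noteq> []" "?v \<noteq> []" "w \<noteq> []" using len l M by fastforce+
    note sp = chain_append_split[OF w'(1) len(1) M l len(2)]
    have lastu: "last ?u = w ! (M * l - 1)" using ne by (simp add: last_conv_nth)
    have "last ?u \<in> X \<times> X" using w'(2) last_in_set[OF ne(1)] set_take_subset[of "M * l" w] by blast
    then have jX: "snd (w ! (M * l - 1)) \<in> X" unfolding lastu by auto
    have cu: "card (chain_walk.closings (block l ?u i)) \<le> 1" if "i < M" for i
      using w'(6)[of i] that block_append_left[OF len(1), of i ?v] by simp
    have cv: "card (chain_walk.closings (block l ?v 0)) \<le> 1"
      using w'(6)[of M] block_append_right[OF len] by simp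
    have su: "set ?u \<subseteq> X \<times> X" "set ?v \<subseteq> X \<times> X" using w'(2) set_take_subset[of "M * l" w] set_drop_subset[of "M * l" w] by blast+
    have "fst (hd ?u) = h" using w'(4) l M by simp
    moreover have "snd (last ?v) = g" using w'(5) ne by simp
    ultimately show "(snd (w ! (M * l - 1)), ?u, ?v) \<in> ?S"
      using jX sp len su cu cv lastu by (auto simp: endpoints_def block_chains_def)
    show "(\<lambda>(j, u, v). u @ v) (snd (w ! (M * l - 1)), ?u, ?v) = w" by simp
  qed
  finally show ?thesis by simp
qed

lemma kpow_kernel:
  assumes l: "0 < l" and h: "h \<in> X"
  shows "kpow X (kernel l E) (Suc M) h g = (\<Sum>w\<in>endpoints l (Suc M) h g. walk_weight E w)"
proof (induction M arbitrary: g)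
  case 0
  then show ?case using kpow_1[OF finite_X h] by (simp add: kernel_def del: kpow.simps)
next
  case (Suc M)
  have "kpow X (kernel l E) (Suc (Suc M)) h g = (\<Sum>j\<in>X. kpow X (kernel l E) (Suc M) h j * kernel l E j g)"
    by (rule kpow.simps)
  also have "\<dots> = (\<Sum>w\<in>endpoints l (Suc (Suc M)) h g. walk_weight E w)"
    unfolding Suc kernel_def by (rule endpoints_Suc[OF l, symmetric]) simp
  finally show ?case .
qed

lemma expectation_trace:
  assumes l: "0 < l" and M: "0 < M" and L: "L = M * l" "real L \<le> K" and Q: "Q = 4 * (real L + 1)\<^sup>2"
    and small: "Q ^ (4 + 9 * M) * (2 * r) ^ 9 * (real d * (real L + 1)) \<le> n / 2"
  shows "measure_pmf.expectation (kept_edges X p) (\<lambda>E. \<Sum>h\<in>X. kpow X (kernel l E) M h h)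
    \<le> 8 * r ^ L * n * (2 * r) ^ (6 * M) * Q ^ (5 * M + 6 * M * M)"
proof -
  obtain M' where M': "M = Suc M'" using M by (cases M) auto
  let ?E = "measure_pmf.expectation (kept_edges X p)"
  let ?W = "\<lambda>w. 4 * r ^ L * ((1 / ((real d - 1) * n)) ^ card (dart_edge ` set w) * (2 * r) ^ card (chain_walk.conflicts l w))"
  have "?E (\<lambda>E. \<Sum>h\<in>X. kpow X (kernel l E) M h h) = ?E (\<lambda>E. \<Sum>h\<in>X. \<Sum>w\<in>endpoints l M h h. walk_weight E w)"
    unfolding M' using kpow_kernel[OF l] by (intro Bochner_Integration.integral_cong sum.cong) auto
  also have "\<dots> = (\<Sum>h\<in>X. \<Sum>w\<in>endpoints l M h h. ?E (\<lambda>E. walk_weight E w))"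
    by simp
  also have "\<dots> \<le> (\<Sum>h\<in>X. \<Sum>w\<in>endpoints l M h h. ?W w)"
  proof (intro sum_mono)
    fix h w assume "w \<in> endpoints l M h h"
    then have w: "chain l w" "set w \<subseteq> X \<times> X" "length w = L" using L by (auto simp: endpoints_def block_chains_def)
    have "\<bar>?E (\<lambda>E. walk_weight E w)\<bar> \<le> ?W w" using expectation_chain[OF w(1,2)] w(3) L by simp
    then show "?E (\<lambda>E. walk_weight E w) \<le> ?W w" by linarith
  qed
  also have "\<dots> = (\<Sum>w\<in>(\<Union>h\<in>X. endpoints l M h h). ?W w)"
    by (rule sum.UNION_disjoint[symmetric]) (auto simp: endpoints_def)
  \<comment> \<open>The closed chains are enlarged to all block chains. The remaining factor n does
    no harm, since the power of the kernel is high.\<close>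
  also have "\<dots> \<le> (\<Sum>w\<in>block_chains l M. ?W w)"
  proof (rule sum_mono2)
    show "0 \<le> ?W w" for w using n_pos d3 by simp
  qed (auto simp: endpoints_def)
  also have "\<dots> = 4 * r ^ L * (\<Sum>w\<in>block_chains l M. (1 / ((real d - 1) * n)) ^ card (dart_edge ` set w) * (2 * r) ^ card (chain_walk.conflicts l w))"
    by (simp only: sum_distrib_left)
  also have "\<dots> \<le> 4 * r ^ L * (2 * n * (2 * r) ^ (6 * M) * Q ^ (5 * M + 6 * M * M))"
  proof (intro mult_left_mono sum_block_chains)
    show "1 \<le> 2 * r" using r_ge_1 by linarith
  qed (use l L Q small r_ge_1 in auto)
  finally show ?thesis by simp
qed

end

section \<open>Tangled walks\<close>

definition reverse_walk :: "dart list \<Rightarrow> dart list" where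
  "reverse_walk w = map prod.swap (rev w)"

lemma length_reverse_walk [simp]: "length (reverse_walk w) = length w" by (simp add: reverse_walk_def)

lemma reverse_walk_idem [simp]: "reverse_walk (reverse_walk w) = w"
  by (simp add: reverse_walk_def rev_map)

text \<open>Up to length l there is no block boundary inside a walk, so \<open>chain l\<close>
  simply means nonbacktracking, which is symmetric under reversal.\<close>

lemma chain_reverse_walk:
  assumes "chain l w" "length w \<le> l"
  shows "chain l (reverse_walk w)"
  unfolding chain_def
proof (intro allI impI)
  fix t assume t: "0 < t \<and> t < length (reverse_walk w)"
  let ?s = "length w - t"
  have s: "0 < ?s" "?s < length w" using t by auto
  have nd: "\<not> l dvd t" "\<not> l dvd ?s" using s assms(2) by (auto dest: dvd_imp_le)
  have "reverse_walk w ! t = prod.swap (w ! (?s - 1))" "reverse_walk w ! (t - 1) = prod.swap (w ! ?s)"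
    using t by (auto simp: reverse_walk_def rev_nth)
  then show "if l dvd t then fst (reverse_walk w ! t) = snd (reverse_walk w ! (t - 1))
         else src (reverse_walk w ! t) = dst (reverse_walk w ! (t - 1)) \<and> fst (reverse_walk w ! t) \<noteq> snd (reverse_walk w ! (t - 1))"
    using chainD[OF assms(1) s] nd by auto
qed

lemma (in chain_walk) visited_all:
  assumes "w \<noteq> []"
  shows "visited w (length w) = src ` set w \<union> dst ` set w"
proof (intro equalityI subsetI)
  fix v assume "v \<in> visited w (length w)"
  then show "v \<in> src ` set w \<union> dst ` set w"
    using assms by (auto simp: visited_def)
next
  fix v assume "v \<in> src ` set w \<union> dst ` set w"
  then obtain x where "x \<in> set w" "v = src x \<or> v = dst x" by auto
  then obtain i where "i < length w" "v = src (w ! i) \<or> v = dst (w ! i)" by (metis in_set_conv_nth)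
  then show "v \<in> visited w (length w)"
    using src_visited'[of i "length w"] dst_visited[of i "length w"] by auto
qed

text \<open>A fresh step discovers one edge and one vertex, a closing step one edge only, and the
  start accounts for the 1.\<close>

lemma (in chain_walk) card_closings_euler:
  assumes "w \<noteq> []"
  shows "card closings + card (src ` set w \<union> dst ` set w) = card (dart_edge ` set w) + 1"
proof -
  let ?F = "{t. t < length w \<and> fresh_step w t}"
  have "{t. t < length w \<and> new_step w t} = ?F \<union> closings" by (auto simp: new_step_iff closings_def)
  moreover have "?F \<inter> closings = {}" by (auto simp: closings_def fresh_step_def closing_step_def)
  ultimately have "card (dart_edge ` set w) = card ?F + card closings"
    by (simp add: card_edges card_Un_disjoint)
  moreover have "{i. i < length w \<and> dst (w ! i) \<notin> visited w i} = ?F" using fresh_iff by auto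
  then have "card (visited w (length w)) = Suc (card ?F)" using card_visited[of w "length w"] by simp
  ultimately show ?thesis using visited_all[OF assms] by simp
qed

text \<open>By the Euler relation the number depends only on the visited subgraph. This makes the
  restricted kernel symmetric.\<close>

lemma closings_reverse_walk:
  assumes "chain l w" "length w \<le> l"
  shows "card (chain_walk.closings (reverse_walk w)) = card (chain_walk.closings w)"
proof (cases "w = []")
  case False
  interpret a: chain_walk l w by unfold_locales (rule assms)
  interpret b: chain_walk l "reverse_walk w" by unfold_locales (rule chain_reverse_walk[OF assms])
  have ne: "reverse_walk w \<noteq> []" using False by (simp add: reverse_walk_def)
  have "src ` set (reverse_walk w) = dst ` set w" "dst ` set (reverse_walk w) = src ` set w"
    "dart_edge ` set (reverse_walk w) = dart_edge ` set w"
    by (auto simp: reverse_walk_def image_image)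
  then show ?thesis using a.card_closings_euler[OF False] b.card_closings_euler[OF ne] by (simp add: Un_commute)
qed (simp add: reverse_walk_def)

lemma closing_step_cong: "(\<And>i. i \<le> t \<Longrightarrow> w ! i = w' ! i) \<Longrightarrow> closing_step w t = closing_step w' t"
  by (auto simp: closing_step_def new_step_def visited_def)

lemma chain_take: "chain l w \<Longrightarrow> chain l (take k w)"
  by (auto simp: chain_def)

lemma chain_drop_short:
  assumes "chain l w" "length w \<le> l"
  shows "chain l (drop k w)"
  unfolding chain_def
proof (intro allI impI)
  fix t assume t: "0 < t \<and> t < length (drop k w)"
  then have *: "0 < k + t" "k + t < length w" by auto
  have "drop k w ! t = w ! (k + t)" using * by simp
  moreover have "drop k w ! (t - 1) = w ! (k + t - 1)" using * t by simp
  moreover  have "\<not> l dvd k + t" "\<not> l dvd t" using t assms(2) by (auto dest!: dvd_imp_le)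
  ultimately show "if l dvd t then fst (drop k w ! t) = snd (drop k w ! (t - 1))
         else src (drop k w ! t) = dst (drop k w ! (t - 1)) \<and> fst (drop k w ! t) \<noteq> snd (drop k w ! (t - 1))"
    using chainD[OF assms(1) *] by metis
qed

lemma chain_snocI:
  assumes "chain l u" "u \<noteq> []" "\<not> l dvd length u" "src x = dst (last u)" "fst x \<noteq> snd (last u)"
  shows "chain l (u @ [x])"
  unfolding chain_def
proof (intro allI impI)
  fix t assume t: "0 < t \<and> t < length (u @ [x])"
  show "if l dvd t then fst ((u @ [x]) ! t) = snd ((u @ [x]) ! (t - 1))
         else src ((u @ [x]) ! t) = dst ((u @ [x]) ! (t - 1)) \<and> fst ((u @ [x]) ! t) \<noteq> snd ((u @ [x]) ! (t - 1))"
  proof (cases "t = length u")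
    case True
    then show ?thesis using assms by (simp add: nth_append last_conv_nth)
  next
    case False
    then have "0 < t" "t < length u" "(u @ [x]) ! t = u ! t" "(u @ [x]) ! (t - 1) = u ! (t - 1)"
      using t by (auto simp: nth_append)
    then show ?thesis using chainD[OF assms(1), of t] by metis
  qed
qed

section \<open>Vertices near short cycles and near the visited part\<close>

context half_edges
begin

definition real_walks :: "nat \<Rightarrow> hedge set set \<Rightarrow> dart list set" where
  "real_walks l E = {w. chain l w \<and> w \<noteq> [] \<and> length w \<le> l \<and> set w \<subseteq> X \<times> X \<and> dart_edge ` set w \<subseteq> E}"

text \<open>The starting points of walks inside E whose last vertex occurred before;
  \<open>length w - 1\<close> excludes the last arrival itself.\<close>

definition near_cycle :: "nat \<Rightarrow> hedge set set \<Rightarrow> nat set" where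
  "near_cycle l E = {v. \<exists>w\<in>real_walks l E. src (hd w) = v \<and> dst (last w) \<in> visited w (length w - 1)}"

definition reach :: "nat \<Rightarrow> hedge set set \<Rightarrow> nat set \<Rightarrow> nat set" where
  "reach l E U = U \<union> {v. \<exists>w\<in>real_walks l E. src (hd w) = v \<and> dst (last w) \<in> U}"

fun backward :: "hedge set set \<Rightarrow> nat set \<Rightarrow> nat \<Rightarrow> nat set" where
  "backward E U 0 = U"
| "backward E U (Suc k) = {v. \<exists>h g. {h, g} \<in> E \<and> g \<in> X \<and> fst h = v \<and> fst g \<in> backward E U k}"

text \<open>A vertex has d half-edges, and each has at most one partner in a matching.\<close>

lemma card_backward:
  assumes E: "is_matching E" and U: "finite U"
  shows "finite (backward E U k) \<and> card (backward E U k) \<le> card U * d ^ k"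
proof (induction k)
  case (Suc k)
  let ?B = "backward E U k"
  have "backward E U (Suc k) \<subseteq> (\<lambda>g. fst (SOME h. {h, g} \<in> E)) ` (?B \<times> {..<d})"
  proof
    fix v assume "v \<in> backward E U (Suc k)"
    then obtain h g where hg: "{h, g} \<in> E" "g \<in> X" "fst h = v" "fst g \<in> ?B" by auto
    define h' where "h' = (SOME h. {h, g} \<in> E)"
    have h': "{h', g} \<in> E" unfolding h'_def by (rule someI[of _ h]) (rule hg)
    have "{h', g} = {h, g}"
    using E h' hg(1) disjointD by (auto simp: is_matching_def)
    then have "h' = h" using E by (auto simp: doubleton_eq_iff)
    then have "v = fst (SOME h. {h, g} \<in> E)" using hg by (simp add: h'_def)
    moreover have "g \<in> ?B \<times> {..<d}" using hg by (auto simp: X_def)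
    ultimately show "v \<in> (\<lambda>g. fst (SOME h. {h, g} \<in> E)) ` (?B \<times> {..<d})" by blast
  qed
  moreover have fin: "finite (?B \<times> {..<d})" using Suc by simp
  ultimately have "finite (backward E U (Suc k))" "card (backward E U (Suc k)) \<le> card (?B \<times> {..<d})"
    by (meson finite_surj, meson surj_card_le)
  moreover have "card (?B \<times> {..<d}) \<le> card U * d ^ Suc k"
    using Suc by simp
  ultimately show ?case by linarith
qed (use U in simp)

lemma reach_backward: "reach l E U \<subseteq> (\<Union>k\<le>l. backward E U k)"
proof -
  have *: "dst (last w) \<in> U \<longrightarrow> src (hd w) \<in> backward E U (length w)"
    if "w \<noteq> []" "chain l w" "length w \<le> l" "set w \<subseteq> X \<times> X" "dart_edge ` set w \<subseteq> E" for w
    using that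
  proof (induction w)
    case (Cons x w)
    have x: "{fst x, snd x} \<in> E" "snd x \<in> X" using Cons.prems by (auto simp: dart_edge_def)
    have bw: "src x \<in> backward E U (Suc k)" if "dst x \<in> backward E U k" for k
      using x that unfolding backward.simps src_def dst_def by blast
    show ?case
    proof (cases "w = []")
      case True
      then show ?thesis using bw[of 0] by simp
    next
      case False
      have "chain l (drop 1 (x # w))" using Cons.prems by (intro chain_drop_short) auto
      then have IH: "dst (last w) \<in> U \<longrightarrow> src (hd w) \<in> backward E U (length w)"
        using Cons False by auto
      have "\<not> l dvd 1" using Cons.prems False by (cases w) auto
      then have "src (hd w) = dst x"
        using chainD[OF Cons.prems(2), of 1] False by (auto simp: hd_conv_nth)
      then show ?thesis using IH bw[of "length w"] False by simp
    qed
  qed simp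
  show ?thesis
  proof
    fix v assume "v \<in> reach l E U"
    then consider "v \<in> U" | w where "w \<in> real_walks l E" "src (hd w) = v" "dst (last w) \<in> U"
      by (auto simp: reach_def)
    then show "v \<in> (\<Union>k\<le>l. backward E U k)"
    proof cases
      case 1
      then have "v \<in> backward E U 0" by simp
      then show ?thesis by blast
    next
      case (2 w)
      then have "v \<in> backward E U (length w)" "length w \<le> l" using *[of w] by (auto simp: real_walks_def)
      then show ?thesis by blast
    qed
  qed
qed

lemma card_reach:
  assumes E: "is_matching E" and U: "finite U"
  shows "finite (reach l E U)" "card (reach l E U) \<le> card U * ((l + 1) * d ^ l)"
proof -
  note B = card_backward[OF E U]
  have fin: "finite (\<Union>k\<le>l. backward E U k)" using B by auto
  then show "finite (reach l E U)" by (rule finite_subset[OF reach_backward])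
  have "card (reach l E U) \<le> card (\<Union>k\<le>l. backward E U k)" by (rule card_mono[OF fin reach_backward])
  also have "\<dots> \<le> (\<Sum>k\<le>l. card (backward E U k))" by (rule card_UN_le) simp
  also have "\<dots> \<le> (\<Sum>k\<le>l. card U * d ^ l)"
  proof (rule sum_mono)
    fix k assume "k \<in> {..l}"
    then have "d ^ k \<le> d ^ l" using d by (intro power_increasing) auto
    then have "card U * d ^ k \<le> card U * d ^ l" by (rule mult_left_mono) simp
    then show "card (backward E U k) \<le> card U * d ^ l" using B[of k] by linarith
  qed
  finally show "card (reach l E U) \<le> card U * ((l + 1) * d ^ l)" by (simp add: mult_ac)
qed

definition danger :: "nat \<Rightarrow> hedge set set \<Rightarrow> dart list \<Rightarrow> nat set" where
  "danger l E w = near_cycle l E \<union> reach l E (visited w (length w))"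

text \<open>A pair outside E has weight only -c. If in addition it must land in a small set, it
  costs c times the size of that set instead of c n, which is what makes these walks
  negligible.\<close>

definition hits :: "nat \<Rightarrow> hedge set set \<Rightarrow> dart list \<Rightarrow> bool" where
  "hits l E w \<longleftrightarrow> (\<exists>j<length w. dart_edge (w ! j) \<notin> E \<and> dst (w ! j) \<in> near_cycle l E \<union> reach l E (visited w j))"

text \<open>If every step outside \<open>E\<close> lands far from short cycles and from the part already visited, then
  all the closing steps belong to the first stretch inside \<open>E\<close>.\<close>

lemma tangled_hits:
  assumes tf: "\<And>w. w \<in> real_walks l E \<Longrightarrow> card (chain_walk.closings w) \<le> 1"
    and w: "chain l w" "length w \<le> l" "set w \<subseteq> X \<times> X" and bad: "\<not> card (chain_walk.closings w) \<le> 1"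
  shows "hits l E w"
proof -
  interpret chain_walk l w by unfold_locales (rule w)
  have ne: "closings \<noteq> {}" using bad by auto
  \<comment> \<open>The last closing step: all cycles are complete at time x.\<close>
  define x where "x = Max closings"
  have x: "x \<in> closings" unfolding x_def using ne by simp
  have x_max: "t \<le> x" if "t \<in> closings" for t unfolding x_def using that by simp
  have xl: "x < length w" and xc: "dst (w ! x) \<in> visited w x" using x by (auto simp: closings_def closing_step_def)
  define J where "J = {j. j \<le> x \<and> dart_edge (w ! j) \<notin> E}"
  have "J \<noteq> {}"
  proof
    assume J: "J = {}"
    let ?u = "take (Suc x) w"
    have nth: "?u ! i = w ! i" if "i \<le> x" for i using that by simp
    have "dart_edge ` set ?u \<subseteq> E"
    proof
      fix f assume "f \<in> dart_edge ` set ?u"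
      then obtain i where "i < length ?u" "f = dart_edge (?u ! i)" by (auto simp: in_set_conv_nth)
      then have "i \<le> x" "f = dart_edge (w ! i)" by auto
      then show "f \<in> E" using J by (auto simp: J_def)
    qed
    then have "?u \<in> real_walks l E"
      using w xl chain_take[OF w(1)] set_take_subset[of "Suc x" w] by (auto simp: real_walks_def)
    then have "card (chain_walk.closings ?u) \<le> 1" by (rule tf)
    moreover have "chain_walk.closings ?u = closings"
    proof -
      interpret u: chain_walk l ?u by unfold_locales (rule chain_take[OF w(1)])
      have "t < length ?u \<and> closing_step ?u t \<longleftrightarrow> t < length w \<and> closing_step w t" for t
      proof (cases "t \<le> x")
        case True
        then have "closing_step ?u t = closing_step w t" by (intro closing_step_cong) simp
        then show ?thesis using True by auto
      next
        case False
        then show ?thesis using x_max[of t] by (auto simp: closings_def)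
      qed
      then show ?thesis by (auto simp: u.closings_def closings_def)
    qed
    ultimately show False using bad by simp
  qed
  have finJ: "finite J" by (simp add: J_def)
  \<comment> \<open>The last step outside E up to time x; from there to x the walk runs inside
    E.\<close>
  define j where "j = Max J"
  have j: "j \<le> x" "dart_edge (w ! j) \<notin> E" using Max_in[OF finJ \<open>J \<noteq> {}\<close>] by (auto simp: j_def J_def)
  have real: "dart_edge (w ! i) \<in> E" if "j < i" "i \<le> x" for i
  proof (rule ccontr)
    assume "dart_edge (w ! i) \<notin> E"
    then have "i \<in> J" using that by (simp add: J_def)
    then have "i \<le> j" using Max_ge[OF finJ] by (simp add: j_def)
    then show False using that by simp
  qed
  have "dst (w ! j) \<in> near_cycle l E \<union> reach l E (visited w j)"
  proof (cases "j = x")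
    case True
    then show ?thesis using xc by (auto simp: reach_def)
  next
    case False
    then have jx: "j < x" using j by simp
    define u where "u = drop (Suc j) (take (Suc x) w)"
    have lu: "length u = x - j" using xl by (simp add: u_def)
    have nth_u: "u ! i = w ! (Suc j + i)" if "i < x - j" for i using that xl by (simp add: u_def)
    have une: "u \<noteq> []" using lu jx by auto
    have lastu: "last u = w ! x" using une lu jx nth_u[of "x - j - 1"] by (simp add: last_conv_nth)
    have hdu: "hd u = w ! Suc j" using une jx nth_u[of 0] by (simp add: hd_conv_nth)
    have srcu: "src (hd u) = dst (w ! j)" using src_dst[of "Suc j"] hdu jx xl by simp
    have "chain l (take (Suc x) w)" by (rule chain_take[OF w(1)])
    then have "chain l u" unfolding u_def using w(2) by (intro chain_drop_short) auto
    moreover have "dart_edge ` set u \<subseteq> E"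
    proof
      fix f assume "f \<in> dart_edge ` set u"
      then obtain i where "i < x - j" "f = dart_edge (u ! i)" by (auto simp: in_set_conv_nth lu)
      then show "f \<in> E" using nth_u[of i] real[of "Suc j + i"] by simp
    qed
    moreover have "set u \<subseteq> X \<times> X" using w(3) unfolding u_def by (meson in_set_dropD in_set_takeD subset_iff)
    ultimately have ru: "u \<in> real_walks l E" using une lu w(2) xl by (auto simp: real_walks_def)
    \<comment> \<open>The step at x returns to what was visited before step j, so that j landed in
      \<open>reach\<close>, or to the stretch inside E that begins with the landing of j, so that j
      landed in \<open>near_cycle\<close>.\<close>
    show ?thesis
    proof (cases "dst (w ! x) \<in> visited w j")
      case True
      then have "dst (w ! j) \<in> reach l E (visited w j)"
        unfolding reach_def using ru srcu lastu by auto
      then show ?thesis by simp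
    next
      case False
      then obtain i where i: "j \<le> i" "i < x" "dst (w ! x) = dst (w ! i)"
      proof -
        have "dst (w ! x) \<in> insert (src (w ! 0)) ((\<lambda>i. dst (w ! i)) ` {..<x})"
          using xc by (simp add: visited_def)
        moreover have "dst (w ! x) \<noteq> src (w ! 0)" using False by (auto simp: visited_def)
        ultimately obtain i where i: "i < x" "dst (w ! x) = dst (w ! i)" by auto
        have "j \<le> i" using False i by (auto simp: visited_def)
        then show thesis using that i by blast
      qed
      have "dst (w ! i) \<in> visited u (length u - 1)"
      proof (cases "i = j")
        case True
        then have "dst (w ! i) = src (u ! 0)" using srcu une by (simp add: hd_conv_nth)
        then show ?thesis by (simp add: visited_def)
      next
        case False
        then have "w ! i = u ! (i - Suc j)" using i nth_u[of "i - Suc j"] by simp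
        moreover have "i - Suc j < length u - 1" using i False lu by simp
        ultimately show ?thesis by (auto simp: visited_def)
      qed
      then have "dst (w ! j) \<in> near_cycle l E"
        unfolding near_cycle_def using ru srcu lastu i by auto
      then show ?thesis by simp
    qed
  qed
  then show ?thesis using j xl unfolding hits_def by (auto intro!: exI[of _ j])
qed

section \<open>Iterating the nonbacktracking eigenvalue equation\<close>

definition siblings :: "hedge \<Rightarrow> hedge set" where
  "siblings g = {h \<in> X. fst h = fst g \<and> h \<noteq> g}"

definition nb_walks :: "nat \<Rightarrow> nat \<Rightarrow> hedge \<Rightarrow> dart list set" where
  "nb_walks l k h = {w. chain l w \<and> length w = k \<and> set w \<subseteq> X \<times> X \<and> w \<noteq> [] \<and> fst (hd w) = h}"

lemma finite_siblings [simp]: "finite (siblings g)" by (simp add: siblings_def)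

lemma card_siblings_le: "card (siblings g) \<le> d"
proof -
  have "card (siblings g) \<le> card (Pair (fst g) ` {..<d})"
    by (intro card_mono) (auto simp: siblings_def X_def)
  also have "\<dots> = d" by (simp add: card_image inj_on_def)
  finally show ?thesis .
qed

lemma finite_nb_walks [simp]: "finite (nb_walks l k h)"
proof (rule finite_subset)
  show "nb_walks l k h \<subseteq> {w. set w \<subseteq> X \<times> X \<and> length w = k}" by (auto simp: nb_walks_def)
qed (auto intro: finite_lists_length_eq)

lemma sum_nb_walks_1: "h \<in> X \<Longrightarrow> (\<Sum>w\<in>nb_walks l 1 h. f w) = (\<Sum>g\<in>X. f [(h, g)])"
proof -
  assume h: "h \<in> X"
  show ?thesis
  proof (rule sum.reindex_bij_witness[where i = "\<lambda>g. [(h, g)]" and j = "\<lambda>w. snd (hd w)"])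
    fix w assume w: "w \<in> nb_walks l 1 h"
    then obtain x where "w = [x]" by (auto simp: nb_walks_def length_Suc_conv)
    then show "[(h, snd (hd w))] = w" "snd (hd w) \<in> X" "f [(h, snd (hd w))] = f w"
      using w by (auto simp: nb_walks_def)
  qed (use h in \<open>auto simp: nb_walks_def chain_def\<close>)
qed

lemma sum_nb_walks_Suc:
  assumes k: "0 < k" "k < l"
  shows "(\<Sum>w\<in>nb_walks l (Suc k) h. f w)
    = (\<Sum>u\<in>nb_walks l k h. \<Sum>j\<in>siblings (snd (last u)). \<Sum>g\<in>X. f (u @ [(j, g)]))"
proof -
  let ?S = "SIGMA u:nb_walks l k h. siblings (snd (last u)) \<times> X"
  have "(\<Sum>u\<in>nb_walks l k h. \<Sum>j\<in>siblings (snd (last u)). \<Sum>g\<in>X. f (u @ [(j, g)]))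
    = (\<Sum>u\<in>nb_walks l k h. \<Sum>x\<in>siblings (snd (last u)) \<times> X. f (u @ [x]))"
    by (simp add: sum.cartesian_product)
  also have "\<dots> = (\<Sum>(u, x)\<in>?S. f (u @ [x]))"
    by (subst sum.Sigma) auto
  also have "\<dots> = (\<Sum>w\<in>nb_walks l (Suc k) h. f w)"
  proof (rule sum.reindex_bij_witness[where j = "\<lambda>(u, x). u @ [x]" and i = "\<lambda>w. (butlast w, last w)"])
    fix a assume "a \<in> ?S"
    then obtain u x where a: "a = (u, x)" "u \<in> nb_walks l k h" "fst x \<in> siblings (snd (last u))" "snd x \<in> X" by auto
    then have u: "chain l u" "length u = k" "u \<noteq> []" by (auto simp: nb_walks_def)
    have "\<not> l dvd length u" using u k by auto
    then have "chain l (u @ [x])"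
      using a u by (intro chain_snocI) (auto simp: siblings_def src_def dst_def)
    then show "(\<lambda>(u, x). u @ [x]) a \<in> nb_walks l (Suc k) h"
      using a by (auto simp: nb_walks_def siblings_def mem_Times_iff)
    show "(butlast ((\<lambda>(u, x). u @ [x]) a), last ((\<lambda>(u, x). u @ [x]) a)) = a" using a by simp
    show "f ((\<lambda>(u, x). u @ [x]) a) = (case a of (u, x) \<Rightarrow> f (u @ [x]))" using a by simp
  next
    fix w assume w: "w \<in> nb_walks l (Suc k) h"
    then have ne: "w \<noteq> []" "length w = Suc k" by (auto simp: nb_walks_def)
    obtain u x where ux: "w = u @ [x]" using ne by (metis rev_exhaust)
    have u: "length u = k" "u \<noteq> []" using ne ux k by auto
    have "\<not> l dvd length u" using u k by auto
    moreover have "chain l (u @ [x])" using w ux by (simp add: nb_walks_def)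
    ultimately have "chain l u" "src x = dst (last u)" "fst x \<noteq> snd (last u)"
      using chain_snocD[of l u x] u by auto
    then show "(butlast w, last w) \<in> ?S"
      using w ux u by (auto simp: nb_walks_def siblings_def src_def dst_def mem_Times_iff)
    show "(\<lambda>(u, x). u @ [x]) (butlast w, last w) = w" using ne by simp
  qed
  finally show ?thesis by simp
qed

lemma hits_snoc:
  "u \<noteq> [] \<Longrightarrow> hits l E (u @ [x]) \<longleftrightarrow> hits l E u \<or> dart_edge x \<notin> E \<and> dst x \<in> danger l E u"
proof -
  assume u: "u \<noteq> []"
  let ?P = "\<lambda>w j. dart_edge (w ! j) \<notin> E \<and> dst (w ! j) \<in> near_cycle l E \<union> reach l E (visited w j)"
  have v: "visited (u @ [x]) j = visited u j" if "j \<le> length u" for j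
    using that u by (auto simp: visited_def nth_append)
  have "hits l E (u @ [x]) \<longleftrightarrow> (\<exists>j<Suc (length u). ?P (u @ [x]) j)" by (simp add: hits_def)
  also have "\<dots> \<longleftrightarrow> (\<exists>j<length u. ?P (u @ [x]) j) \<or> ?P (u @ [x]) (length u)"
    using less_Suc_eq by blast
  also have "(\<exists>j<length u. ?P (u @ [x]) j) \<longleftrightarrow> (\<exists>j<length u. ?P u j)"
  proof (intro ex_cong1 conj_cong refl)
    fix j assume "j < length u"
    then have "(u @ [x]) ! j = u ! j" "visited (u @ [x]) j = visited u j" using v[of j] by (auto simp: nth_append)
    then show "dart_edge ((u @ [x]) ! j) \<notin> E \<longleftrightarrow> dart_edge (u ! j) \<notin> E"
      "dst ((u @ [x]) ! j) \<in> near_cycle l E \<union> reach l E (visited (u @ [x]) j) \<longleftrightarrow> dst (u ! j) \<in> near_cycle l E \<union> reach l E (visited u j)"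
      by simp_all
  qed
  also have "?P (u @ [x]) (length u) \<longleftrightarrow> dart_edge x \<notin> E \<and> dst x \<in> danger l E u"
    using v[of "length u"] by (simp add: danger_def)
  also have "(\<exists>j<length u. ?P u j) \<longleftrightarrow> hits l E u" by (simp add: hits_def)
  finally show ?thesis .
qed

end

context trace_model
begin

definition nbsum :: "(hedge \<Rightarrow> real) \<Rightarrow> hedge \<Rightarrow> real" where
  "nbsum x g = (\<Sum>h\<in>siblings g. x h)"

lemma walk_weight_snoc: "walk_weight E (u @ [x]) = walk_weight E u * weight E x"
  by (simp add: walk_weight_def)

lemma sqnorm_nbsum: "sqnorm X (nbsum x) \<le> (real d)\<^sup>2 * sqnorm X x"
proof -
  have "sqnorm X (nbsum x) \<le> (\<Sum>g\<in>X. real d * (\<Sum>h\<in>X. if fst h = fst g then (x h)\<^sup>2 else 0))"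
    unfolding sqnorm_def
  proof (rule sum_mono)
    fix g assume "g \<in> X"
    have "(nbsum x g)\<^sup>2 = (\<Sum>h\<in>siblings g. 1 * x h)\<^sup>2" by (simp add: nbsum_def)
    also have "\<dots> \<le> (\<Sum>h\<in>siblings g. 1\<^sup>2) * (\<Sum>h\<in>siblings g. (x h)\<^sup>2)" by (rule Cauchy_Schwarz_ineq_sum)
    also have "\<dots> \<le> real d * (\<Sum>h\<in>X. if fst h = fst g then (x h)\<^sup>2 else 0)"
    proof (intro mult_mono)
      have "(\<Sum>h\<in>siblings g. (x h)\<^sup>2) = (\<Sum>h\<in>siblings g. if fst h = fst g then (x h)\<^sup>2 else 0)"
        by (intro sum.cong) (auto simp: siblings_def)
      also have "\<dots> \<le> (\<Sum>h\<in>X. if fst h = fst g then (x h)\<^sup>2 else 0)"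
        by (intro sum_mono2) (auto simp: siblings_def)
      finally show "(\<Sum>h\<in>siblings g. (x h)\<^sup>2) \<le> (\<Sum>h\<in>X. if fst h = fst g then (x h)\<^sup>2 else 0)" .
    qed (use card_siblings_le[of g] in \<open>auto intro!: sum_nonneg\<close>)
    finally show "(nbsum x g)\<^sup>2 \<le> real d * (\<Sum>h\<in>X. if fst h = fst g then (x h)\<^sup>2 else 0)" .
  qed
  also have "\<dots> = real d * (\<Sum>h\<in>X. \<Sum>g\<in>X. if fst h = fst g then (x h)\<^sup>2 else 0)"
    by (subst sum.swap) (simp add: sum_distrib_left)
  also have "\<dots> = real d * (\<Sum>h\<in>X. real d * (x h)\<^sup>2)"
  proof (intro arg_cong2[where f = times] sum.cong refl)
    fix h assume h: "h \<in> X"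
    have "{g \<in> X. fst h = fst g} = Pair (fst h) ` {..<d}" using h by (auto simp: X_def)
    then have "card {g \<in> X. fst h = fst g} = d" by (simp add: card_image inj_on_def)
    then show "(\<Sum>g\<in>X. if fst h = fst g then (x h)\<^sup>2 else 0) = real d * (x h)\<^sup>2"
      by (simp add: sum.If_cases Int_def)
  qed
  finally show ?thesis by (simp add: sqnorm_def sum_distrib_left power2_eq_square mult.assoc)
qed

text \<open>The eigenvalue equation, inserted at the end of a walk, appends one nonbacktracking
  step. The final sum over siblings stays unevaluated, so that the walks end with a full
  dart.\<close>

lemma eigenvector_iterate:
  assumes ev: "\<And>h. h \<in> X \<Longrightarrow> s * x h = (\<Sum>g\<in>X. weight E (h, g) * nbsum x g)"
    and h: "h \<in> X"
  shows "0 < k \<Longrightarrow> k \<le> l \<Longrightarrow> s ^ k * x h = (\<Sum>w\<in>nb_walks l k h. walk_weight E w * nbsum x (snd (last w)))"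
proof (induction k)
  case (Suc k)
  show ?case
  proof (cases "k = 0")
    case True
    have "(\<Sum>w\<in>nb_walks l 1 h. walk_weight E w * nbsum x (snd (last w))) = (\<Sum>g\<in>X. weight E (h, g) * nbsum x g)"
      by (subst sum_nb_walks_1[OF h]) (simp add: walk_weight_def)
    then show ?thesis using True ev[OF h] by simp
  next
    case False
    have "(\<Sum>w\<in>nb_walks l (Suc k) h. walk_weight E w * nbsum x (snd (last w)))
      = (\<Sum>u\<in>nb_walks l k h. \<Sum>j\<in>siblings (snd (last u)). \<Sum>g\<in>X. walk_weight E (u @ [(j, g)]) * nbsum x g)"
      using False Suc.prems by (subst sum_nb_walks_Suc) auto
    also have "\<dots> = (\<Sum>u\<in>nb_walks l k h. walk_weight E u * (\<Sum>j\<in>siblings (snd (last u)). \<Sum>g\<in>X. weight E (j, g) * nbsum x g))"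
      by (simp add: walk_weight_snoc sum_distrib_left mult.assoc)
    also have "\<dots> = (\<Sum>u\<in>nb_walks l k h. walk_weight E u * (\<Sum>j\<in>siblings (snd (last u)). s * x j))"
      using ev by (intro sum.cong refl arg_cong2[where f = times]) (auto simp: siblings_def)
    also have "\<dots> = s * (\<Sum>u\<in>nb_walks l k h. walk_weight E u * nbsum x (snd (last u)))"
      by (simp add: nbsum_def sum_distrib_left mult_ac)
    also have "\<dots> = s * (s ^ k * x h)" using Suc False by simp
    finally show ?thesis by simp
  qed
qed simp

definition tangled_walks :: "nat \<Rightarrow> hedge \<Rightarrow> hedge \<Rightarrow> dart list set" where
  "tangled_walks l h g = {w \<in> nb_walks l l h. snd (last w) = g \<and> \<not> card (chain_walk.closings w) \<le> 1}"

definition tangled_kernel :: "nat \<Rightarrow> hedge set set \<Rightarrow> hedge \<Rightarrow> hedge \<Rightarrow> real" where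
  "tangled_kernel l E h g = (\<Sum>w\<in>tangled_walks l h g. walk_weight E w)"

lemma endpoints_1:
  "0 < l \<Longrightarrow> endpoints l 1 h g = {w \<in> nb_walks l l h. snd (last w) = g \<and> card (chain_walk.closings w) \<le> 1}"
  by (auto simp: endpoints_def nb_walks_def block_chains_def block_def)

lemma eigenvector_split:
  assumes ev: "\<And>h. h \<in> X \<Longrightarrow> s * x h = (\<Sum>g\<in>X. weight E (h, g) * nbsum x g)"
    and h: "h \<in> X" and l: "0 < l"
  shows "s ^ l * x h = kapply X (kernel l E) (nbsum x) h + kapply X (tangled_kernel l E) (nbsum x) h"
proof -
  let ?f = "\<lambda>w. walk_weight E w * nbsum x (snd (last w))"
  have "s ^ l * x h = (\<Sum>w\<in>nb_walks l l h. ?f w)" using eigenvector_iterate[OF ev h, of l l] l by simp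
  also have "\<dots> = (\<Sum>g\<in>X. \<Sum>w\<in>{w \<in> nb_walks l l h. snd (last w) = g}. ?f w)"
    by (rule sum.group[symmetric, OF finite_nb_walks finite_X]) (auto simp: nb_walks_def dest: last_in_set)
  also have "\<dots> = (\<Sum>g\<in>X. (\<Sum>w\<in>endpoints l 1 h g. ?f w) + (\<Sum>w\<in>tangled_walks l h g. ?f w))"
  proof (intro sum.cong refl)
    fix g
    have "{w \<in> nb_walks l l h. snd (last w) = g} = endpoints l 1 h g \<union> tangled_walks l h g"
      unfolding endpoints_1[OF l] tangled_walks_def by auto
    moreover have "endpoints l 1 h g \<inter> tangled_walks l h g = {}"
      unfolding endpoints_1[OF l] tangled_walks_def by auto
    moreover have "finite (tangled_walks l h g)"
      by (rule finite_subset[OF _ finite_nb_walks[of l l h]]) (auto simp: tangled_walks_def)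
    ultimately show "(\<Sum>w\<in>{w \<in> nb_walks l l h. snd (last w) = g}. ?f w)
      = (\<Sum>w\<in>endpoints l 1 h g. ?f w) + (\<Sum>w\<in>tangled_walks l h g. ?f w)"
      by (simp add: sum.union_disjoint)
  qed
  also have "\<dots> = (\<Sum>g\<in>X. kernel l E h g * nbsum x g + tangled_kernel l E h g * nbsum x g)"
    unfolding kernel_def tangled_kernel_def sum_distrib_right
    by (intro sum.cong refl arg_cong2[where f = "(+)"]) (auto simp: endpoints_def tangled_walks_def)
  finally show ?thesis by (simp add: kapply_def sum.distrib)
qed

lemma walk_weight_reverse: "walk_weight E (reverse_walk w) = walk_weight E w"
proof -
  have "weight E (prod.swap x) = weight E x" for x by (simp add: weight_def)
  then have "map (weight E) (reverse_walk w) = rev (map (weight E) w)"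
    by (simp add: reverse_walk_def rev_map)
  then show ?thesis by (simp add: walk_weight_def)
qed

text \<open>Reversal preserves weights, because a dart and its reverse have the same edge, and it
  preserves the number of cycles.\<close>

lemma kernel_sym: assumes "0 < l" shows "kernel l E h g = kernel l E g h"
  unfolding kernel_def
proof (rule sum.reindex_bij_witness[where i = reverse_walk and j = reverse_walk])
  have *: "reverse_walk w \<in> endpoints l 1 g h" if "w \<in> endpoints l 1 h g" for w h g
  proof -
    have w: "chain l w" "length w = l" "set w \<subseteq> X \<times> X" "w \<noteq> []" "fst (hd w) = h" "snd (last w) = g" "card (chain_walk.closings w) \<le> 1"
      using that unfolding endpoints_1[OF assms] by (auto simp: nb_walks_def)
    have "fst (hd (reverse_walk w)) = g" "snd (last (reverse_walk w)) = h"
      using w(4-6) by (auto simp: reverse_walk_def hd_map last_map hd_rev last_rev)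
    then show ?thesis unfolding endpoints_1[OF assms]
      using w chain_reverse_walk[OF w(1)] closings_reverse_walk[OF w(1)]
      by (auto simp: nb_walks_def reverse_walk_def)
  qed
  show "reverse_walk w \<in> endpoints l 1 g h" if "w \<in> endpoints l 1 h g" for w using * that .
  show "reverse_walk w \<in> endpoints l 1 h g" if "w \<in> endpoints l 1 g h" for w using * that .
qed (simp_all add: walk_weight_reverse)

context
  fixes E :: "hedge set set" and l D :: nat
  assumes E: "is_matching E" and l: "0 < l"
    and D: "\<And>U. finite U \<Longrightarrow> card U \<le> l \<Longrightarrow>
      finite (near_cycle l E \<union> reach l E U) \<and> card (near_cycle l E \<union> reach l E U) \<le> D"
begin

lemma danger_le: "length w < l \<Longrightarrow> finite (danger l E w) \<and> card (danger l E w) \<le> D"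
proof -
  assume w: "length w < l"
  have "card {i. i < length w \<and> dst (w ! i) \<notin> visited w i} \<le> card {..<length w}" by (rule card_mono) auto
  then have "card (visited w (length w)) \<le> l" using w by (simp add: card_visited)
  moreover have "finite (visited w (length w))" by (simp add: visited_def)
  ultimately show ?thesis using D unfolding danger_def by simp
qed

lemma abs_weight_le: "\<bar>weight E x\<bar> \<le> of_bool (dart_edge x \<in> E) + c"
  using c01 by (auto simp: weight_def)

lemma cn_le: "c * n \<le> 1" using cn n_pos by (simp add: field_simps)

text \<open>A half-edge has at most one partner in E; the constants c add up to at most c n \<le>
  1.\<close>

lemma sum_abs_weight: "(\<Sum>g\<in>X. \<bar>weight E (h, g)\<bar>) \<le> 2"
proof -
  have "(\<Sum>g\<in>X. \<bar>weight E (h, g)\<bar>) \<le> (\<Sum>g\<in>X. of_bool ({h, g} \<in> E) + c)"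
    using abs_weight_le[of "(h, _)"] by (intro sum_mono) (simp add: dart_edge_def)
  also have "\<dots> = real (card {g \<in> X. {h, g} \<in> E}) + c * n"
    by (simp add: sum.distrib card_X n_def Int_def)
  also have "card {g \<in> X. {h, g} \<in> E} \<le> 1"
  proof -
    have "g = g'" if "{h, g} \<in> E" "{h, g'} \<in> E" for g g'
    proof -
      have "disjoint E" using E by (simp add: is_matching_def)
      then have "{h, g} = {h, g'}" using that disjointD[of E "{h, g}" "{h, g'}"] by auto
      then show ?thesis using E by (auto simp: doubleton_eq_iff)
    qed
    then show ?thesis by (intro card_le_Suc0_iff_eq[THEN iffD2, simplified One_nat_def[symmetric]]) auto
  qed
  finally show ?thesis using cn_le by simp
qed

lemma sum_siblings_weight:
  assumes "\<And>j. (\<Sum>g\<in>X. f j g) \<le> b" "0 \<le> b"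
  shows "(\<Sum>j\<in>siblings v. \<Sum>g\<in>X. f j g) \<le> real d * b"
proof -
  have "(\<Sum>j\<in>siblings v. \<Sum>g\<in>X. f j g) \<le> (\<Sum>j\<in>siblings v. b)" by (intro sum_mono assms)
  also have "\<dots> \<le> real d * b" using card_siblings_le[of v] assms(2) by (simp add: mult_right_mono)
  finally show ?thesis .
qed

lemma total_weight:
  assumes "h \<in> X"
  shows "0 < k \<Longrightarrow> k \<le> l \<Longrightarrow> (\<Sum>w\<in>nb_walks l k h. \<bar>walk_weight E w\<bar>) \<le> (2 * real d) ^ k"
proof (induction k)
  case (Suc k)
  show ?case
  proof (cases "k = 0")
    case True
    have "(\<Sum>w\<in>nb_walks l 1 h. \<bar>walk_weight E w\<bar>) = (\<Sum>g\<in>X. \<bar>weight E (h, g)\<bar>)"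
      by (subst sum_nb_walks_1[OF assms]) (simp add: walk_weight_def)
    also have "\<dots> \<le> 2 * real d" using sum_abs_weight[of h] d3 by simp
    finally show ?thesis using True by simp
  next
    case False
    have "(\<Sum>w\<in>nb_walks l (Suc k) h. \<bar>walk_weight E w\<bar>)
      = (\<Sum>u\<in>nb_walks l k h. \<bar>walk_weight E u\<bar> * (\<Sum>j\<in>siblings (snd (last u)). \<Sum>g\<in>X. \<bar>weight E (j, g)\<bar>))"
      using False Suc.prems by (subst sum_nb_walks_Suc) (auto simp: walk_weight_snoc abs_mult sum_distrib_left)
    also have "\<dots> \<le> (\<Sum>u\<in>nb_walks l k h. \<bar>walk_weight E u\<bar> * (real d * 2))"
      by (intro sum_mono mult_left_mono sum_siblings_weight sum_abs_weight) auto
    also have "\<dots> = (\<Sum>u\<in>nb_walks l k h. \<bar>walk_weight E u\<bar>) * (real d * 2)" by (simp add: sum_distrib_right)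
    also have "\<dots> \<le> (2 * real d) ^ k * (real d * 2)" using Suc False by (intro mult_right_mono) auto
    finally show ?thesis by (simp add: mult_ac)
  qed
qed simp

lemma sum_danger_weight:
  assumes "finite V" "card V \<le> D"
  shows "(\<Sum>g\<in>X. if dart_edge (j, g) \<notin> E \<and> dst (j, g) \<in> V then \<bar>weight E (j, g)\<bar> else 0) \<le> c * (real D * real d)"
proof -
  have "(\<Sum>g\<in>X. if dart_edge (j, g) \<notin> E \<and> dst (j, g) \<in> V then \<bar>weight E (j, g)\<bar> else 0)
    \<le> (\<Sum>g\<in>X. if g \<in> V \<times> {..<d} then c else 0)"
    using c01 by (intro sum_mono) (auto simp: weight_def dst_def X_def)
  also have "\<dots> \<le> (\<Sum>g\<in>V \<times> {..<d}. c)"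
  proof -
    have "(\<Sum>g\<in>X. if g \<in> V \<times> {..<d} then c else 0) = (\<Sum>g\<in>X \<inter> (V \<times> {..<d}). c)"
      by (simp only: sum.inter_restrict[OF finite_X])
    also have "\<dots> \<le> (\<Sum>g\<in>V \<times> {..<d}. c)" using assms(1) c01 by (intro sum_mono2) auto
    finally show ?thesis .
  qed
  also have "\<dots> = c * (real (card V) * real d)" by (simp add: card_cartesian_product)
  also have "\<dots> \<le> c * (real D * real d)" using assms c01 by (intro mult_left_mono mult_right_mono) auto
  finally show ?thesis .
qed

text \<open>There are k positions for the hit. At that position the sum of weights drops from a
  constant to c D d, at most D vertices with d half-edges each.\<close>

lemma hit_weight:
  assumes h: "h \<in> X"
  shows "0 < k \<Longrightarrow> k \<le> l \<Longrightarrow>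
    (\<Sum>w\<in>{w \<in> nb_walks l k h. hits l E w}. \<bar>walk_weight E w\<bar>) \<le> real k * (2 * real d) ^ k * (c * (real D * real d))"
proof (induction k)
  case (Suc k)
  let ?B = "c * (real D * real d)"
  have B0: "0 \<le> ?B" using c01 by simp
  have eq: "(\<Sum>w\<in>{w \<in> nb_walks l k h. hits l E w}. \<bar>walk_weight E w\<bar>)
    = (\<Sum>w\<in>nb_walks l k h. if hits l E w then \<bar>walk_weight E w\<bar> else 0)" for k
    by (simp add: sum.inter_filter)
  show ?case
  proof (cases "k = 0")
    case True
    have "(\<Sum>w\<in>nb_walks l 1 h. if hits l E w then \<bar>walk_weight E w\<bar> else 0)
      = (\<Sum>g\<in>X. if dart_edge (h, g) \<notin> E \<and> dst (h, g) \<in> near_cycle l E \<union> reach l E {fst h} then \<bar>weight E (h, g)\<bar> else 0)"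
      by (subst sum_nb_walks_1[OF h], rule sum.cong) (auto simp: walk_weight_def hits_def visited_def src_def)
    also have "\<dots> \<le> ?B" using D[of "{fst h}"] l by (intro sum_danger_weight) auto
    also have "\<dots> \<le> (2 * real d) * ?B" using d3 B0 mult_right_mono[of 1 "2 * real d" ?B] by simp
    finally show ?thesis unfolding eq using True by simp
  next
    case False
    \<comment> \<open>Either the prefix has a hit already, or the last step is the hit; only the
      second case restricts the last step.\<close>
    have split: "(if hits l E (u @ [(j, g)]) then \<bar>walk_weight E (u @ [(j, g)])\<bar> else 0)
       \<le> (if hits l E u then \<bar>walk_weight E u\<bar> else 0) * \<bar>weight E (j, g)\<bar>
         + \<bar>walk_weight E u\<bar> * (if dart_edge (j, g) \<notin> E \<and> dst (j, g) \<in> danger l E u then \<bar>weight E (j, g)\<bar> else 0)"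
      if "u \<noteq> []" for u j g
      using hits_snoc[OF that, of l E "(j, g)"] by (auto simp: walk_weight_snoc abs_mult)
    have "(\<Sum>w\<in>nb_walks l (Suc k) h. if hits l E w then \<bar>walk_weight E w\<bar> else 0)
      = (\<Sum>u\<in>nb_walks l k h. \<Sum>j\<in>siblings (snd (last u)). \<Sum>g\<in>X. if hits l E (u @ [(j, g)]) then \<bar>walk_weight E (u @ [(j, g)])\<bar> else 0)"
      using False Suc.prems by (intro sum_nb_walks_Suc) auto
    also have "\<dots> \<le> (\<Sum>u\<in>nb_walks l k h. \<Sum>j\<in>siblings (snd (last u)). \<Sum>g\<in>X.
        (if hits l E u then \<bar>walk_weight E u\<bar> else 0) * \<bar>weight E (j, g)\<bar>
         + \<bar>walk_weight E u\<bar> * (if dart_edge (j, g) \<notin> E \<and> dst (j, g) \<in> danger l E u then \<bar>weight E (j, g)\<bar> else 0))"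
      by (intro sum_mono split) (auto simp: nb_walks_def)
    also have "\<dots> = (\<Sum>u\<in>nb_walks l k h. (if hits l E u then \<bar>walk_weight E u\<bar> else 0) * (\<Sum>j\<in>siblings (snd (last u)). \<Sum>g\<in>X. \<bar>weight E (j, g)\<bar>)
       + \<bar>walk_weight E u\<bar> * (\<Sum>j\<in>siblings (snd (last u)). \<Sum>g\<in>X. if dart_edge (j, g) \<notin> E \<and> dst (j, g) \<in> danger l E u then \<bar>weight E (j, g)\<bar> else 0))"
      by (simp only: sum.distrib sum_distrib_left)
    also have "\<dots> \<le> (\<Sum>u\<in>nb_walks l k h. (if hits l E u then \<bar>walk_weight E u\<bar> else 0) * (real d * 2) + \<bar>walk_weight E u\<bar> * (real d * ?B))"
    proof (intro sum_mono add_mono mult_left_mono sum_siblings_weight sum_abs_weight sum_danger_weight)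
      fix u assume "u \<in> nb_walks l k h"
      then have "length u < l" using Suc.prems by (auto simp: nb_walks_def)
      then show "card (danger l E u) \<le> D" "finite (danger l E u)" using danger_le[of u] by auto
    qed (use B0 in auto)
    also have "\<dots> = (\<Sum>u\<in>nb_walks l k h. if hits l E u then \<bar>walk_weight E u\<bar> else 0) * (real d * 2)
       + (\<Sum>u\<in>nb_walks l k h. \<bar>walk_weight E u\<bar>) * (real d * ?B)"
      by (simp only: sum.distrib sum_distrib_right)
    also have "\<dots> \<le> (real k * (2 * real d) ^ k * ?B) * (real d * 2) + (2 * real d) ^ k * (real d * ?B)"
      using Suc False total_weight[OF h, of k] B0 unfolding eq by (intro add_mono mult_right_mono) auto
    also have "\<dots> \<le> (real k * (2 * real d) ^ k * ?B) * (real d * 2) + (2 * real d) ^ k * (2 * real d * ?B)"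
      using B0 by (intro add_left_mono mult_left_mono mult_right_mono) auto
    also have "\<dots> = real (Suc k) * (2 * real d) ^ Suc k * ?B" by (simp add: algebra_simps)
    finally show ?thesis unfolding eq .
  qed
qed simp

context
  assumes tf: "\<And>w. w \<in> real_walks l E \<Longrightarrow> card (chain_walk.closings w) \<le> 1"
begin

text \<open>In each row the sum of squares is at most the square of the sum of absolute values, and
  there are n rows.\<close>

lemma frobenius_tangled:
  "(\<Sum>h\<in>X. \<Sum>g\<in>X. (tangled_kernel l E h g)\<^sup>2) \<le> n * (real l * (2 * real d) ^ l * (c * (real D * real d)))\<^sup>2"
proof -
  let ?B = "real l * (2 * real d) ^ l * (c * (real D * real d))"
  have "(\<Sum>g\<in>X. (tangled_kernel l E h g)\<^sup>2) \<le> ?B\<^sup>2" if h: "h \<in> X" for h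
  proof -
    have "(\<Sum>g\<in>X. \<bar>tangled_kernel l E h g\<bar>) \<le> (\<Sum>g\<in>X. \<Sum>w\<in>tangled_walks l h g. \<bar>walk_weight E w\<bar>)"
      unfolding tangled_kernel_def by (intro sum_mono sum_abs)
    also have "\<dots> = (\<Sum>w\<in>(\<Union>g\<in>X. tangled_walks l h g). \<bar>walk_weight E w\<bar>)"
      by (rule sum.UNION_disjoint[symmetric])
        (auto simp: tangled_walks_def intro: finite_subset[OF _ finite_nb_walks])
    also have "\<dots> \<le> (\<Sum>w\<in>{w \<in> nb_walks l l h. hits l E w}. \<bar>walk_weight E w\<bar>)"
    proof (rule sum_mono2)
      show "finite {w \<in> nb_walks l l h. hits l E w}" by (rule finite_subset[OF _ finite_nb_walks[of l l h]]) auto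
      show "(\<Union>g\<in>X. tangled_walks l h g) \<subseteq> {w \<in> nb_walks l l h. hits l E w}"
        using tangled_hits[OF tf] by (auto simp: tangled_walks_def nb_walks_def)
    qed simp
    also have "\<dots> \<le> ?B" using hit_weight[OF h, of l] l by simp
    finally have B: "(\<Sum>g\<in>X. \<bar>tangled_kernel l E h g\<bar>) \<le> ?B" .
    have "(\<Sum>g\<in>X. (tangled_kernel l E h g)\<^sup>2) \<le> (\<Sum>g\<in>X. \<bar>tangled_kernel l E h g\<bar> * (\<Sum>g\<in>X. \<bar>tangled_kernel l E h g\<bar>))"
    proof (rule sum_mono)
      fix g assume "g \<in> X"
      then have "\<bar>tangled_kernel l E h g\<bar> \<le> (\<Sum>g\<in>X. \<bar>tangled_kernel l E h g\<bar>)"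
        by (intro member_le_sum) auto
      then have "\<bar>tangled_kernel l E h g\<bar> * \<bar>tangled_kernel l E h g\<bar> \<le> \<bar>tangled_kernel l E h g\<bar> * (\<Sum>g\<in>X. \<bar>tangled_kernel l E h g\<bar>)"
        by (rule mult_left_mono) simp
      then show "(tangled_kernel l E h g)\<^sup>2 \<le> \<bar>tangled_kernel l E h g\<bar> * (\<Sum>g\<in>X. \<bar>tangled_kernel l E h g\<bar>)"
        by (simp add: power2_eq_square)
    qed
    also have "\<dots> = (\<Sum>g\<in>X. \<bar>tangled_kernel l E h g\<bar>)\<^sup>2" by (simp add: sum_distrib_right[symmetric] power2_eq_square)
    also have "\<dots> \<le> ?B\<^sup>2" using B by (intro power_mono sum_nonneg) auto
    finally show ?thesis .
  qed
  then have "(\<Sum>h\<in>X. \<Sum>g\<in>X. (tangled_kernel l E h g)\<^sup>2) \<le> (\<Sum>h\<in>X. ?B\<^sup>2)" by (rule sum_mono)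
  also have "\<dots> = n * ?B\<^sup>2" by (simp add: card_X n_def)
  finally show ?thesis .
qed

text \<open>The untangled kernel enters through its operator bound \<gamma>, the tangled one through
  its Hilbert-Schmidt norm. The factor 2 comes from the square of a sum, the factor d^2 from
  \<open>sqnorm_nbsum\<close>.\<close>

lemma eigenvalue_bound:
  assumes ev: "\<And>h. h \<in> X \<Longrightarrow> s * x h = (\<Sum>g\<in>X. weight E (h, g) * nbsum x g)"
    and x: "0 < sqnorm X x"
    and \<gamma>: "\<And>y. sqnorm X (kapply X (kernel l E) y) \<le> \<gamma> * sqnorm X y"
  shows "s ^ (2 * l) \<le> 2 * (real d)\<^sup>2 * (\<gamma> + n * (real l * (2 * real d) ^ l * (c * (real D * real d)))\<^sup>2)"
proof -
  let ?\<beta> = "n * (real l * (2 * real d) ^ l * (c * (real D * real d)))\<^sup>2"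
  let ?y = "nbsum x"
  have \<beta>0: "0 \<le> ?\<beta>" using n_pos by simp
  have \<gamma>0: "0 \<le> \<gamma>"
  proof -
    have "0 \<le> \<gamma> * sqnorm X x" using \<gamma>[of x] sqnorm_nonneg by (rule order.trans[rotated])
    then show ?thesis using x by (simp add: zero_le_mult_iff)
  qed
  have "s ^ (2 * l) * sqnorm X x = (\<Sum>h\<in>X. (s ^ l * x h)\<^sup>2)"
    by (simp add: sqnorm_def sum_distrib_left power_mult_distrib flip: power_mult)
      (simp add: mult.commute)
  also have "\<dots> = (\<Sum>h\<in>X. (kapply X (kernel l E) ?y h + kapply X (tangled_kernel l E) ?y h)\<^sup>2)"
    using eigenvector_split[OF ev _ l] by (intro sum.cong) auto
  also have "\<dots> \<le> (\<Sum>h\<in>X. 2 * (kapply X (kernel l E) ?y h)\<^sup>2 + 2 * (kapply X (tangled_kernel l E) ?y h)\<^sup>2)"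
  proof (rule sum_mono)
    show "(a + b)\<^sup>2 \<le> 2 * a\<^sup>2 + 2 * b\<^sup>2" for a b :: real
      using zero_le_power2[of "a - b"] by (simp add: power2_eq_square algebra_simps)
  qed
  also have "\<dots> = 2 * sqnorm X (kapply X (kernel l E) ?y) + 2 * sqnorm X (kapply X (tangled_kernel l E) ?y)"
    by (simp add: sqnorm_def sum.distrib sum_distrib_left)
  also have "\<dots> \<le> 2 * (\<gamma> * sqnorm X ?y) + 2 * (?\<beta> * sqnorm X ?y)"
  proof (intro add_mono mult_left_mono \<gamma>)
    have "sqnorm X (kapply X (tangled_kernel l E) ?y) \<le> (\<Sum>h\<in>X. \<Sum>g\<in>X. (tangled_kernel l E h g)\<^sup>2) * sqnorm X ?y"
      by (rule sqnorm_kapply_le) simp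
    also have "\<dots> \<le> ?\<beta> * sqnorm X ?y" by (intro mult_right_mono frobenius_tangled sqnorm_nonneg)
    finally show "sqnorm X (kapply X (tangled_kernel l E) ?y) \<le> ?\<beta> * sqnorm X ?y" .
  qed auto
  also have "\<dots> = 2 * (\<gamma> + ?\<beta>) * sqnorm X ?y" by (simp add: algebra_simps)
  also have "\<dots> \<le> 2 * (\<gamma> + ?\<beta>) * ((real d)\<^sup>2 * sqnorm X x)"
    using \<beta>0 \<gamma>0 by (intro mult_left_mono sqnorm_nbsum) auto
  also have "\<dots> = (2 * (real d)\<^sup>2 * (\<gamma> + ?\<beta>)) * sqnorm X x" by (simp only: mult_ac)
  finally have "s ^ (2 * l) * sqnorm X x \<le> (2 * (real d)\<^sup>2 * (\<gamma> + ?\<beta>)) * sqnorm X x" .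
  then show ?thesis using x by simp
qed

end

end

end

section \<open>The Bethe form of the percolated graph\<close>

lemma zero_of_quadratic_nonneg:
  fixes b c :: real
  assumes "\<And>t. 0 \<le> 2 * t * b + t\<^sup>2 * c"
  shows "b = 0"
proof (rule ccontr)
  assume b: "b \<noteq> 0"
  define m where "m = 1 + \<bar>c\<bar>"
  have m: "m > 0" "c < m" by (auto simp: m_def)
  have "2 * (- b / m) * b + (- b / m)\<^sup>2 * c = (b\<^sup>2 / m\<^sup>2) * (c - 2 * m)"
    by (simp add: power2_eq_square field_simps)
  also have "\<dots> < 0" using b m by (intro mult_pos_neg) auto
  finally show False using assms[of "- b / m"] by simp
qed

text \<open>Requiring functions on the naturals to vanish from N on makes this a compact set in the
  product topology, so no separate finite-dimensional type is involved.\<close>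

lemma compact_bounded_functions:
  "compact {f :: nat \<Rightarrow> real. \<forall>v. f v \<in> (if v < N then {-1..1} else {0})}"
proof -
  have "compactin (product_topology (\<lambda>v::nat. euclidean) UNIV) (PiE UNIV (\<lambda>v. if v < N then {-1..1::real} else {0}))"
    by (subst compactin_PiE) auto
  moreover have "PiE UNIV (\<lambda>v. if v < N then {-1..1::real} else {0}) = {f. \<forall>v. f v \<in> (if v < N then {-1..1} else {0})}"
    by (auto simp: PiE_def Pi_def)
  ultimately show ?thesis by (simp add: euclidean_product_topology)
qed

locale bethe = half_edges +
  fixes E :: "hedge set set" and c :: real
  assumes E: "is_matching E" "\<Union>E \<subseteq> X" and c: "0 \<le> c" "c * n \<le> 1"
begin

definition mate :: "hedge \<Rightarrow> hedge \<Rightarrow> real" where "mate h g = of_bool ({h, g} \<in> E)"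
definition kept :: "hedge \<Rightarrow> real" where "kept h = (\<Sum>g\<in>X. mate h g)"
definition pull :: "(nat \<Rightarrow> real) \<Rightarrow> hedge \<Rightarrow> real" where "pull f h = (\<Sum>g\<in>X. mate h g * f (fst g))"
text \<open>This is (s + mate)^-1 applied to the constant 1: \<open>mate\<close> maps 1 to 1 at
  half-edges with a partner and to 0 at the others.\<close>

definition resol :: "real \<Rightarrow> hedge \<Rightarrow> real" where "resol s h = (1 - kept h) / s + kept h / (s + 1)"
definition total :: "real \<Rightarrow> (nat \<Rightarrow> real) \<Rightarrow> real" where "total s f = (\<Sum>h\<in>X. resol s h * f (fst h))"
text \<open>The Sherman-Morrison coefficient in the inverse of s + mate - c J, where J is the
  all-ones matrix on half-edges.\<close>

definition tau :: "real \<Rightarrow> real" where "tau s = c / (1 - c * (\<Sum>h\<in>X. resol s h))"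

text \<open>The bilinear form of s^2 - 1 - s A + D, the matrix in the Ihara-Bass formula for the
  percolated graph, with D its degree matrix.\<close>

definition bethe_form :: "real \<Rightarrow> (nat \<Rightarrow> real) \<Rightarrow> (nat \<Rightarrow> real) \<Rightarrow> real" where
  "bethe_form s f f' = (s\<^sup>2 - 1) * (\<Sum>v<N. f v * f' v) - s * (\<Sum>h\<in>X. pull f h * f' (fst h))
     + (\<Sum>h\<in>X. kept h * f (fst h) * f' (fst h))"

text \<open>The Ihara-Bass form of the centred operator: centring is a perturbation of rank one and
  adds a square of rank one, which vanishes where \<open>total s f = 0\<close>.\<close>

definition shifted_form :: "real \<Rightarrow> (nat \<Rightarrow> real) \<Rightarrow> (nat \<Rightarrow> real) \<Rightarrow> real" where
  "shifted_form s f f' = bethe_form s f f' + (s\<^sup>2 - 1) * s * tau s * total s f * total s f'"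

lemma mate_sym: "mate h g = mate g h" by (simp add: mate_def insert_commute)

lemma mate_unique: "mate h g \<noteq> 0 \<Longrightarrow> mate h g' \<noteq> 0 \<Longrightarrow> g = g'"
  using E disjointD[of E "{h, g}" "{h, g'}"] by (auto simp: mate_def is_matching_def doubleton_eq_iff)

lemma mate_eq: "mate g h = 1 \<Longrightarrow> mate g j = of_bool (j = h)"
proof (cases "mate g j = 0")
  case False
  assume "mate g h = 1"
  then show ?thesis using False mate_unique[of g h j] by simp
qed auto

lemma mate_cases:
  assumes "h \<in> X"
  obtains "\<And>g. mate h g = 0" | g where "g \<in> X" "mate h g = 1" "\<And>g'. mate h g' = of_bool (g' = g)"
proof (cases "\<exists>g. mate h g \<noteq> 0")
  case True
  then obtain g where g: "mate h g \<noteq> 0" by auto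
  then have "g \<in> X" using E(2) by (auto simp: mate_def)
  moreover have "mate h g = 1" using g by (auto simp: mate_def)
  moreover have "mate h g' = of_bool (g' = g)" for g'
  proof (cases "mate h g' = 0")
    case True
    then show ?thesis using g by auto
  next
    case False
    then show ?thesis using mate_unique[OF g, of g'] \<open>mate h g = 1\<close> by simp
  qed
  ultimately show thesis by (rule that(2))
qed (use that(1) in auto)

lemma sum_of_bool_eq: "g \<in> X \<Longrightarrow> (\<Sum>j\<in>X. of_bool (j = g) * f j) = (f g :: real)"
  by auto

lemma mate_sums:
  assumes "h \<in> X"
  shows "kept h = 0 \<or> kept h = 1"
    and "(\<Sum>g\<in>X. mate h g * kept g) = kept h"
    and "(\<Sum>g\<in>X. mate h g * (kept g * f (fst g))) = pull f h"
    and "(\<Sum>g\<in>X. mate h g * ((1 - kept g) * z g)) = 0"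
    and "(\<Sum>g\<in>X. mate h g * pull f g) = kept h * f (fst h)"
    and "(\<Sum>g\<in>X. mate h g * resol s g) = kept h / (s + 1)"
proof -
  have kg: "kept g = 1" if "h \<in> X" "mate h g = 1" for g h
  proof -
    have g: "g \<in> X" using that E(2) by (auto simp: mate_def split: if_splits)
    have "mate g h = 1" using that mate_sym by simp
    then have "mate g j = of_bool (j = h)" for j by (rule mate_eq)
    then show ?thesis using sum_of_bool_eq[OF that(1), of "\<lambda>_. 1"] by (simp add: kept_def)
  qed
  have pg: "pull f g = f (fst h)" if "mate h g = 1" for g
  proof -
    have "mate g h = 1" using that mate_sym by simp
    then have "mate g j = of_bool (j = h)" for j by (rule mate_eq)
    then show ?thesis using sum_of_bool_eq[OF assms, of "\<lambda>j. f (fst j)"] by (simp add: pull_def)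
  qed
  consider "\<And>g. mate h g = 0" | g where "g \<in> X" "mate h g = 1" "\<And>g'. mate h g' = of_bool (g' = g)"
    using mate_cases[OF assms] by blast
  then have "(kept h = 0 \<or> kept h = 1) \<and> (\<Sum>g\<in>X. mate h g * kept g) = kept h \<and>
    (\<Sum>g\<in>X. mate h g * (kept g * f (fst g))) = pull f h \<and>
    (\<Sum>g\<in>X. mate h g * ((1 - kept g) * z g)) = 0 \<and>
    (\<Sum>g\<in>X. mate h g * pull f g) = kept h * f (fst h) \<and>
    (\<Sum>g\<in>X. mate h g * resol s g) = kept h / (s + 1)"
  proof cases
    case 1
    then show ?thesis by (simp add: kept_def pull_def)
  next
    case (2 g)
    have k: "kept h = 1" using sum_of_bool_eq[OF 2(1), of "\<lambda>_. 1"] by (simp add: kept_def 2(3))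
    have p: "pull f h = f (fst g)" using sum_of_bool_eq[OF 2(1), of "\<lambda>j. f (fst j)"] by (simp add: pull_def 2(3))
    have "kept g = 1" "pull f g = f (fst h)" using kg[OF assms 2(2)] pg[OF 2(2)] by auto
    then show ?thesis using k p unfolding 2(3) by (simp add: sum_of_bool_eq[OF 2(1)] resol_def)
  qed
  then show "kept h = 0 \<or> kept h = 1" "(\<Sum>g\<in>X. mate h g * kept g) = kept h"
    "(\<Sum>g\<in>X. mate h g * (kept g * f (fst g))) = pull f h"
    "(\<Sum>g\<in>X. mate h g * ((1 - kept g) * z g)) = 0"
    "(\<Sum>g\<in>X. mate h g * pull f g) = kept h * f (fst h)"
    "(\<Sum>g\<in>X. mate h g * resol s g) = kept h / (s + 1)" by auto
qed

lemma pull_adjoint: "(\<Sum>h\<in>X. pull f h * f' (fst h)) = (\<Sum>h\<in>X. f (fst h) * pull f' h)"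
proof -
  have "(\<Sum>h\<in>X. pull f h * f' (fst h)) = (\<Sum>h\<in>X. \<Sum>g\<in>X. mate h g * f (fst g) * f' (fst h))"
    by (simp add: pull_def sum_distrib_right)
  also have "\<dots> = (\<Sum>g\<in>X. \<Sum>h\<in>X. mate h g * f (fst g) * f' (fst h))" by (rule sum.swap)
  also have "\<dots> = (\<Sum>g\<in>X. \<Sum>h\<in>X. f (fst g) * (mate g h * f' (fst h)))"
    by (intro sum.cong refl) (metis mate_sym mult.commute mult.left_commute)
  finally show ?thesis by (simp add: pull_def sum_distrib_left)
qed

lemma sum_pull: "(\<Sum>h\<in>X. pull f h) = (\<Sum>h\<in>X. kept h * f (fst h))"
proof -
  have "pull (\<lambda>_. 1) h = kept h" for h by (simp add: pull_def kept_def)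
  then show ?thesis using pull_adjoint[of f "\<lambda>_. 1"] by (simp add: mult.commute)
qed

lemma resol_bounds:
  assumes "1 < s" "h \<in> X"
  shows "0 \<le> resol s h" "resol s h \<le> 1 / s"
proof -
  have "1 / (s + 1) \<le> 1 / s" using assms(1) by (intro divide_left_mono) auto
  then show "0 \<le> resol s h" "resol s h \<le> 1 / s"
    using mate_sums(1)[OF assms(2)] assms(1) by (auto simp: resol_def)
qed

text \<open>Because c n \<le> 1 the denominator of \<open>tau\<close> stays positive for s > 1; so
  the added square has a nonnegative coefficient that is continuous in s.\<close>

lemma total_resol:
  assumes "1 < s"
  shows "c * (\<Sum>h\<in>X. resol s h) < 1" "0 \<le> tau s"
proof -
  have "(\<Sum>h\<in>X. resol s h) \<le> (\<Sum>h\<in>X. 1 / s)" using resol_bounds[OF assms] by (intro sum_mono) auto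
  then have "c * (\<Sum>h\<in>X. resol s h) \<le> c * (n * (1 / s))"
    using c by (intro mult_left_mono) (auto simp: card_X n_def)
  also have "\<dots> = (c * n) / s" by simp
  also have "\<dots> \<le> 1 / s" using c assms by (intro divide_right_mono) auto
  also have "\<dots> < 1" using assms by simp
  finally show *: "c * (\<Sum>h\<in>X. resol s h) < 1" .
  show "0 \<le> tau s" using * c by (simp add: tau_def)
qed

lemma sum_by_vertex: "(\<Sum>h\<in>X. F h) = (\<Sum>v<N. \<Sum>h\<in>{h \<in> X. fst h = v}. F h :: real)"
  by (rule sum.group[symmetric]) (auto simp: X_def)

lemma sum_fst_delta: "v < N \<Longrightarrow> (\<Sum>h\<in>X. F h * of_bool (fst h = v)) = (\<Sum>h\<in>{h \<in> X. fst h = v}. F h :: real)"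
  by (simp add: sum.inter_filter of_bool_def if_distrib cong: if_cong)

lemma card_fibre: "v < N \<Longrightarrow> card {h \<in> X. fst h = v} = d"
proof -
  assume "v < N"
  then have "{h \<in> X. fst h = v} = Pair v ` {..<d}" by (auto simp: X_def)
  then show ?thesis by (simp add: card_image inj_on_def)
qed

text \<open>With W = mate - c and f the vertex sums of x, the eigenvalue equation reads s x = W (f -
  x), that is x = f - s (s + W)^-1 f with f lifted to half-edges. Here x is defined by this formula,
  and the null vector equation at a vertex says precisely that x has the vertex sum f there. As f
  does not vanish, neither does x.\<close>

lemma eigenvector_of_null_vector:
  assumes s: "1 < s" and null: "\<And>v. v < N \<Longrightarrow> shifted_form s f (\<lambda>u. of_bool (u = v)) = 0"
    and f: "v < N" "f v \<noteq> 0"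
  shows "\<exists>x. 0 < sqnorm X x \<and> (\<forall>h\<in>X. s * x h = (\<Sum>g\<in>X. (mate h g - c) * (\<Sum>j\<in>siblings g. x j)))"
proof -
  let ?q = "s\<^sup>2 - 1"
  have sq: "?q = (s - 1) * (s + 1)" by (simp add: power2_eq_square algebra_simps)
  have q0: "?q > 0" unfolding sq using s by (intro mult_pos_pos) auto
  define U where "U = total s f"
  \<comment> \<open>This is (s + mate)^-1 applied to the lifted f: division by s at a half-edge
    without partner, and the inverse of a 2 by 2 matrix on each matched pair.\<close>
  define R where "R h = (1 - kept h) * f (fst h) / s + (s * (kept h * f (fst h)) - pull f h) / ?q" for h
  define x where "x h = f (fst h) - s * (R h + tau s * resol s h * U)" for h
  \<comment> \<open>Consistency: the vertex sums of x reproduce f. This is the one place where the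
    null vector equation enters.\<close>
  have fib: "(\<Sum>h\<in>{h \<in> X. fst h = v}. x h) = f v" if v: "v < N" for v
  proof -
    let ?Xv = "{h \<in> X. fst h = v}"
    define D where "D = (\<Sum>h\<in>?Xv. kept h)"
    define P where "P = (\<Sum>h\<in>?Xv. pull f h)"
    define u where "u = (\<Sum>h\<in>?Xv. resol s h)"
    have "shifted_form s f (\<lambda>u. of_bool (u = v)) = ?q * f v - s * P + f v * D + ?q * s * tau s * U * u"
    proof -
      have "(\<Sum>w<N. f w * of_bool (w = v)) = f v" using v by (simp add: cong: if_cong)
      moreover have "(\<Sum>h\<in>?Xv. kept h * f (fst h)) = f v * D"
        by (simp add: D_def sum_distrib_left mult.commute)
      ultimately show ?thesis
        unfolding shifted_form_def bethe_form_def using sum_fst_delta[OF v]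
        by (simp add: P_def U_def u_def total_def)
    qed
    then have eq: "?q * f v - s * P + f v * D + ?q * s * tau s * U * u = 0" using null[OF v] by simp
    have "(\<Sum>h\<in>?Xv. x h) = (\<Sum>h\<in>?Xv. f v - s * (((1 - kept h) * f v / s + (s * (kept h * f v) - pull f h) / ?q) + tau s * resol s h * U))"
      by (intro sum.cong) (auto simp: x_def R_def)
    also have "\<dots> = real d * f v - s * ((real d - D) * f v / s + (s * (D * f v) - P) / ?q + tau s * u * U)"
      using card_fibre[OF v]
      by (simp add: sum_subtractf sum.distrib sum_distrib_left[symmetric] sum_distrib_right[symmetric] sum_divide_distrib[symmetric] D_def P_def u_def)
    also have "\<dots> = D * f v - s * (s * (D * f v) - P) / ?q - s * tau s * u * U"
      using s by (simp add: field_simps)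
    also have "\<dots> = ((s * P - D * f v) - ?q * s * tau s * U * u) / ?q"
      using q0 by (simp add: field_simps power2_eq_square)
    also have "\<dots> = f v" using eq q0 by (simp add: field_simps)
    finally show ?thesis .
  qed
  have sib: "(\<Sum>j\<in>siblings g. x j) = s * (R g + tau s * resol s g * U)" if g: "g \<in> X" for g
  proof -
    have "{h \<in> X. fst h = fst g} = insert g (siblings g)" "g \<notin> siblings g" using g by (auto simp: siblings_def)
    then have "(\<Sum>h\<in>{h \<in> X. fst h = fst g}. x h) = x g + (\<Sum>j\<in>siblings g. x j)" by simp
    moreover have "fst g < N" using g by (auto simp: X_def)
    ultimately have "(\<Sum>j\<in>siblings g. x j) = f (fst g) - x g" using fib[of "fst g"] by simp
    then show ?thesis by (simp add: x_def)
  qed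
  define \<rho> where "\<rho> = (\<Sum>h\<in>X. resol s h)"
  have \<rho>1: "c * \<rho> < 1" using total_resol[OF s] by (simp add: \<rho>_def)
  have sumR: "(\<Sum>g\<in>X. R g) = U"
  proof -
    define A where "A = (\<Sum>g\<in>X. (1 - kept g) * f (fst g))"
    define B where "B = (\<Sum>g\<in>X. kept g * f (fst g))"
    have "(\<Sum>g\<in>X. R g) = A / s + (s * B - B) / ?q"
      unfolding R_def sum.distrib sum_divide_distrib[symmetric] sum_subtractf sum_distrib_left[symmetric] sum_pull
      by (simp add: A_def B_def)
    also have "(s * B - B) / ?q = B / (s + 1)"
    proof -
      have "s * B - B = (s - 1) * B" by (simp add: algebra_simps)
      then show ?thesis unfolding sq using s by simp
    qed
    also have "A / s + B / (s + 1) = U"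
      unfolding U_def total_def resol_def A_def B_def
      by (simp add: distrib_right sum.distrib sum_divide_distrib)
    finally show ?thesis .
  qed
  have ev: "s * x h = (\<Sum>g\<in>X. (mate h g - c) * (\<Sum>j\<in>siblings g. x j))" if h: "h \<in> X" for h
  proof -
    have mR: "(\<Sum>g\<in>X. mate h g * R g) = (s * pull f h - kept h * f (fst h)) / ?q"
    proof -
      have "(\<Sum>g\<in>X. mate h g * R g) = (\<Sum>g\<in>X. mate h g * ((1 - kept g) * (f (fst g) / s))
         + (s * (mate h g * (kept g * f (fst g))) - mate h g * pull f g) / ?q)"
        by (intro sum.cong refl) (simp add: R_def algebra_simps diff_divide_distrib)
      also have "\<dots> = (\<Sum>g\<in>X. mate h g * ((1 - kept g) * (f (fst g) / s)))
         + (s * (\<Sum>g\<in>X. mate h g * (kept g * f (fst g))) - (\<Sum>g\<in>X. mate h g * pull f g)) / ?q"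
        by (simp only: sum.distrib sum_subtractf sum_distrib_left sum_divide_distrib diff_divide_distrib)
      also have "\<dots> = (s * pull f h - kept h * f (fst h)) / ?q"
        by (simp only: mate_sums(3-5)[OF h] add_0)
      finally show ?thesis .
    qed
    have "(\<Sum>g\<in>X. (mate h g - c) * (\<Sum>j\<in>siblings g. x j))
      = (\<Sum>g\<in>X. (mate h g - c) * (s * (R g + tau s * resol s g * U)))"
      using sib by (intro sum.cong) auto
    also have "\<dots> = (\<Sum>g\<in>X. s * (mate h g * R g) + s * tau s * U * (mate h g * resol s g) - c * s * R g - c * s * tau s * U * resol s g)"
      by (intro sum.cong refl) (simp add: algebra_simps)
    also have "\<dots> = s * ((s * pull f h - kept h * f (fst h)) / ?q) + s * tau s * U * (kept h / (s + 1)) - c * s * U - c * s * tau s * U * \<rho>"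
      unfolding sum.distrib sum_subtractf sum_distrib_left[symmetric] mR mate_sums(6)[OF h] sumR \<rho>_def[symmetric] ..
    also have "\<dots> = s * ((s * pull f h - kept h * f (fst h)) / ?q + tau s * U * (kept h / (s + 1)) - c * U * (1 + tau s * \<rho>))"
      by (simp add: algebra_simps)
    \<comment> \<open>The fixed point equation of the Sherman-Morrison coefficient.\<close>
    also have "c * U * (1 + tau s * \<rho>) = tau s * U"
    proof -
      have "1 + tau s * \<rho> = 1 / (1 - c * \<rho>)" using \<rho>1 by (simp add: tau_def \<rho>_def[symmetric] field_simps)
      then show ?thesis by (simp add: tau_def \<rho>_def[symmetric])
    qed
    also have "s * ((s * pull f h - kept h * f (fst h)) / ?q + tau s * U * (kept h / (s + 1)) - tau s * U) = s * x h"
    proof -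
      have k: "kept h = 0 \<or> kept h = 1" by (rule mate_sums(1)[OF h])
      have "x h = (s * pull f h - kept h * f (fst h)) / ?q + tau s * U * (kept h / (s + 1)) - tau s * U"
      proof (cases "kept h = 0")
        case True
        have "x h = f (fst h) - s * (f (fst h) / s) + s * (pull f h / ?q) - (s * (1 / s)) * (tau s * U)"
          by (simp add: x_def R_def resol_def True algebra_simps)
        moreover have "s * (f (fst h) / s) = f (fst h)" "s * (1 / s) = 1" using s by auto
        ultimately show ?thesis using True by simp
      next
        case False
        then have k1: "kept h = 1" using k by simp
        have "x h = f (fst h) - s * ((s * f (fst h) - pull f h) / ?q) - tau s * U * (s / (s + 1))"
          using k1 by (simp add: x_def R_def resol_def algebra_simps)
        also have "f (fst h) - s * ((s * f (fst h) - pull f h) / ?q) = (s * pull f h - f (fst h)) / ?q"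
          using q0 by (simp add: field_simps power2_eq_square)
        also have "s / (s + 1) = 1 - 1 / (s + 1)" using s by (simp add: field_simps)
        finally show ?thesis using k1 by (simp add: algebra_simps)
      qed
      then show ?thesis by simp
    qed
    finally show ?thesis by simp
  qed
  have "0 < sqnorm X x"
  proof (rule ccontr)
    assume "\<not> 0 < sqnorm X x"
    then have "sqnorm X x = 0" using sqnorm_nonneg[of X x] by simp
    then have "x h = 0" if "h \<in> X" for h using that by (simp add: sqnorm_def sum_nonneg_eq_0_iff)
    then have "(\<Sum>h\<in>{h \<in> X. fst h = v}. x h) = 0" by (intro sum.neutral) auto
    then show False using fib[OF f(1)] f(2) by simp
  qed
  then show ?thesis using ev by blast
qed

lemma shifted_form_cong:
  assumes "\<And>v. v < N \<Longrightarrow> f v = f' v" "\<And>v. v < N \<Longrightarrow> g v = g' v"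
  shows "shifted_form s f g = shifted_form s f' g'"
proof -
  have *: "h \<in> X \<Longrightarrow> f (fst h) = f' (fst h) \<and> g (fst h) = g' (fst h)" for h
    using assms by (auto simp: X_def)
  then show ?thesis
    unfolding shifted_form_def bethe_form_def total_def pull_def using assms by simp
qed

lemma shifted_form_scale: "shifted_form s (\<lambda>v. a * f v) (\<lambda>v. b * g v) = a * b * shifted_form s f g"
proof -
  have "pull (\<lambda>v. a * f v) h = a * pull f h" for h by (simp add: pull_def sum_distrib_left mult_ac)
  moreover have "total s (\<lambda>v. a * f v) = a * total s f" for a f by (simp add: total_def sum_distrib_left mult_ac)
  ultimately show ?thesis
    unfolding shifted_form_def bethe_form_def
    by (simp add: algebra_simps sum_distrib_left)
qed

lemma shifted_form_add_left: "shifted_form s (\<lambda>v. f v + f' v) g = shifted_form s f g + shifted_form s f' g"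
proof -
  have "pull (\<lambda>v. f v + f' v) h = pull f h + pull f' h" for h by (simp add: pull_def sum.distrib algebra_simps)
  moreover have "total s (\<lambda>v. f v + f' v) = total s f + total s f'" by (simp add: total_def sum.distrib algebra_simps)
  ultimately show ?thesis
    unfolding shifted_form_def bethe_form_def
    by (simp add: algebra_simps sum.distrib)
qed

lemma shifted_form_sym: "shifted_form s f g = shifted_form s g f"
  unfolding shifted_form_def bethe_form_def using pull_adjoint[of f g] by (simp add: mult_ac)

lemma sum_pull_bound: "\<bar>\<Sum>h\<in>X. pull f h * f (fst h)\<bar> \<le> real d * (\<Sum>v<N. (f v)\<^sup>2)"
proof -
  have fib: "(\<Sum>h\<in>X. (f (fst h))\<^sup>2) = real d * (\<Sum>v<N. (f v)\<^sup>2)"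
    by (subst sum_by_vertex) (simp add: card_fibre sum_distrib_left)
  have "\<bar>\<Sum>h\<in>X. pull f h * f (fst h)\<bar> \<le> (\<Sum>h\<in>X. \<bar>pull f h * f (fst h)\<bar>)" by (rule sum_abs)
  also have "\<dots> \<le> (\<Sum>h\<in>X. ((pull f h)\<^sup>2 + (f (fst h))\<^sup>2) / 2)"
  proof (rule sum_mono)
    fix h
    show "\<bar>pull f h * f (fst h)\<bar> \<le> ((pull f h)\<^sup>2 + (f (fst h))\<^sup>2) / 2"
      using zero_le_power2[of "pull f h - f (fst h)"] zero_le_power2[of "pull f h + f (fst h)"] unfolding abs_le_iff by (simp add: power2_eq_square algebra_simps)
  qed
  also have "\<dots> = ((\<Sum>h\<in>X. (pull f h)\<^sup>2) + (\<Sum>h\<in>X. (f (fst h))\<^sup>2)) / 2"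
    by (simp only: sum.distrib[symmetric] sum_divide_distrib)
  also have "(\<Sum>h\<in>X. (pull f h)\<^sup>2) = (\<Sum>h\<in>X. pull (\<lambda>v. (f v)\<^sup>2) h)"
  proof (rule sum.cong[OF refl])
    fix h assume h: "h \<in> X"
    show "(pull f h)\<^sup>2 = pull (\<lambda>v. (f v)\<^sup>2) h"
      using mate_cases[OF h]
    proof cases
      case (2 g)
      show ?thesis unfolding pull_def 2(3)
        using sum_of_bool_eq[OF 2(1), of "\<lambda>j. f (fst j)"] sum_of_bool_eq[OF 2(1), of "\<lambda>j. (f (fst j))\<^sup>2"] by simp
    qed (simp add: pull_def)
  qed
  also have "\<dots> \<le> (\<Sum>h\<in>X. (f (fst h))\<^sup>2)"
    unfolding sum_pull
  proof (rule sum_mono)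
    fix h assume "h \<in> X"
    then show "kept h * (f (fst h))\<^sup>2 \<le> (f (fst h))\<^sup>2" using mate_sums(1)[of h] by auto
  qed
  finally show ?thesis using fib by simp
qed

text \<open>The adjacency part is at most s d times the square norm, which s^2 - 1 exceeds from d +
  1 on. This confines the search for the largest critical s to a compact interval.\<close>

lemma shifted_form_pos:
  assumes "s \<ge> real d + 1" "v < N" "f v \<noteq> 0"
  shows "0 < shifted_form s f f"
proof -
  have s: "1 < s" using assms d by simp
  let ?S = "\<Sum>v<N. (f v)\<^sup>2"
  have S0: "0 < ?S" using assms by (intro sum_pos2[of _ v]) auto
  have P: "(\<Sum>h\<in>X. pull f h * f (fst h)) \<le> real d * ?S" using sum_pull_bound[of f] by linarith
  have K: "0 \<le> (\<Sum>h\<in>X. kept h * f (fst h) * f (fst h))"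
  proof (rule sum_nonneg)
    fix h assume "h \<in> X"
    then show "0 \<le> kept h * f (fst h) * f (fst h)" using mate_sums(1)[of h] by auto
  qed
  have T: "0 \<le> (s\<^sup>2 - 1) * s * tau s * total s f * total s f"
    using total_resol[OF s] s by (auto simp: mult.assoc)
  have "0 < (s\<^sup>2 - 1 - s * real d) * ?S"
  proof (rule mult_pos_pos[OF _ S0])
    have "s * (real d + 1) \<le> s * s" using assms by (intro mult_left_mono) auto
    then show "0 < s\<^sup>2 - 1 - s * real d" using s by (simp add: power2_eq_square algebra_simps)
  qed
  also have "\<dots> = (s\<^sup>2 - 1) * ?S - s * (real d * ?S)" by (simp add: algebra_simps)
  also have "\<dots> \<le> (s\<^sup>2 - 1) * ?S - s * (\<Sum>h\<in>X. pull f h * f (fst h))"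
    using P s by (intro diff_left_mono mult_left_mono) auto
  also have "\<dots> \<le> shifted_form s f f"
    unfolding shifted_form_def bethe_form_def using K T by (simp add: power2_eq_square)
  finally show ?thesis .
qed

lemma continuous_shifted_form:
  "continuous_on ({1<..} \<times> UNIV) (\<lambda>p. shifted_form (fst p) (snd p) (snd p))"
proof -
  let ?A = "{1<..} \<times> (UNIV :: (nat \<Rightarrow> real) set)"
  have coord: "continuous_on ?A (\<lambda>p. snd p v)" for v :: nat
    by (rule continuous_on_compose2[OF continuous_on_product_coordinates]) (auto intro: continuous_intros)
  have pull: "continuous_on ?A (\<lambda>p. pull (snd p) h)" for h
    unfolding pull_def by (intro continuous_intros coord)
  have resol: "continuous_on ?A (\<lambda>p. resol (fst p) h)" for h
    unfolding resol_def by (intro continuous_intros) auto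
  have total: "continuous_on ?A (\<lambda>p. total (fst p) (snd p))"
    unfolding total_def by (intro continuous_intros coord resol)
  have tau: "continuous_on ?A (\<lambda>p. tau (fst p))"
    unfolding tau_def using total_resol(1) by (intro continuous_intros resol) fastforce
  show ?thesis
    unfolding shifted_form_def bethe_form_def
    by (intro continuous_intros coord pull total tau)
qed

text \<open>The largest \<open>s\<close> at which the form fails to be positive definite is an eigenvalue.\<close>

lemma eigenvector_of_negative_form:
  assumes s0: "1 < s0" and neg: "shifted_form s0 f f < 0"
  shows "\<exists>s\<ge>s0. \<exists>x. 0 < sqnorm X x \<and> (\<forall>h\<in>X. s * x h = (\<Sum>g\<in>X. (mate h g - c) * (\<Sum>j\<in>siblings g. x j)))"
proof -
  define S where "S = {f :: nat \<Rightarrow> real. (\<forall>v. f v \<in> (if v < N then {-1..1} else {0})) \<and> (\<Sum>v<N. (f v)\<^sup>2) = 1}"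
  \<comment> \<open>Beyond d + 1 the form is positive definite, so the largest critical s lies
    strictly below s1 and can be approached from the right.\<close>
  define s1 where "s1 = s0 + real d + 1"
  let ?Psi = "\<lambda>p. shifted_form (fst p) (snd p) (snd p)"
  define Z where "Z = {p \<in> {s0..s1} \<times> S. ?Psi p \<le> 0}"
  have normalize: "\<exists>f'\<in>S. \<exists>a>0. \<forall>s. shifted_form s f' f' = a * shifted_form s f f" if "v < N" "f v \<noteq> 0" for f v
  proof -
    let ?q = "\<Sum>v<N. (f v)\<^sup>2"
    have q: "0 < ?q" using that by (intro sum_pos2[of _ v]) auto
    define a where "a = 1 / sqrt ?q"
    define f' where "f' v = (if v < N then a * f v else 0)" for v
    have a: "a > 0" "a\<^sup>2 * ?q = 1" using q by (auto simp: a_def power_divide)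
    have one: "(\<Sum>v<N. (f' v)\<^sup>2) = 1"
      using a(2) by (simp add: f'_def power_mult_distrib sum_distrib_left)
    have "f' v \<in> {-1..1}" if "v < N" for v
    proof -
      have "(f' v)\<^sup>2 \<le> (\<Sum>v<N. (f' v)\<^sup>2)" using that by (intro member_le_sum) auto
      then have "(f' v)\<^sup>2 \<le> 1" using one by simp
      then have "\<bar>f' v\<bar> \<le> 1" by (simp only: abs_square_le_1)
      then show ?thesis by auto
    qed
    then have "f' \<in> S" using one by (auto simp: S_def f'_def)
    moreover have "shifted_form s f' f' = a\<^sup>2 * shifted_form s f f" for s
    proof -
      have "shifted_form s f' f' = shifted_form s (\<lambda>v. a * f v) (\<lambda>v. a * f v)"
        by (rule shifted_form_cong) (auto simp: f'_def)
      then show ?thesis by (simp add: shifted_form_scale power2_eq_square)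
    qed
    ultimately show ?thesis using a by (intro bexI[of _ f'] exI[of _ "a\<^sup>2"]) auto
  qed
  have S_nz: "\<exists>v<N. f v \<noteq> 0" if "f \<in> S" for f
  proof (rule ccontr)
    assume "\<not> ?thesis"
    then have "(\<Sum>v<N. (f v)\<^sup>2) = 0" by (intro sum.neutral) auto
    then show False using that by (simp add: S_def)
  qed
  have comp: "compact S"
  proof -
    have "closed {f :: nat \<Rightarrow> real. (\<Sum>v<N. (f v)\<^sup>2) = 1}"
      by (intro closed_Collect_eq continuous_intros continuous_on_product_coordinates)
    then have "compact ({f :: nat \<Rightarrow> real. \<forall>v. f v \<in> (if v < N then {-1..1} else {0})} \<inter> {f. (\<Sum>v<N. (f v)\<^sup>2) = 1})"
      using compact_bounded_functions by (rule compact_Int_closed[rotated])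
    then show ?thesis by (simp add: S_def Collect_conj_eq)
  qed
  have cont: "continuous_on ({s0..s1} \<times> S) ?Psi"
    by (rule continuous_on_subset[OF continuous_shifted_form]) (use s0 in auto)
  have "compact ({s0..s1} \<times> S)" by (intro compact_Times comp compact_Icc)
  moreover have "closedin (top_of_set ({s0..s1} \<times> S)) Z"
    unfolding Z_def using continuous_closedin_preimage[OF cont, of "{..0}"] by (simp add: Int_def)
  ultimately have "compact Z" using closedin_compact by blast
  then have cZ: "compact (fst ` Z)" by (intro compact_continuous_image continuous_intros)
  have "\<exists>v<N. f v \<noteq> 0"
  proof (rule ccontr)
    assume "\<not> ?thesis"
    then have "shifted_form s0 f f = shifted_form s0 (\<lambda>v. 0 * f v) (\<lambda>v. 0 * f v)" by (intro shifted_form_cong) auto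
    then show False using neg unfolding shifted_form_scale by simp
  qed
  then obtain v where "v < N" "f v \<noteq> 0" by auto
  then obtain f0 a where f0: "f0 \<in> S" "a > 0" "\<And>s. shifted_form s f0 f0 = a * shifted_form s f f" using normalize by blast
  have "shifted_form s0 f0 f0 < 0" unfolding f0(3) using f0(2) neg by (rule mult_pos_neg)
  then have "(s0, f0) \<in> Z" using f0 by (auto simp: Z_def s1_def)
  then have "fst ` Z \<noteq> {}" by auto
  then obtain s where s: "s \<in> fst ` Z" "\<And>t. t \<in> fst ` Z \<Longrightarrow> t \<le> s" using compact_attains_sup[OF cZ] by auto
  then obtain fs where fs: "s0 \<le> s" "s \<le> s1" "fs \<in> S" "shifted_form s fs fs \<le> 0" by (auto simp: Z_def)
  have "s \<noteq> s1"
  proof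
    assume "s = s1"
    then have "real d + 1 \<le> s" using s0 by (simp add: s1_def)
    then have "0 < shifted_form s fs fs" using S_nz[OF fs(3)] shifted_form_pos by blast
    then show False using fs by simp
  qed
  then have ss1: "s < s1" using fs by simp
  \<comment> \<open>For t slightly above s the form is positive on the sphere, by maximality of s;
    nonnegativity at s is the limit from the right.\<close>
  have nonneg: "0 \<le> shifted_form s g g" for g
  proof (cases "\<exists>v<N. g v \<noteq> 0")
    case False
    then have "shifted_form s g g = shifted_form s (\<lambda>v. 0 * g v) (\<lambda>v. 0 * g v)" by (intro shifted_form_cong) auto
    then show ?thesis unfolding shifted_form_scale by simp
  next
    case True
    then obtain v where "v < N" "g v \<noteq> 0" by auto
    then obtain g' b where g': "g' \<in> S" "b > 0" "\<And>s. shifted_form s g' g' = b * shifted_form s g g" using normalize by blast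
    have pos: "0 < shifted_form t g' g'" if "s < t" "t \<le> s1" for t
    proof (rule ccontr)
      assume "\<not> ?thesis"
      then have "(t, g') \<in> Z" using that g' fs by (auto simp: Z_def)
      then have "t \<le> s" using s(2) by force
      then show False using that by simp
    qed
    have "continuous_on {s0..s1} (\<lambda>t. ?Psi (t, g'))"
      by (rule continuous_on_compose2[OF cont]) (use g' in \<open>auto intro!: continuous_intros\<close>)
    then have "continuous (at s within {s0..s1}) (\<lambda>t. shifted_form t g' g')"
      using fs by (simp add: continuous_on_eq_continuous_within)
    then have "((\<lambda>t. shifted_form t g' g') \<longlongrightarrow> shifted_form s g' g') (at s within {s0..s1})"
      by (simp add: continuous_within)
    then have "((\<lambda>t. shifted_form t g' g') \<longlongrightarrow> shifted_form s g' g') (at s within {s..s1})"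
      by (rule tendsto_within_subset) (use fs in auto)
    then have lim: "((\<lambda>t. shifted_form t g' g') \<longlongrightarrow> shifted_form s g' g') (at_right s)"
      using at_within_Icc_at_right[OF ss1] by simp
    have ev: "eventually (\<lambda>t. 0 \<le> shifted_form t g' g') (at_right s)"
      unfolding eventually_at_right_field using pos ss1 by (intro exI[of _ s1]) (auto intro: less_imp_le)
    have nt: "at_right s \<noteq> bot" by simp
    have "0 \<le> shifted_form s g' g'" by (rule tendsto_lowerbound[OF lim ev nt])
    then show ?thesis unfolding g'(3) using g'(2) by (simp add: zero_le_mult_iff)
  qed
  have zero: "shifted_form s fs fs = 0" using nonneg[of fs] fs by simp
  \<comment> \<open>A nonnegative form that vanishes at \<open>fs\<close> has vanishing first
    variation there.\<close>
  have null: "shifted_form s fs (\<lambda>u. of_bool (u = v)) = 0" for v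
  proof (rule zero_of_quadratic_nonneg)
    fix t
    let ?e = "\<lambda>u. of_bool (u = v) :: real"
    have "0 \<le> shifted_form s (\<lambda>u. fs u + t * ?e u) (\<lambda>u. fs u + t * ?e u)" by (rule nonneg)
    also have "\<dots> = shifted_form s fs (\<lambda>u. fs u + t * ?e u) + shifted_form s (\<lambda>u. t * ?e u) (\<lambda>u. fs u + t * ?e u)"
      by (rule shifted_form_add_left)
    also have "shifted_form s fs (\<lambda>u. fs u + t * ?e u) = shifted_form s fs fs + shifted_form s (\<lambda>u. t * ?e u) fs"
      unfolding shifted_form_sym[of s fs "\<lambda>u. fs u + t * ?e u"] by (rule shifted_form_add_left)
    also have "shifted_form s (\<lambda>u. t * ?e u) (\<lambda>u. fs u + t * ?e u) = shifted_form s fs (\<lambda>u. t * ?e u) + shifted_form s (\<lambda>u. t * ?e u) (\<lambda>u. t * ?e u)"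
      unfolding shifted_form_sym[of s "\<lambda>u. t * ?e u" "\<lambda>u. fs u + t * ?e u"] by (rule shifted_form_add_left)
    also have "shifted_form s (\<lambda>u. t * ?e u) (\<lambda>u. t * ?e u) = t\<^sup>2 * shifted_form s ?e ?e"
      by (simp add: shifted_form_scale power2_eq_square)
    also have "shifted_form s (\<lambda>u. t * ?e u) fs = t * shifted_form s fs ?e"
      using shifted_form_scale[of s t ?e 1 fs] shifted_form_sym[of s fs ?e] by simp
    also have "shifted_form s fs (\<lambda>u. t * ?e u) = t * shifted_form s fs ?e"
      using shifted_form_scale[of s 1 fs t ?e] by simp
    finally show "0 \<le> 2 * t * shifted_form s fs ?e + t\<^sup>2 * shifted_form s ?e ?e" using zero by simp
  qed
  obtain v where "v < N" "fs v \<noteq> 0" using S_nz[OF fs(3)] by auto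
  then show ?thesis using eigenvector_of_null_vector[of s fs v] null fs(1) s0 by (meson less_le_trans)
qed

lemma bethe_form_nonneg:
  assumes s0: "1 < s0"
    and no_ev: "\<And>s x. s0 \<le> s \<Longrightarrow> 0 < sqnorm X x \<Longrightarrow> \<exists>h\<in>X. s * x h \<noteq> (\<Sum>g\<in>X. (mate h g - c) * (\<Sum>j\<in>siblings g. x j))"
    and perp: "total s0 f = 0"
  shows "0 \<le> bethe_form s0 f f"
proof -
  have "0 \<le> shifted_form s0 f f"
    using eigenvector_of_negative_form[OF s0, of f] no_ev by (meson not_less)
  then show ?thesis by (simp add: shifted_form_def perp)
qed

end

section \<open>Quadratic forms on graphs with trees attached\<close>

text \<open>V0 is the core, p the parent map, C x the children of x, a the square of a function and
  g the terms of its quadratic form. Each tree edge charges s to the lower end and 1 / s to the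
  upper end; equality would hold for functions that decay like s^-depth. A tree vertex is charged s
  + D / s in total. A core vertex is charged only for its children, and what it saves is the sum
  subtracted at the end.\<close>

lemma infsum_tree_bound:
  fixes a g core :: "'a \<Rightarrow> real"
  assumes C: "\<And>x. C x = {y \<in> V - V0. p y = x}"
    and V0: "finite V0" "V0 \<subseteq> V" and p: "\<And>y. y \<in> V - V0 \<Longrightarrow> p y \<in> V"
    and ch: "\<And>x. x \<in> V \<Longrightarrow> finite (C x) \<and> card (C x) \<le> D'"
    and chD: "\<And>x. x \<in> V - V0 \<Longrightarrow> card (C x) = D"
    and a: "\<And>x. 0 \<le> a x" "a summable_on V" and s: "0 < s"
    and g: "\<And>x. x \<in> V \<Longrightarrow> \<bar>g x - (if x \<in> V0 then core x else 0)\<bar> \<le>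
       (\<Sum>y\<in>C x. (a x / s + s * a y) / 2) + (if x \<in> V0 then 0 else (a (p x) / s + s * a x) / 2)"
  shows "\<bar>infsum g V - (\<Sum>x\<in>V0. core x)\<bar> \<le>
    (s + real D / s) * infsum a V - (\<Sum>x\<in>V0. (s + (real D - real (card (C x))) / s) * a x)"
proof -
  let ?B = "V - V0"
  let ?T = "Sigma V C"
  let ?k = "\<lambda>x. real (card (C x))"
  have bij: "bij_betw snd ?T ?B"
    by (rule bij_betwI[where g = "\<lambda>y. (p y, y)"]) (use p in \<open>auto simp: C\<close>)
  have aB: "a summable_on ?B" by (rule summable_on_subset_banach[OF a(2)]) auto
  \<comment> \<open>Each a x is repeated at most D' times, once per child.\<close>
  have apB: "(\<lambda>y. a (p y)) summable_on ?B"
  proof (rule nonneg_bdd_above_summable_on)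
    show "bdd_above (sum (\<lambda>y. a (p y)) ` {F. F \<subseteq> ?B \<and> finite F})"
    proof (rule bdd_aboveI)
      fix z assume "z \<in> sum (\<lambda>y. a (p y)) ` {F. F \<subseteq> ?B \<and> finite F}"
      then obtain F where F: "F \<subseteq> ?B" "finite F" "z = (\<Sum>y\<in>F. a (p y))" by auto
      have "z = (\<Sum>x\<in>p ` F. \<Sum>y\<in>{y \<in> F. p y = x}. a (p y))" using F sum.image_gen[of F "\<lambda>y. a (p y)" p] by simp
      also have "\<dots> = (\<Sum>x\<in>p ` F. real (card {y \<in> F. p y = x}) * a x)" by (intro sum.cong) auto
      also have "\<dots> \<le> (\<Sum>x\<in>p ` F. real D' * a x)"
      proof (intro sum_mono mult_right_mono a)
        fix x assume "x \<in> p ` F"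
        then have "x \<in> V" using F p by auto
        have "card {y \<in> F. p y = x} \<le> card (C x)" using F ch[OF \<open>x \<in> V\<close>] by (intro card_mono) (auto simp: C)
        then show "real (card {y \<in> F. p y = x}) \<le> real D'" using ch[OF \<open>x \<in> V\<close>] by linarith
      qed
      also have "\<dots> = real D' * (\<Sum>x\<in>p ` F. a x)" by (simp add: sum_distrib_left)
      also have "\<dots> \<le> real D' * infsum a V"
        using F p a by (intro mult_left_mono finite_sum_le_infsum) auto
      finally show "z \<le> real D' * infsum a V" .
    qed
  qed (use a in auto)
  have T1: "(\<lambda>z. a (snd z)) summable_on ?T" using summable_on_reindex_bij_betw[OF bij, of a] aB by simp
  have T2: "(\<lambda>z. a (fst z)) summable_on ?T"
  proof -
    have "(\<lambda>z. a (p (snd z))) summable_on ?T" using summable_on_reindex_bij_betw[OF bij, of "\<lambda>y. a (p y)"] apB by simp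
    then show ?thesis by (rule summable_on_cong[THEN iffD1, rotated]) (auto simp: C)
  qed
  have fin: "finite (C x)" if "x \<in> V" for x using ch[OF that] by simp
  have s1: "(\<lambda>x. \<Sum>y\<in>C x. a y) summable_on V" and i1: "infsum (\<lambda>x. \<Sum>y\<in>C x. a y) V = infsum a ?B"
  proof -
    have "(\<lambda>x. infsum (\<lambda>y. a (snd (x, y))) (C x)) summable_on V"
      using T1 by (intro summable_on_Sigma_banach) (simp add: case_prod_unfold)
    then show "(\<lambda>x. \<Sum>y\<in>C x. a y) summable_on V"
      by (rule summable_on_cong[THEN iffD1, rotated]) (simp add: fin)
    have "infsum (\<lambda>x. \<Sum>y\<in>C x. a y) V = infsum (\<lambda>x. infsum (\<lambda>y. a (snd (x, y))) (C x)) V"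
      by (rule infsum_cong) (simp add: fin)
    also have "\<dots> = infsum (\<lambda>z. a (snd z)) ?T" by (rule infsum_Sigma_banach[OF T1])
    also have "\<dots> = infsum a ?B" by (rule infsum_reindex_bij_betw[OF bij])
    finally show "infsum (\<lambda>x. \<Sum>y\<in>C x. a y) V = infsum a ?B" .
  qed
  have s2: "(\<lambda>x. ?k x * a x) summable_on V" and i2: "infsum (\<lambda>y. a (p y)) ?B = infsum (\<lambda>x. ?k x * a x) V"
  proof -
    have "(\<lambda>x. infsum (\<lambda>y. a (fst (x, y))) (C x)) summable_on V"
      using T2 by (intro summable_on_Sigma_banach) (simp add: case_prod_unfold)
    then show "(\<lambda>x. ?k x * a x) summable_on V"
      by (rule summable_on_cong[THEN iffD1, rotated]) simp
    have "infsum (\<lambda>y. a (p y)) ?B = infsum (\<lambda>z. a (p (snd z))) ?T" by (rule infsum_reindex_bij_betw[OF bij, symmetric])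
    also have "\<dots> = infsum (\<lambda>z. a (fst z)) ?T" by (rule infsum_cong) (auto simp: C)
    also have "\<dots> = infsum (\<lambda>x. infsum (\<lambda>y. a (fst (x, y))) (C x)) V" by (rule infsum_Sigma_banach[OF T2, symmetric])
    also have "\<dots> = infsum (\<lambda>x. ?k x * a x) V" by (rule infsum_cong) simp
    finally show "infsum (\<lambda>y. a (p y)) ?B = infsum (\<lambda>x. ?k x * a x) V" .
  qed
  \<comment> \<open>In the row of x, \<open>w1\<close> collects the shares of the edges to the
    children, \<open>w2\<close> that of the edge to the parent; every tree edge thus appears once in
    each.\<close>
  define w1 where "w1 x = 1 / (2 * s) * (?k x * a x) + s / 2 * (\<Sum>y\<in>C x. a y)" for x
  define w2 where "w2 x = 1 / (2 * s) * a (p x) + s / 2 * a x" for x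
  have sw1: "w1 summable_on V" unfolding w1_def by (intro summable_on_add summable_on_cmult_right s1 s2)
  have sw2: "w2 summable_on ?B" unfolding w2_def by (intro summable_on_add summable_on_cmult_right aB apB)
  have iw1: "infsum w1 V = 1 / (2 * s) * infsum (\<lambda>x. ?k x * a x) V + s / 2 * infsum a ?B"
    unfolding w1_def
    by (simp only: infsum_add[OF summable_on_cmult_right[OF s2] summable_on_cmult_right[OF s1]]
        infsum_cmult_right[OF s2] infsum_cmult_right[OF s1] i1)
  have iw2: "infsum w2 ?B = 1 / (2 * s) * infsum (\<lambda>x. ?k x * a x) V + s / 2 * infsum a ?B"
    unfolding w2_def
    by (simp only: infsum_add[OF summable_on_cmult_right[OF apB] summable_on_cmult_right[OF aB]]
        infsum_cmult_right[OF apB] infsum_cmult_right[OF aB] i2)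
  define w2' where "w2' x = (if x \<in> V0 then 0 else w2 x)" for x
  have sw2': "w2' summable_on V"
    using sw2 by (rule summable_on_cong_neutral[THEN iffD1, rotated -1]) (auto simp: w2'_def)
  have iw2': "infsum w2' V = infsum w2 ?B"
    by (rule infsum_cong_neutral) (auto simp: w2'_def)
  let ?w = "\<lambda>x. w1 x + w2' x"
  have sw: "?w summable_on V" by (intro summable_on_add sw1 sw2')
  let ?c = "\<lambda>x. if x \<in> V0 then core x else 0"
  let ?e = "\<lambda>x. g x - ?c x"
  have le: "\<bar>?e x\<bar> \<le> ?w x" if x: "x \<in> V" for x
  proof -
    have "(\<Sum>y\<in>C x. (a x / s + s * a y) / 2) = w1 x"
      by (simp add: w1_def add_divide_distrib sum.distrib sum_distrib_left)
    moreover have "(a (p x) / s + s * a x) / 2 = w2 x" by (simp add: w2_def)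
    ultimately show ?thesis using g[OF x] by (simp add: w2'_def split: if_splits)
  qed
  have se: "?e summable_on V"
  proof (rule Infinite_Sum.abs_summable_summable, rule Infinite_Sum.abs_summable_on_comparison_test)
    show "(\<lambda>x. norm (?w x)) summable_on V"
      using iffD1[OF summable_on_iff_abs_summable_on_real sw] by simp
    show "norm (?e x) \<le> norm (?w x)" if "x \<in> V" for x using le[OF that] unfolding real_norm_def by linarith
  qed
  have sc: "?c summable_on V" and ic: "infsum ?c V = (\<Sum>x\<in>V0. core x)"
  proof -
    have "core summable_on V0" using V0 by simp
    then show "?c summable_on V" by (rule summable_on_cong_neutral[THEN iffD1, rotated -1]) (use V0 in auto)
    have "infsum ?c V = infsum core V0" by (rule infsum_cong_neutral) (use V0 in auto)
    then show "infsum ?c V = (\<Sum>x\<in>V0. core x)" using V0 by simp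
  qed
  have "infsum g V = infsum (\<lambda>x. ?e x + ?c x) V" by (rule infsum_cong) auto
  also have "\<dots> = infsum ?e V + infsum ?c V" by (rule infsum_add[OF se sc])
  finally have ig: "infsum g V - (\<Sum>x\<in>V0. core x) = infsum ?e V" using ic by simp
  have "infsum ?e V \<le> infsum ?w V" by (rule infsum_mono[OF se sw]) (use le in \<open>auto simp: abs_le_iff\<close>)
  moreover have "- infsum ?w V \<le> infsum ?e V"
  proof -
    have "infsum (\<lambda>x. - ?w x) V \<le> infsum ?e V"
    proof (rule infsum_mono[OF _ se])
      show "(\<lambda>x. - ?w x) summable_on V" using sw by (simp only: summable_on_uminus)
      show "- ?w x \<le> ?e x" if "x \<in> V" for x using le[OF that] by (simp only: abs_le_iff) linarith
    qed
    then show ?thesis by (simp only: infsum_uminus)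
  qed
  ultimately have main: "\<bar>infsum g V - (\<Sum>x\<in>V0. core x)\<bar> \<le> infsum ?w V" unfolding ig by simp
  have "infsum ?w V = 1 / s * infsum (\<lambda>x. ?k x * a x) V + s * infsum a ?B"
    unfolding infsum_add[OF sw1 sw2'] iw1 iw2' iw2 by simp
  also have "infsum (\<lambda>x. ?k x * a x) V = (\<Sum>x\<in>V0. ?k x * a x) + real D * infsum a ?B"
  proof -
    have "infsum (\<lambda>x. ?k x * a x) (V0 \<union> ?B) = infsum (\<lambda>x. ?k x * a x) V0 + infsum (\<lambda>x. ?k x * a x) ?B"
      using V0 by (intro infsum_Un_disjoint summable_on_subset_banach[OF s2]) auto
    moreover have "V0 \<union> ?B = V" using V0 by auto
    moreover have "infsum (\<lambda>x. ?k x * a x) ?B = infsum (\<lambda>x. real D * a x) ?B" using chD by (intro infsum_cong) simp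
    ultimately show ?thesis using V0 aB by (simp add: infsum_cmult_right)
  qed
  also have "1 / s * ((\<Sum>x\<in>V0. ?k x * a x) + real D * infsum a ?B) + s * infsum a ?B
    = (s + real D / s) * (infsum a ?B + (\<Sum>x\<in>V0. a x)) - (\<Sum>x\<in>V0. (s + (real D - ?k x) / s) * a x)"
    by (simp add: algebra_simps sum.distrib sum_distrib_left sum_divide_distrib add_divide_distrib diff_divide_distrib sum_subtractf)
  also have "infsum a ?B + (\<Sum>x\<in>V0. a x) = infsum a V"
  proof -
    have "infsum a (?B \<union> V0) = infsum a ?B + infsum a V0"
      using V0 aB by (intro infsum_Un_disjoint) auto
    moreover have "?B \<union> V0 = V" using V0 by auto
    ultimately show ?thesis using V0 by simp
  qed
  finally show ?thesis using main by simp
qed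

lemma abs_mult_le_weighted:
  fixes x y s :: real
  assumes "0 < s"
  shows "\<bar>x * y\<bar> \<le> (x\<^sup>2 / s + s * y\<^sup>2) / 2"
proof -
  have "0 \<le> (\<bar>x\<bar> - s * \<bar>y\<bar>)\<^sup>2" by simp
  then have "2 * s * \<bar>x * y\<bar> \<le> x\<^sup>2 + s\<^sup>2 * y\<^sup>2"
    by (simp add: power2_diff power_mult_distrib abs_mult mult_ac)
  then show ?thesis using assms by (simp add: field_simps power2_eq_square)
qed

section \<open>Adjacency operator of the tree extension\<close>

context half_edges
begin

definition core where "core E = core_graph N E"
definition ext where "ext E = ext_verts d (core E)"
definition roots :: "(nat \<times> nat list) set" where "roots = (\<lambda>v. (v, [])) ` {..<N}"
definition parent :: "nat \<times> nat list \<Rightarrow> nat \<times> nat list" where "parent x = (fst x, butlast (snd x))"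

lemma roots_subset: "roots \<subseteq> ext E"
  by (auto simp: roots_def ext_def ext_verts_def core_def core_graph_def)

lemma finite_roots [simp]: "finite roots" by (simp add: roots_def)

lemma ext_roots: "x \<in> ext E \<Longrightarrow> x \<in> roots \<longleftrightarrow> snd x = []"
  by (auto simp: roots_def ext_def ext_verts_def core_def core_graph_def)

lemma parent_ext: "x \<in> ext E - roots \<Longrightarrow> parent x \<in> ext E"
proof -
  assume x: "x \<in> ext E - roots"
  obtain v js where vj: "x = (v, js)" by (cases x)
  then have js: "js \<noteq> []" using x ext_roots[of x E] by auto
  have "hd (butlast js) = hd js" if "butlast js \<noteq> []" using that by (cases js) auto
  moreover have "set (tl (butlast js)) \<subseteq> set (tl js)" by (metis butlast_tl in_set_butlastD subsetI)
  ultimately show ?thesis using x vj js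
    by (auto simp: ext_def ext_verts_def parent_def)
qed

definition children where "children E x = {y \<in> ext E - roots. parent y = x}"

lemma children_root:
  assumes "v < N"
  shows "children E (v, []) = (\<lambda>i. (v, [i])) ` {..<d - degree (core E) v}"
  unfolding children_def
proof (intro equalityI subsetI)
  fix y assume y: "y \<in> {y \<in> ext E - roots. parent y = (v, [])}"
  obtain u js where uj: "y = (u, js)" by (cases y)
  have "js \<noteq> []" "u = v" "butlast js = []" using y uj ext_roots[of y E] by (auto simp: parent_def)
  then obtain i where "js = [i]" by (metis append_butlast_last_id append_Nil)
  then show "y \<in> (\<lambda>i. (v, [i])) ` {..<d - degree (core E) v}"
    using y uj \<open>u = v\<close> by (auto simp: ext_def ext_verts_def)
next
  fix y assume "y \<in> (\<lambda>i. (v, [i])) ` {..<d - degree (core E) v}"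
  then show "y \<in> {y \<in> ext E - roots. parent y = (v, [])}"
    using assms by (auto simp: ext_def ext_verts_def parent_def roots_def core_def core_graph_def)
qed

lemma children_tree:
  assumes "x \<in> ext E - roots"
  shows "children E x = (\<lambda>i. (fst x, snd x @ [i])) ` {..<d - 1}"
  unfolding children_def
proof (intro equalityI subsetI)
  have js: "snd x \<noteq> []" using assms ext_roots[of x E] by auto
  fix y assume y: "y \<in> {y \<in> ext E - roots. parent y = x}"
  obtain u js where uj: "y = (u, js)" by (cases y)
  have j: "js \<noteq> []" "u = fst x" "butlast js = snd x" using y uj ext_roots[of y E] by (auto simp: parent_def)
  then have jl: "js = snd x @ [last js]" by (metis append_butlast_last_id)
  have "set (tl js) \<subseteq> {..<d - 1}" using y uj by (auto simp: ext_def ext_verts_def)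
  moreover have "tl js = tl (snd x) @ [last js]" using jl js by (metis tl_append2)
  ultimately have "last js < d - 1" by auto
  then show "y \<in> (\<lambda>i. (fst x, snd x @ [i])) ` {..<d - 1}" using uj j jl by auto
next
  have js: "snd x \<noteq> []" using assms ext_roots[of x E] by auto
  fix y assume "y \<in> (\<lambda>i. (fst x, snd x @ [i])) ` {..<d - 1}"
  then show "y \<in> {y \<in> ext E - roots. parent y = x}"
    using assms js by (cases x) (auto simp: ext_def ext_verts_def parent_def roots_def)
qed

lemma card_children:
  "v < N \<Longrightarrow> card (children E (v, [])) = d - degree (core E) v"
  "x \<in> ext E - roots \<Longrightarrow> card (children E x) = d - 1"
  by (simp_all add: children_root children_tree card_image inj_on_def)

lemma finite_children: assumes "x \<in> ext E" shows "finite (children E x)"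
proof (cases "x \<in> roots")
  case True
  then obtain v where "v < N" "x = (v, [])" by (auto simp: roots_def)
  then show ?thesis by (simp add: children_root)
next
  case False
  then have "x \<in> ext E - roots" using assms by simp
  then show ?thesis by (simp add: children_tree)
qed

end

context bethe
begin

definition G where "G = inf_graph d N E"

lemma verts_G: "verts G = ext E"
  by (simp add: G_def inf_graph_def tree_extension_def ext_def core_def)

lemma edges_G: "edges G = Inl ` E \<union> Inr ` (ext E - roots)"
  using ext_roots by (auto simp: G_def inf_graph_def tree_extension_def ext_def core_def core_graph_def)

lemma ends_G: "ends G (Inl e) = image_mset (\<lambda>v. (v, [])) (image_mset fst (mset_set e))"
  "ends G (Inr x) = {#parent x, x#}"
  by (auto simp: G_def inf_graph_def tree_extension_def core_graph_def parent_def split: prod.split)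

lemma E_doubleton:
  assumes "e \<in> E"
  obtains h g where "e = {h, g}" "h \<noteq> g" "h \<in> X" "g \<in> X"
  using assms E by (fastforce simp: is_matching_def card_2_iff)

lemma finite_E [simp]: "finite E"
  by (rule finite_subset[of _ "Pow X"]) (use E in auto)

definition core_adj :: "nat \<Rightarrow> nat \<Rightarrow> real" where
  "core_adj u v = (if u = v then 2 else 1) * real (card {e \<in> E. image_mset fst (mset_set e) = {#u, v#}})"

text \<open>An edge between distinct vertices u and v corresponds to one ordered pair of half-edges,
  a loop to two; this is the factor 2 on the diagonal.\<close>

lemma core_adj_eq: "core_adj u v = (\<Sum>h\<in>{h \<in> X. fst h = u}. \<Sum>g\<in>{g \<in> X. fst g = v}. mate h g)"
proof -
  let ?P = "{(h, g). h \<in> X \<and> fst h = u \<and> g \<in> X \<and> fst g = v \<and> {h, g} \<in> E}"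
  let ?F = "{e \<in> E. image_mset fst (mset_set e) = {#u, v#}}"
  have finP: "finite ?P" by (rule finite_subset[of _ "X \<times> X"]) auto
  have "(\<Sum>h\<in>{h \<in> X. fst h = u}. \<Sum>g\<in>{g \<in> X. fst g = v}. mate h g)
    = (\<Sum>(h, g)\<in>{h \<in> X. fst h = u} \<times> {g \<in> X. fst g = v}. mate h g)" by (rule sum.cartesian_product)
  also have "\<dots> = real (card ?P)"
  proof -
    have "?P = {z \<in> {h \<in> X. fst h = u} \<times> {g \<in> X. fst g = v}. {fst z, snd z} \<in> E}" by auto
    then show ?thesis by (simp add: mate_def case_prod_unfold Int_def)
  qed
  also have "card ?P = (\<Sum>e\<in>?F. card {z \<in> ?P. {fst z, snd z} = e})"
  proof -
    have "(\<lambda>z. {fst z, snd z}) ` ?P \<subseteq> ?F"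
    proof
      fix e assume "e \<in> (\<lambda>z. {fst z, snd z}) ` ?P"
      then obtain h g where hg: "e = {h, g}" "fst h = u" "fst g = v" "e \<in> E" by auto
      then have "card e = 2" using E by (simp add: is_matching_def)
      then have "h \<noteq> g" using hg by auto
      then show "e \<in> ?F" using hg by auto
    qed
    then have "(\<Sum>z\<in>?P. 1 :: nat) = (\<Sum>e\<in>?F. \<Sum>z\<in>{z \<in> ?P. {fst z, snd z} = e}. 1)"
      using finP by (intro sum.group[symmetric]) auto
    then show ?thesis by simp
  qed
  also have "\<dots> = (\<Sum>e\<in>?F. if u = v then 2 else 1)"
  proof (rule sum.cong[OF refl])
    fix e assume e: "e \<in> ?F"
    then have "e \<in> E" by simp
    then obtain h g where hg: "e = {h, g}" "h \<noteq> g" "h \<in> X" "g \<in> X" by (rule E_doubleton)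
    then have ms: "{#fst h, fst g#} = {#u, v#}" using e by simp
    then have uv: "(fst h = u \<and> fst g = v) \<or> (fst h = v \<and> fst g = u)"
      by (auto simp: add_eq_conv_ex)
    have "{z \<in> ?P. {fst z, snd z} = e} = {z \<in> {(h, g), (g, h)}. fst (fst z) = u \<and> fst (snd z) = v}"
    proof (rule set_eqI)
      fix z :: "hedge \<times> hedge"
      obtain h' g' where z: "z = (h', g')" by (cases z)
      show "z \<in> {z \<in> ?P. {fst z, snd z} = e} \<longleftrightarrow> z \<in> {z \<in> {(h, g), (g, h)}. fst (fst z) = u \<and> fst (snd z) = v}"
        using hg(3,4) \<open>e \<in> E\<close> unfolding z hg(1) by (simp add: doubleton_eq_iff) (metis insert_commute)
    qed
    also have "\<dots> = (if u = v then {(h, g), (g, h)} else if fst h = u then {(h, g)} else {(g, h)})"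
      using uv by auto
    finally show "card {z \<in> ?P. {fst z, snd z} = e} = (if u = v then 2 else 1)"
      using hg by simp
  qed
  finally show ?thesis by (simp add: core_adj_def)
qed

lemma degree_core: "v < N \<Longrightarrow> real (degree (core E) v) = (\<Sum>h\<in>{h \<in> X. fst h = v}. kept h)"
proof -
  assume v: "v < N"
  have "degree (core E) v = (\<Sum>e\<in>E. card {h \<in> e. fst h = v})"
  proof -
    have "count (image_mset fst (mset_set e)) v = card {h \<in> e. fst h = v}" if "e \<in> E" for e
    proof -
      from that obtain h g where hg: "e = {h, g}" "h \<noteq> g" "h \<in> X" "g \<in> X" by (rule E_doubleton)
      have "{h' \<in> {h, g}. fst h' = v} = (if fst h = v then {h} else {}) \<union> (if fst g = v then {g} else {})" by auto
      then show ?thesis using hg by auto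
    qed
    then show ?thesis by (simp add: degree_def core_def core_graph_def)
  qed
  also have "\<dots> = card (\<Union>e\<in>E. {h \<in> e. fst h = v})"
  proof (rule card_UN_disjoint[symmetric])
    have "finite e" if "e \<in> E" for e using that by (rule E_doubleton) simp
    then show "\<forall>e\<in>E. finite {h \<in> e. fst h = v}" by simp
    show "\<forall>e\<in>E. \<forall>e'\<in>E. e \<noteq> e' \<longrightarrow> {h \<in> e. fst h = v} \<inter> {h \<in> e'. fst h = v} = {}"
    proof (intro ballI impI)
      fix e e' assume "e \<in> E" "e' \<in> E" "e \<noteq> e'"
      then have "e \<inter> e' = {}" using E disjointD unfolding is_matching_def by metis
      then show "{h \<in> e. fst h = v} \<inter> {h \<in> e'. fst h = v} = {}" by blast
    qed
  qed simp
  also have "(\<Union>e\<in>E. {h \<in> e. fst h = v}) = {h \<in> \<Union>E. fst h = v}" by auto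
  also have "\<dots> = {h \<in> {h \<in> X. fst h = v}. h \<in> \<Union>E}" using E(2) by auto
  finally have deg: "degree (core E) v = card {h \<in> {h \<in> X. fst h = v}. h \<in> \<Union>E}" .
  have "(\<Sum>h\<in>{h \<in> X. fst h = v}. kept h) = (\<Sum>h\<in>{h \<in> X. fst h = v}. of_bool (h \<in> \<Union>E))"
  proof (rule sum.cong[OF refl])
    fix h assume "h \<in> {h \<in> X. fst h = v}"
    then have h: "h \<in> X" by simp
    show "kept h = of_bool (h \<in> \<Union>E)"
    proof (cases "h \<in> \<Union>E")
      case True
      then obtain e where e: "e \<in> E" "h \<in> e" by auto
      from e(1) obtain h' g' where hg: "e = {h', g'}" "h' \<noteq> g'" "h' \<in> X" "g' \<in> X" by (rule E_doubleton)
      then obtain g where g: "e = {h, g}" "g \<in> X" using e(2) by (metis insertE insert_commute singletonD)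
      then have "mate h g = 1" using e by (simp add: mate_def)
      then have "(\<Sum>j\<in>X. mate h j) = (\<Sum>j\<in>X. of_bool (j = g) * 1)" using mate_eq[of h g] by simp
      also have "\<dots> = 1" by (rule sum_of_bool_eq[OF g(2)])
      finally show ?thesis using True by (simp add: kept_def)
    next
      case False
      then have "mate h g = 0" for g by (auto simp: mate_def)
      then show ?thesis using False by (simp add: kept_def)
    qed
  qed
  also have "\<dots> = real (card {h \<in> {h \<in> X. fst h = v}. h \<in> \<Union>E})"
    by (simp add: Int_def)
  finally show ?thesis using deg by simp
qed

lemma degree_le: "v < N \<Longrightarrow> degree (core E) v \<le> d"
proof -
  assume v: "v < N"
  have "(\<Sum>h\<in>{h \<in> X. fst h = v}. kept h) \<le> (\<Sum>h\<in>{h \<in> X. fst h = v}. 1)"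
    using mate_sums(1) by (intro sum_mono) force
  then show ?thesis using degree_core[OF v] card_fibre[OF v] by simp
qed

lemma parent_neq: "z \<in> ext E - roots \<Longrightarrow> parent z \<noteq> z"
proof
  assume z: "z \<in> ext E - roots" "parent z = z"
  then have "snd z \<noteq> []" using ext_roots[of z E] by auto
  moreover have "butlast (snd z) = snd z" using z(2) by (metis parent_def snd_conv)
  then have "length (snd z) - 1 = length (snd z)" by (metis length_butlast)
  ultimately show False by (cases "snd z") auto
qed

lemma adj_G:
  assumes x: "x \<in> ext E" and y: "y \<in> ext E"
  shows "adj G x y = (if x \<in> roots \<and> y \<in> roots then core_adj (fst x) (fst y) else 0)
    + of_bool (y \<in> children E x) + of_bool (x \<in> children E y)"
proof -
  define r where "r = (\<lambda>v::nat. (v, [] :: nat list))"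
  define A where "A = {e \<in> E. image_mset r (image_mset fst (mset_set e)) = {#x, y#}}"
  define B where "B = {z \<in> ext E - roots. {#parent z, z#} = {#x, y#}}"
  have B: "B = (if y \<in> children E x then {y} else {}) \<union> (if x \<in> children E y then {x} else {})"
    unfolding B_def by (auto simp: children_def add_eq_conv_ex)
  have fB: "finite B" unfolding B by simp
  have fA: "finite A" unfolding A_def by simp
  have xy: "x \<noteq> y" if "y \<in> children E x \<or> x \<in> children E y"
    using that parent_neq[of y] by (auto simp: children_def)
  have cB: "(if x = y then 2 else 1) * real (card B) = of_bool (y \<in> children E x) + of_bool (x \<in> children E y)"
    unfolding B by auto
  have cA: "(if x = y then 2 else 1) * real (card A) = (if x \<in> roots \<and> y \<in> roots then core_adj (fst x) (fst y) else 0)"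
  proof (cases "x \<in> roots \<and> y \<in> roots")
    case True
    then obtain u v where uv: "x = (u, [])" "y = (v, [])" by (auto simp: roots_def)
    have inj: "inj r" by (simp add: inj_def r_def)
    have "image_mset r K = {#x, y#} \<longleftrightarrow> K = {#u, v#}" for K
    proof -
      have "{#x, y#} = image_mset r {#u, v#}" using uv by (simp add: r_def)
      then show ?thesis using multiset.inj_map[OF inj] by (metis injD)
    qed
    then have "A = {e \<in> E. image_mset fst (mset_set e) = {#u, v#}}" unfolding A_def by (simp only:)
    then show ?thesis using True uv by (simp add: core_adj_def)
  next
    case False
    have "e \<notin> A" for e
    proof
      assume "e \<in> A"
      then have "image_mset r (image_mset fst (mset_set e)) = {#x, y#}" by (simp only: A_def mem_Collect_eq)
      then have "x \<in># image_mset r (image_mset fst (mset_set e))"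
        "y \<in># image_mset r (image_mset fst (mset_set e))" by (simp_all only:) auto
      then have "snd x = []" "snd y = []" by (auto simp: r_def)
      then show False using False x y ext_roots by blast
    qed
    then have "A = {}" by blast
    then show ?thesis using False by (simp only: card.empty) auto
  qed
  have "{e \<in> edges G. ends G e = {#x, y#}} = Inl ` A \<union> Inr ` B"
    unfolding edges_G A_def B_def r_def by (auto simp: ends_G simp del: multiset.map_comp)
  moreover have "Inl ` A \<inter> Inr ` B = {}" by blast
  ultimately have "card {e \<in> edges G. ends G e = {#x, y#}} = card A + card B"
    using fA fB by (simp add: card_Un_disjoint card_image)
  then have "adj G x y = (if x = y then 2 else 1) * real (card A) + (if x = y then 2 else 1) * real (card B)"
    by (simp add: adj_def)
  then show ?thesis unfolding cA cB by simp
qed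

lemma adj_op_G:
  assumes x: "x \<in> ext E"
  shows "adj_op G f x = (if x \<in> roots then (\<Sum>h\<in>{h \<in> X. fst h = fst x}. pull (\<lambda>v. f (v, [])) h) else 0)
    + (\<Sum>y\<in>children E x. f y) + (if x \<in> roots then 0 else f (parent x))"
proof -
  let ?P = "if x \<in> roots then {} else {parent x}"
  let ?F = "roots \<union> children E x \<union> ?P"
  let ?c = "\<lambda>y. if x \<in> roots \<and> y \<in> roots then core_adj (fst x) (fst y) else 0"
  have fin: "finite ?F" using finite_children[OF x] by simp
  have sub: "?F \<subseteq> ext E" using roots_subset parent_ext x by (auto simp: children_def)
  have par: "x \<in> children E y \<longleftrightarrow> y \<in> ?P" if "y \<in> ext E" for y
    using x by (auto simp: children_def)
  have "adj_op G f x = infsum (\<lambda>y. adj G x y * f y) (ext E)" by (simp add: adj_op_def verts_G)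
  also have "\<dots> = infsum (\<lambda>y. adj G x y * f y) ?F"
  proof (rule infsum_cong_neutral)
    fix y assume "y \<in> ext E - ?F"
    then show "adj G x y * f y = 0" using adj_G[OF x, of y] par[of y] by auto
  qed (use sub in auto)
  also have "\<dots> = (\<Sum>y\<in>?F. adj G x y * f y)" using fin by simp
  also have "\<dots> = (\<Sum>y\<in>?F. ?c y * f y + (of_bool (y \<in> children E x) * f y + of_bool (y \<in> ?P) * f y))"
  proof (rule sum.cong[OF refl])
    fix y assume "y \<in> ?F"
    then have "y \<in> ext E" using sub by blast
    then show "adj G x y * f y = ?c y * f y + (of_bool (y \<in> children E x) * f y + of_bool (y \<in> ?P) * f y)"
      using adj_G[OF x, of y] par[of y] by (simp add: algebra_simps)
  qed
  also have "\<dots> = (\<Sum>y\<in>?F. ?c y * f y) + ((\<Sum>y\<in>?F. of_bool (y \<in> children E x) * f y) + (\<Sum>y\<in>?F. of_bool (y \<in> ?P) * f y))"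
    by (simp only: sum.distrib)
  also have "(\<Sum>y\<in>?F. of_bool (y \<in> children E x) * f y) = (\<Sum>y\<in>children E x. f y)"
    using fin by (intro sum.mono_neutral_cong_right) auto
  also have "(\<Sum>y\<in>?F. of_bool (y \<in> ?P) * f y) = (\<Sum>y\<in>?P. f y)"
    using fin by (intro sum.mono_neutral_cong_right) auto
  also have "(\<Sum>y\<in>?P. f y) = (if x \<in> roots then 0 else f (parent x))" by simp
  also have "(\<Sum>y\<in>?F. ?c y * f y) = (\<Sum>y\<in>roots. ?c y * f y)"
    using fin by (intro sum.mono_neutral_right) auto
  also have "(\<Sum>y\<in>roots. ?c y * f y) = (if x \<in> roots then (\<Sum>v<N. core_adj (fst x) v * f (v, [])) else 0)"
    by (auto simp: roots_def sum.reindex inj_on_def)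
  also have "(\<Sum>v<N. core_adj (fst x) v * f (v, [])) = (\<Sum>h\<in>{h \<in> X. fst h = fst x}. pull (\<lambda>v. f (v, [])) h)"
  proof -
    have "(\<Sum>v<N. core_adj (fst x) v * f (v, []))
      = (\<Sum>v<N. \<Sum>h\<in>{h \<in> X. fst h = fst x}. \<Sum>g\<in>{g \<in> X. fst g = v}. mate h g * f (fst g, []))"
      unfolding core_adj_eq by (simp add: sum_distrib_right)
    also have "\<dots> = (\<Sum>h\<in>{h \<in> X. fst h = fst x}. \<Sum>v<N. \<Sum>g\<in>{g \<in> X. fst g = v}. mate h g * f (fst g, []))"
      by (rule sum.swap)
    also have "\<dots> = (\<Sum>h\<in>{h \<in> X. fst h = fst x}. pull (\<lambda>v. f (v, [])) h)"
      unfolding pull_def by (intro sum.cong refl sum_by_vertex[symmetric])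
    finally show ?thesis .
  qed
  finally show ?thesis by simp
qed

text \<open>The estimate is two-sided: the upper side, for general s, leads to the bound for
  \<lambda>_2; the lower side, for s = 1, shows that the infima in \<open>graph_lambda\<close> are
  taken over bounded sets.\<close>

lemma form_bound:
  assumes f: "f \<in> ell2 (ext E)" and s: "0 < s"
  defines "f0 \<equiv> \<lambda>v. f (v, [])"
  shows "\<bar>ell2_inner (ext E) f (adj_op G f) - (\<Sum>h\<in>X. pull f0 h * f0 (fst h))\<bar>
    \<le> (s + (real d - 1) / s) * ell2_inner (ext E) f f - (\<Sum>v<N. (s + (real (degree (core E) v) - 1) / s) * (f0 v)\<^sup>2)"
proof -
  let ?core = "\<lambda>x. f x * (\<Sum>h\<in>{h \<in> X. fst h = fst x}. pull f0 h)"
  let ?g = "\<lambda>x. f x * adj_op G f x"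
  let ?a = "\<lambda>x. (f x)\<^sup>2"
  have sum_roots: "(\<Sum>x\<in>roots. F x) = (\<Sum>v<N. F (v, []))" for F :: "_ \<Rightarrow> real"
    by (simp add: roots_def sum.reindex inj_on_def)
  have "\<bar>infsum ?g (ext E) - (\<Sum>x\<in>roots. ?core x)\<bar> \<le>
    (s + real (d - 1) / s) * infsum ?a (ext E) - (\<Sum>x\<in>roots. (s + (real (d - 1) - real (card (children E x))) / s) * ?a x)"
  proof (rule infsum_tree_bound[where p = parent and D' = d])
    show "children E x = {y \<in> ext E - roots. parent y = x}" for x by (simp add: children_def)
    show "roots \<subseteq> ext E" by (rule roots_subset)
    show "parent y \<in> ext E" if "y \<in> ext E - roots" for y using parent_ext[OF that] .
    show "finite (children E x) \<and> card (children E x) \<le> d" if "x \<in> ext E" for x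
    proof (cases "x \<in> roots")
      case True
      then show ?thesis using finite_children[OF that] card_children(1)[of "fst x" E] by (auto simp: roots_def)
    next
      case False
      then show ?thesis using finite_children[OF that] card_children(2)[of x E] that by simp
    qed
    show "card (children E x) = d - 1" if "x \<in> ext E - roots" for x using card_children(2)[OF that] .
    show "?a summable_on ext E" using f by (simp add: ell2_def)
    fix x assume x: "x \<in> ext E"
    have "?g x - (if x \<in> roots then ?core x else 0) = (\<Sum>y\<in>children E x. f x * f y) + (if x \<in> roots then 0 else f (parent x) * f x)"
      unfolding adj_op_G[OF x] f0_def by (simp add: algebra_simps sum_distrib_left)
    also have "\<bar>\<dots>\<bar> \<le> (\<Sum>y\<in>children E x. \<bar>f x * f y\<bar>) + (if x \<in> roots then 0 else \<bar>f (parent x) * f x\<bar>)"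
    proof -
      have "\<bar>\<Sum>y\<in>children E x. f x * f y\<bar> \<le> (\<Sum>y\<in>children E x. \<bar>f x * f y\<bar>)" by (rule sum_abs)
      then show ?thesis
        by (cases "x \<in> roots") (simp, simp only: if_False)
    qed
    also have "\<dots> \<le> (\<Sum>y\<in>children E x. (?a x / s + s * ?a y) / 2) + (if x \<in> roots then 0 else (?a (parent x) / s + s * ?a x) / 2)"
      using abs_mult_le_weighted[OF s] by (intro add_mono sum_mono) auto
    finally show "\<bar>?g x - (if x \<in> roots then ?core x else 0)\<bar> \<le>
       (\<Sum>y\<in>children E x. (?a x / s + s * ?a y) / 2) + (if x \<in> roots then 0 else (?a (parent x) / s + s * ?a x) / 2)" .
  qed (use s in auto)
  moreover have "(\<Sum>x\<in>roots. ?core x) = (\<Sum>h\<in>X. pull f0 h * f0 (fst h))"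
  proof -
    have "(\<Sum>x\<in>roots. ?core x) = (\<Sum>v<N. \<Sum>h\<in>{h \<in> X. fst h = v}. pull f0 h * f0 (fst h))"
      unfolding sum_roots by (simp add: f0_def sum_distrib_left mult.commute)
    then show ?thesis by (simp only: sum_by_vertex[symmetric])
  qed
  moreover have "(\<Sum>x\<in>roots. (s + (real (d - 1) - real (card (children E x))) / s) * ?a x)
    = (\<Sum>v<N. (s + (real (degree (core E) v) - 1) / s) * (f0 v)\<^sup>2)"
  proof -
    have "real (d - 1) - real (d - degree (core E) v) = real (degree (core E) v) - 1" if "v < N" for v
      using degree_le[OF that] d by simp
    then show ?thesis unfolding sum_roots by (simp add: card_children f0_def)
  qed
  moreover have "real (d - 1) = real d - 1" using d by simp
  moreover have "infsum ?a (ext E) = ell2_inner (ext E) f f" by (simp add: ell2_inner_def power2_eq_square)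
  ultimately show ?thesis by (simp add: ell2_inner_def)
qed

text \<open>Multiplied by s, the savings at the core vertices minus the core adjacency form are
  exactly the Bethe form.\<close>

lemma form_upper:
  assumes f: "f \<in> ell2 (ext E)" and s: "0 < s"
    and pos: "0 \<le> bethe_form s (\<lambda>v. f (v, [])) (\<lambda>v. f (v, []))"
  shows "ell2_inner (ext E) f (adj_op G f) \<le> (s + (real d - 1) / s) * ell2_inner (ext E) f f"
proof -
  let ?f0 = "\<lambda>v. f (v, [])"
  have "(\<Sum>h\<in>X. kept h * ?f0 (fst h) * ?f0 (fst h)) = (\<Sum>v<N. real (degree (core E) v) * (?f0 v)\<^sup>2)"
  proof -
    have "(\<Sum>h\<in>X. kept h * ?f0 (fst h) * ?f0 (fst h)) = (\<Sum>v<N. \<Sum>h\<in>{h \<in> X. fst h = v}. kept h * ?f0 (fst h) * ?f0 (fst h))"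
      by (rule sum_by_vertex)
    also have "\<dots> = (\<Sum>v<N. real (degree (core E) v) * (?f0 v)\<^sup>2)"
      using degree_core by (intro sum.cong) (auto simp: sum_distrib_right power2_eq_square mult.assoc)
    finally show ?thesis .
  qed
  then have "bethe_form s ?f0 ?f0 = s * ((\<Sum>v<N. (s + (real (degree (core E) v) - 1) / s) * (?f0 v)\<^sup>2) - (\<Sum>h\<in>X. pull ?f0 h * ?f0 (fst h)))"
    using s unfolding bethe_form_def
    by (simp add: algebra_simps sum_distrib_left sum.distrib sum_subtractf power2_eq_square diff_divide_distrib)
  then have "0 \<le> (\<Sum>v<N. (s + (real (degree (core E) v) - 1) / s) * (?f0 v)\<^sup>2) - (\<Sum>h\<in>X. pull ?f0 h * ?f0 (fst h))"
    using pos s by (simp add: zero_le_mult_iff)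
  then show ?thesis using form_bound[OF f s] by simp
qed

lemma form_lower:
  assumes f: "f \<in> ell2 (ext E)"
  shows "- (2 * real d) * ell2_inner (ext E) f f - \<bar>\<Sum>h\<in>X. pull (\<lambda>v. f (v, [])) h * f (fst h, [])\<bar> \<le> ell2_inner (ext E) f (adj_op G f)"
proof -
  have "0 \<le> (\<Sum>v<N. (1 + (real (degree (core E) v) - 1) / 1) * (f (v, []))\<^sup>2)" by (intro sum_nonneg) auto
  moreover have "0 \<le> ell2_inner (ext E) f f" unfolding ell2_inner_def by (intro infsum_nonneg) simp
  then have "(1 + (real d - 1) / 1) * ell2_inner (ext E) f f \<le> (2 * real d) * ell2_inner (ext E) f f"
    by (intro mult_right_mono) auto
  moreover note form_bound[OF f, of 1]
  ultimately show ?thesis by linarith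
qed

lemma form_bounded_below:
  assumes f: "f \<in> ell2 (ext E)"
  shows "- (3 * real d) * ell2_inner (ext E) f f \<le> ell2_inner (ext E) f (adj_op G f)"
proof -
  have "\<bar>\<Sum>h\<in>X. pull (\<lambda>v. f (v, [])) h * f (fst h, [])\<bar> \<le> real d * (\<Sum>v<N. (f (v, []))\<^sup>2)"
    by (rule sum_pull_bound)
  also have "(\<Sum>v<N. (f (v, []))\<^sup>2) = (\<Sum>x\<in>roots. (f x)\<^sup>2)"
    by (simp add: roots_def sum.reindex inj_on_def)
  also have "\<dots> \<le> infsum (\<lambda>x. (f x)\<^sup>2) (ext E)"
    using f roots_subset by (intro finite_sum_le_infsum) (auto simp: ell2_def)
  also have "\<dots> = ell2_inner (ext E) f f" by (simp add: ell2_inner_def power2_eq_square)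
  finally have "\<bar>\<Sum>h\<in>X. pull (\<lambda>v. f (v, [])) h * f (fst h, [])\<bar> \<le> real d * ell2_inner (ext E) f f"
    by (simp add: mult_left_mono)
  then show ?thesis using form_lower[OF f] by simp
qed

end

section \<open>Two-dimensional subspaces and the second min-max value\<close>

lemma subspace_dim2_kernel:
  fixes S :: "('v \<Rightarrow> real) set"
  assumes S: "fun_subspace S" "fun_dim S = 2"
    and \<phi>: "\<And>a b f g. \<phi> (\<lambda>x. a * f x + b * g x) = a * \<phi> f + b * (\<phi> g :: real)"
  obtains f where "f \<in> S" "f \<noteq> (\<lambda>x. 0)" "\<phi> f = 0"
proof -
  obtain B where B: "B \<subseteq> S" "\<not> fun_vs.dependent B" "card B = 2"
    using fun_vs.basis_exists[of S] S(2) by metis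
  then obtain f g where fg: "B = {f, g}" "f \<noteq> g" by (auto simp: card_2_iff)
  then have mem: "f \<in> S" "g \<in> S" using B by auto
  have z: "(\<lambda>x. 0) = (0 :: _ \<Rightarrow> real)" by (simp add: fun_eq_iff)
  have f0: "f \<noteq> (\<lambda>x. 0)" using B(2) fg fun_vs.dependent_zero[of B] unfolding z by auto
  show thesis
  proof (cases "\<phi> f = 0")
    case True
    then show thesis using that mem f0 by blast
  next
    case False
    define h where "h = (\<lambda>x. - \<phi> g * f x + \<phi> f * g x)"
    have "(\<lambda>x. - \<phi> g * f x) \<in> S" "(\<lambda>x. \<phi> f * g x) \<in> S"
      using fun_vs.subspace_scale[OF S(1) mem(1), of "- \<phi> g"] fun_vs.subspace_scale[OF S(1) mem(2)] by simp_all
    then have "h \<in> S" using fun_vs.subspace_add[OF S(1), of "\<lambda>x. - \<phi> g * f x" "\<lambda>x. \<phi> f * g x"]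
      by (simp add: h_def plus_fun_def)
    moreover have "\<phi> h = 0" unfolding h_def \<phi> by simp
    moreover have "h \<noteq> (\<lambda>x. 0)"
    proof
      assume h: "h = (\<lambda>x. 0)"
      have "g = (\<lambda>x. (\<phi> g / \<phi> f) * f x)"
      proof
        fix x
        have "h x = 0" by (simp add: h)
        then show "g x = (\<phi> g / \<phi> f) * f x" using False by (simp add: h_def field_simps)
      qed
      then have "g \<in> fun_vs.span {f}" using fun_vs.span_scale[OF fun_vs.span_base[of f "{f}"], of "\<phi> g / \<phi> f"] by simp
      moreover have "B - {g} = {f}" using fg by auto
      ultimately have "fun_vs.dependent B" using fg unfolding fun_vs.dependent_def by auto
      then show False using B by simp
    qed
    ultimately show thesis using that by blast
  qed
qed

lemma ell2_inner_pos:
  assumes f: "f \<in> ell2 V" "f \<noteq> (\<lambda>x. 0)"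
  shows "0 < ell2_inner V f f"
proof -
  obtain x where x: "f x \<noteq> 0" using f(2) by auto
  then have xV: "x \<in> V" using f(1) by (auto simp: ell2_def)
  have "0 < (\<Sum>y\<in>{x}. (f y)\<^sup>2)" using x by simp
  also have "\<dots> \<le> infsum (\<lambda>x. (f x)\<^sup>2) V"
    using f(1) xV by (intro finite_sum_le_infsum) (auto simp: ell2_def)
  finally show ?thesis by (simp add: ell2_inner_def power2_eq_square)
qed

lemma ell2_inner_scale: "ell2_inner V (\<lambda>x. a * f x) (\<lambda>x. b * g x) = a * b * ell2_inner V f g"
proof -
  have "ell2_inner V (\<lambda>x. a * f x) (\<lambda>x. b * g x) = (\<Sum>\<^sub>\<infinity>x\<in>V. (a * b) * (f x * g x))"
    unfolding ell2_inner_def by (intro infsum_cong) (simp only: mult_ac)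
  then show ?thesis by (simp only: infsum_cmult_right' ell2_inner_def)
qed

text \<open>The supremum in \<open>graph_lambda\<close> is over a nonempty set, without which it
  could not be bounded.\<close>

lemma dim2_subspace_exists:
  fixes V :: "'v set"
  assumes "x \<in> V" "y \<in> V" "x \<noteq> y"
  shows "\<exists>S. S \<subseteq> ell2 V \<and> fun_subspace S \<and> fun_dim S = 2"
proof -
  define \<delta> where "\<delta> = (\<lambda>(z :: 'v) w. of_bool (w = z) :: real)"
  have neq: "\<delta> x \<noteq> \<delta> y" using assms by (auto simp: \<delta>_def fun_eq_iff)
  define S where "S = fun_vs.span {\<delta> x, \<delta> y}"
  have S: "\<exists>a b. f = (\<lambda>w. a * \<delta> x w + b * \<delta> y w)" if "f \<in> S" for f
  proof -
    from that obtain a where "f - (\<lambda>w. a * \<delta> x w) \<in> fun_vs.span {\<delta> y}"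
      unfolding S_def fun_vs.span_insert by auto
    then obtain b where "f - (\<lambda>w. a * \<delta> x w) = (\<lambda>w. b * \<delta> y w)"
      unfolding fun_vs.span_singleton by auto
    then have "f = (\<lambda>w. a * \<delta> x w + b * \<delta> y w)" by (auto simp: algebra_simps)
    then show ?thesis by blast
  qed
  have indep: "\<not> fun_vs.dependent {\<delta> x, \<delta> y}"
  proof
    assume "fun_vs.dependent {\<delta> x, \<delta> y}"
    then have "\<delta> x \<in> fun_vs.span {\<delta> y} \<or> \<delta> y \<in> fun_vs.span {\<delta> x}"
      using neq unfolding fun_vs.dependent_def by (auto simp: insert_Diff_if)
    then obtain a where "\<delta> x = (\<lambda>w. a * \<delta> y w) \<or> \<delta> y = (\<lambda>w. a * \<delta> x w)"
      unfolding fun_vs.span_singleton by auto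
    then have "\<delta> x x = a * \<delta> y x \<or> \<delta> y y = a * \<delta> x y" by metis
    then show False using assms by (simp add: \<delta>_def)
  qed
  have "S \<subseteq> ell2 V"
  proof
    fix f assume "f \<in> S"
    then obtain a b where f: "f = (\<lambda>w. a * \<delta> x w + b * \<delta> y w)" using S by blast
    have "(\<lambda>w. (f w)\<^sup>2) summable_on V \<longleftrightarrow> (\<lambda>w. (f w)\<^sup>2) summable_on {x, y}"
      using assms by (intro summable_on_cong_neutral) (auto simp: f \<delta>_def)
    then show "f \<in> ell2 V" using assms by (auto simp: ell2_def f \<delta>_def)
  qed
  moreover have "fun_subspace S" unfolding S_def by (rule fun_vs.subspace_span)
  moreover have "fun_dim S = 2"
    unfolding S_def using fun_vs.dim_span_eq_card_independent[OF indep] neq by simp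
  ultimately show ?thesis by blast
qed

lemma (in bethe) graph_lambda_le:
  assumes s: "1 < s" and N: "2 \<le> N"
    and no_ev: "\<And>t x. s \<le> t \<Longrightarrow> 0 < sqnorm X x \<Longrightarrow> \<exists>h\<in>X. t * x h \<noteq> (\<Sum>g\<in>X. (mate h g - c) * (\<Sum>j\<in>siblings g. x j))"
  shows "graph_lambda 2 G \<le> s + (real d - 1) / s"
  unfolding graph_lambda_def verts_G
proof (rule cSUP_least)
  have "(0, []) \<in> ext E" "(1, []) \<in> ext E" using N roots_subset[of E] by (auto simp: roots_def)
  then show "{S. S \<subseteq> ell2 (ext E) \<and> fun_subspace S \<and> fun_dim S = 2} \<noteq> {}"
    using dim2_subspace_exists[of "(0, [])" "ext E" "(1, [])"] by auto
next
  fix S assume "S \<in> {S. S \<subseteq> ell2 (ext E) \<and> fun_subspace S \<and> fun_dim S = 2}"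
  then have S: "S \<subseteq> ell2 (ext E)" "fun_subspace S" "fun_dim S = 2" by auto
  \<comment> \<open>The functional whose kernel is the hyperplane of
    \<open>bethe_form_nonneg\<close>; every two-dimensional subspace contains a nonzero vector of
    that kernel.\<close>
  define \<phi> where "\<phi> f = total s (\<lambda>v. f (v, []))" for f :: "nat \<times> nat list \<Rightarrow> real"
  have \<phi>: "\<phi> (\<lambda>x. a * f x + b * g x) = a * \<phi> f + b * \<phi> g" for a b f g
    by (simp add: \<phi>_def total_def distrib_left sum.distrib sum_distrib_left mult.left_commute)
  obtain f where f: "f \<in> S" "f \<noteq> (\<lambda>x. 0)" "\<phi> f = 0"
    using subspace_dim2_kernel[where \<phi> = \<phi>, OF S(2,3) \<phi>] by metis
  define a where "a = 1 / ell2_norm (ext E) f"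
  define u where "u = (\<lambda>x. a * f x)"
  have pos: "0 < ell2_inner (ext E) f f" using ell2_inner_pos f S by blast
  have u: "u \<in> S" unfolding u_def using fun_vs.subspace_scale[OF S(2) f(1)] .
  have u1: "ell2_inner (ext E) u u = 1"
    unfolding u_def ell2_inner_scale using pos by (simp add: a_def ell2_norm_def)
  have "\<phi> u = 0" using \<phi>[of a f 0 f] f(3) by (simp add: u_def)
  then have "0 \<le> bethe_form s (\<lambda>v. u (v, [])) (\<lambda>v. u (v, []))"
    unfolding \<phi>_def by (intro bethe_form_nonneg[OF s no_ev])
  then have upper: "ell2_inner (ext E) u (adj_op G u) \<le> s + (real d - 1) / s"
    using form_upper[of u s] u S s u1 by auto
  have "bdd_below ((\<lambda>f. ell2_inner (ext E) f (adj_op G f)) ` {f \<in> S. ell2_norm (ext E) f = 1})"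
  proof (rule bdd_belowI2)
    fix g assume "g \<in> {f \<in> S. ell2_norm (ext E) f = 1}"
    then have "g \<in> ell2 (ext E)" "ell2_inner (ext E) g g = 1" using S by (auto simp: ell2_norm_def)
    then show "- (3 * real d) \<le> ell2_inner (ext E) g (adj_op G g)" using form_bounded_below[of g] by simp
  qed
  moreover have "u \<in> {f \<in> S. ell2_norm (ext E) f = 1}" using u u1 by (simp add: ell2_norm_def)
  ultimately have "(INF f \<in> {f \<in> S. ell2_norm (ext E) f = 1}. ell2_inner (ext E) f (adj_op G f)) \<le> ell2_inner (ext E) u (adj_op G u)"
    by (rule cINF_lower)
  then show "(INF f \<in> {f \<in> S. ell2_norm (ext E) f = 1}. ell2_inner (ext E) f (adj_op G f)) \<le> s + (real d - 1) / s"
    using upper by linarith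
qed

section \<open>Counting walks that run into a given set\<close>

lemma sum_UN_le_nonneg:
  fixes f :: "'b \<Rightarrow> real"
  assumes "finite I" "\<And>i. i \<in> I \<Longrightarrow> finite (A i)" "\<And>x. 0 \<le> f x"
  shows "(\<Sum>x\<in>(\<Union>i\<in>I. A i). f x) \<le> (\<Sum>i\<in>I. \<Sum>x\<in>A i. f x)"
  using assms(1,2)
proof (induction I)
  case (insert i I)
  have "(\<Sum>x\<in>(\<Union>i\<in>insert i I. A i). f x) = (\<Sum>x\<in>A i. f x) + (\<Sum>x\<in>(\<Union>i\<in>I. A i). f x) - (\<Sum>x\<in>A i \<inter> (\<Union>i\<in>I. A i). f x)"
    using insert by (simp add: sum_Un)
  also have "\<dots> \<le> (\<Sum>x\<in>A i. f x) + (\<Sum>x\<in>(\<Union>i\<in>I. A i). f x)" using assms(3) by (simp add: sum_nonneg)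
  finally show ?case using insert by simp
qed simp

context half_edges
begin

lemma card_siblings: "g \<in> X \<Longrightarrow> real (card (siblings g)) = real d - 1"
  using card_other_half_edges[of g] d by (simp add: siblings_def)

lemma nb_walks_last: "u \<in> nb_walks l k h \<Longrightarrow> snd (last u) \<in> X"
proof -
  assume u: "u \<in> nb_walks l k h"
  then have "last u \<in> set u" "set u \<subseteq> X \<times> X" by (auto simp: nb_walks_def)
  then have "last u \<in> X \<times> X" by blast
  then show ?thesis by (simp add: mem_Times_iff)
qed

lemma card_nb_walks:
  assumes h: "h \<in> X"
  shows "Suc k \<le> l \<Longrightarrow> real (card (nb_walks l (Suc k) h)) = (real d - 1) ^ k * n ^ Suc k"
proof (induction k)
  case 0
  show ?case using sum_nb_walks_1[OF h, of "\<lambda>_. 1 :: real" l] by (simp add: card_X n_def)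
next
  case (Suc k)
  have "real (card (nb_walks l (Suc (Suc k)) h))
    = (\<Sum>u\<in>nb_walks l (Suc k) h. \<Sum>j\<in>siblings (snd (last u)). \<Sum>g\<in>X. 1)"
    using sum_nb_walks_Suc[of "Suc k" l "\<lambda>_. 1 :: real" h] Suc by simp
  also have "\<dots> = (\<Sum>u\<in>nb_walks l (Suc k) h. (real d - 1) * n)"
    by (intro sum.cong refl) (simp add: card_siblings nb_walks_last card_X n_def)
  also have "\<dots> = real (card (nb_walks l (Suc k) h)) * ((real d - 1) * n)" by simp
  also have "\<dots> = (real d - 1) ^ Suc k * n ^ Suc (Suc k)" using Suc by simp
  finally show ?case .
qed

lemma card_half_edges_at: "finite U \<Longrightarrow> real (card {g \<in> X. fst g \<in> U}) \<le> real d * real (card U)"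
proof -
  assume U: "finite U"
  have "card {g \<in> X. fst g \<in> U} \<le> card (U \<times> {..<d})" using U by (intro card_mono) (auto simp: X_def)
  then show ?thesis by (simp add: card_cartesian_product mult.commute flip: of_nat_mult)
qed

lemma card_visited_le: "card (visited w k) \<le> Suc k" "finite (visited w k)"
proof -
  have "card (visited w k) \<le> Suc (card ((\<lambda>i. dst (w ! i)) ` {..<k}))"
    unfolding visited_def by (rule card_insert_le_m1) auto
  also have "\<dots> \<le> Suc k" using card_image_le[of "{..<k}" "\<lambda>i. dst (w ! i)"] by simp
  finally show "card (visited w k) \<le> Suc k" "finite (visited w k)" by (auto simp: visited_def)
qed

definition closing_at :: "nat set \<Rightarrow> dart list \<Rightarrow> bool" where
  "closing_at W w \<longleftrightarrow> dst (last w) \<in> W \<union> visited w (length w - 1)"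

text \<open>The last landing is restricted to W and at most k + 1 vertices of the walk, so one
  factor n is replaced by d times their number.\<close>

lemma card_closing_nb_walks:
  assumes h: "h \<in> X" and W: "finite W" and k: "Suc k \<le> l"
  shows "real (card {w \<in> nb_walks l (Suc k) h. closing_at W w})
    \<le> (real d - 1) ^ k * n ^ k * (real d * (real (card W) + real (Suc k)))"
proof -
  have U: "real (card {g \<in> X. fst g \<in> W \<union> U}) \<le> real d * (real (card W) + real (Suc k))" if "finite U" "card U \<le> Suc k" for U
  proof -
    have "real (card {g \<in> X. fst g \<in> W \<union> U}) \<le> real d * real (card (W \<union> U))"
      using that W by (intro card_half_edges_at) auto
    also have "\<dots> \<le> real d * real (card W + Suc k)" using card_Un_le[of W U] that by (intro mult_left_mono of_nat_mono) auto
    finally show ?thesis by (simp only: of_nat_add)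
  qed
  have "real (card {w \<in> nb_walks l (Suc k) h. closing_at W w}) = (\<Sum>w\<in>nb_walks l (Suc k) h. of_bool (closing_at W w))"
    by (simp add: Int_def)
  also have "\<dots> \<le> (real d - 1) ^ k * n ^ k * (real d * (real (card W) + real (Suc k)))"
  proof (cases k)
    case 0
    have "(\<Sum>w\<in>nb_walks l 1 h. of_bool (closing_at W w)) = (\<Sum>g\<in>X. of_bool (closing_at W [(h, g)]))"
      by (rule sum_nb_walks_1[OF h])
    also have "\<dots> = real (card {g \<in> X. fst g \<in> W \<union> {fst h}})"
      by (simp add: of_bool_def sum.If_cases Int_def closing_at_def visited_def dst_def src_def)
    also have "\<dots> \<le> real d * (real (card W) + real (Suc k))" by (rule U) auto
    finally show ?thesis using 0 by simp
  next
    case (Suc k')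
    have "(\<Sum>w\<in>nb_walks l (Suc k) h. of_bool (closing_at W w))
      = (\<Sum>u\<in>nb_walks l k h. \<Sum>j\<in>siblings (snd (last u)). \<Sum>g\<in>X. of_bool (closing_at W (u @ [(j, g)])))"
      using Suc k by (intro sum_nb_walks_Suc) auto
    also have "\<dots> \<le> (\<Sum>u\<in>nb_walks l k h. (real d - 1) * (real d * (real (card W) + real (Suc k))))"
    proof (rule sum_mono)
      fix u assume u: "u \<in> nb_walks l k h"
      then have lu: "length u = k" "u \<noteq> []" by (auto simp: nb_walks_def)
      have "(\<Sum>g\<in>X. of_bool (closing_at W (u @ [(j, g)]))) \<le> real d * (real (card W) + real (Suc k))" for j
      proof -
        have "visited (u @ [(j, g)]) k = visited u k" for g using lu by (auto simp: visited_def nth_append)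
        then have "(\<Sum>g\<in>X. of_bool (closing_at W (u @ [(j, g)]))) = real (card {g \<in> X. fst g \<in> W \<union> visited u k})"
          using lu by (simp add: of_bool_def sum.If_cases Int_def closing_at_def dst_def)
        then show ?thesis using U[OF card_visited_le(2,1)[of u k]] by simp
      qed
      then have "(\<Sum>j\<in>siblings (snd (last u)). \<Sum>g\<in>X. of_bool (closing_at W (u @ [(j, g)])))
        \<le> real (card (siblings (snd (last u)))) * (real d * (real (card W) + real (Suc k)))"
        by (intro sum_bounded_above) auto
      then show "(\<Sum>j\<in>siblings (snd (last u)). \<Sum>g\<in>X. of_bool (closing_at W (u @ [(j, g)])))
        \<le> (real d - 1) * (real d * (real (card W) + real (Suc k)))"
        by (simp add: card_siblings nb_walks_last[OF u])
    qed
    also have "\<dots> = real (card (nb_walks l (Suc k') h)) * ((real d - 1) * (real d * (real (card W) + real (Suc k))))"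
      by (simp add: Suc)
    also have "\<dots> = (real d - 1) ^ k * n ^ k * (real d * (real (card W) + real (Suc k)))"
      using card_nb_walks[OF h, of k' l] Suc k by simp
    finally show ?thesis .
  qed
  finally show ?thesis .
qed

text \<open>As in an ear decomposition, every vertex but the last is new and lies outside W. If W
  contains the support of F, then all edges of the walk are distinct and outside F, see
  \<open>card_ear\<close>, so the probability of a union of ears factorizes up to the bound (1 / n)
  per step.\<close>

definition ears :: "nat \<Rightarrow> nat set \<Rightarrow> hedge set set \<Rightarrow> nat set \<Rightarrow> dart list set" where
  "ears m A F W = {w. chain m w \<and> w \<noteq> [] \<and> length w \<le> m \<and> set w \<subseteq> X \<times> X \<and> src (hd w) \<in> A \<and>
     dart_edge (hd w) \<notin> F \<and> (\<forall>t<length w - 1. dst (w ! t) \<notin> W \<union> visited w t)}"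

definition support :: "hedge set set \<Rightarrow> nat set" where "support F = fst ` \<Union>F"

lemma ears_subset: "ears m A F W \<subseteq> (\<Union>h\<in>{h \<in> X. fst h \<in> A}. \<Union>k<m. nb_walks m (Suc k) h)"
proof
  fix w assume w: "w \<in> ears m A F W"
  then have "hd w \<in> X \<times> X" by (auto simp: ears_def)
  then have "fst (hd w) \<in> {h \<in> X. fst h \<in> A}" using w by (auto simp: ears_def src_def)
  moreover have "w \<in> nb_walks m (Suc (length w - 1)) (fst (hd w))" using w by (auto simp: ears_def nb_walks_def)
  moreover have "length w - 1 < m" using w by (cases w) (auto simp: ears_def)
  ultimately show "w \<in> (\<Union>h\<in>{h \<in> X. fst h \<in> A}. \<Union>k<m. nb_walks m (Suc k) h)" by blast
qed

lemma finite_ears [simp]: "finite (ears m A F W)"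
  by (rule finite_subset[OF ears_subset]) auto

lemma card_ear:
  assumes w: "w \<in> ears m A F W" and F: "finite F" "support F \<subseteq> W"
  shows "card (F \<union> dart_edge ` set w) = card F + length w"
proof -
  interpret chain_walk m w using w by unfold_locales (simp add: ears_def)
  have w': "w \<noteq> []" "length w \<le> m" "dart_edge (hd w) \<notin> F" "\<And>t. t < length w - 1 \<Longrightarrow> dst (w ! t) \<notin> W \<union> visited w t"
    using w by (auto simp: ears_def)
  have nd: "\<not> m dvd t" if "0 < t" "t < length w" for t using that w'(2) by (auto dest: dvd_imp_le)
  have new: "new_step w t" if t: "t < length w" for t
  proof (cases "t = 0")
    case False
    then have "fresh_step w (t - 1)" using fresh_iff[of "t - 1"] w'(4)[of "t - 1"] t by auto
    then show ?thesis using new_after_fresh[of t] False t nd by auto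
  qed (simp add: new_step_def)
  have "F \<inter> dart_edge ` set w = {}"
  proof (rule ccontr)
    assume "F \<inter> dart_edge ` set w \<noteq> {}"
    then obtain x where "x \<in> set w" "dart_edge x \<in> F" by blast
    then obtain t where t: "t < length w" "dart_edge (w ! t) \<in> F" by (metis in_set_conv_nth)
    then have "t \<noteq> 0" using w' by (metis hd_conv_nth)
    then have "src (w ! t) = dst (w ! (t - 1))" "t - 1 < length w - 1" using src_dst[of t] t by auto
    then have "src (w ! t) \<notin> W" using w'(4)[of "t - 1"] by auto
    moreover have "src (w ! t) \<in> support F" using t(2) by (auto simp: support_def src_def dart_edge_def)
    ultimately show False using F by auto
  qed
  then have "card (F \<union> dart_edge ` set w) = card F + card (dart_edge ` set w)" using F by (simp add: card_Un_disjoint)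
  also have "card (dart_edge ` set w) = length w"
  proof -
    have "{t. t < length w \<and> new_step w t} = {..<length w}" using new by auto
    then show ?thesis by (simp add: card_edges)
  qed
  finally show ?thesis .
qed

text \<open>The weight of an ear is the bound for the probability of its edges.\<close>

lemma sum_ears:
  assumes A: "finite A"
  shows "(\<Sum>w\<in>ears m A F W. (1 / n) ^ length w) \<le> real d * real (card A) * (real m * (real d - 1) ^ m)"
proof -
  have d1: "1 \<le> real d - 1" using d by simp
  have "(\<Sum>w\<in>ears m A F W. (1 / n) ^ length w) \<le> (\<Sum>w\<in>(\<Union>h\<in>{h \<in> X. fst h \<in> A}. \<Union>k<m. nb_walks m (Suc k) h). (1 / n) ^ length w)"
    using n_pos by (intro sum_mono2 ears_subset) auto
  also have "\<dots> \<le> (\<Sum>h\<in>{h \<in> X. fst h \<in> A}. \<Sum>w\<in>(\<Union>k<m. nb_walks m (Suc k) h). (1 / n) ^ length w)"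
    using n_pos by (intro sum_UN_le_nonneg) auto
  also have "\<dots> \<le> (\<Sum>h\<in>{h \<in> X. fst h \<in> A}. \<Sum>k<m. \<Sum>w\<in>nb_walks m (Suc k) h. (1 / n) ^ length w)"
    using n_pos by (intro sum_mono sum_UN_le_nonneg) auto
  also have "\<dots> \<le> (\<Sum>h\<in>{h \<in> X. fst h \<in> A}. \<Sum>k<m. (real d - 1) ^ m)"
  proof (intro sum_mono)
    fix h k assume hk: "h \<in> {h \<in> X. fst h \<in> A}" "k \<in> {..<m}"
    have "(\<Sum>w\<in>nb_walks m (Suc k) h. (1 / n) ^ length w) = (\<Sum>w\<in>nb_walks m (Suc k) h. (1 / n) ^ Suc k)"
      by (intro sum.cong) (auto simp: nb_walks_def)
    also have "\<dots> = (real d - 1) ^ k" using card_nb_walks[of h k m] hk n_pos by (simp add: power_divide)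
    also have "\<dots> \<le> (real d - 1) ^ m" using hk d1 by (intro power_increasing) auto
    finally show "(\<Sum>w\<in>nb_walks m (Suc k) h. (1 / n) ^ length w) \<le> (real d - 1) ^ m" .
  qed
  also have "\<dots> = real (card {h \<in> X. fst h \<in> A}) * (real m * (real d - 1) ^ m)" by simp
  also have "\<dots> \<le> real d * real (card A) * (real m * (real d - 1) ^ m)"
    using card_half_edges_at[OF A] d1 by (intro mult_right_mono) auto
  finally show ?thesis .
qed

text \<open>As \<open>sum_ears\<close>, but the restricted last landing yields a factor 1 /
  n.\<close>

lemma sum_closing_ears:
  assumes A: "finite A" and W: "finite W"
  shows "(\<Sum>w\<in>{w \<in> ears m A F W. closing_at W w}. (1 / n) ^ length w)
    \<le> real d * real (card A) * (real m * ((real d - 1) ^ m * (real d * (real (card W) + real m)) / n))"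
proof -
  have d1: "1 \<le> real d - 1" using d by simp
  let ?B = "\<lambda>k h. {w \<in> nb_walks m (Suc k) h. closing_at W w}"
  have "{w \<in> ears m A F W. closing_at W w} \<subseteq> (\<Union>h\<in>{h \<in> X. fst h \<in> A}. \<Union>k<m. ?B k h)"
  proof
    fix w assume w: "w \<in> {w \<in> ears m A F W. closing_at W w}"
    then have "w \<in> ears m A F W" by simp
    then have "w \<in> (\<Union>h\<in>{h \<in> X. fst h \<in> A}. \<Union>k<m. nb_walks m (Suc k) h)" by (rule subsetD[OF ears_subset])
    then obtain h where "h \<in> {h \<in> X. fst h \<in> A}" "w \<in> (\<Union>k<m. nb_walks m (Suc k) h)" by (rule UN_E)
    moreover from this(2) obtain k where "k \<in> {..<m}" "w \<in> nb_walks m (Suc k) h" by (rule UN_E)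
    ultimately show "w \<in> (\<Union>h\<in>{h \<in> X. fst h \<in> A}. \<Union>k<m. ?B k h)" using w by (intro UN_I[of h] UN_I[of k]) auto
  qed
  then have "(\<Sum>w\<in>{w \<in> ears m A F W. closing_at W w}. (1 / n) ^ length w)
     \<le> (\<Sum>w\<in>(\<Union>h\<in>{h \<in> X. fst h \<in> A}. \<Union>k<m. ?B k h). (1 / n) ^ length w)"
    using n_pos by (intro sum_mono2) auto
  also have "\<dots> \<le> (\<Sum>h\<in>{h \<in> X. fst h \<in> A}. \<Sum>w\<in>(\<Union>k<m. ?B k h). (1 / n) ^ length w)"
    using n_pos by (intro sum_UN_le_nonneg) auto
  also have "\<dots> \<le> (\<Sum>h\<in>{h \<in> X. fst h \<in> A}. \<Sum>k<m. \<Sum>w\<in>?B k h. (1 / n) ^ length w)"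
    using n_pos by (intro sum_mono sum_UN_le_nonneg) auto
  also have "\<dots> \<le> (\<Sum>h\<in>{h \<in> X. fst h \<in> A}. \<Sum>k<m. (real d - 1) ^ m * (real d * (real (card W) + real m)) / n)"
  proof (intro sum_mono)
    fix h k assume hk: "h \<in> {h \<in> X. fst h \<in> A}" "k \<in> {..<m}"
    have "(\<Sum>w\<in>?B k h. (1 / n) ^ length w) = (\<Sum>w\<in>?B k h. (1 / n) ^ Suc k)"
      by (intro sum.cong) (auto simp: nb_walks_def)
    also have "\<dots> = real (card (?B k h)) * (1 / n) ^ Suc k" by simp
    also have "\<dots> \<le> ((real d - 1) ^ k * n ^ k * (real d * (real (card W) + real (Suc k)))) * (1 / n) ^ Suc k"
      using hk W n_pos by (intro mult_right_mono card_closing_nb_walks) auto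
    also have "\<dots> = (real d - 1) ^ k * (real d * (real (card W) + real (Suc k))) * (n ^ k * (1 / n) ^ Suc k)"
      by (simp only: mult_ac)
    also have "n ^ k * (1 / n) ^ Suc k = 1 / n" by (simp add: power_divide)
    also have "(real d - 1) ^ k * (real d * (real (card W) + real (Suc k))) * (1 / n) = (real d - 1) ^ k * (real d * (real (card W) + real (Suc k))) / n"
      by simp
    also have "\<dots> \<le> (real d - 1) ^ m * (real d * (real (card W) + real m)) / n"
      using hk d1 n_pos by (intro divide_right_mono mult_mono power_increasing mult_left_mono) auto
    finally show "(\<Sum>w\<in>?B k h. (1 / n) ^ length w) \<le> (real d - 1) ^ m * (real d * (real (card W) + real m)) / n" .
  qed
  also have "\<dots> = real (card {h \<in> X. fst h \<in> A}) * (real m * ((real d - 1) ^ m * (real d * (real (card W) + real m)) / n))" by simp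
  also have "\<dots> \<le> real d * real (card A) * (real m * ((real d - 1) ^ m * (real d * (real (card W) + real m)) / n))"
    using card_half_edges_at[OF A] d1 n_pos by (intro mult_right_mono) auto
  finally show ?thesis .
qed

text \<open>The walk is cut at its first arrival in W or at a vertex of its own.\<close>

lemma truncated_ear:
  assumes w: "chain m w" "length w \<le> m" "set w \<subseteq> X \<times> X" "w \<noteq> []" "src (hd w) \<in> A" "dart_edge (hd w) \<notin> F"
    and hit: "closing_at W w"
  obtains k where "0 < k" "k \<le> length w" "take k w \<in> ears m A F W" "closing_at W (take k w)"
proof -
  define t where "t = (LEAST t. t < length w \<and> dst (w ! t) \<in> W \<union> visited w t)"
  have "length w - 1 < length w \<and> dst (w ! (length w - 1)) \<in> W \<union> visited w (length w - 1)"
    using hit w(4) by (simp add: closing_at_def last_conv_nth)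
  then have t: "t < length w" "dst (w ! t) \<in> W \<union> visited w t" unfolding t_def by (metis (mono_tags, lifting) LeastI)+
  have min: "dst (w ! i) \<notin> W \<union> visited w i" if "i < t" for i
    using not_less_Least[of i "\<lambda>t. t < length w \<and> dst (w ! t) \<in> W \<union> visited w t"] that t unfolding t_def by auto
  have vis: "visited (take (Suc t) w) i = visited w i" if "i \<le> t" for i
    using that by (auto simp: visited_def)
  have "last (take (Suc t) w) = w ! t" using t by (simp add: take_Suc_conv_app_nth)
  then have "closing_at W (take (Suc t) w)" using t vis[of t] by (simp add: closing_at_def)
  moreover have "take (Suc t) w \<in> ears m A F W"
    using w t min vis set_take_subset[of "Suc t" w] by (auto simp: ears_def chain_take)
  ultimately show thesis using that[of "Suc t"] t by auto
qed

end

section \<open>Short cycles in sparse random edge sets\<close>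

context half_edges
begin

lemma near_cycle_subset: "near_cycle l E \<subseteq> {..<N}"
proof
  fix v assume "v \<in> near_cycle l E"
  then obtain w where w: "w \<in> real_walks l E" "src (hd w) = v" by (auto simp: near_cycle_def)
  then have "hd w \<in> X \<times> X" by (auto simp: real_walks_def)
  then show "v \<in> {..<N}" using w(2) by (auto simp: src_def X_def)
qed

definition grow :: "nat set \<Rightarrow> dart list \<Rightarrow> nat set" where "grow W w = W \<union> dst ` set w"
text \<open>The empty walk covers the case that the target has been explored already.\<close>

definition openings where "openings m W F = insert [] (ears m W F W)"
definition closures where "closures m W F = {w \<in> ears m W F W. closing_at W w}"

definition explored :: "nat \<Rightarrow> nat \<Rightarrow> nat set \<Rightarrow> hedge set set \<Rightarrow> bool" where
  "explored m j W F \<longleftrightarrow> finite W \<and> finite F \<and> support F \<subseteq> W \<and> card W \<le> 1 + j * m \<and> card F \<le> j * m"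

lemma finite_openings [simp]: "finite (openings m W F)" "finite (closures m W F)"
  by (auto simp: openings_def closures_def)

lemma closures_subset: "closures m W F \<subseteq> openings m W F"
  by (auto simp: openings_def closures_def)

lemma support_ear:
  assumes w: "w \<in> ears m A F W" and "A \<subseteq> V" "support F \<subseteq> V"
  shows "support (F \<union> dart_edge ` set w) \<subseteq> V \<union> dst ` set w"
proof -
  interpret chain_walk m w using w by unfold_locales (simp add: ears_def)
  have ne: "w \<noteq> []" "src (hd w) \<in> A" using w by (auto simp: ears_def)
  have src: "src x \<in> V \<union> dst ` set w" if "x \<in> set w" for x
  proof -
    from that obtain t where t: "t < length w" "x = w ! t" by (metis in_set_conv_nth)
    then have "src x \<in> visited w t" using src_visited by simp
    then show ?thesis using ne assms(2) t by (auto simp: visited_def hd_conv_nth)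
  qed
  have *: "fst ` dart_edge x = {src x, dst x}" for x by (simp add: dart_edge_def src_def dst_def)
  have "support (F \<union> dart_edge ` set w) = support F \<union> (\<Union>x\<in>set w. fst ` dart_edge x)" by (simp add: support_def image_Un image_UN)
  also have "\<dots> \<subseteq> V \<union> dst ` set w" unfolding * using src assms(3) by blast
  finally show ?thesis .
qed

lemma explored_grow:
  assumes W: "explored m j W F" and w: "w \<in> openings m W F"
  shows "explored m (Suc j) (grow W w) (F \<union> dart_edge ` set w)"
    and "card (F \<union> dart_edge ` set w) = card F + length w"
proof -
  have ear: "support (F \<union> dart_edge ` set w) \<subseteq> grow W w \<and> card (F \<union> dart_edge ` set w) = card F + length w \<and> length w \<le> m"
  proof (cases "w = []")
    case False
    then have w': "w \<in> ears m W F W" using w by (simp add: openings_def)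
    then show ?thesis using support_ear[OF w', of W] card_ear[OF w'] W by (auto simp: explored_def grow_def ears_def)
  qed (use W in \<open>simp add: explored_def grow_def\<close>)
  have "card (grow W w) \<le> card W + length w"
    using card_Un_le[of W "dst ` set w"] card_image_le[of "set w" dst] card_length[of w] unfolding grow_def by simp
  then show "explored m (Suc j) (grow W w) (F \<union> dart_edge ` set w)"
    using ear W by (auto simp: explored_def grow_def)
  show "card (F \<union> dart_edge ` set w) = card F + length w" using ear by simp
qed

text \<open>Two cycles near v, built in four stages: a path to the first cycle, the closing of that
  cycle, then the same for the second, each stage an ear over what is already explored. The explicit
  vertex and edge sets let a union bound peel off one stage at a time; each closure costs a factor 1
  / n.\<close>

definition tangled :: "nat \<Rightarrow> nat \<Rightarrow> hedge set set \<Rightarrow> bool" where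
  "tangled m v E \<longleftrightarrow>
    (\<exists>w1\<in>openings m {v} {}. let W1 = grow {v} w1; F1 = {} \<union> dart_edge ` set w1 in
     \<exists>w2\<in>closures m W1 F1. let W2 = grow W1 w2; F2 = F1 \<union> dart_edge ` set w2 in
     \<exists>w3\<in>openings m W2 F2. let W3 = grow W2 w3; F3 = F2 \<union> dart_edge ` set w3 in
     \<exists>w4\<in>closures m W3 F3. F3 \<union> dart_edge ` set w4 \<subseteq> E)"

end

text \<open>All that matters of the law in this part: up to K prescribed edges are no more likely
  than with independent edges of probability 1 / n.\<close>

locale sparse_edges = half_edges +
  fixes P :: "hedge set set pmf" and K :: nat
  assumes prob_edges: "finite F \<Longrightarrow> card F \<le> K \<Longrightarrow> measure_pmf.prob P {E. F \<subseteq> E} \<le> (1 / n) ^ card F"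
    and finite_P: "finite (set_pmf P)"
begin

lemma card_support:
  assumes "finite F" "F \<subseteq> range dart_edge"
  shows "finite (support F)" "card (support F) \<le> 2 * card F"
proof -
  have *: "finite (fst ` e)" "card (fst ` e) \<le> 2" if "e \<in> F" for e
  proof -
    have "\<exists>x. e = {fst x, snd x}" using that assms(2) unfolding dart_edge_def by blast
    then obtain h g where "e = {h, g}" by blast
    then show "finite (fst ` e)" "card (fst ` e) \<le> 2" by (auto simp: card_insert_if)
  qed
  have eq: "support F = (\<Union>e\<in>F. fst ` e)" by (auto simp: support_def)
  show "finite (support F)" unfolding eq using assms(1) * by auto
  have "card (support F) \<le> (\<Sum>e\<in>F. card (fst ` e))" unfolding eq by (rule card_UN_le) (rule assms(1))
  also have "\<dots> \<le> (\<Sum>e\<in>F. 2)" by (rule sum_mono) (rule *)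
  finally show "card (support F) \<le> 2 * card F" by simp
qed

text \<open>A walk that witnesses a vertex outside W begins with an edge outside F; cut at its first
  return, it is a closing ear.\<close>

lemma near_cycle_ears:
  assumes F: "finite F" "support F \<subseteq> W" and W: "finite W"
  shows "card (near_cycle l E) \<le> card W + card {w \<in> {w \<in> ears l {..<N} F W. closing_at W w}. dart_edge ` set w \<subseteq> E}"
proof -
  let ?C = "{w \<in> {w \<in> ears l {..<N} F W. closing_at W w}. dart_edge ` set w \<subseteq> E}"
  have "near_cycle l E \<subseteq> W \<union> (\<lambda>w. src (hd w)) ` ?C"
  proof
    fix v assume v: "v \<in> near_cycle l E"
    then obtain w where w: "w \<in> real_walks l E" "src (hd w) = v" "dst (last w) \<in> visited w (length w - 1)"
      by (auto simp: near_cycle_def)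
    show "v \<in> W \<union> (\<lambda>w. src (hd w)) ` ?C"
    proof (cases "v \<in> W")
      case False
      have "dart_edge (hd w) \<notin> F"
      using w(2) False F by (auto simp: support_def src_def dart_edge_def)
      moreover have "closing_at W w" using w by (simp add: closing_at_def)
      moreover have "v \<in> {..<N}" using v near_cycle_subset by blast
      ultimately obtain k where k: "0 < k" "k \<le> length w" "take k w \<in> ears l {..<N} F W" "closing_at W (take k w)"
        using truncated_ear[of l w "{..<N}" F W] w(1,2) unfolding real_walks_def by blast
      have "dart_edge ` set (take k w) \<subseteq> E" using w(1) set_take_subset[of k w] by (auto simp: real_walks_def)
      moreover have "src (hd (take k w)) = v" using k w(2) by simp
      ultimately have "take k w \<in> ?C" using k by simp
      then show ?thesis using \<open>src (hd (take k w)) = v\<close> by blast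
    qed simp
  qed
  then have "card (near_cycle l E) \<le> card (W \<union> (\<lambda>w. src (hd w)) ` ?C)" using W by (intro card_mono) auto
  also have "\<dots> \<le> card W + card ((\<lambda>w. src (hd w)) ` ?C)" by (rule card_Un_le)
  also have "card ((\<lambda>w. src (hd w)) ` ?C) \<le> card ?C" by (rule card_image_le) simp
  finally show ?thesis by simp
qed

lemma integrable_P [simp]: "integrable P (g :: _ \<Rightarrow> real)"
  by (intro integrable_measure_pmf_finite finite_P)

text \<open>The moment is unfolded one factor at a time, with F the edges revealed so far. A further
  vertex lies in the support of F, of size at most 2 K, or is witnessed by a closing ear, whose
  edges are added to F. T bounds the total weight of one round; since the ear may start at any of
  the N vertices, the factor d N cancels the 1 / n of closing.\<close>

lemma near_cycle_moment:
  fixes l :: nat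
  defines "T \<equiv> 2 * real K + real l * (real d - 1) ^ l * (real d * (2 * real K + real l))"
  shows "finite F \<Longrightarrow> F \<subseteq> range dart_edge \<Longrightarrow> card F + M * l \<le> K \<Longrightarrow>
    measure_pmf.expectation P (\<lambda>E. of_bool (F \<subseteq> E) * real (card (near_cycle l E)) ^ M) \<le> (1 / n) ^ card F * T ^ M"
proof (induction M arbitrary: F)
  case 0
  have "(\<lambda>E. of_bool (F \<subseteq> E) :: real) = indicator {E. F \<subseteq> E}" by auto
  then show ?case using prob_edges[of F] 0 by simp
next
  case (Suc M)
  have d1: "1 \<le> real d - 1" using d by simp
  have T0: "0 \<le> T" unfolding T_def using d1 by auto
  define W where "W = support F"
  have W: "finite W" "card W \<le> 2 * card F" "support F \<subseteq> W" using card_support[OF Suc.prems(1,2)] by (auto simp: W_def)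
  define C where "C = {w \<in> ears l {..<N} F W. closing_at W w}"
  have C: "finite C" by (simp add: C_def)
  have F': "card (F \<union> dart_edge ` set w) = card F + length w" "length w \<le> l" if "w \<in> C" for w
    using that card_ear[of w l "{..<N}" F W] Suc.prems(1) W(3) by (auto simp: C_def ears_def)
  let ?f = "\<lambda>F E. of_bool (F \<subseteq> E) * real (card (near_cycle l E)) ^ M"
  have "measure_pmf.expectation P (\<lambda>E. of_bool (F \<subseteq> E) * real (card (near_cycle l E)) ^ Suc M)
    \<le> measure_pmf.expectation P (\<lambda>E. real (card W) * ?f F E + (\<Sum>w\<in>C. ?f (F \<union> dart_edge ` set w) E))"
  proof (rule integral_mono)
    fix E
    have "card (near_cycle l E) \<le> card W + card {w \<in> C. dart_edge ` set w \<subseteq> E}"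
      unfolding C_def by (rule near_cycle_ears[OF Suc.prems(1) W(3,1)])
    then have "real (card (near_cycle l E)) \<le> real (card W) + real (card {w \<in> C. dart_edge ` set w \<subseteq> E})"
      by linarith
    then have "?f F E * real (card (near_cycle l E)) \<le> ?f F E * (real (card W) + real (card {w \<in> C. dart_edge ` set w \<subseteq> E}))"
      by (intro mult_left_mono) auto
    also have "real (card {w \<in> C. dart_edge ` set w \<subseteq> E}) = (\<Sum>w\<in>C. of_bool (dart_edge ` set w \<subseteq> E))"
      using C by (simp add: Int_def)
    also have "?f F E * (real (card W) + (\<Sum>w\<in>C. of_bool (dart_edge ` set w \<subseteq> E)))
      = real (card W) * ?f F E + (\<Sum>w\<in>C. ?f F E * of_bool (dart_edge ` set w \<subseteq> E))"
      by (simp add: distrib_left sum_distrib_left)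
    also have "(\<Sum>w\<in>C. ?f F E * of_bool (dart_edge ` set w \<subseteq> E)) = (\<Sum>w\<in>C. ?f (F \<union> dart_edge ` set w) E)"
      by (intro sum.cong) auto
    finally show "of_bool (F \<subseteq> E) * real (card (near_cycle l E)) ^ Suc M \<le> real (card W) * ?f F E + (\<Sum>w\<in>C. ?f (F \<union> dart_edge ` set w) E)"
      by (simp add: mult_ac)
  qed simp_all
  also have "\<dots> = real (card W) * measure_pmf.expectation P (?f F) + (\<Sum>w\<in>C. measure_pmf.expectation P (?f (F \<union> dart_edge ` set w)))"
    by (subst Bochner_Integration.integral_add) (simp_all add: Bochner_Integration.integral_sum)
  also have "\<dots> \<le> real (card W) * ((1 / n) ^ card F * T ^ M) + (\<Sum>w\<in>C. (1 / n) ^ card F * T ^ M * (1 / n) ^ length w)"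
  proof (intro add_mono mult_left_mono sum_mono)
    show "measure_pmf.expectation P (?f F) \<le> (1 / n) ^ card F * T ^ M" using Suc.prems by (intro Suc.IH) auto
    fix w assume w: "w \<in> C"
    have "measure_pmf.expectation P (?f (F \<union> dart_edge ` set w)) \<le> (1 / n) ^ card (F \<union> dart_edge ` set w) * T ^ M"
      using Suc.prems F'[OF w] by (intro Suc.IH) auto
    then show "measure_pmf.expectation P (?f (F \<union> dart_edge ` set w)) \<le> (1 / n) ^ card F * T ^ M * (1 / n) ^ length w"
      unfolding F'(1)[OF w] by (simp add: power_add mult_ac)
  qed simp
  also have "\<dots> = (1 / n) ^ card F * T ^ M * (real (card W) + (\<Sum>w\<in>C. (1 / n) ^ length w))"
    by (simp add: distrib_left sum_distrib_left)
  also have "\<dots> \<le> (1 / n) ^ card F * T ^ M * T"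
  proof (rule mult_left_mono)
    have WK: "real (card W) \<le> 2 * real K" using W(2) Suc.prems(3) by simp
    have "(\<Sum>w\<in>C. (1 / n) ^ length w) \<le> real d * real (card {..<N}) * (real l * ((real d - 1) ^ l * (real d * (real (card W) + real l)) / n))"
      unfolding C_def using W(1) by (intro sum_closing_ears) auto
    also have "\<dots> = real l * (real d - 1) ^ l * (real d * (real (card W) + real l))"
      using N d by (simp add: n_def)
    also have "\<dots> \<le> real l * (real d - 1) ^ l * (real d * (2 * real K + real l))"
      using WK d1 by (intro mult_left_mono add_right_mono) auto
    finally show "real (card W) + (\<Sum>w\<in>C. (1 / n) ^ length w) \<le> T" using WK by (simp add: T_def)
  qed (use T0 n_pos in auto)
  finally show ?case by (simp add: mult_ac)
qed

text \<open>One stage of a nested union bound: the factor (1 / n)^card F is carried along, and each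
  stage multiplies by the total weight of its ears.\<close>

lemma union_bound_walks:
  assumes I: "finite I" "\<And>w. w \<in> I \<Longrightarrow> card (F \<union> dart_edge ` set w) = card F + length w"
    and Q: "\<And>w. w \<in> I \<Longrightarrow> measure_pmf.prob P {E. Q w E} \<le> (1 / n) ^ card (F \<union> dart_edge ` set w) * \<beta>"
    and \<alpha>: "(\<Sum>w\<in>I. (1 / n) ^ length w) \<le> \<alpha>" and \<beta>: "0 \<le> \<beta>"
  shows "measure_pmf.prob P {E. \<exists>w\<in>I. Q w E} \<le> (1 / n) ^ card F * (\<alpha> * \<beta>)"
proof -
  have "{E. \<exists>w\<in>I. Q w E} = (\<Union>w\<in>I. {E. Q w E})" by auto
  then have "measure_pmf.prob P {E. \<exists>w\<in>I. Q w E} \<le> (\<Sum>w\<in>I. measure_pmf.prob P {E. Q w E})"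
    using measure_pmf.finite_measure_subadditive_finite[OF I(1)] by simp
  also have "\<dots> \<le> (\<Sum>w\<in>I. (1 / n) ^ card (F \<union> dart_edge ` set w) * \<beta>)" by (rule sum_mono) (rule Q)
  also have "\<dots> = (1 / n) ^ card F * ((\<Sum>w\<in>I. (1 / n) ^ length w) * \<beta>)"
    using I(2) by (simp add: sum_distrib_left power_add mult_ac)
  also have "\<dots> \<le> (1 / n) ^ card F * (\<alpha> * \<beta>)"
    using \<alpha> \<beta> n_pos by (intro mult_left_mono mult_right_mono) auto
  finally show ?thesis .
qed

text \<open>The two openings contribute \<alpha> each and the two closures \<beta> each. Before the
  last stage at most 1 + 3 m vertices are explored, so x bounds all sizes.\<close>

lemma prob_tangled:
  assumes K: "4 * m \<le> K"
  defines "x \<equiv> 4 * real m + 1"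
  defines "\<alpha> \<equiv> 1 + real d * x * (real m * (real d - 1) ^ m)"
  defines "\<beta> \<equiv> real d * x * (real m * ((real d - 1) ^ m * (real d * (x + real m)) / n))"
  shows "measure_pmf.prob P {E. tangled m v E} \<le> (\<alpha> * \<beta>)\<^sup>2"
proof -
  have d1: "1 \<le> real d - 1" using d by simp
  have x: "real (card W) \<le> x" if "explored m j W F" "j \<le> 3" for j W F
  proof -
    have "card W \<le> 1 + j * m" using that by (simp add: explored_def)
    also have "\<dots> \<le> 1 + 3 * m" using that by (intro add_left_mono mult_right_mono) auto
    finally show ?thesis by (simp add: x_def)
  qed
  have fW: "finite W" if "explored m j W F" for j W F using that by (simp add: explored_def)
  have \<alpha>: "(\<Sum>w\<in>openings m W F. (1 / n) ^ length w) \<le> \<alpha>" if "explored m j W F" "j \<le> 3" for j W F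
  proof -
    have "(\<Sum>w\<in>openings m W F. (1 / n) ^ length w) = 1 + (\<Sum>w\<in>ears m W F W. (1 / n) ^ length w)"
      unfolding openings_def by (subst sum.insert) (simp_all, simp add: ears_def)
    also have "\<dots> \<le> 1 + real d * real (card W) * (real m * (real d - 1) ^ m)"
      using sum_ears[OF fW[OF that(1)], of m F W] by simp
    also have "\<dots> \<le> \<alpha>" unfolding \<alpha>_def using x[OF that] d1 by (intro add_left_mono mult_right_mono mult_left_mono) auto
    finally show ?thesis .
  qed
  have \<beta>: "(\<Sum>w\<in>closures m W F. (1 / n) ^ length w) \<le> \<beta>" if "explored m j W F" "j \<le> 3" for j W F
  proof -
    have "(\<Sum>w\<in>closures m W F. (1 / n) ^ length w)
      \<le> real d * real (card W) * (real m * ((real d - 1) ^ m * (real d * (real (card W) + real m)) / n))"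
      unfolding closures_def by (intro sum_closing_ears fW[OF that(1)])
    also have "\<dots> \<le> \<beta>" unfolding \<beta>_def using x[OF that] d1 n_pos
      by (intro mult_mono mult_left_mono divide_right_mono add_right_mono) auto
    finally show ?thesis .
  qed
  have pos: "0 \<le> \<alpha>" "0 \<le> \<beta>" unfolding \<alpha>_def \<beta>_def x_def using d1 n_pos by auto
  have P4: "measure_pmf.prob P {E. \<exists>w\<in>closures m W F. F \<union> dart_edge ` set w \<subseteq> E} \<le> (1 / n) ^ card F * (\<beta> * 1)"
    if "explored m 3 W F" for W F
  proof (rule union_bound_walks[OF _ _ _ \<beta>[OF that]])
    fix w assume w: "w \<in> closures m W F"
    then have w': "w \<in> openings m W F" using closures_subset by blast
    show "card (F \<union> dart_edge ` set w) = card F + length w" by (rule explored_grow[OF that w'])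
    have "card (F \<union> dart_edge ` set w) \<le> 4 * m" "finite F" using explored_grow(1)[OF that w'] by (auto simp: explored_def)
    then show "measure_pmf.prob P {E. F \<union> dart_edge ` set w \<subseteq> E} \<le> (1 / n) ^ card (F \<union> dart_edge ` set w) * 1"
      using prob_edges[of "F \<union> dart_edge ` set w"] K by simp
  qed simp_all
  let ?Q3 = "\<lambda>W F E. \<exists>w\<in>closures m W F. F \<union> dart_edge ` set w \<subseteq> E"
  let ?Q2 = "\<lambda>W F E. \<exists>w\<in>openings m W F. ?Q3 (grow W w) (F \<union> dart_edge ` set w) E"
  let ?Q1 = "\<lambda>W F E. \<exists>w\<in>closures m W F. ?Q2 (grow W w) (F \<union> dart_edge ` set w) E"
  have P3: "measure_pmf.prob P {E. ?Q2 W F E} \<le> (1 / n) ^ card F * (\<alpha> * (\<beta> * 1))" if "explored m 2 W F" for W F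
  proof (rule union_bound_walks[OF _ _ _ \<alpha>[OF that]])
    fix w assume w: "w \<in> openings m W F"
    show "card (F \<union> dart_edge ` set w) = card F + length w" by (rule explored_grow[OF that w])
    show "measure_pmf.prob P {E. ?Q3 (grow W w) (F \<union> dart_edge ` set w) E} \<le> (1 / n) ^ card (F \<union> dart_edge ` set w) * (\<beta> * 1)"
      using explored_grow(1)[OF that w] by (intro P4) simp
  qed (use pos in simp_all)
  have P2: "measure_pmf.prob P {E. ?Q1 W F E} \<le> (1 / n) ^ card F * (\<beta> * (\<alpha> * (\<beta> * 1)))" if "explored m 1 W F" for W F
  proof (rule union_bound_walks[OF _ _ _ \<beta>[OF that]])
    fix w assume "w \<in> closures m W F"
    then have w: "w \<in> openings m W F" using closures_subset by blast
    show "card (F \<union> dart_edge ` set w) = card F + length w" by (rule explored_grow[OF that w])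
    show "measure_pmf.prob P {E. ?Q2 (grow W w) (F \<union> dart_edge ` set w) E} \<le> (1 / n) ^ card (F \<union> dart_edge ` set w) * (\<alpha> * (\<beta> * 1))"
      using explored_grow(1)[OF that w] by (intro P3) (simp add: numeral_eq_Suc)
  qed (use pos in simp_all)
  have e0: "explored m 0 {v} {}" by (simp add: explored_def support_def)
  have "measure_pmf.prob P {E. \<exists>w\<in>openings m {v} {}. ?Q1 (grow {v} w) ({} \<union> dart_edge ` set w) E}
    \<le> (1 / n) ^ card ({} :: hedge set set) * (\<alpha> * (\<beta> * (\<alpha> * (\<beta> * 1))))"
  proof (rule union_bound_walks[OF _ _ _ \<alpha>[OF e0]])
    fix w assume w: "w \<in> openings m {v} {}"
    show "card ({} \<union> dart_edge ` set w) = card ({} :: hedge set set) + length w" by (rule explored_grow[OF e0 w])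
    show "measure_pmf.prob P {E. ?Q1 (grow {v} w) ({} \<union> dart_edge ` set w) E} \<le> (1 / n) ^ card ({} \<union> dart_edge ` set w) * (\<beta> * (\<alpha> * (\<beta> * 1)))"
      using explored_grow(1)[OF e0 w] by (intro P2) simp
  qed (use pos in simp_all)
  then show ?thesis by (simp add: tangled_def Let_def power2_eq_square)
qed

end

section \<open>Cycles and breadth-first search\<close>

text \<open>Of a cycle only the parity of its degrees is retained: evenness passes to symmetric
  differences and cannot hold for a nonempty set of edges of a tree.\<close>

lemma cycle_even:
  assumes "is_cycle H C"
  shows "finite C" "C \<noteq> {}" "C \<subseteq> edges H" "even (\<Sum>e\<in>C. count (ends H e) v)"
    and "\<And>e. e \<in> C \<Longrightarrow> set_mset (ends H e) \<subseteq> verts H"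
proof -
  obtain vs es where c: "es \<noteq> []" "length vs = length es" "distinct vs" "distinct es"
    "set vs \<subseteq> verts H" "set es \<subseteq> edges H" "C = set es"
    "\<forall>i<length es. ends H (es ! i) = {#vs ! i, vs ! (Suc i mod length vs)#}"
    using assms unfolding is_cycle_def by blast
  show "finite C" "C \<noteq> {}" "C \<subseteq> edges H" using c by auto
  let ?g = "\<lambda>u. of_bool (u = v) :: nat"
  have "(\<Sum>e\<in>C. count (ends H e) v) = (\<Sum>i<length es. count (ends H (es ! i)) v)"
    using c by (simp add: sum.distinct_set_conv_list sum_list_sum_nth atLeast0LessThan)
  also have "\<dots> = (\<Sum>i<length es. ?g (vs ! i) + ?g (rotate1 vs ! i))"
    using c by (intro sum.cong) (auto simp: nth_rotate1)
  also have "\<dots> = sum_list (map ?g vs) + sum_list (map ?g (rotate1 vs))"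
    using c by (simp add: sum.distrib sum_list_sum_nth atLeast0LessThan)
  also have "sum_list (map ?g (rotate1 vs)) = sum_list (map ?g vs)" by (cases vs) auto
  finally show "even (\<Sum>e\<in>C. count (ends H e) v)" by simp
  show "set_mset (ends H e) \<subseteq> verts H" if "e \<in> C" for e
  proof -
    obtain i where i: "i < length es" "e = es ! i" using \<open>e \<in> C\<close> c by (metis in_set_conv_nth)
    then have "Suc i mod length vs < length vs" using c(2) by (intro mod_less_divisor) auto
    then have "vs ! i \<in> set vs" "vs ! (Suc i mod length vs) \<in> set vs" using c(2) i by auto
    then show ?thesis using c(5,8) i by auto
  qed
qed

lemma even_sum_symdiff:
  fixes g :: "'b \<Rightarrow> nat"
  assumes "finite C" "finite C'" "even (\<Sum>e\<in>C. g e)" "even (\<Sum>e\<in>C'. g e)"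
  shows "even (\<Sum>e\<in>(C - C') \<union> (C' - C). g e)"
proof -
  have "(\<Sum>e\<in>C. g e) = (\<Sum>e\<in>C - C'. g e) + (\<Sum>e\<in>C \<inter> C'. g e)"
    using assms by (subst sum.union_disjoint[symmetric]) (auto intro!: sum.cong)
  moreover have "(\<Sum>e\<in>C'. g e) = (\<Sum>e\<in>C' - C. g e) + (\<Sum>e\<in>C \<inter> C'. g e)"
    using assms by (subst sum.union_disjoint[symmetric]) (auto intro!: sum.cong)
  moreover have "(\<Sum>e\<in>(C - C') \<union> (C' - C). g e) = (\<Sum>e\<in>C - C'. g e) + (\<Sum>e\<in>C' - C. g e)"
    using assms by (intro sum.union_disjoint) auto
  ultimately show ?thesis using assms(3,4) by simp
qed

text \<open>In a matching, leaving by the half-edge of arrival means using the same edge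
  again.\<close>

lemma chain_matchingI:
  assumes E: "is_matching E" and w: "length w \<le> m" "dart_edge ` set w \<subseteq> E"
    and s: "\<And>t. 0 < t \<Longrightarrow> t < length w \<Longrightarrow> src (w ! t) = dst (w ! (t - 1)) \<and> dart_edge (w ! t) \<noteq> dart_edge (w ! (t - 1))"
  shows "chain m w"
  unfolding chain_def
proof (intro allI impI)
  fix t assume t: "0 < t \<and> t < length w"
  then have "\<not> m dvd t" using w by (auto dest: dvd_imp_le)
  moreover have "fst (w ! t) \<noteq> snd (w ! (t - 1))"
  proof
    assume eq: "fst (w ! t) = snd (w ! (t - 1))"
    have "dart_edge (w ! t) \<in> E" "dart_edge (w ! (t - 1)) \<in> E" using w t by auto
    moreover have "dart_edge (w ! t) \<inter> dart_edge (w ! (t - 1)) \<noteq> {}" using eq by (auto simp: dart_edge_def)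
    ultimately have "dart_edge (w ! t) = dart_edge (w ! (t - 1))" using E disjointD unfolding is_matching_def by metis
    then show False using s t by auto
  qed
  ultimately show "if m dvd t then fst (w ! t) = snd (w ! (t - 1))
      else src (w ! t) = dst (w ! (t - 1)) \<and> fst (w ! t) \<noteq> snd (w ! (t - 1))"
    using s t by auto
qed

lemma dart_edge_fibre:
  "{h \<in> dart_edge x. fst h = u} = (if src x = u then {fst x} else {}) \<union> (if dst x = u then {snd x} else {})"
  by (cases x) (auto simp: dart_edge_def src_def dst_def)

section \<open>Breadth-first search from a vertex of the core\<close>

locale rooted = half_edges +
  fixes E :: "hedge set set" and root :: nat
  assumes E: "is_matching E" "\<Union>E \<subseteq> X"
begin

definition adjacency :: "(nat \<times> nat) set" where
  "adjacency = {(u, v). \<exists>x. dart_edge x \<in> E \<and> src x = u \<and> dst x = v}"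

definition bfs_ball :: "nat \<Rightarrow> nat set" where "bfs_ball s = {u. \<exists>k\<le>s. (root, u) \<in> adjacency ^^ k}"

definition level :: "nat \<Rightarrow> nat" where "level u = (LEAST k. (root, u) \<in> adjacency ^^ k)"

definition par :: "nat \<Rightarrow> dart" where
  "par u = (SOME x. dart_edge x \<in> E \<and> dst x = u \<and> src x \<in> bfs_ball (level u) \<and> level u = Suc (level (src x)))"

definition tree :: "hedge set set" where "tree = {dart_edge (par u) |u. \<exists>s. u \<in> bfs_ball s \<and> u \<noteq> root}"

lemma level_ball: "u \<in> bfs_ball s \<Longrightarrow> level u \<le> s \<and> (root, u) \<in> adjacency ^^ level u"
  unfolding bfs_ball_def level_def by (auto intro: LeastI Least_le[THEN order_trans])

lemma level_root: "level root = 0" "root \<in> bfs_ball s"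
  unfolding bfs_ball_def level_def by auto

lemma bfs_ball_mono: "u \<in> bfs_ball s \<Longrightarrow> s \<le> t \<Longrightarrow> u \<in> bfs_ball t"
  unfolding bfs_ball_def using order_trans by blast

lemma level_0: "u \<in> bfs_ball s \<Longrightarrow> level u = 0 \<longleftrightarrow> u = root"
  using level_ball[of u s] level_root by auto

lemma par:
  assumes "u \<in> bfs_ball s" "u \<noteq> root"
  shows "dart_edge (par u) \<in> E" "dst (par u) = u" "src (par u) \<in> bfs_ball s" "level u = Suc (level (src (par u)))"
proof -
  have l: "(root, u) \<in> adjacency ^^ level u" "level u \<le> s" using level_ball[OF assms(1)] by auto
  have "level u \<noteq> 0" using level_0 assms by auto
  then obtain k where k: "level u = Suc k" by (cases "level u") auto
  then obtain y where y: "(root, y) \<in> adjacency ^^ k" "(y, u) \<in> adjacency" using l by auto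
  then obtain x where x: "dart_edge x \<in> E" "src x = y" "dst x = u" by (auto simp: adjacency_def)
  have yb: "y \<in> bfs_ball k" using y by (auto simp: bfs_ball_def)
  have "level y \<le> k" using level_ball[OF yb] by auto
  moreover have "level u \<le> Suc (level y)"
  proof -
    have "(root, u) \<in> adjacency ^^ Suc (level y)" using level_ball[OF yb] y by auto
    then show ?thesis unfolding level_def[of u] by (rule Least_le)
  qed
  ultimately have "level y = k" using k by simp
  moreover have "y \<in> bfs_ball (level u)" using bfs_ball_mono[OF yb] k by simp
  ultimately have "dart_edge x \<in> E \<and> dst x = u \<and> src x \<in> bfs_ball (level u) \<and> level u = Suc (level (src x))"
    using x k by simp
  then have *: "dart_edge (par u) \<in> E \<and> dst (par u) = u \<and> src (par u) \<in> bfs_ball (level u) \<and> level u = Suc (level (src (par u)))"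
    unfolding par_def by (rule someI)
  then show "dart_edge (par u) \<in> E" "dst (par u) = u" "level u = Suc (level (src (par u)))" by auto
  show "src (par u) \<in> bfs_ball s" using * l(2) bfs_ball_mono by blast
qed

text \<open>At a deepest vertex of a nonempty set of tree edges only the edge to the parent is left.\<close>

lemma even_set_not_in_tree:
  assumes Z: "finite Z" "Z \<noteq> {}" "\<And>u. even (\<Sum>e\<in>Z. card {h \<in> e. fst h = u})"
  shows "\<not> Z \<subseteq> tree"
proof
  assume sub: "Z \<subseteq> tree"
  define D where "D = {u. (\<exists>s. u \<in> bfs_ball s \<and> u \<noteq> root) \<and> dart_edge (par u) \<in> Z}"
  have "D \<subseteq> support Z"
  proof
    fix u assume u: "u \<in> D"
    then have "dst (par u) = u" using par by (auto simp: D_def)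
    then have "u = fst (snd (par u))" "snd (par u) \<in> dart_edge (par u)" by (auto simp: dst_def dart_edge_def)
    then show "u \<in> support Z" using u by (auto simp: D_def support_def)
  qed
  moreover have "finite (support Z)"
  using sub Z(1) by (auto simp: tree_def dart_edge_def support_def)
  ultimately have finD: "finite D" by (rule finite_subset)
  have "D \<noteq> {}" using Z(2) sub by (auto simp: D_def tree_def)
  then have "Max (level ` D) \<in> level ` D" using finD by (intro Max_in) auto
  then obtain u where u: "u \<in> D" "level u = Max (level ` D)" by auto
  have max: "level y \<le> level u" if "y \<in> D" for y using that finD unfolding u(2) by (intro Max_ge) auto
  obtain s where s: "u \<in> bfs_ball s" "u \<noteq> root" "dart_edge (par u) \<in> Z" using u(1) by (auto simp: D_def)
  have one: "card {h \<in> e. fst h = u} = of_bool (e = dart_edge (par u))" if "e \<in> Z" for e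
  proof -
    have "e \<in> tree" using that sub by blast
    then obtain y t where y: "e = dart_edge (par y)" "y \<in> bfs_ball t" "y \<noteq> root" unfolding tree_def by blast
    then have "y \<in> D" using that by (auto simp: D_def)
    then have "level y \<le> level u" by (rule max)
    then have ne: "src (par y) \<noteq> u" using par(4)[OF y(2,3)] by auto
    have dy: "dst (par y) = y" using par(2)[OF y(2,3)] .
    have fib: "{h \<in> e. fst h = u} = (if y = u then {snd (par y)} else {})"
      unfolding y(1) dart_edge_fibre using ne dy by simp
    have "y = u \<longleftrightarrow> e = dart_edge (par u)"
    proof
      assume eq: "e = dart_edge (par u)"
      have "dst (par u) = u" using par(2)[OF s(1,2)] .
      then have "snd (par u) \<in> {h \<in> e. fst h = u}" unfolding eq dart_edge_fibre by simp
      then show "y = u" unfolding fib by (auto split: if_splits)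
    qed (use y in simp)
    then show ?thesis unfolding fib by simp
  qed
  have "(\<Sum>e\<in>Z. card {h \<in> e. fst h = u}) = (\<Sum>e\<in>Z. if e = dart_edge (par u) then 1 else 0)"
    by (intro sum.cong refl) (simp add: one)
  also have "\<dots> = 1" using Z(1) s(3) by simp
  finally show False using Z(3)[of u] by simp
qed

text \<open>The tree path from u to the root; the level of u is passed along to make the recursion
  primitive.\<close>

fun up :: "nat \<Rightarrow> nat \<Rightarrow> dart list" where
  "up 0 u = []"
| "up (Suc k) u = prod.swap (par u) # up k (src (par u))"

lemma up:
  "u \<in> bfs_ball s \<Longrightarrow> level u = k \<Longrightarrow> length (up k u) = k \<and> dart_edge ` set (up k u) \<subseteq> E \<inter> tree
    \<and> (k = 0 \<longrightarrow> u = root) \<and> (0 < k \<longrightarrow> src (hd (up k u)) = u \<and> dst (last (up k u)) = root)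
    \<and> (\<forall>t<k. level (src (up k u ! t)) = k - t \<and> level (dst (up k u ! t)) = k - Suc t)
    \<and> (\<forall>t<k. 0 < t \<longrightarrow> src (up k u ! t) = dst (up k u ! (t - 1)))"
proof (induction k arbitrary: u)
  case 0
  then show ?case using level_0 by auto
next
  case (Suc k)
  have "u \<noteq> root" using Suc.prems level_root by auto
  note p = par[OF Suc.prems(1) this]
  let ?y = "src (par u)"
  have ly: "level ?y = k" using p Suc.prems by simp
  note IH = Suc.IH[OF p(3) ly]
  have pt: "dart_edge (par u) \<in> tree" using Suc.prems \<open>u \<noteq> root\<close> by (auto simp: tree_def)
  have *: "dst (last (up (Suc k) u)) = root" using IH by (cases "k = 0") auto
  have lev: "level (src (up (Suc k) u ! t)) = Suc k - t \<and> level (dst (up (Suc k) u ! t)) = Suc k - Suc t" if "t < Suc k" for t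
    using that IH p Suc.prems by (cases t) auto
  have con: "src (up (Suc k) u ! t) = dst (up (Suc k) u ! (t - 1))" if "t < Suc k" "0 < t" for t
  proof -
    have "\<exists>i. t = Suc i" using that(2) by (cases t) auto
    then obtain i where i: "t = Suc i" by blast
    show ?thesis
    proof (cases i)
      case 0
      then have "0 < k" "up k ?y \<noteq> []" using that IH by auto
      then show ?thesis using IH i 0 by (simp add: hd_conv_nth)
    next
      case (Suc j)
      then show ?thesis using IH i that by auto
    qed
  qed
  show ?case using IH p pt lev con by auto
qed

lemma up_chain:
  assumes "u \<in> bfs_ball s" "level u = k" "k \<le> m"
  shows "chain m (up k u)"
proof (rule chain_matchingI[OF E(1)])
  note U = up[OF assms(1,2)]
  show "length (up k u) \<le> m" "dart_edge ` set (up k u) \<subseteq> E" using U assms by auto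
  fix t assume t: "0 < t" "t < length (up k u)"
  have "dart_edge (up k u ! t) \<noteq> dart_edge (up k u ! (t - 1))"
  proof
    assume "dart_edge (up k u ! t) = dart_edge (up k u ! (t - 1))"
    then have "src (up k u ! t) = src (up k u ! (t - 1)) \<or> src (up k u ! (t - 1)) = dst (up k u ! t)"
      by (auto simp: dart_edge_eq)
    then have "level (src (up k u ! t)) = level (src (up k u ! (t - 1))) \<or> level (src (up k u ! (t - 1))) = level (dst (up k u ! t))"
      by metis
    then show False using U t by auto
  qed
  then show "src (up k u ! t) = dst (up k u ! (t - 1)) \<and> dart_edge (up k u ! t) \<noteq> dart_edge (up k u ! (t - 1))"
    using U t by auto
qed

lemma darts_subset: "dart_edge ` set w \<subseteq> E \<Longrightarrow> set w \<subseteq> X \<times> X"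
proof
  fix x assume "dart_edge ` set w \<subseteq> E" "x \<in> set w"
  then have "dart_edge x \<subseteq> X" using E(2) by blast
  then show "x \<in> X \<times> X" by (cases x) (auto simp: dart_edge_def)
qed

text \<open>The tree path from a towards the root is followed until it first meets W and then
  reversed.\<close>

lemma opening_exists:
  assumes W: "root \<in> W" "support F \<subseteq> W" and a: "a \<in> bfs_ball s" and m: "s \<le> m"
  shows "\<exists>w\<in>openings m W F. dart_edge ` set w \<subseteq> E \<inter> tree \<and> a \<in> grow W w"
proof (cases "a \<in> W")
  case True
  then show ?thesis by (intro bexI[of _ "[]"]) (auto simp: openings_def grow_def)
next
  case False
  define U where "U = up (level a) a"
  have lm: "level a \<le> m" using level_ball[OF a] m by simp
  note U = up[OF a refl, folded U_def]
  have ch: "chain m U" unfolding U_def by (rule up_chain[OF a refl lm])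
  have l0: "0 < level a" using False W(1) level_0[OF a] by auto
  define j where "j = (LEAST j. j < level a \<and> dst (U ! j) \<in> W)"
  have "U \<noteq> []" using U l0 by auto
  then have "level a - 1 < level a \<and> dst (U ! (level a - 1)) \<in> W"
    using U l0 W(1) last_conv_nth[OF \<open>U \<noteq> []\<close>] by auto
  then have j: "j < level a" "dst (U ! j) \<in> W" unfolding j_def by (metis (mono_tags, lifting) LeastI)+
  have min: "dst (U ! i) \<notin> W" if "i < j" for i
    using not_less_Least[of i "\<lambda>j. j < level a \<and> dst (U ! j) \<in> W"] that j unfolding j_def by auto
  have srcW: "src (U ! i) \<notin> W" if "i \<le> j" for i
  proof (cases "i = 0")
    case True
    then show ?thesis using U l0 False \<open>U \<noteq> []\<close> by (simp add: hd_conv_nth)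
  next
    case False
    then have "src (U ! i) = dst (U ! (i - 1))" using U j that by auto
    then show ?thesis using min[of "i - 1"] False that by simp
  qed
  define w where "w = reverse_walk (take (Suc j) U)"
  have lw: "length w = Suc j" using U j by (simp add: w_def)
  have nth: "w ! t = prod.swap (U ! (j - t))" if "t \<le> j" for t
    using that U j by (simp add: w_def reverse_walk_def rev_nth)
  have ne: "w \<noteq> []" using lw by auto
  have "chain m w" unfolding w_def using ch j lm by (intro chain_reverse_walk chain_take) auto
  have edges: "dart_edge ` set w \<subseteq> E \<inter> tree"
  proof -
    have "dart_edge ` set w = dart_edge ` set (take (Suc j) U)" by (auto simp: w_def reverse_walk_def image_image)
    also have "\<dots> \<subseteq> dart_edge ` set U" by (intro image_mono set_take_subset)
    also have "\<dots> \<subseteq> E \<inter> tree" by (rule U[THEN conjunct2, THEN conjunct1])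
    finally show ?thesis .
  qed
  \<comment> \<open>Levels increase by one along the reversed path, which makes its vertices
    distinct.\<close>
  have lev: "level (dst (w ! t)) = level a - j + t" "level (src (w ! t)) = level a - j + t - 1" if "t \<le> j" for t
    using nth[OF that] U that j by auto
  have "dst (w ! t) \<notin> W \<union> visited w t" if t: "t \<le> j" for t
  proof -
    have "dst (w ! t) \<notin> W" using nth[OF t] srcW[of "j - t"] by simp
    moreover have "dst (w ! t) \<noteq> src (w ! 0)" using lev(1)[OF t] lev(2)[of 0] j by auto
    moreover have "dst (w ! t) \<noteq> dst (w ! i)" if "i < t" for i using lev(1)[OF t] lev(1)[of i] that t by auto
    ultimately show ?thesis by (auto simp: visited_def)
  qed
  note fresh = this
  have "dart_edge (hd w) \<notin> F"
  proof
    assume "dart_edge (hd w) \<in> F"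
    then have "dst (w ! 0) \<in> support F" using ne by (auto simp: support_def dst_def dart_edge_def hd_conv_nth)
    then show False using fresh[of 0] W(2) by auto
  qed
  moreover have "src (hd w) \<in> W" using ne nth[of 0] j by (simp add: hd_conv_nth)
  moreover have "set w \<subseteq> X \<times> X" using edges by (intro darts_subset) auto
  moreover have "length w \<le> m" using lw j lm by simp
  moreover have "\<forall>t<length w - 1. dst (w ! t) \<notin> W \<union> visited w t" using fresh lw by simp
  ultimately have "w \<in> ears m W F W" using \<open>chain m w\<close> ne unfolding ears_def by blast
  moreover have "a \<in> grow W w"
  proof -
    have "dst (w ! j) = a" using nth[of j] U l0 \<open>U \<noteq> []\<close> by (simp add: hd_conv_nth)
    moreover have "w ! j \<in> set w" using lw by simp
    ultimately show ?thesis by (auto simp: grow_def)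
  qed
  ultimately show ?thesis using edges by (auto simp: openings_def)
qed

text \<open>After crossing x, the tree path from its far end leads to the root, which lies in W; the
  walk is cut at its first return. It does not backtrack, because x is no tree edge and levels
  decrease along the path.\<close>

lemma closure_exists:
  assumes W: "root \<in> W" "src x \<in> W" and x: "dart_edge x \<in> E" "dart_edge x \<notin> tree" "dart_edge x \<notin> F"
    and b: "dst x \<in> bfs_ball s" and m: "Suc s \<le> m"
  shows "\<exists>w\<in>closures m W F. dart_edge ` set w \<subseteq> E \<inter> insert (dart_edge x) tree"
proof -
  define U where "U = up (level (dst x)) (dst x)"
  note U = up[OF b refl, folded U_def]
  have lm: "Suc (level (dst x)) \<le> m" using level_ball[OF b] m by simp
  define w where "w = x # U"
  have "chain m U" unfolding U_def by (rule up_chain[OF b refl]) (use lm in simp)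
  have "chain m w"
  proof (rule chain_matchingI[OF E(1)])
    show "length w \<le> m" "dart_edge ` set w \<subseteq> E" using U x lm by (auto simp: w_def)
    fix t assume t: "0 < t" "t < length w"
    show "src (w ! t) = dst (w ! (t - 1)) \<and> dart_edge (w ! t) \<noteq> dart_edge (w ! (t - 1))"
    proof (cases "t = 1")
      case True
      then have ne: "U \<noteq> []" using t by (auto simp: w_def)
      then have "dart_edge (U ! 0) \<in> tree" using U by (metis IntD2 hd_conv_nth hd_in_set image_subset_iff)
      then show ?thesis using True U ne x by (auto simp: w_def hd_conv_nth)
    next
      case False
      then obtain i where i: "t = Suc (Suc i)" using t by (metis One_nat_def Suc_pred not_gr_zero)
      have "src (U ! Suc i) = dst (U ! i)" using U i t by (auto simp: w_def)
      moreover have "dart_edge (U ! Suc i) \<noteq> dart_edge (U ! i)"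
      proof
        assume "dart_edge (U ! Suc i) = dart_edge (U ! i)"
        then have "src (U ! Suc i) = src (U ! i) \<or> dst (U ! Suc i) = src (U ! i)" by (auto simp: dart_edge_eq)
        then have "level (src (U ! Suc i)) = level (src (U ! i)) \<or> level (dst (U ! Suc i)) = level (src (U ! i))" by metis
        then show False using U i t by (auto simp: w_def)
      qed
      ultimately show ?thesis using i by (simp add: w_def)
    qed
  qed
  moreover have "closing_at W w"
  using U W by (auto simp: w_def closing_at_def)
  moreover have "dart_edge ` set w \<subseteq> E \<inter> insert (dart_edge x) tree" using U x by (auto simp: w_def)
  moreover have "length w \<le> m" using U lm by (simp add: w_def)
  moreover have "w \<noteq> []" "hd w = x" by (auto simp: w_def)
  ultimately obtain k where "0 < k" "k \<le> length w" "take k w \<in> ears m W F W" "closing_at W (take k w)"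
    using truncated_ear[of m w W F W] W x darts_subset[of w] by (metis le_inf_iff)
  then show ?thesis
    using \<open>dart_edge ` set w \<subseteq> E \<inter> insert (dart_edge x) tree\<close> set_take_subset[of k w]
    by (intro bexI[of _ "take k w"]) (auto simp: closures_def)
qed

text \<open>Each of two edges outside the tree is reached along the tree, crossed, and closed up
  along the tree. Before the second closing only tree edges and the first edge have been explored,
  so the second edge is still new.\<close>

lemma tangledI:
  assumes f: "dart_edge x \<in> E" "dart_edge x \<notin> tree" "dart_edge y \<in> E" "dart_edge y \<notin> tree" "dart_edge x \<noteq> dart_edge y"
    and b: "src x \<in> bfs_ball s" "dst x \<in> bfs_ball s" "src y \<in> bfs_ball s" "dst y \<in> bfs_ball s"
  shows "tangled (Suc s) root E"
proof -
  let ?m = "Suc s"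
  have e0: "explored ?m 0 {root} {}" by (simp add: explored_def support_def)
  have gr: "W \<subseteq> grow W w" for W w by (auto simp: grow_def)
  obtain w1 where w1: "w1 \<in> openings ?m {root} {}" "dart_edge ` set w1 \<subseteq> E \<inter> tree" "src x \<in> grow {root} w1"
    using opening_exists[of "{root}" "{}" "src x" s ?m] b by (auto simp: support_def)
  define W1 F1 where "W1 = grow {root} w1" and "F1 = {} \<union> dart_edge ` set w1"
  have e1: "explored ?m 1 W1 F1" unfolding W1_def F1_def using explored_grow(1)[OF e0 w1(1)] by simp
  have F1: "F1 \<subseteq> E \<inter> tree" using w1 by (simp add: F1_def)
  have r1: "root \<in> W1" by (simp add: W1_def grow_def)
  obtain w2 where w2: "w2 \<in> closures ?m W1 F1" "dart_edge ` set w2 \<subseteq> E \<inter> insert (dart_edge x) tree"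
    using closure_exists[of W1 x F1 s ?m] r1 w1(3) f b F1 W1_def by auto
  define W2 F2 where "W2 = grow W1 w2" and "F2 = F1 \<union> dart_edge ` set w2"
  have e2: "explored ?m 2 W2 F2"
    unfolding W2_def F2_def using explored_grow(1)[OF e1 subsetD[OF closures_subset w2(1)]] by (simp add: numeral_eq_Suc)
  have F2: "F2 \<subseteq> E \<inter> insert (dart_edge x) tree" using w2 F1 by (auto simp: F2_def)
  have r2: "root \<in> W2" using r1 gr by (auto simp: W2_def)
  obtain w3 where w3: "w3 \<in> openings ?m W2 F2" "dart_edge ` set w3 \<subseteq> E \<inter> tree" "src y \<in> grow W2 w3"
    using opening_exists[of W2 F2 "src y" s ?m] b r2 e2 by (auto simp: explored_def)
  define W3 F3 where "W3 = grow W2 w3" and "F3 = F2 \<union> dart_edge ` set w3"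
  have F3: "F3 \<subseteq> E \<inter> insert (dart_edge x) tree" using w3 F2 by (auto simp: F3_def)
  have r3: "root \<in> W3" using r2 gr by (auto simp: W3_def)
  have "dart_edge y \<notin> F3" using F3 f by auto
  then obtain w4 where w4: "w4 \<in> closures ?m W3 F3" "dart_edge ` set w4 \<subseteq> E \<inter> insert (dart_edge y) tree"
    using closure_exists[of W3 y F3 s ?m] r3 w3(3) f b W3_def by auto
  have "F3 \<union> dart_edge ` set w4 \<subseteq> E" using F3 w4 by auto
  then show ?thesis
    unfolding tangled_def Let_def using w1(1) w2(1) w3(1) w4(1)
    unfolding W3_def F3_def W2_def F2_def W1_def F1_def by blast
qed

text \<open>Each even set contains an edge outside the tree. If the two sets supply the same edge,
  their symmetric difference is even, nonempty and without this edge, so it supplies another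
  one.\<close>

lemma two_even_sets_tangled:
  assumes C: "finite C" "C \<noteq> {}" "\<And>u. even (\<Sum>e\<in>C. card {h \<in> e. fst h = u})" "C \<subseteq> E" "support C \<subseteq> bfs_ball s"
    and C': "finite C'" "C' \<noteq> {}" "\<And>u. even (\<Sum>e\<in>C'. card {h \<in> e. fst h = u})" "C' \<subseteq> E" "support C' \<subseteq> bfs_ball s"
    and ne: "C \<noteq> C'"
  shows "tangled (Suc s) root E"
proof -
  have "\<exists>f\<in>C \<union> C'. \<exists>f'\<in>C \<union> C'. f \<noteq> f' \<and> f \<notin> tree \<and> f' \<notin> tree"
  proof -
    obtain f where f: "f \<in> C" "f \<notin> tree" using even_set_not_in_tree[OF C(1-3)] by blast
    obtain f' where f': "f' \<in> C'" "f' \<notin> tree" using even_set_not_in_tree[OF C'(1-3)] by blast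
    show ?thesis
    proof (cases "f = f'")
      case True
      let ?Z = "(C - C') \<union> (C' - C)"
      have "finite ?Z" "?Z \<noteq> {}" using C(1) C'(1) ne by auto
      then have "\<not> ?Z \<subseteq> tree"
        using C(1,3) C'(1,3) by (intro even_set_not_in_tree even_sum_symdiff)
      then obtain g where g: "g \<in> ?Z" "g \<notin> tree" by (meson subsetI)
      moreover have "f \<notin> ?Z" using True f f' by auto
      ultimately have "f \<noteq> g" "g \<in> C \<union> C'" by auto
      then show ?thesis using f g by (meson UnI1)
    qed (use f f' in blast)
  qed
  then obtain f f' where ff: "f \<in> C \<union> C'" "f' \<in> C \<union> C'" "f \<noteq> f'" "f \<notin> tree" "f' \<notin> tree" by blast
  have "\<exists>x. f = dart_edge x \<and> src x \<in> bfs_ball s \<and> dst x \<in> bfs_ball s" if "f \<in> C \<union> C'" for f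
  proof -
    have fE: "f \<in> E" using that C(4) C'(4) by blast
    have "fst ` f \<subseteq> support C \<union> support C'" using that unfolding support_def by blast
    then have "fst ` f \<subseteq> bfs_ball s" using C(5) C'(5) by blast
    moreover obtain h g where "f = {h, g}" using E(1) fE by (auto simp: is_matching_def card_2_iff)
    ultimately show ?thesis by (intro exI[of _ "(h, g)"]) (auto simp: dart_edge_def src_def dst_def)
  qed
  note ex = this
  obtain x where x: "f = dart_edge x" "src x \<in> bfs_ball s" "dst x \<in> bfs_ball s" using ex[OF ff(1)] by blast
  obtain y where y: "f' = dart_edge y" "src y \<in> bfs_ball s" "dst y \<in> bfs_ball s" using ex[OF ff(2)] by blast
  have "f \<in> E" "f' \<in> E" using ff C C' by auto
  then show ?thesis using tangledI[of x y s] x y ff by auto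
qed

end

section \<open>Cycles of the extended graph and closing steps of walks\<close>

context bethe
begin

lemma ends_core: "e = {h, g} \<Longrightarrow> h \<noteq> g \<Longrightarrow> ends G (Inl e) = {#(fst h, []), (fst g, [])#}"
  by (simp add: ends_G)

lemma count_ends_core:
  assumes "e \<in> E"
  shows "count (ends G (Inl e)) (u, []) = card {h \<in> e. fst h = u}"
proof -
  obtain h g where hg: "e = {h, g}" "h \<noteq> g" using assms by (rule E_doubleton)
  have "{h' \<in> {h, g}. fst h' = u} = (if fst h = u then {h} else {}) \<union> (if fst g = u then {g} else {})" by auto
  then show ?thesis using hg ends_core[OF hg] by auto
qed

lemma ext_fst: "x \<in> ext E \<Longrightarrow> fst x < N"
  by (auto simp: ext_def ext_verts_def core_def core_graph_def)

text \<open>Tree edges are bridges: at its lower end point a lowest tree edge has no other edge of the set.\<close>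

lemma even_edges_core:
  assumes Z: "finite Z" "Z \<subseteq> edges G" "\<And>x. even (\<Sum>e\<in>Z. count (ends G e) x)"
  shows "Z \<subseteq> Inl ` E"
proof (rule ccontr)
  define T where "T = {x. Inr x \<in> Z}"
  assume "\<not> Z \<subseteq> Inl ` E"
  then have "T \<noteq> {}" using Z(2) by (auto simp: T_def edges_G)
  have "finite (Inr -` Z)" using Z(1) by (intro finite_vimageI) auto
  then have finT: "finite T" by (simp add: T_def vimage_def)
  have "Max ((length \<circ> snd) ` T) \<in> (length \<circ> snd) ` T" using finT \<open>T \<noteq> {}\<close> by (intro Max_in) auto
  then obtain x where x: "x \<in> T" "length (snd x) = Max ((length \<circ> snd) ` T)" by auto
  have max: "length (snd y) \<le> length (snd x)" if "y \<in> T" for y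
    unfolding x(2) using that finT by (intro Max_ge) auto
  have xE: "x \<in> ext E - roots" using x(1) Z(2) by (auto simp: T_def edges_G)
  have one: "count (ends G e) x = (if e = Inr x then 1 else 0)" if e: "e \<in> Z" for e
  proof -
    have "e \<in> edges G" using e Z(2) by blast
    then consider e' where "e = Inl e'" "e' \<in> E" | y where "e = Inr y" "y \<in> ext E - roots" unfolding edges_G by blast
    then show ?thesis
    proof cases
      case 1
      have "snd x \<noteq> []" using xE ext_roots[of x E] by auto
      moreover obtain h g where "e' = {h, g}" "h \<noteq> g" using 1(2) by (rule E_doubleton)
      ultimately show ?thesis using ends_core[of e' h g] 1 by (cases x) auto
    next
      case (2 y)
      have "parent y \<noteq> x"
      proof
        assume "parent y = x"
        then have "length (snd x) = length (snd y) - 1" by (auto simp: parent_def)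
        moreover have "snd y \<noteq> []" using 2 ext_roots[of y E] by auto
        then have "0 < length (snd y)" by simp
        moreover have "y \<in> T" using e 2 by (simp add: T_def)
        then have "length (snd y) \<le> length (snd x)" by (rule max)
        ultimately show False by linarith
      qed
      then show ?thesis using 2 by (auto simp: ends_G)
    qed
  qed
  have "(\<Sum>e\<in>Z. count (ends G e) x) = (\<Sum>e\<in>Z. if e = Inr x then 1 else 0)"
    by (intro sum.cong refl) (rule one)
  also have "\<dots> = 1" using Z(1) x(1) by (simp add: T_def)
  finally show False using Z(3)[of x] by simp
qed

text \<open>Projecting every tree to its root does not lengthen paths, and cycles live in the core.
  Hence two cycles in a ball of radius s around a, even if a is a tree vertex, lie in the search
  ball of radius floor s around \<open>fst a\<close>; closing up takes one step more.\<close>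

lemma not_tangle_free_tangled:
  assumes s: "0 \<le> s" and nt: "\<not> tangle_free G s"
  shows "\<exists>v<N. tangled (Suc (nat \<lfloor>s\<rfloor>)) v E"
proof -
  obtain a C C' where a: "a \<in> verts G" and C: "is_cycle (induced G (graph_ball G a s)) C"
    and C': "is_cycle (induced G (graph_ball G a s)) C'" and ne: "C \<noteq> C'"
    using nt unfolding tangle_free_def by blast
  have aN: "fst a < N" using a ext_fst by (simp add: verts_G)
  interpret rooted N d E "fst a" by unfold_locales (rule E)+
  have adjI: "(src x, dst x) \<in> adjacency" if "dart_edge x \<in> E" for x using that unfolding adjacency_def by blast
  have proj: "fst x = fst y \<or> (fst x, fst y) \<in> adjacency" if "(x, y) \<in> adj_rel G" for x y
  proof -
    have "\<exists>e\<in>edges G. ends G e = {#x, y#}" using that by (simp add: adj_rel_def)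
    then obtain e where e: "e \<in> edges G" "ends G e = {#x, y#}" by blast
    then consider e' where "e = Inl e'" "e' \<in> E" | z where "e = Inr z" unfolding edges_G by blast
    then show ?thesis
    proof cases
      case 1
      obtain h g where hg: "e' = {h, g}" "h \<noteq> g" using 1(2) by (rule E_doubleton)
      then have "{#(fst h, []), (fst g, [])#} = {#x, y#}" using ends_core[OF hg] e 1 by simp
      then have "(fst x = fst h \<and> fst y = fst g) \<or> (fst x = fst g \<and> fst y = fst h)"
        by (auto simp: add_eq_conv_ex)
      moreover have "dart_edge (h, g) \<in> E" "dart_edge (g, h) \<in> E" using hg 1 by (auto simp: dart_edge_def insert_commute)
      then have "(fst h, fst g) \<in> adjacency" "(fst g, fst h) \<in> adjacency"
        using adjI[of "(h, g)"] adjI[of "(g, h)"] by (simp_all add: src_def dst_def)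
      ultimately show ?thesis by auto
    next
      case (2 z)
      then have "{#parent z, z#} = {#x, y#}" using e by (simp add: ends_G)
      then have "(x = parent z \<and> y = z) \<or> (x = z \<and> y = parent z)" by (auto simp: add_eq_conv_ex)
      then show ?thesis by (auto simp: parent_def)
    qed
  qed
  have path: "(x, y) \<in> adj_rel G ^^ k \<Longrightarrow> \<exists>j\<le>k. (fst x, fst y) \<in> adjacency ^^ j" for x y k
  proof (induction k arbitrary: y)
    case (Suc k)
    then obtain z where z: "(x, z) \<in> adj_rel G ^^ k" "(z, y) \<in> adj_rel G" by auto
    obtain j where j: "j \<le> k" "(fst x, fst z) \<in> adjacency ^^ j" using Suc.IH[OF z(1)] by blast
    from proj[OF z(2)] show ?case
    proof
      assume "fst z = fst y"
      then show ?thesis using j by (intro exI[of _ j]) auto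
    next
      assume "(fst z, fst y) \<in> adjacency"
      then show ?thesis using j by (intro exI[of _ "Suc j"]) auto
    qed
  qed auto
  have core: "\<exists>C0. C = Inl ` C0 \<and> finite C0 \<and> C0 \<noteq> {} \<and> (\<forall>u. even (\<Sum>e\<in>C0. card {h \<in> e. fst h = u}))
      \<and> C0 \<subseteq> E \<and> support C0 \<subseteq> bfs_ball (nat \<lfloor>s\<rfloor>)"
    if cyc: "is_cycle (induced G (graph_ball G a s)) C" for C
  proof -
    note c = cycle_even[OF cyc]
    have "C \<subseteq> edges G" using c(3) by (auto simp: induced_def)
    moreover have ev: "even (\<Sum>e\<in>C. count (ends G e) x)" for x using c(4)[of x] by (simp add: induced_def)
    ultimately have sub: "C \<subseteq> Inl ` E" using c(1) by (intro even_edges_core)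
    define C0 where "C0 = {e \<in> E. Inl e \<in> C}"
    have eq: "C = Inl ` C0" using sub by (auto simp: C0_def)
    have C0E: "C0 \<subseteq> E" by (auto simp: C0_def)
    have "even (\<Sum>e\<in>C0. card {h \<in> e. fst h = u})" for u
    proof -
      have "(\<Sum>e\<in>C. count (ends G e) (u, [])) = (\<Sum>e\<in>C0. count (ends G (Inl e)) (u, []))"
        unfolding eq by (simp add: sum.reindex)
      also have "\<dots> = (\<Sum>e\<in>C0. card {h \<in> e. fst h = u})"
        using C0E by (intro sum.cong refl count_ends_core) blast
      finally show ?thesis using ev[of "(u, [])"] by simp
    qed
    moreover have "support C0 \<subseteq> bfs_ball (nat \<lfloor>s\<rfloor>)"
    proof
      fix u assume "u \<in> support C0"
      then obtain e h where h: "e \<in> C0" "h \<in> e" "u = fst h" by (auto simp: support_def)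
      have eE: "e \<in> E" using h C0E by blast
      have "0 < card {h \<in> e. fst h = u}"
      proof -
        have "finite e" using eE by (rule E_doubleton) simp
        moreover have "{h \<in> e. fst h = u} \<noteq> {}" using h by blast
        ultimately show ?thesis by (simp add: card_gt_0_iff del: Collect_empty_eq)
      qed
      then have "(u, []) \<in># ends G (Inl e)" using count_ends_core[OF eE, of u] by (simp flip: count_greater_zero_iff)
      moreover have "Inl e \<in> C" using h eq by blast
      then have "set_mset (ends G (Inl e)) \<subseteq> graph_ball G a s" using c(3) by (auto simp: induced_def)
      ultimately have "(u, []) \<in> graph_ball G a s" by blast
      then obtain k where k: "real k \<le> s" "(a, (u, [])) \<in> adj_rel G ^^ k" unfolding graph_ball_def by blast
      then obtain j where "j \<le> k" "(fst a, u) \<in> adjacency ^^ j" using path[OF k(2)] by auto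
      moreover have "k \<le> nat \<lfloor>s\<rfloor>" using k(1) by (rule le_nat_floor)
      ultimately show "u \<in> bfs_ball (nat \<lfloor>s\<rfloor>)" unfolding bfs_ball_def using order_trans by blast
    qed
    moreover have "finite C0" "C0 \<noteq> {}" using c(1,2) eq by (auto simp: finite_image_iff)
    ultimately show ?thesis using eq C0E by blast
  qed
  obtain C0 where C0: "C = Inl ` C0" "finite C0" "C0 \<noteq> {}" "\<And>u. even (\<Sum>e\<in>C0. card {h \<in> e. fst h = u})"
    "C0 \<subseteq> E" "support C0 \<subseteq> bfs_ball (nat \<lfloor>s\<rfloor>)" using core[OF C] by blast
  obtain C1 where C1: "C' = Inl ` C1" "finite C1" "C1 \<noteq> {}" "\<And>u. even (\<Sum>e\<in>C1. card {h \<in> e. fst h = u})"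
    "C1 \<subseteq> E" "support C1 \<subseteq> bfs_ball (nat \<lfloor>s\<rfloor>)" using core[OF C'] by blast
  have "C0 \<noteq> C1" using ne C0(1) C1(1) by blast
  then have "tangled (Suc (nat \<lfloor>s\<rfloor>)) (fst a) E" using two_even_sets_tangled[OF C0(2-6) C1(2-6)] by blast
  then show ?thesis using aN by blast
qed

text \<open>The edge of a closing step forms a cycle with edges used before. The edge of a later
  closing step is new at its time, so it is in no cycle obtained from an earlier one: two closing
  steps give two cycles, both in the ball of radius l around the start.\<close>

lemma closings_not_tangle_free:
  assumes w: "w \<in> real_walks l E" and l: "real l \<le> s" and cl: "\<not> card (chain_walk.closings w) \<le> 1"
  shows "\<not> tangle_free G s"
proof -
  have w': "chain l w" "w \<noteq> []" "length w \<le> l" "set w \<subseteq> X \<times> X" "dart_edge ` set w \<subseteq> E"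
    using w by (auto simp: real_walks_def)
  interpret chain_walk l w by unfold_locales (rule w'(1))
  define pos where "pos t = ((if t = 0 then src (w ! 0) else dst (w ! (t - 1))), [] :: nat list)" for t
  let ?B = "graph_ball G (pos 0) s"
  let ?H = "induced G ?B"
  have wt: "w ! t \<in> X \<times> X" "dart_edge (w ! t) \<in> E" if "t < length w" for t using w'(4,5) that by auto
  have pos_src: "(src (w ! t), []) = pos t" if "t < length w" for t using src_dst[of t] that by (auto simp: pos_def)
  have ends: "ends G (Inl (dart_edge (w ! t))) = {#pos t, pos (Suc t)#}" if t: "t < length w" for t
  using wt(2)[OF t] E(1) ends_core[of "dart_edge (w ! t)" "fst (w ! t)" "snd (w ! t)"] pos_src[OF t] by (fastforce simp: is_matching_def dart_edge_def src_def dst_def pos_def)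
  have edge: "Inl (dart_edge (w ! t)) \<in> edges G" if "t < length w" for t using wt(2)[OF that] by (simp add: edges_G)
  have walk: "(pos 0, pos t) \<in> adj_rel G ^^ t" if "t \<le> length w" for t
    using that
  proof (induction t)
    case (Suc t)
    then have "(pos t, pos (Suc t)) \<in> adj_rel G" unfolding adj_rel_def using edge[of t] ends[of t] by auto
    then show ?case using Suc by auto
  qed simp
  have verts: "pos t \<in> verts G" if "t \<le> length w" for t
  proof -
    have "fst (pos t) < N" using wt(1)[of "t - 1"] wt(1)[of 0] that w'(2)
      by (auto simp: pos_def src_def dst_def X_def mem_Times_iff)
    moreover have "pos t = (fst (pos t), [])" by (simp add: pos_def)
    ultimately have "pos t \<in> roots" unfolding roots_def by (metis imageI lessThan_iff)
    then show ?thesis using roots_subset by (auto simp: verts_G)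
  qed
  have ball: "pos t \<in> ?B" if "t \<le> length w" for t
  proof -
    have "real t \<le> s" using that w'(3) l by linarith
    then show ?thesis using walk[OF that] verts[OF that] unfolding graph_ball_def by blast
  qed
  have edgeH: "Inl (dart_edge (w ! t)) \<in> edges ?H" if "t < length w" for t
    using edge[OF that] ball[of t] ball[of "Suc t"] that ends[OF that] by (auto simp: induced_def)
  have vertsH: "pos t \<in> verts ?H" if "t \<le> length w" for t using verts[OF that] ball[OF that] by (simp add: induced_def)
  let ?Z = "\<lambda>j. (\<lambda>t. Inl (dart_edge (w ! t))) ` {..<j}"
  \<comment> \<open>Loop erasure: a simple path between two positions of the walk, made of edges
    used before time j.\<close>
  have simple: "\<exists>vs es. length vs = Suc (length es) \<and> distinct vs \<and> distinct es \<and> vs ! 0 = pos i \<and> vs ! length es = pos j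
      \<and> set vs \<subseteq> verts ?H \<and> set es \<subseteq> ?Z j \<and> (\<forall>k<length es. ends G (es ! k) = {#vs ! k, vs ! Suc k#})"
    if "i \<le> j" "j \<le> length w" for i j
    using that
  proof (induction j rule: dec_induct)
    case base
    then show ?case using vertsH[of i] by (intro exI[of _ "[pos i]"] exI[of _ "[]"]) auto
  next
    case (step j)
    then obtain vs es where p: "length vs = Suc (length es)" "distinct vs" "distinct es" "vs ! 0 = pos i" "vs ! length es = pos j"
      "set vs \<subseteq> verts ?H" "set es \<subseteq> ?Z j" "\<forall>k<length es. ends G (es ! k) = {#vs ! k, vs ! Suc k#}" by auto
    show ?case
    proof (cases "pos (Suc j) \<in> set vs")
      case True
      then obtain k where k: "k < length vs" "vs ! k = pos (Suc j)" by (metis in_set_conv_nth)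
      have lk: "length (take k es) = k" using k(1) p(1) by simp
      show ?thesis
      proof (intro exI[of _ "take (Suc k) vs"] exI[of _ "take k es"] conjI allI impI)
        show "set (take (Suc k) vs) \<subseteq> verts ?H" using p(6) set_take_subset[of "Suc k" vs] by blast
        have "?Z j \<subseteq> ?Z (Suc j)" by auto
        then show "set (take k es) \<subseteq> ?Z (Suc j)" using p(7) set_take_subset[of k es] by blast
        fix t assume "t < length (take k es)"
        then show "ends G (take k es ! t) = {#take (Suc k) vs ! t, take (Suc k) vs ! Suc t#}" using p(8) by simp
      qed (use p k lk in simp_all)
    next
      case False
      let ?e = "Inl (dart_edge (w ! j))"
      have endse: "ends G ?e = {#pos j, pos (Suc j)#}" using step by (intro ends) auto
      have "?e \<notin> set es"
      proof
        assume "?e \<in> set es"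
        then obtain k where k: "k < length es" "?e = es ! k" by (metis in_set_conv_nth)
        then have "ends G ?e = {#vs ! k, vs ! Suc k#}" using p(8) by simp
        then have "pos (Suc j) \<in># {#vs ! k, vs ! Suc k#}" unfolding endse by (metis add_mset_commute union_single_eq_member)
        then have "pos (Suc j) = vs ! k \<or> pos (Suc j) = vs ! Suc k" by auto
        then show False using False k(1) p(1) by auto
      qed
      moreover have "pos (Suc j) \<in> verts ?H" using step by (intro vertsH) auto
      moreover have "set (es @ [?e]) \<subseteq> ?Z (Suc j)" using p(7) by auto
      ultimately show ?thesis using p False endse
        by (intro exI[of _ "vs @ [pos (Suc j)]"] exI[of _ "es @ [?e]"]) (auto simp: nth_append less_Suc_eq)
    qed
  qed
  have cycle: "\<exists>C. is_cycle ?H C \<and> Inl (dart_edge (w ! x)) \<in> C \<and> C \<subseteq> ?Z (Suc x)" if x: "x \<in> closings" for x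
  proof -
    have x': "x < length w" "new_step w x" "dst (w ! x) \<in> visited w x" using x by (auto simp: closings_def closing_step_def)
    obtain i where i: "i \<le> x" "pos i = pos (Suc x)"
    proof -
      from x'(3) consider "dst (w ! x) = src (w ! 0)" | i where "i < x" "dst (w ! x) = dst (w ! i)" by (auto simp: visited_def)
      then show thesis
      proof cases
        case 1
        then show thesis using that[of 0] by (simp add: pos_def)
      next
        case (2 i)
        then show thesis using that[of "Suc i"] by (simp add: pos_def)
      qed
    qed
    obtain vs es where p: "length vs = Suc (length es)" "distinct vs" "distinct es" "vs ! 0 = pos i" "vs ! length es = pos x"
      "set vs \<subseteq> verts ?H" "set es \<subseteq> ?Z x" "\<forall>k<length es. ends G (es ! k) = {#vs ! k, vs ! Suc k#}"
      using simple[of i x] i x' by auto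
    let ?e = "Inl (dart_edge (w ! x))"
    have new: "?e \<notin> ?Z x" using x'(2) by (auto simp: new_step_def)
    have "is_cycle ?H (insert ?e (set es))"
      unfolding is_cycle_def
    proof (intro exI[of _ vs] exI[of _ "es @ [?e]"] conjI allI impI)
      show "set (es @ [?e]) \<subseteq> edges ?H" using p(7) edgeH x' by auto
      show "distinct (es @ [?e])" using p(3,7) new by auto
      fix k assume k: "k < length (es @ [?e])"
      show "ends ?H ((es @ [?e]) ! k) = {#vs ! k, vs ! (Suc k mod length vs)#}"
      proof (cases "k = length es")
        case True
        then show ?thesis using p i ends[OF x'(1)] by (simp add: induced_def)
      next
        case False
        then show ?thesis using p k by (simp add: nth_append induced_def)
      qed
    qed (use p in auto)
    moreover have "insert ?e (set es) \<subseteq> ?Z (Suc x)" using p(7) by auto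
    ultimately show ?thesis by blast
  qed
  have "\<exists>x\<in>closings. \<exists>y\<in>closings. x \<noteq> y"
  proof (rule ccontr)
    assume "\<not> ?thesis"
    then have "closings \<subseteq> {SOME x. x \<in> closings}" by (metis singletonI some_in_eq subsetI empty_iff)
    then have "card closings \<le> 1" using card_mono[of "{SOME x. x \<in> closings}" closings] by simp
    then show False using cl by simp
  qed
  then obtain x y where xy: "x \<in> closings" "y \<in> closings" "x < y" by (metis linorder_neqE_nat)
  obtain C where C: "is_cycle ?H C" "C \<subseteq> ?Z (Suc x)" using cycle[OF xy(1)] by blast
  obtain C' where C': "is_cycle ?H C'" "Inl (dart_edge (w ! y)) \<in> C'" using cycle[OF xy(2)] by blast
  have "Inl (dart_edge (w ! y)) \<notin> ?Z (Suc x)"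
  proof
    assume "Inl (dart_edge (w ! y)) \<in> ?Z (Suc x)"
    then obtain t where "t < Suc x" "dart_edge (w ! t) = dart_edge (w ! y)" by auto
    moreover have "new_step w y" using xy(2) by (simp add: closings_def closing_step_def)
    ultimately show False using xy(3) by (auto simp: new_step_def)
  qed
  then have "C \<noteq> C'" using C C' by blast
  then show ?thesis unfolding tangle_free_def using C(1) C'(1) verts[of 0] by blast
qed

end

section \<open>Exceptional events and asymptotics\<close>

text \<open>Translates the edge condition of \<open>omega_bar\<close> into a lower bound p d N / 4
  for the number of undirected edges.\<close>

lemma card_directed_core_edges:
  assumes "is_matching E" "finite E"
  shows "card (directed_core_edges E) = 2 * card E"
proof -
  have two: "\<exists>h g. e = {h, g} \<and> h \<noteq> g" if "e \<in> E" for e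
    using that assms(1) by (auto simp: is_matching_def card_2_iff)
  have *: "card {x. dart_edge x = e} = 2" "finite {x. dart_edge x = e}" if e: "e \<in> E" for e
  proof -
    obtain h g where hg: "e = {h, g}" "h \<noteq> g" using two[OF e] by blast
    have "dart_edge x = e \<longleftrightarrow> x = (h, g) \<or> x = (g, h)" for x
      using dart_edge_eq[of x "(h, g)"] hg by (simp add: dart_edge_def)
    then have "{x. dart_edge x = e} = {(h, g), (g, h)}" by auto
    then show "card {x. dart_edge x = e} = 2" "finite {x. dart_edge x = e}" using hg by auto
  qed
  have "directed_core_edges E = (\<Union>e\<in>E. {x. dart_edge x = e})"
    by (auto simp: directed_core_edges_def dart_edge_def)
  also have "card \<dots> = (\<Sum>e\<in>E. card {x. dart_edge x = e})"
    using assms(2) * by (intro card_UN_disjoint) auto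
  finally show ?thesis using * by simp
qed

text \<open>Given the matching, the number of kept edges is binomial with mean p n / 2, n the number
  of half-edges; this is the Hoeffding bound at half the mean, averaged over matchings.\<close>

lemma prob_few_edges:
  assumes X: "finite X" "even (card X)" "0 < card X" and p: "0 \<le> p" "p \<le> 1"
  shows "measure_pmf.prob (kept_edges X p) {E. real (card E) < p * real (card X) / 4} \<le> exp (- p\<^sup>2 * real (card X) / 4)"
proof -
  let ?PM = "perfect_matchings X" and ?A = "{E :: 'a set set. real (card E) < p * real (card X) / 4}"
  let ?R = "\<lambda>M. map_pmf (\<lambda>\<omega>. {e \<in> M. \<omega> e}) (Pi_pmf M False (\<lambda>_. bernoulli_pmf p))"
  have fin: "finite ?PM" "?PM \<noteq> {}" using X by (auto simp: finite_perfect_matchings perfect_matchings_nonempty)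
  have inner: "measure_pmf.prob (?R M) ?A \<le> exp (- p\<^sup>2 * real (card X) / 4)" if M: "M \<in> ?PM" for M
  proof -
    have fM: "finite M" using M X finite_matching by auto
    have "is_matching M" "\<Union>M = X" using M by (auto simp: perfect_matchings_iff)
    then have k: "card X = 2 * card M" using card_Union_matching[of M] fM by simp
    then have k0: "0 < card M" using X by simp
    let ?k = "real (card M)"
    have "measure_pmf.prob (?R M) ?A = measure_pmf.prob (map_pmf (\<lambda>f. card {x \<in> M. f x}) (Pi_pmf M False (\<lambda>_. bernoulli_pmf p))) {x. real x < p * real (card X) / 4}"
      by simp
    also have "\<dots> = measure_pmf.prob (binomial_pmf (card M) p) {x. real x < p * real (card X) / 4}"
      using binomial_pmf_altdef'[OF fM refl, of p False] p by simp
    also have "\<dots> \<le> measure_pmf.prob (binomial_pmf (card M) p) {x. real x \<le> ?k * p - ?k * p / 2}"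
      by (rule measure_pmf.finite_measure_mono) (auto simp: k)
    also have "\<dots> \<le> exp (-2 * (?k * p / 2)\<^sup>2 / ?k)"
    proof (rule binomial_distribution.prob_le)
      show "binomial_distribution p" by unfold_locales (use p in auto)
    qed (use k0 p in auto)
    also have "-2 * (?k * p / 2)\<^sup>2 / ?k = - p\<^sup>2 * real (card X) / 4"
      using k by (simp add: power2_eq_square)
    finally show ?thesis .
  qed
  have ind: "measure_pmf.expectation R (indicator A) /\<^sub>R b = measure_pmf.prob R A / b" for R :: "'a set set pmf" and A b
    by (simp add: divide_inverse)
  have "measure_pmf.prob (kept_edges X p) ?A = measure_pmf.expectation (kept_edges X p) (indicator ?A)" by simp
  also have "\<dots> = (\<Sum>M\<in>?PM. measure_pmf.expectation (?R M) (indicator ?A) /\<^sub>R real (card ?PM))"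
    unfolding kept_edges_def using fin finite_matching[OF X(1)]
    by (intro pmf_expectation_bind_pmf_of_set) (auto intro!: finite_set_Pi_pmf_bool)
  also have "\<dots> = (\<Sum>M\<in>?PM. measure_pmf.prob (?R M) ?A / real (card ?PM))"
    by (simp only: ind)
  also have "\<dots> \<le> (\<Sum>M\<in>?PM. exp (- p\<^sup>2 * real (card X) / 4) / real (card ?PM))"
    by (intro sum_mono divide_right_mono inner) auto
  also have "\<dots> = exp (- p\<^sup>2 * real (card X) / 4)" using fin by simp
  finally show ?thesis .
qed

text \<open>The deterministic part: on a tangle-free outcome with a small trace and few vertices
  near cycles, no real eigenvalue of the centred operator reaches s0. The second summand in the
  bound by D accounts for \<open>reach\<close> from the at most l visited vertices.\<close>

lemma (in trace_model) graph_lambda_good: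
  assumes E: "is_matching E" "\<Union>E \<subseteq> X" and l: "0 < l" "real l \<le> s" and tf: "tangle_free (inf_graph d N E) s"
    and nc: "real (card (near_cycle l E)) + real l * ((real l + 1) * real d ^ l) \<le> real D"
    and m: "0 < m" "0 \<le> \<gamma>" and tr: "(\<Sum>h\<in>X. kpow X (kernel l E) (2 * m) h h) \<le> \<gamma> ^ m"
    and s0: "1 < s0" and N2: "2 \<le> N"
    and large: "2 * (real d)\<^sup>2 * (\<gamma> + n * (real l * (2 * real d) ^ l * (c * (real D * real d)))\<^sup>2) < s0 ^ (2 * l)"
  shows "graph_lambda 2 (inf_graph d N E) \<le> s0 + (real d - 1) / s0"
proof -
  have c0: "0 \<le> c" using c p n1 by simp
  have "c * n \<le> 1" using cn n_pos by (simp add: field_simps)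
  then interpret B: bethe N d E c by unfold_locales (use E c0 in auto)
  have ncf: "finite (near_cycle l E)" using near_cycle_subset by (rule finite_subset) simp
  have D: "finite (near_cycle l E \<union> reach l E U) \<and> card (near_cycle l E \<union> reach l E U) \<le> D" if U: "finite U" "card U \<le> l" for U
  proof -
    have r: "finite (reach l E U)" "card (reach l E U) \<le> card U * ((l + 1) * d ^ l)" using card_reach[OF E(1) U(1)] by auto
    have "card (near_cycle l E \<union> reach l E U) \<le> card (near_cycle l E) + card (reach l E U)" by (rule card_Un_le)
    also have "\<dots> \<le> card (near_cycle l E) + l * ((l + 1) * d ^ l)" using r(2) U(2) by (intro add_left_mono) (meson mult_le_mono1 order_trans)
    finally have "real (card (near_cycle l E \<union> reach l E U)) \<le> real (card (near_cycle l E) + l * ((l + 1) * d ^ l))" by (rule of_nat_mono)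
    also have "\<dots> \<le> real D" using nc by (simp add: algebra_simps)
    finally show ?thesis using ncf r(1) by simp
  qed
  have cl: "card (chain_walk.closings w) \<le> 1" if "w \<in> real_walks l E" for w
    using B.closings_not_tangle_free[OF that l(2)] tf by (auto simp: B.G_def)
  have \<gamma>: "sqnorm X (kapply X (kernel l E) y) \<le> \<gamma> * sqnorm X y" for y
  proof (rule power_le_imp_le_base)
    have "sqnorm X (kapply X (kernel l E) y) ^ m \<le> (\<Sum>h\<in>X. kpow X (kernel l E) (2 * m) h h) * sqnorm X y ^ m"
      by (rule sqnorm_kapply_power) (use m kernel_sym[OF l(1)] in auto)
    also have "\<dots> \<le> \<gamma> ^ m * sqnorm X y ^ m" using tr sqnorm_nonneg[of X y] by (intro mult_right_mono) auto
    finally have "sqnorm X (kapply X (kernel l E) y) ^ m \<le> (\<gamma> * sqnorm X y) ^ m" by (simp add: power_mult_distrib)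
    then show "sqnorm X (kapply X (kernel l E) y) ^ Suc (m - 1) \<le> (\<gamma> * sqnorm X y) ^ Suc (m - 1)" using m by simp
    show "0 \<le> \<gamma> * sqnorm X y" using m sqnorm_nonneg[of X y] by simp
  qed
  have "graph_lambda 2 B.G \<le> s0 + (real d - 1) / s0"
  proof (rule B.graph_lambda_le[OF s0 N2])
    fix t x assume t: "s0 \<le> t" and x: "0 < sqnorm X x"
    show "\<exists>h\<in>X. t * x h \<noteq> (\<Sum>g\<in>X. (B.mate h g - c) * (\<Sum>j\<in>siblings g. x j))"
    proof (rule ccontr)
      assume "\<not> ?thesis"
      then have ev: "t * x h = (\<Sum>g\<in>X. weight E (h, g) * nbsum x g)" if "h \<in> X" for h
        using that by (simp add: weight_def dart_edge_def B.mate_def nbsum_def)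
      have "t ^ (2 * l) \<le> 2 * (real d)\<^sup>2 * (\<gamma> + n * (real l * (2 * real d) ^ l * (c * (real D * real d)))\<^sup>2)"
        by (rule eigenvalue_bound[OF E(1) l(1) D cl ev x \<gamma>])
      moreover have "s0 ^ (2 * l) \<le> t ^ (2 * l)" using t s0 by (intro power_mono) auto
      ultimately show False using large by linarith
    qed
  qed
  then show ?thesis by (simp add: B.G_def)
qed

lemma (in trace_model) prob_trace_large:
  assumes l: "0 < l" and m: "0 < m" and L: "L = 2 * m * l" "real L \<le> K" and Q: "Q = 4 * (real L + 1)\<^sup>2"
    and small: "Q ^ (4 + 18 * m) * (2 * r) ^ 9 * (real d * (real L + 1)) \<le> n / 2" and \<gamma>: "0 < \<gamma>"
  shows "measure_pmf.prob (kept_edges X p) {E. \<gamma> ^ m < (\<Sum>h\<in>X. kpow X (kernel l E) (2 * m) h h)}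
    \<le> 8 * r ^ L * n * (2 * r) ^ (12 * m) * Q ^ (10 * m + 24 * m * m) / \<gamma> ^ m"
proof -
  let ?T = "\<lambda>E. \<Sum>h\<in>X. kpow X (kernel l E) (2 * m) h h"
  have "measure_pmf.expectation (kept_edges X p) ?T \<le> 8 * r ^ L * n * (2 * r) ^ (6 * (2 * m)) * Q ^ (5 * (2 * m) + 6 * (2 * m) * (2 * m))"
    by (rule expectation_trace[OF l _ L Q]) (use m small in \<open>auto\<close>)
  then have ex: "measure_pmf.expectation (kept_edges X p) ?T \<le> 8 * r ^ L * n * (2 * r) ^ (12 * m) * Q ^ (10 * m + 24 * m * m)"
    by (simp add: mult.assoc)
  have nn: "0 \<le> ?T E" for E
  proof -
    have "(\<Sum>h\<in>X. \<Sum>g\<in>X. (kpow X (kernel l E) m h g)\<^sup>2) = ?T E"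
      by (rule frobenius_kpow) (use kernel_sym[OF l] in auto)
    moreover have "0 \<le> (\<Sum>h\<in>X. \<Sum>g\<in>X. (kpow X (kernel l E) m h g)\<^sup>2)" by (intro sum_nonneg) auto
    ultimately show ?thesis by simp
  qed
  have "measure_pmf.prob (kept_edges X p) {E. \<gamma> ^ m < ?T E} \<le> measure_pmf.prob (kept_edges X p) {E \<in> space (kept_edges X p). \<gamma> ^ m \<le> ?T E}"
    by (rule measure_pmf.finite_measure_mono) auto
  also have "\<dots> \<le> measure_pmf.expectation (kept_edges X p) ?T / \<gamma> ^ m"
    using nn \<gamma> by (intro integral_Markov_inequality_measure[where A = "{}"]) auto
  also have "\<dots> \<le> 8 * r ^ L * n * (2 * r) ^ (12 * m) * Q ^ (10 * m + 24 * m * m) / \<gamma> ^ m"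
    using ex \<gamma> by (intro divide_right_mono) auto
  finally show ?thesis .
qed

lemma (in sparse_edges) prob_near_cycle_large:
  assumes K: "M * l \<le> K" and a: "0 < a"
  shows "measure_pmf.prob P {E. a < real (card (near_cycle l E))}
    \<le> ((2 * real K + real l * (real d - 1) ^ l * (real d * (2 * real K + real l))) / a) ^ M"
proof (cases "M = 0")
  case False
  let ?T = "2 * real K + real l * (real d - 1) ^ l * (real d * (2 * real K + real l))"
  have "measure_pmf.prob P {E. a < real (card (near_cycle l E))} \<le> measure_pmf.prob P {E \<in> space P. a ^ M \<le> real (card (near_cycle l E)) ^ M}"
    using a by (intro measure_pmf.finite_measure_mono) (auto intro: power_mono)
  also have "\<dots> \<le> measure_pmf.expectation P (\<lambda>E. real (card (near_cycle l E)) ^ M) / a ^ M"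
    using a by (intro integral_Markov_inequality_measure[where A = "{}"]) auto
  also have "\<dots> \<le> ?T ^ M / a ^ M"
    using near_cycle_moment[of "{}" M l] K a by (intro divide_right_mono) auto
  finally show ?thesis by (simp add: power_divide)
qed simp

text \<open>For s = log N / 6 to base d - 1, the bound is N times the square of N^(1/6) N^(1/6) / N,
  up to logarithms, hence of order N^(-1/3).\<close>

lemma (in sparse_edges) prob_not_tangle_free:
  assumes P: "\<And>E. E \<in> set_pmf P \<Longrightarrow> is_matching E \<and> \<Union>E \<subseteq> X"
    and s: "0 \<le> s" and m: "m = Suc (nat \<lfloor>s\<rfloor>)" "4 * m \<le> K"
  defines "x \<equiv> 4 * real m + 1"
  shows "measure_pmf.prob P {E. \<not> tangle_free (inf_graph d N E) s}
    \<le> real N * ((1 + real d * x * (real m * (real d - 1) ^ m)) * (real d * x * (real m * ((real d - 1) ^ m * (real d * (x + real m)) / n))))\<^sup>2"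
proof -
  have "measure_pmf.prob P {E. \<not> tangle_free (inf_graph d N E) s} \<le> measure_pmf.prob P (\<Union>v<N. {E. tangled m v E})"
  proof (rule measure_pmf.finite_measure_mono_AE)
    show "AE E in P. E \<in> {E. \<not> tangle_free (inf_graph d N E) s} \<longrightarrow> E \<in> (\<Union>v<N. {E. tangled m v E})"
    proof (rule AE_pmfI, rule impI)
      fix E assume E: "E \<in> set_pmf P" "E \<in> {E. \<not> tangle_free (inf_graph d N E) s}"
      interpret B: bethe N d E 0 by unfold_locales (use P[OF E(1)] in auto)
      show "E \<in> (\<Union>v<N. {E. tangled m v E})" using B.not_tangle_free_tangled[OF s] E(2) m by (auto simp: B.G_def)
    qed
  qed auto
  also have "\<dots> \<le> (\<Sum>v<N. measure_pmf.prob P {E. tangled m v E})"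
    by (rule measure_pmf.finite_measure_subadditive_finite) auto
  also have "\<dots> \<le> (\<Sum>v<N. ((1 + real d * x * (real m * (real d - 1) ^ m)) * (real d * x * (real m * ((real d - 1) ^ m * (real d * (x + real m)) / n))))\<^sup>2)"
    unfolding x_def by (intro sum_mono prob_tangled m)
  finally show ?thesis by simp
qed

text \<open>Since p < 1 there is room: each factor p / (n - 1 - 2 i) is at most 1 / n as long as i
  stays below K.\<close>

lemma (in half_edges) sparse_kept_edges:
  assumes ev: "even (N * d)" and p: "0 \<le> p" "p \<le> 1" and K: "p * n \<le> n - 1 - 2 * real K"
  shows "sparse_edges N d (kept_edges X p) K"
proof unfold_locales
  have eX: "even (card X)" using ev by (simp add: card_X)
  show "finite (set_pmf (kept_edges X p))" by (rule finite_set_kept_edges) (use eX in auto)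
  fix F :: "hedge set set" assume F: "finite F" "card F \<le> K"
  have "match_prob (card X) p (card F) \<le> (1 / n) ^ card F"
  proof -
    have nX: "real (card X) = n" by (simp add: card_X n_def)
    have "match_prob (card X) p (card F) = (\<Prod>i<card F. p * (1 / (n - 1 - 2 * real i)))"
      unfolding match_prob_def nX prod.distrib by simp
    also have "\<dots> \<le> (\<Prod>i<card F. 1 / n)"
    proof (rule prod_mono)
      fix i assume "i \<in> {..<card F}"
      then have "real i < real K" using F by simp
      then have b: "p * n \<le> n - 1 - 2 * real i" "0 < n - 1 - 2 * real i"
        using K mult_nonneg_nonneg[OF p(1), of n] n_pos by linarith+
      then show "0 \<le> p * (1 / (n - 1 - 2 * real i)) \<and> p * (1 / (n - 1 - 2 * real i)) \<le> 1 / n"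
        using p by (simp add: field_simps)
    qed
    finally show ?thesis by simp
  qed
  then show "measure_pmf.prob (kept_edges X p) {E. F \<subseteq> E} \<le> (1 / n) ^ card F"
    using prob_kept_edges[OF finite_X eX p F(1)] n_pos by simp
qed

text \<open>The quadratic is negative at sqrt (d - 1), by the lower bound on \<mu>, and positive at
  d - 1, by the upper one.\<close>

lemma keep_prob_bounds:
  assumes d: "3 \<le> d" and \<mu>: "2 * sqrt (real d - 1) < \<mu>" "\<mu> < real d"
  shows "0 < keep_prob d \<mu>" "keep_prob d \<mu> < 1"
proof -
  let ?r = "sqrt (real d - 1)" and ?f = "\<lambda>t. t\<^sup>2 - \<mu> * t + real d - 1"
  have r: "1 < ?r" "?r * ?r = real d - 1" using d by auto
  have rd: "?r < real d - 1" using r mult_strict_right_mono[of 1 ?r ?r] by simp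
  have f0: "?f ?r < 0"
  proof -
    have "?f ?r = (2 * ?r - \<mu>) * ?r" using r(2) by (simp add: algebra_simps)
    also have "\<dots> < 0" using \<mu>(1) r(1) by (intro mult_neg_pos) auto
    finally show ?thesis .
  qed
  have f1: "?f (real d - 1) > 0"
  proof -
    have "?f (real d - 1) = (real d - \<mu>) * (real d - 1)" by (simp add: power2_eq_square algebra_simps)
    also have "\<dots> > 0" using \<mu>(2) d by (intro mult_pos_pos) auto
    finally show ?thesis .
  qed
  have "continuous_on {?r..real d - 1} ?f" by (intro continuous_intros)
  then obtain t where t: "?r \<le> t" "t \<le> real d - 1" "?f t = 0"
    using IVT'[of ?f ?r 0 "real d - 1"] f0 f1 rd by auto
  have ts: "?r < t" "t < real d - 1" using t f0 f1 by (auto simp: order_le_less)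
  \<comment> \<open>By Vieta the two roots have product d - 1, so they cannot both exceed sqrt (d -
    1).\<close>
  have uniq: "u = t" if u: "u\<^sup>2 - \<mu> * u + real d - 1 = 0" "?r < u" for u
  proof (rule ccontr)
    assume ne: "u \<noteq> t"
    have "(u - t) * (u + t - \<mu>) = 0" using u(1) t(3) by (simp add: power2_eq_square algebra_simps)
    then have "\<mu> = u + t" using ne by simp
    then have "u * t = real d - 1" using u(1) by (simp add: power2_eq_square algebra_simps)
    moreover have "?r * ?r < u * t" using u(2) ts(1) r(1) by (intro mult_strict_mono) linarith+
    ultimately show False by simp
  qed
  have "theta d \<mu> = t" unfolding theta_def
  proof (rule the_equality)
    show "t\<^sup>2 - \<mu> * t + real d - 1 = 0 \<and> ?r < t \<and> t < real d - 1" using t(3) ts by blast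
  qed (use uniq in blast)
  moreover have "0 < t" "0 < real d - 1" using ts r(1) by linarith+
  ultimately show "0 < keep_prob d \<mu>" "keep_prob d \<mu> < 1" using ts by (simp_all add: keep_prob_def)
qed

text \<open>All requirements on the parameters as explicit inequalities, so that only asymptotics
  remain. Each of the two bad events has probability at most \<epsilon>, and division by a
  conditioning probability of at least 1/2 gives 4 \<epsilon>.\<close>

lemma conditional_bound:
  fixes d N l m Kn M D :: nat and \<mu> s s0 K \<gamma> a \<epsilon> :: real
  defines "p \<equiv> keep_prob d \<mu>" and "n \<equiv> real (N * d)" and "r \<equiv> sqrt (real d - 1)" and "L \<equiv> 2 * m * l" and "m' \<equiv> Suc (nat \<lfloor>s\<rfloor>)"
  defines "\<eta> \<equiv> 1 / r" and "Q \<equiv> 4 * (real L + 1)\<^sup>2" and "c \<equiv> p / (n - 1)" and "x \<equiv> 4 * real m' + 1"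
  assumes d: "3 \<le> d" and N: "2 \<le> N" and ev: "even (N * d)" and p: "0 < p" "p < 1"
    and l: "0 < l" "real l \<le> s" and s: "s = 1 / 6 * log (real d - 1) (real N)" and m: "0 < m"
    and K: "real L \<le> K" "4 * K\<^sup>2 \<le> n - 1" "4 * K < n - 1" "2 * K * (1 + \<eta>) \<le> (n - 1) * \<eta>\<^sup>2"
    and pn: "p * n \<le> n - 1 - 2 * real Kn"
    and small: "Q ^ (4 + 18 * m) * (2 * r) ^ 9 * (real d * (real L + 1)) \<le> n / 2"
    and \<gamma>: "0 < \<gamma>" "8 * r ^ L * n * (2 * r) ^ (12 * m) * Q ^ (10 * m + 24 * m * m) / \<gamma> ^ m \<le> \<epsilon>"
    and a: "0 < a" "M * l \<le> Kn" "((2 * real Kn + real l * (real d - 1) ^ l * (real d * (2 * real Kn + real l))) / a) ^ M \<le> \<epsilon>"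
    and D: "a + real l * ((real l + 1) * real d ^ l) \<le> real D"
    and s0: "1 < s0" "2 * (real d)\<^sup>2 * (\<gamma> + n * (real l * (2 * real d) ^ l * (c * (real D * real d)))\<^sup>2) < s0 ^ (2 * l)"
    and m': "4 * m' \<le> Kn"
      "real N * ((1 + real d * x * (real m' * (real d - 1) ^ m')) * (real d * x * (real m' * ((real d - 1) ^ m' * (real d * (x + real m')) / n))))\<^sup>2 \<le> 1 / 4"
    and few: "exp (- p\<^sup>2 * n / 4) \<le> 1 / 4"
  shows "\<P>(E in measure_pmf (random_edges d \<mu> N). graph_lambda 2 (inf_graph d N E) \<le> s0 + (real d - 1) / s0
      \<bar> omega_bar d \<mu> N E) \<ge> 1 - 4 * \<epsilon>"
proof -
  interpret H: half_edges N d by unfold_locales (use N d in auto)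
  have nn: "H.n = n" by (simp add: H.n_def n_def)
  have cX: "real (card H.X) = n" by (simp add: H.card_X n_def)
  have n2: "6 \<le> n"
  proof -
    have "2 * 3 \<le> N * d" using N d by (rule mult_le_mono)
    then show ?thesis unfolding n_def by linarith
  qed
  have pn1: "p * n \<le> n - 1" using pn by linarith
  have cn: "c \<le> 1 / n" using pn1 n2 by (simp add: c_def field_simps)
  have r0: "0 < r" using d by (simp add: r_def)
  interpret T: trace_model N d p c \<eta> K
  proof (unfold_locales, unfold cX nn)
    show "even (card H.X)" using ev by (simp add: H.card_X)
    show "0 < \<eta>" using r0 by (simp add: \<eta>_def)
    show "\<eta> = 1 / sqrt (real d - 1)" by (simp add: \<eta>_def r_def)
  qed (use p K d n2 cn in \<open>auto simp: c_def\<close>)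
  interpret S: sparse_edges N d "kept_edges H.X p" Kn
    by (rule H.sparse_kept_edges[OF ev]) (use p pn nn in auto)
  let ?P = "random_edges d \<mu> N"
  have P: "?P = kept_edges H.X p" by (simp add: random_edges_kept H.X_def p_def)
  have E: "is_matching E" "\<Union>E \<subseteq> H.X" "finite E" if "E \<in> set_pmf ?P" for E
    using set_kept_edges[of H.X E p] that ev unfolding P by (auto simp: H.card_X)
  let ?T = "\<lambda>E. \<Sum>h\<in>H.X. kpow H.X (T.kernel l E) (2 * m) h h"
  let ?B1 = "{E. \<gamma> ^ m < ?T E}" and ?B2 = "{E. a < real (card (H.near_cycle l E))}"
  let ?A = "{E. graph_lambda 2 (inf_graph d N E) \<le> s0 + (real d - 1) / s0 \<and> omega_bar d \<mu> N E}"
  let ?O = "{E. omega_bar d \<mu> N E}"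
  have B1: "measure_pmf.prob ?P ?B1 \<le> \<epsilon>"
    using T.prob_trace_large[OF l(1) m _ K(1), of Q \<gamma>] small \<gamma> unfolding P nn r_def Q_def L_def by auto
  have B2: "measure_pmf.prob ?P ?B2 \<le> \<epsilon>"
    using S.prob_near_cycle_large[OF a(2,1)] a(3) unfolding P by linarith
  have good: "graph_lambda 2 (inf_graph d N E) \<le> s0 + (real d - 1) / s0"
    if "E \<in> set_pmf ?P" "omega_bar d \<mu> N E" "E \<notin> ?B1" "E \<notin> ?B2" for E
  proof (rule T.graph_lambda_good[OF E(1,2)[OF that(1)] l _ _ m _ _ s0(1) N])
    show "tangle_free (inf_graph d N E) s" using that(2) unfolding omega_bar_def s by simp
    show "real (card (H.near_cycle l E)) + real l * ((real l + 1) * real d ^ l) \<le> real D" using that(4) D by simp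
    show "0 \<le> \<gamma>" using \<gamma> by simp
    show "?T E \<le> \<gamma> ^ m" using that(3) by simp
    show "2 * (real d)\<^sup>2 * (\<gamma> + H.n * (real l * (2 * real d) ^ l * (c * (real D * real d)))\<^sup>2) < s0 ^ (2 * l)"
      unfolding nn by (rule s0(2))
  qed
  have O: "measure_pmf.prob ?P ?O \<le> measure_pmf.prob ?P ?A + 2 * \<epsilon>"
  proof -
    have "measure_pmf.prob ?P ?O \<le> measure_pmf.prob ?P (?A \<union> (?B1 \<union> ?B2))"
    proof (rule measure_pmf.finite_measure_mono_AE)
      show "AE E in ?P. E \<in> ?O \<longrightarrow> E \<in> ?A \<union> (?B1 \<union> ?B2)"
        using good by (intro AE_pmfI) blast
    qed auto
    also have "\<dots> \<le> measure_pmf.prob ?P ?A + (measure_pmf.prob ?P ?B1 + measure_pmf.prob ?P ?B2)"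
      by (intro order_trans[OF measure_Un_le] add_left_mono measure_Un_le) auto
    finally show ?thesis using B1 B2 by linarith
  qed
  \<comment> \<open>Being tangled and having too few edges each have probability at most
    1/4.\<close>
  have half: "1 / 2 \<le> measure_pmf.prob ?P ?O"
  proof -
    let ?N1 = "{E. \<not> tangle_free (inf_graph d N E) s}" and ?N2 = "{E. real (card E) < p * n / 4}"
    have s_nn: "0 \<le> s" using l by linarith
    have "measure_pmf.prob ?P ?N1 \<le> 1 / 4"
      using S.prob_not_tangle_free[OF _ s_nn m'_def[THEN meta_eq_to_obj_eq] m'(1)] m'(2) E unfolding P nn x_def by fastforce
    moreover have "measure_pmf.prob ?P ?N2 \<le> 1 / 4"
    proof -
      have "even (card H.X)" using ev by (simp add: H.card_X)
      moreover have "0 < card H.X" using cX n2 by linarith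
      ultimately have "measure_pmf.prob ?P ?N2 \<le> exp (- p\<^sup>2 * n / 4)"
        using prob_few_edges[of H.X p] p unfolding P cX by simp
      then show ?thesis using few by linarith
    qed
    moreover have "measure_pmf.prob ?P UNIV \<le> measure_pmf.prob ?P (?O \<union> (?N1 \<union> ?N2))"
    proof (rule measure_pmf.finite_measure_mono_AE)
      show "AE E in ?P. E \<in> UNIV \<longrightarrow> E \<in> ?O \<union> (?N1 \<union> ?N2)"
      proof (rule AE_pmfI, rule impI)
        fix E assume ES: "E \<in> set_pmf ?P"
        have "real (card (directed_core_edges E)) = 2 * real (card E)" using card_directed_core_edges[OF E(1,3)[OF ES]] by simp
        then show "E \<in> ?O \<union> (?N1 \<union> ?N2)" by (auto simp: omega_bar_def s n_def p_def field_simps)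
      qed
    qed auto
    moreover have "measure_pmf.prob ?P (?O \<union> (?N1 \<union> ?N2)) \<le> measure_pmf.prob ?P ?O + (measure_pmf.prob ?P ?N1 + measure_pmf.prob ?P ?N2)"
      by (intro order_trans[OF measure_Un_le] add_left_mono measure_Un_le) auto
    ultimately show ?thesis by simp
  qed
  have e0: "0 \<le> \<epsilon>" using B1 measure_nonneg[of "measure_pmf ?P" ?B1] by linarith
  have "1 - 4 * \<epsilon> \<le> measure_pmf.prob ?P ?A / measure_pmf.prob ?P ?O"
  proof -
    have "(1 - 4 * \<epsilon>) * measure_pmf.prob ?P ?O = measure_pmf.prob ?P ?O - 4 * \<epsilon> * measure_pmf.prob ?P ?O" by (simp add: algebra_simps)
    also have "\<dots> \<le> measure_pmf.prob ?P ?O - 2 * \<epsilon>" using mult_left_mono[OF half, of "4 * \<epsilon>"] e0 by simp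
    also have "\<dots> \<le> measure_pmf.prob ?P ?A" using O by linarith
    finally show ?thesis using half by (simp add: pos_le_divide_eq)
  qed
  then show ?thesis by (simp add: cond_prob_def)
qed

section \<open>Asymptotics of the parameters\<close>

lemma eventually_log_bounds:
  fixes k b :: real and M :: nat
  assumes "0 < k"
  shows "\<forall>\<^sub>F t in at_top. 1 \<le> ln (ln t) \<and> 4 \<le> ln t \<and> b \<le> ln t / (200 * k) \<and> ln t * ln (ln t) + 1 \<le> (ln t)\<^sup>2
    \<and> real M * ln t \<le> (ln t) ^ 3 - 1 \<and> 4 * ln t \<le> (ln t) ^ 3 - 1"
  unfolding eventually_conj_iff using assms by (intro conjI; real_asymp)

lemma eventually_size_bounds:
  fixes d p \<eta> R :: real
  assumes "3 \<le> d" "0 < p" "p < 1" "0 < \<eta>" "0 < R"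
  shows "\<forall>\<^sub>F t in at_top. 4 * ((ln t) ^ 3)\<^sup>2 \<le> t * d - 1 \<and> 4 * (ln t) ^ 3 < t * d - 1
    \<and> 2 * (ln t) ^ 3 * (1 + \<eta>) \<le> (t * d - 1) * \<eta>\<^sup>2 \<and> 1 + 2 * (ln t) ^ 3 \<le> ((1 - p) * d) * t
    \<and> exp ((4 + 36 * ln (ln t)) * (5 * ln (ln t))) * R * (d * (ln t)\<^sup>2) \<le> t * d / 2
    \<and> exp (- p\<^sup>2 * (t * d) / 4) \<le> 1 / 4"
proof -
  have "0 < (1 - p) * d" using assms by simp
  then show ?thesis unfolding eventually_conj_iff using assms by (intro conjI; real_asymp)
qed

text \<open>Powers of t = N: (2 d)^l is at most t^(1/100), the near-cycle count is controlled up to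
  t^(1/8), and D is about t^(1/4). So the tangled part has order t^(1/50 + 1/2 - 1) and the tangle
  probability order t^(-1/3), up to logarithms.\<close>

lemma eventually_power_bounds:
  fixes d A k q :: real
  assumes "3 \<le> d" "0 < k" "0 \<le> q"
  shows "\<forall>\<^sub>F t in at_top.
      8 * (t * d) * exp (2 * ln (ln t) * A) * exp ((20 * ln (ln t) + 96 * (ln (ln t))\<^sup>2) * (5 * ln (ln t)))
        / exp (ln t * sqrt (ln (ln t)) / (200 * k)) \<le> t powr - q
    \<and> 2 * (ln t) ^ 3 + ln t * (t powr (1 / 100) * (d * (2 * (ln t) ^ 3 + ln t))) \<le> t powr (1 / 50)
    \<and> t powr (1 / 8) + ln t * ((ln t + 1) * t powr (1 / 100)) \<le> t powr (1 / 4) - 1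
    \<and> t * d * (ln t * (t powr (1 / 100) * (1 / (t * d) * (t powr (1 / 4) * d))))\<^sup>2 \<le> 1
    \<and> t * ((1 + d * (5 * ln t) * (ln t * ((d - 1) * t powr (1 / 6)))) *
        (d * (5 * ln t) * (ln t * ((d - 1) * t powr (1 / 6) * (d * (6 * ln t)) / (t * d)))))\<^sup>2 \<le> 1 / 4"
proof -
  have "0 < d - 1" using assms by simp
  then show ?thesis unfolding eventually_conj_iff using assms by (intro conjI; real_asymp)
qed

lemma exp_half_le: "0 \<le> \<delta> \<Longrightarrow> \<delta> \<le> 1 \<Longrightarrow> exp (\<delta> / 2) \<le> 1 + (\<delta> :: real)"
proof -
  assume \<delta>: "0 \<le> \<delta>" "\<delta> \<le> 1"
  have "exp (\<delta> / 2) \<le> 1 + \<delta> / 2 + (\<delta> / 2)\<^sup>2" using \<delta> by (intro exp_bound) auto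
  also have "(\<delta> / 2)\<^sup>2 \<le> \<delta> / 2" using \<delta> mult_left_mono[of \<delta> 1 \<delta>] by (simp add: power2_eq_square)
  finally show ?thesis by simp
qed

theorem proposition3p4:
  fixes d :: nat and \<mu> q :: real
  assumes "3 \<le> d"
    and "2 * sqrt (real d - 1) < \<mu>" and "\<mu> < real d"
    and "0 \<le> q"
  shows "\<exists>C K :: real. \<forall>\<^sub>F N in sequentially.
    even (N * d) \<longrightarrow>
    \<P>(E in measure_pmf (random_edges d \<mu> N). omega_bar d \<mu> N E) > 0 \<longrightarrow>
    \<P>(E in measure_pmf (random_edges d \<mu> N).
        graph_lambda 2 (inf_graph d N E) \<le> 2 * sqrt (real d - 1) + C / ln (ln (real N))
        \<bar> omega_bar d \<mu> N E)
      \<ge> 1 - K * real N powr (- q)"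
proof -
  define p r where "p = keep_prob d \<mu>" and "r = sqrt (real d - 1)"
  have p: "0 < p" "p < 1" using keep_prob_bounds[OF assms(1-3)] by (auto simp: p_def)
  have d: "3 \<le> real d" using assms(1) by simp
  have r: "1 < r" "r * r = real d - 1" "r\<^sup>2 = real d - 1" using d by (auto simp: r_def)
  \<comment> \<open>Chosen such that (2 d)^l = exp (k l), the crude bound for the total weight of
    walks of length l.\<close>
  define k where "k = ln (2 * real d)"
  have k: "1 \<le> k"
  using exp_le d by (auto simp: k_def ln_ge_iff)
  \<comment> \<open>The constant cost per unit of m: (2 r)^12 for the conflicts of two blocks, 4 d^2
    from the definition of \<gamma>.\<close>
  define A where "A = ln ((2 * r) ^ 12 * (4 * (real d)\<^sup>2))"
  have A1: "1 \<le> (2 * r) ^ 12 * (4 * (real d)\<^sup>2)"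
  proof -
    have "1 \<le> (2 * r) ^ 12" using r(1) by (intro one_le_power) auto
    moreover have "1 \<le> (real d)\<^sup>2" using d by (intro one_le_power) simp
    then have "1 \<le> 4 * (real d)\<^sup>2" by linarith
    ultimately show ?thesis using mult_mono[of 1 "(2 * r) ^ 12" 1 "4 * (real d)\<^sup>2"] by simp
  qed
  have A: "0 \<le> A" unfolding A_def by (rule ln_ge_zero[OF A1])
  \<comment> \<open>The order of the near-cycle moment. One factor gains t^(1/50 - 1/8) =
    t^(-21/200), so 10 q of them yield t^(-q).\<close>
  define M where "M = nat \<lceil>10 * q\<rceil>"
  have M: "10 * q \<le> real M" unfolding M_def by linarith
  \<comment> \<open>From l \<ge> b follows 4 d^2 < l < s0^(2 l), which absorbs the constant error
    term.\<close>
  define b where "b = 4 * (real d)\<^sup>2 + 1"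
  have b: "1 \<le> b" by (simp add: b_def)
  have pos: "0 < k" "0 < 1 / r" "0 < (2 * r) ^ 9" using k r(1) by simp_all
  note ev = eventually_compose_filterlim[OF eventually_log_bounds[OF pos(1), of b M] filterlim_real_sequentially]
    eventually_compose_filterlim[OF eventually_size_bounds[OF d p pos(2,3)] filterlim_real_sequentially]
    eventually_compose_filterlim[OF eventually_power_bounds[OF d pos(1) assms(4), of A] filterlim_real_sequentially]
  have "\<forall>\<^sub>F N in sequentially. even (N * d) \<longrightarrow>
    \<P>(E in measure_pmf (random_edges d \<mu> N). omega_bar d \<mu> N E) > 0 \<longrightarrow>
    \<P>(E in measure_pmf (random_edges d \<mu> N).
        graph_lambda 2 (inf_graph d N E) \<le> 2 * sqrt (real d - 1) + r / ln (ln (real N))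
        \<bar> omega_bar d \<mu> N E)
      \<ge> 1 - 4 * real N powr (- q)"
    using ev
  proof eventually_elim
    case (elim N)
    define t x y n where "t = real N" and "x = ln t" and "y = ln x" and "n = real (N * d)"
    have n: "n = t * real d" by (simp add: n_def t_def)
    have e1: "1 \<le> y" "4 \<le> x" "b \<le> x / (200 * k)" "x * y + 1 \<le> x\<^sup>2" "real M * x \<le> x ^ 3 - 1" "4 * x \<le> x ^ 3 - 1"
      using elim(1) by (simp_all add: t_def x_def y_def)
    have e2: "4 * (x ^ 3)\<^sup>2 \<le> n - 1" "4 * x ^ 3 < n - 1" "2 * x ^ 3 * (1 + 1 / r) \<le> (n - 1) * (1 / r)\<^sup>2"
      "exp ((4 + 36 * y) * (5 * y)) * (2 * r) ^ 9 * (real d * x\<^sup>2) \<le> n / 2" "exp (- p\<^sup>2 * n / 4) \<le> 1 / 4"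
      using elim(2) by (simp_all add: t_def x_def y_def n)
    have pn: "p * n \<le> n - 1 - 2 * x ^ 3" using elim(2) by (simp add: t_def x_def n algebra_simps)
    have e3: "8 * n * exp (2 * y * A) * exp ((20 * y + 96 * y\<^sup>2) * (5 * y)) / exp (x * sqrt y / (200 * k)) \<le> t powr - q"
      "2 * x ^ 3 + x * (t powr (1 / 100) * (real d * (2 * x ^ 3 + x))) \<le> t powr (1 / 50)"
      "t powr (1 / 8) + x * ((x + 1) * t powr (1 / 100)) \<le> t powr (1 / 4) - 1"
      "n * (x * (t powr (1 / 100) * (1 / n * (t powr (1 / 4) * real d))))\<^sup>2 \<le> 1"
      "t * ((1 + real d * (5 * x) * (x * ((real d - 1) * t powr (1 / 6)))) *
        (real d * (5 * x) * (x * ((real d - 1) * t powr (1 / 6) * (real d * (6 * x)) / n))))\<^sup>2 \<le> 1 / 4"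
      using elim(3) by (simp_all add: t_def x_def y_def n)
    have N2: "2 \<le> N"
    proof (rule ccontr)
      assume "\<not> 2 \<le> N"
      then have "N = 0 \<or> N = 1" by auto
      then show False using e1(2) by (auto simp: x_def t_def)
    qed
    have t: "2 \<le> t" using N2 by (simp add: t_def)
    have n1: "1 < n" using e2(2) e1(2) using zero_less_power[of x 3] by linarith
    \<comment> \<open>A small multiple of ln N, below the tangle-free radius and with (2 d)^l \<le>
      t^(1/100).\<close>
    define l where "l = nat \<lfloor>x / (100 * k)\<rfloor>"
    have l: "real l \<le> x / (100 * k)" "x / (200 * k) \<le> real l"
    proof -
      have "0 \<le> x / (100 * k)" using e1(2) k by simp
      then show "real l \<le> x / (100 * k)" unfolding l_def by linarith
      have "1 \<le> x / (200 * k)" using e1(3) b by linarith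
      moreover have "x / (100 * k) = 2 * (x / (200 * k))" by simp
      ultimately show "x / (200 * k) \<le> real l" unfolding l_def by linarith
    qed
    have lb: "b \<le> real l" using l(2) e1(3) by linarith
    have l0: "0 < l" using lb b by linarith
    have lx: "real l \<le> x / 100"
    proof -
      have "x / (100 * k) \<le> x / (100 * 1)" using k e1(2) by (intro divide_left_mono) auto
      then show ?thesis using l(1) by simp
    qed
    have lx1: "real l \<le> x" using lx by linarith
    have pow_l: "(2 * real d) ^ l \<le> t powr (1 / 100)"
    proof -
      have "(2 * real d) ^ l = exp (real l * k)" using d by (simp add: k_def exp_of_nat_mult)
      also have "\<dots> \<le> exp (x / 100)" using l(1) k by (simp add: field_simps)
      also have "\<dots> = t powr (1 / 100)" using t by (simp add: powr_def x_def)
      finally show ?thesis .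
    qed
    define m where "m = nat \<lceil>y\<rceil>"
    have m: "y \<le> real m" "real m \<le> 2 * y" "0 < m" using e1(1) unfolding m_def by linarith+
    \<comment> \<open>The exponent \<delta> m l of the gain is then of order ln N times sqrt (ln (ln
      N)), more than any multiple of ln N, while the loss \<delta>^2 is 1 / ln (ln N).\<close>
    define \<delta> where "\<delta> = 1 / sqrt y"
    have \<delta>: "0 < \<delta>" "\<delta> \<le> 1" "\<delta>\<^sup>2 = 1 / y" using e1(1) by (auto simp: \<delta>_def power_divide)
    define s0 where "s0 = r * (1 + \<delta>)"
    have s0: "1 < s0" "r \<le> s0" using r(1) \<delta>(1) mult_strict_mono[of 1 r 1 "1 + \<delta>"] by (auto simp: s0_def)
    \<comment> \<open>The untangled kernel is allowed half of s0^(2 l) in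
      \<open>eigenvalue_bound\<close>.\<close>
    define \<gamma> where "\<gamma> = s0 ^ (2 * l) / (4 * (real d)\<^sup>2)"
    have \<gamma>: "0 < \<gamma>" using s0 d by (simp add: \<gamma>_def)
    define L Q where "L = 2 * m * l" and "Q = 4 * (real L + 1)\<^sup>2"
    have L1: "real L + 1 \<le> x\<^sup>2"
    proof -
      have "real L = 2 * real m * real l" by (simp add: L_def)
      also have "\<dots> \<le> 2 * (2 * y) * (x / 100)" using m(2) lx by (intro mult_mono) auto
      also have "\<dots> \<le> x * y" using e1(1,2) by simp
      finally show ?thesis using e1(4) by linarith
    qed
    have L2: "y * x / (100 * k) \<le> real L"
    proof -
      have "y * x / (100 * k) = 2 * y * (x / (200 * k))" by simp
      also have "\<dots> \<le> 2 * real m * real l" using m(1) l(2) e1 k by (intro mult_mono) auto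
      finally show ?thesis by (simp add: L_def)
    qed
    have "1 \<le> (real L + 1)\<^sup>2" by (intro one_le_power) simp
    then have Q1: "1 \<le> Q" unfolding Q_def by linarith
    \<comment> \<open>Since x \<ge> 4, Q \<le> 4 x^4 \<le> x^5: each surprise costs only a power of
      ln N.\<close>
    have Q5: "Q \<le> exp (5 * y)"
    proof -
      have "Q \<le> 4 * (x\<^sup>2)\<^sup>2" unfolding Q_def using L1 by (intro mult_left_mono power_mono) auto
      also have "\<dots> \<le> x * (x\<^sup>2)\<^sup>2" using e1(2) by (intro mult_right_mono) auto
      also have "\<dots> = x ^ 5" by (simp add: numeral_eq_Suc)
      also have "\<dots> = exp (5 * y)" using e1(2) exp_of_nat_mult[of 5 y] by (simp add: y_def)
      finally show ?thesis .
    qed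
    have Qp: "Q ^ i \<le> exp (z * (5 * y))" if "real i \<le> z" for i z
    proof -
      have "Q ^ i \<le> exp (5 * y) ^ i" using Q5 Q1 by (intro power_mono) auto
      also have "\<dots> = exp (real i * (5 * y))" by (simp add: exp_of_nat_mult)
      also have "\<dots> \<le> exp (z * (5 * y))" using that e1(1) by simp
      finally show ?thesis .
    qed
    \<comment> \<open>The cube of ln N dominates all numbers of edges that occur: L, M l and 4
      m'.\<close>
    define Kn where "Kn = nat \<lfloor>x ^ 3\<rfloor>"
    have x3: "0 \<le> x ^ 3" using e1(2) by simp
    have Kn: "real Kn \<le> x ^ 3" "x ^ 3 - 1 \<le> real Kn" unfolding Kn_def using x3 by linarith+
    define D where "D = nat \<lfloor>t powr (1 / 4)\<rfloor>"
    have D: "real D \<le> t powr (1 / 4)" "t powr (1 / 4) - 1 \<le> real D"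
      unfolding D_def using powr_ge_zero[of t "1 / 4"] by linarith+
    define s where "s = 1 / 6 * log (real d - 1) (real N)"
    have "ln 2 \<le> ln (real d - 1)" "ln (real d - 1) \<le> k" unfolding k_def using d by (subst ln_le_cancel_iff; simp)+
    then have ld: "2 / 3 \<le> ln (real d - 1)" "ln (real d - 1) \<le> k" using ln2_ge_two_thirds by auto
    have s: "s = x / (6 * ln (real d - 1))" by (simp add: s_def log_def x_def t_def)
    have ls: "real l \<le> s"
    proof -
      have "x / (100 * k) \<le> x / (6 * ln (real d - 1))" using ld e1(2) by (intro divide_left_mono) auto
      then show ?thesis using l(1) s by linarith
    qed
    have s1: "0 \<le> s" "s + 1 \<le> x"
    proof -
      show "0 \<le> s" using ls by linarith
      have "s \<le> x / (6 * (2 / 3))" unfolding s using ld e1(2) by (intro divide_left_mono mult_left_mono) auto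
      then show "s + 1 \<le> x" using e1(2) by simp
    qed
    define m' where "m' = Suc (nat \<lfloor>s\<rfloor>)"
    have m': "real m' \<le> x" "1 \<le> real m'" unfolding m'_def using s1 by linarith+
    have pow_m': "(real d - 1) ^ m' \<le> (real d - 1) * t powr (1 / 6)"
    proof -
      have "(real d - 1) ^ nat \<lfloor>s\<rfloor> = (real d - 1) powr real (nat \<lfloor>s\<rfloor>)" using d by (simp add: powr_realpow)
      also have "\<dots> \<le> (real d - 1) powr s" using s1 d by (intro powr_mono) auto
      also have "\<dots> = t powr (1 / 6)"
      using ld s t by (auto simp: powr_def x_def)
      finally show ?thesis using d by (simp add: m'_def)
    qed
    have \<gamma>_bound: "8 * r ^ L * n * (2 * r) ^ (12 * m) * Q ^ (10 * m + 24 * m * m) / \<gamma> ^ m \<le> t powr - q"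
    proof -
      have "s0 ^ L = r ^ L * (1 + \<delta>) ^ L" by (simp add: s0_def power_mult_distrib)
      moreover have "\<gamma> ^ m = s0 ^ L / (4 * (real d)\<^sup>2) ^ m"
        by (simp add: \<gamma>_def power_divide L_def mult_ac flip: power_mult)
      moreover have "((2 * r) ^ 12 * (4 * (real d)\<^sup>2)) ^ m = (2 * r) ^ (12 * m) * (4 * (real d)\<^sup>2) ^ m"
        by (simp only: power_mult power_mult_distrib[of "(2 * r) ^ 12"])
      moreover have "8 * a1 * n * a2 * a3 / (a1 * a4 / a5) = 8 * n * (a2 * a5) * a3 / a4" if "a1 \<noteq> 0" for a1 a2 a3 a4 a5
        using that by simp
      moreover have "r ^ L \<noteq> 0" using r(1) by simp
      ultimately have "8 * r ^ L * n * (2 * r) ^ (12 * m) * Q ^ (10 * m + 24 * m * m) / \<gamma> ^ m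
        = 8 * n * ((2 * r) ^ 12 * (4 * (real d)\<^sup>2)) ^ m * Q ^ (10 * m + 24 * m * m) / (1 + \<delta>) ^ L" by metis
      also have "\<dots> \<le> 8 * n * exp (2 * y * A) * exp ((20 * y + 96 * y\<^sup>2) * (5 * y)) / exp (x * sqrt y / (200 * k))"
      proof (intro frac_le mult_mono)
        have "((2 * r) ^ 12 * (4 * (real d)\<^sup>2)) ^ m = exp (real m * A)" using A1 by (simp add: A_def exp_of_nat_mult)
        also have "\<dots> \<le> exp (2 * y * A)" using m(2) A by (simp add: mult_right_mono)
        finally show "((2 * r) ^ 12 * (4 * (real d)\<^sup>2)) ^ m \<le> exp (2 * y * A)" .
        have "real m * real m \<le> (2 * y) * (2 * y)" using m(2) by (intro mult_mono) auto
        then show "Q ^ (10 * m + 24 * m * m) \<le> exp ((20 * y + 96 * y\<^sup>2) * (5 * y))"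
          using m(2) by (intro Qp) (simp add: power2_eq_square)
        \<comment> \<open>The gain (1 + \<delta>)^L is bounded below by exp (\<delta> L / 2), with L
          at least y x / (100 k).\<close>
        have "x * sqrt y / (200 * k) = (y * x / (100 * k)) * (\<delta> / 2)"
          using e1(1) k by (simp add: \<delta>_def field_simps)
        also have "\<dots> \<le> real L * (\<delta> / 2)" using L2 \<delta> by (intro mult_right_mono) auto
        finally have "exp (x * sqrt y / (200 * k)) \<le> exp (\<delta> / 2) ^ L" by (simp flip: exp_of_nat_mult)
        also have "\<dots> \<le> (1 + \<delta>) ^ L" using exp_half_le[of \<delta>] \<delta> by (intro power_mono) auto
        finally show "exp (x * sqrt y / (200 * k)) \<le> (1 + \<delta>) ^ L" .
      qed (use n1 Q1 r in auto)
      finally show ?thesis using e3(1) by linarith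
    qed
    have small: "Q ^ (4 + 18 * m) * (2 * r) ^ 9 * (real d * (real L + 1)) \<le> n / 2"
    proof -
      have "Q ^ (4 + 18 * m) * (2 * r) ^ 9 * (real d * (real L + 1)) \<le> exp ((4 + 36 * y) * (5 * y)) * (2 * r) ^ 9 * (real d * x\<^sup>2)"
        using m(2) L1 r(1) by (intro mult_mono Qp mult_left_mono) auto
      then show ?thesis using e2(4) by linarith
    qed
    have dl: "(real d - 1) ^ l \<le> t powr (1 / 100)" "real d ^ l \<le> t powr (1 / 100)"
      using d by (intro order_trans[OF power_mono pow_l]; simp)+
    have nc: "((2 * real Kn + real l * (real d - 1) ^ l * (real d * (2 * real Kn + real l))) / t powr (1 / 8)) ^ M \<le> t powr - q"
    proof -
      have "2 * real Kn + real l * (real d - 1) ^ l * (real d * (2 * real Kn + real l))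
        \<le> 2 * x ^ 3 + x * t powr (1 / 100) * (real d * (2 * x ^ 3 + x))"
        using Kn(1) lx1 dl(1) d by (intro add_mono mult_mono mult_left_mono) auto
      also have "\<dots> \<le> t powr (1 / 50)" using e3(2) by simp
      finally have "((2 * real Kn + real l * (real d - 1) ^ l * (real d * (2 * real Kn + real l))) / t powr (1 / 8)) ^ M
        \<le> (t powr (1 / 50) / t powr (1 / 8)) ^ M"
        using d by (intro power_mono divide_right_mono) auto
      also have "\<dots> = t powr (- (21 / 200) * real M)"
        using t by (simp add: powr_diff[symmetric] powr_powr flip: powr_realpow)
      also have "\<dots> \<le> t powr - q" using M t by (intro powr_mono) auto
      finally show ?thesis .
    qed
    have Dl: "t powr (1 / 8) + real l * ((real l + 1) * real d ^ l) \<le> real D"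
    proof -
      have "real l * ((real l + 1) * real d ^ l) \<le> x * ((x + 1) * t powr (1 / 100))"
        using lx1 dl(2) by (intro mult_mono) auto
      then show ?thesis using e3(3) D(2) by linarith
    qed
    have large: "2 * (real d)\<^sup>2 * (\<gamma> + n * (real l * (2 * real d) ^ l * (p / (n - 1) * (real D * real d)))\<^sup>2) < s0 ^ (2 * l)"
    proof -
      have "p * n \<le> n - 1" using pn x3 by linarith
      then have c: "p / (n - 1) \<le> 1 / n" using n1 by (simp add: field_simps)
      \<comment> \<open>The tangled part is at most 1, although D may be as large as t^(1/4),
        because c is about 1 / n and enters squared.\<close>
      have "n * (real l * (2 * real d) ^ l * (p / (n - 1) * (real D * real d)))\<^sup>2
        \<le> n * (x * t powr (1 / 100) * (1 / n * (t powr (1 / 4) * real d)))\<^sup>2"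
        using lx1 pow_l c D(1) n1 p by (intro mult_left_mono power_mono mult_mono mult_right_mono) auto
      also have "\<dots> \<le> 1" using e3(4) by (simp add: mult.assoc)
      finally have "2 * (real d)\<^sup>2 * (\<gamma> + n * (real l * (2 * real d) ^ l * (p / (n - 1) * (real D * real d)))\<^sup>2)
        \<le> 2 * (real d)\<^sup>2 * (\<gamma> + 1)" by (intro mult_left_mono add_left_mono) auto
      also have "\<dots> = s0 ^ (2 * l) / 2 + 2 * (real d)\<^sup>2" using d by (simp add: \<gamma>_def field_simps)
      \<comment> \<open>The other half of s0^(2 l) exceeds the constant 2 d^2.\<close>
      also have "\<dots> < s0 ^ (2 * l)"
      proof -
        have "4 * (real d)\<^sup>2 < real l" using lb by (simp add: b_def)
        also have "\<dots> < 2 ^ l" by (rule of_nat_less_two_power)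
        also have "\<dots> \<le> (real d - 1) ^ l" using d by (intro power_mono) auto
        also have "\<dots> = r ^ (2 * l)" by (simp add: power_mult r(3))
        also have "\<dots> \<le> s0 ^ (2 * l)" using s0(2) r(1) by (intro power_mono) auto
        finally show ?thesis by simp
      qed
      finally show ?thesis .
    qed
    have tang: "real N * ((1 + real d * (4 * real m' + 1) * (real m' * (real d - 1) ^ m')) *
       (real d * (4 * real m' + 1) * (real m' * ((real d - 1) ^ m' * (real d * ((4 * real m' + 1) + real m')) / n))))\<^sup>2 \<le> 1 / 4"
    proof -
      \<comment> \<open>As 1 \<le> m' \<le> x, the terms 4 m' + 1 and 5 m' + 1 are at most 5 x and 6
        x.\<close>
      have "real N * ((1 + real d * (4 * real m' + 1) * (real m' * (real d - 1) ^ m')) *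
          (real d * (4 * real m' + 1) * (real m' * ((real d - 1) ^ m' * (real d * ((4 * real m' + 1) + real m')) / n))))\<^sup>2
        \<le> t * ((1 + real d * (5 * x) * (x * ((real d - 1) * t powr (1 / 6)))) *
          (real d * (5 * x) * (x * ((real d - 1) * t powr (1 / 6) * (real d * (6 * x)) / n))))\<^sup>2"
        unfolding t_def[symmetric] using m' pow_m' d n1 t
        by (intro mult_left_mono power_mono mult_mono add_left_mono divide_right_mono) auto
      then show ?thesis using e3(5) by linarith
    qed
    show ?case
    proof (intro impI)
      assume even: "even (N * d)"
      have "1 - 4 * t powr - q \<le> \<P>(E in measure_pmf (random_edges d \<mu> N). graph_lambda 2 (inf_graph d N E) \<le> s0 + (real d - 1) / s0
        \<bar> omega_bar d \<mu> N E)"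
      proof (rule conditional_bound[OF assms(1) N2 even, where l = l and m = m and Kn = Kn and M = M and D = D
          and s = s and K = "x ^ 3" and \<gamma> = \<gamma> and a = "t powr (1 / 8)"])
        show "real (2 * m * l) \<le> x ^ 3"
        proof -
          have "x\<^sup>2 \<le> x ^ 3" using e1(2) by (intro power_increasing) auto
          then show ?thesis using L1 by (simp add: L_def)
        qed
        show "M * l \<le> Kn"
        proof -
          have "real M * real l \<le> real M * x" using lx1 by (intro mult_left_mono) auto
          then have "real (M * l) \<le> real Kn" unfolding of_nat_mult using e1(5) Kn(2) by linarith
          then show ?thesis by (simp only: of_nat_le_iff)
        qed
        show "4 * Suc (nat \<lfloor>s\<rfloor>) \<le> Kn"
        using m'(1) e1(6) Kn(2) by (auto simp: m'_def)
        show "keep_prob d \<mu> * real (N * d) \<le> real (N * d) - 1 - 2 * real Kn"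
          using pn Kn(1) unfolding p_def n_def by linarith
      qed (fact p[unfolded p_def] l0 ls s_def m(3) e2[unfolded n_def r_def p_def] small[unfolded L_def Q_def r_def n_def]
          \<gamma> \<gamma>_bound[unfolded L_def Q_def r_def n_def] nc Dl s0(1) large[unfolded p_def n_def] tang[unfolded m'_def n_def]
          | use t in simp)+
      moreover have "s0 + (real d - 1) / s0 \<le> 2 * sqrt (real d - 1) + r / ln (ln (real N))"
      proof -
        \<comment> \<open>Expansion of 1 / (1 + \<delta>) to second order: in r (1 + \<delta>) + r /
          (1 + \<delta>) the linear terms cancel and r \<delta>^2 = r / y remains.\<close>
        have "1 = (1 + \<delta>) * (1 - \<delta> + \<delta>\<^sup>2) - \<delta> ^ 3" by (simp add: power2_eq_square power3_eq_cube algebra_simps)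
        also have "\<dots> \<le> (1 + \<delta>) * (1 - \<delta> + \<delta>\<^sup>2)" using \<delta>(1) by simp
        finally have "1 / (1 + \<delta>) \<le> 1 - \<delta> + \<delta>\<^sup>2" using \<delta>(1) by (simp add: field_simps)
        then have "r * (1 / (1 + \<delta>)) \<le> r * (1 - \<delta> + \<delta>\<^sup>2)" using r(1) by (intro mult_left_mono) auto
        moreover have "(real d - 1) / s0 = r * (1 / (1 + \<delta>))" using r \<delta>(1) by (simp add: s0_def flip: r(2))
        ultimately have "s0 + (real d - 1) / s0 \<le> r * (1 + \<delta>) + r * (1 - \<delta> + \<delta>\<^sup>2)" by (simp add: s0_def)
        also have "\<dots> = 2 * r + r / y" by (simp add: \<delta>(3) algebra_simps)
        finally show ?thesis by (simp add: r_def y_def x_def t_def)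
      qed
      then have "\<P>(E in measure_pmf (random_edges d \<mu> N). graph_lambda 2 (inf_graph d N E) \<le> s0 + (real d - 1) / s0
          \<bar> omega_bar d \<mu> N E)
        \<le> \<P>(E in measure_pmf (random_edges d \<mu> N). graph_lambda 2 (inf_graph d N E) \<le> 2 * sqrt (real d - 1) + r / ln (ln (real N))
          \<bar> omega_bar d \<mu> N E)"
        unfolding cond_prob_def by (intro divide_right_mono measure_pmf.finite_measure_mono) auto
      ultimately show "\<P>(E in measure_pmf (random_edges d \<mu> N). graph_lambda 2 (inf_graph d N E) \<le> 2 * sqrt (real d - 1) + r / ln (ln (real N))
          \<bar> omega_bar d \<mu> N E) \<ge> 1 - 4 * real N powr - q"
        unfolding t_def by linarith
    qed
  qed
  then show ?thesis by blast
qed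

end
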